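(* Suppose that $g\in C^2([0,\infty))$ satisfies $$\alpha\lambda g(0)+(g'(0)-\lambda-\delta)(\lambda+\delta)>0\qquad\text{and}\qquad \sup_{x\ge0}\{g''(x)+\alpha g'(x)-\alpha\delta\}<0.$$ Then the ordinary differential equation $$[g(x)-u_0]\varphi''(x)+[\alpha g(x)-\alpha u_0+g'(x)-(\lambda+\delta)]\varphi'(x)-\alpha\delta\varphi(x)=0,\qquad x>0,$$ admits a solution $\psi_2$ that is negative, strictly increasing and concave. Let $\psi_1$ denote a positive and strictly increasing solution to the integro-differential equation $$g(x)\varphi'(x)-(\lambda+\delta)\varphi(x)+\lambda\int_0^x\varphi(x-y)\,\alpha e^{-\alpha y}\,\mathrm{d}y=0,\qquad x>0.$$ (i) If furthermore $$\frac{\psi_2(0)}{\psi_2'(0)}>\frac{g(0)}{\lambda+\delta}-\frac{u_0}{\delta},$$ then there exists a unique $d>0$ such that $$\frac{\psi_1(d)}{\psi_1'(d)}-\frac{\psi_2(d)}{\psi_2'(d)}=\frac{u_0}{\delta},$$ and consequently the optimal restricted payment scheme is the one with rate $u^*(t)=u_0I_{\{X^*(t)\ge d\}}$, where $X^*$ is the corresponding controlled surplus process, and the value function is $$V_R(x)=\begin{cases}\dfrac{\psi_1(x)}{\psi_1'(d)}, & \text{if } 0\le x<d,\\[2ex] \dfrac{u_0}{\delta}+\dfrac{\psi_2(x)}{\psi_2'(d)}, & \text{if } x\ge d.\end{cases}$$ (ii) Otherwise, if $$\frac{\psi_2(0)}{\psi_2'(0)}\le\frac{g(0)}{\lambda+\delta}-\frac{u_0}{\delta},$$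 then the optimal restricted payment scheme is $D_R^*=\{\int_0^t u_R^*(s)\,\mathrm{d}s,\ t\ge0\}$ with $u_R^*(t)=u_0$ for all $t\ge0$, and the value function is $$V_R(x)=\frac{\psi_2(x)}{K}+\frac{u_0}{\delta},\quad x\ge0,\qquad\text{where}\qquad K=\frac{[g(0)-u_0]\psi_2'(0)-(\lambda+\delta)\psi_2(0)}{(\lambda/\delta)u_0}.$$
   Context: Model. Let $(\Omega,\mathcal F,\{\mathcal F_t\}_{t\ge0},\mathrm P)$ be a filtered probability space satisfying the usual conditions. $N=\{N(t),t\ge0\}$ is a Poisson process with rate $\lambda>0$, and $Y_1,Y_2,\dots$ are i.i.d. random variables, independent of $N$, with exponential distribution function $Q(y)=1-e^{-\alpha y}$, $y\ge0$, for some $\alpha>0$; $\sum_{i=1}^{N(t)}Y_i$ is a compound Poisson process relative to $\{\mathcal F_t\}$. The function $g$ (on $[0,\infty)$) takes values in $(0,\infty)$, is Lipschitz continuous and satisfies the linear growth condition. $\delta>0$ is a constant. Restricted dividend schemes. Fix a constant $u_0$ with $0<u_0<\inf\{g(x):x\ge0\}$. $\Pi_R$ is the set of all $D_R(t)=\int_0^t u(s)\,\mathrm{d}s$ with $u$ an $\mathcal F_t$-adapted process satisfying $0\le u(t)\le u_0$ for all $t\ge0$. For initial surplus $x\ge0$ and $D=D_R\in\Pi_R$ the controlled surplus (considered up to ruin) is $$X^D(t)=x+\int_0^t g(X^D(s))\,\mathrm{d}s-\sum_{i=1}^{N(t)}Y_i-D(t),$$ the ruin time is $\tau=\inf\{t\ge0:X^D(t)<0\}$,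 and $$J(x,D_R)=\mathrm E_x\int_0^\tau e^{-\delta t}u(t)\,\mathrm{d}t,\qquad V_R(x)=\sup_{D_R\in\Pi_R}J(x,D_R),\quad x\ge0.$$ A scheme $D\in\Pi_R$ is optimal if $J(x,D)=V_R(x)$ for the initial surplus $x\ge0$. $I_A$ denotes the indicator of $A$. Solutions of the integro-differential equation (resp. the ODE) are real-valued functions on $[0,\infty)$ that are once (resp. twice) continuously differentiable and satisfy the equation for $x>0$. A positive, strictly increasing solution $\psi_1$ of the integro-differential equation always exists in this setting, and it is unique up to a multiplicative constant. *)

theory Defs
  imports "HOL-Probability.Probability"
begin

section \<open>Calculus on the half-line\<close>

text \<open>One-sided at \<open>0\<close>, the ordinary derivative elsewhere.\<close>

definition hderiv :: "(real \<Rightarrow> real) \<Rightarrow> real \<Rightarrow> real" where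
  "hderiv f x = vector_derivative f (at x within {0..})"

definition C1_halfline :: "(real \<Rightarrow> real) \<Rightarrow> bool" where
  "C1_halfline f \<longleftrightarrow> f differentiable_on {0..} \<and> continuous_on {0..} (hderiv f)"

definition C2_halfline :: "(real \<Rightarrow> real) \<Rightarrow> bool" where
  "C2_halfline f \<longleftrightarrow> C1_halfline f \<and> C1_halfline (hderiv f)"

definition ide_solution ::
  "(real \<Rightarrow> real) \<Rightarrow> real \<Rightarrow> real \<Rightarrow> real \<Rightarrow> (real \<Rightarrow> real) \<Rightarrow> bool" where
  "ide_solution g lam \<alpha> \<delta> \<phi> \<longleftrightarrow> C1_halfline \<phi> \<and>
     (\<forall>x>0. g x * hderiv \<phi> x - (lam + \<delta>) * \<phi> x
        + lam * (LBINT y:{0..x}. \<phi> (x - y) * (\<alpha> * exp (- \<alpha> * y))) = 0)"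

definition ode_solution ::
  "(real \<Rightarrow> real) \<Rightarrow> real \<Rightarrow> real \<Rightarrow> real \<Rightarrow> real \<Rightarrow> (real \<Rightarrow> real) \<Rightarrow> bool" where
  "ode_solution g lam \<alpha> \<delta> u0 \<phi> \<longleftrightarrow> C2_halfline \<phi> \<and>
     (\<forall>x>0. (g x - u0) * hderiv (hderiv \<phi>) x
        + (\<alpha> * g x - \<alpha> * u0 + hderiv g x - (lam + \<delta>)) * hderiv \<phi> x
        - \<alpha> * \<delta> * \<phi> x = 0)"


section \<open>The risk model\<close>

text \<open>Only the values of \<open>F\<close> and of all processes at times \<open>t \<ge> 0\<close> matter.\<close>

locale usual_filtered_prob_space = prob_space M + complete_measure M
  for M :: "'a measure" +
  fixes F :: "real \<Rightarrow> 'a measure"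
  assumes subalgebra_F: "0 \<le> t \<Longrightarrow> subalgebra M (F t)"
    and mono_F: "0 \<le> s \<Longrightarrow> s \<le> t \<Longrightarrow> sets (F s) \<subseteq> sets (F t)"
    and null_sets_F: "null_sets M \<subseteq> sets (F 0)"
    and right_continuous_F: "0 \<le> t \<Longrightarrow> sets (F t) = (\<Inter>s\<in>{t<..}. sets (F s))"

definition (in prob_space) poisson_process :: "real \<Rightarrow> (real \<Rightarrow> 'a \<Rightarrow> nat) \<Rightarrow> bool" where
  "poisson_process lam N \<longleftrightarrow>
     (\<forall>\<omega>\<in>space M. N 0 \<omega> = 0 \<and> mono_on {0..} (\<lambda>t. N t \<omega>) \<and>
        (\<forall>t\<ge>0. continuous (at_right t) (\<lambda>s. N s \<omega>))) \<and>
     (\<forall>t. incseq t \<and> 0 \<le> t 0 \<longrightarrow>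
        indep_vars (\<lambda>_. count_space UNIV) (\<lambda>i \<omega>. N (t (Suc i)) \<omega> - N (t i) \<omega>) (UNIV :: nat set)) \<and>
     (\<forall>s t. 0 \<le> s \<and> s < t \<longrightarrow>
        distr M (count_space UNIV) (\<lambda>\<omega>. N t \<omega> - N s \<omega>) = measure_pmf (poisson_pmf (lam * (t - s))))"

definition aggregate_claims :: "(real \<Rightarrow> 'a \<Rightarrow> nat) \<Rightarrow> (nat \<Rightarrow> 'a \<Rightarrow> real) \<Rightarrow> real \<Rightarrow> 'a \<Rightarrow> real" where
  "aggregate_claims N Y t \<omega> = (\<Sum>i=1..N t \<omega>. Y i \<omega>)"

text \<open>
  The claim sizes are \<open>Y 1, Y 2, \<dots>\<close>; \<open>Y 0\<close> is not used. The last two assumptions say that the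
  compound Poisson process is one relative to the filtration.
\<close>

locale risk_model = usual_filtered_prob_space M F
  for M :: "'a measure" and F :: "real \<Rightarrow> 'a measure" +
  fixes N :: "real \<Rightarrow> 'a \<Rightarrow> nat" and Y :: "nat \<Rightarrow> 'a \<Rightarrow> real" and lam \<alpha> :: real
  assumes lam_pos: "0 < lam" and alpha_pos: "0 < \<alpha>"
    and poisson_N: "poisson_process lam N"
    and indep_Y: "indep_vars (\<lambda>_. borel) Y {1..}"
    and exponential_Y: "1 \<le> i \<Longrightarrow> distributed M lborel (Y i) (exponential_density \<alpha>)"
    and indep_Y_N: "indep_var
          (\<Pi>\<^sub>M i\<in>{1..}. borel) (\<lambda>\<omega>. \<lambda>i\<in>{1..}. Y i \<omega>)
          (\<Pi>\<^sub>M t\<in>{0..}. count_space UNIV) (\<lambda>\<omega>. \<lambda>t\<in>{0..}. N t \<omega>)"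
    and adapted_claims: "0 \<le> t \<Longrightarrow> aggregate_claims N Y t \<in> borel_measurable (F t)"
    and indep_increments_claims: "0 \<le> s \<Longrightarrow> s \<le> t \<Longrightarrow>
          indep_set (sets (F s))
            {(\<lambda>\<omega>. aggregate_claims N Y t \<omega> - aggregate_claims N Y s \<omega>) -` B \<inter> space M | B. B \<in> sets borel}"


section \<open>Restricted dividend schemes\<close>

text \<open>
  A scheme is represented by its rate process \<open>u\<close>. Joint measurability in time and scenario is what
  makes the time integrals of the adapted process \<open>u\<close> meaningful.
\<close>

definition rates ::
  "'a measure \<Rightarrow> (real \<Rightarrow> 'a measure) \<Rightarrow> real \<Rightarrow> (real \<Rightarrow> 'a \<Rightarrow> real) set" where
  "rates M F u0 = {u.
     (\<lambda>(t, \<omega>). u t \<omega>) \<in> borel_measurable (restrict_space borel {0..} \<Otimes>\<^sub>M M) \<and>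
     (\<forall>t\<ge>0. u t \<in> borel_measurable (F t)) \<and>
     (\<forall>t\<ge>0. \<forall>\<omega>\<in>space M. 0 \<le> u t \<omega> \<and> u t \<omega> \<le> u0)}"

definition dividends :: "(real \<Rightarrow> 'a \<Rightarrow> real) \<Rightarrow> real \<Rightarrow> 'a \<Rightarrow> real" where
  "dividends u t \<omega> = (LBINT s:{0..t}. u s \<omega>)"

text \<open>Ruin time of a single path; it is \<open>\<infinity>\<close> if the path is never negative.\<close>

definition ruin_time :: "(real \<Rightarrow> real) \<Rightarrow> ereal" where
  "ruin_time f = (INF t\<in>{t. 0 \<le> t \<and> f t < 0}. ereal t)"

text \<open>
  Paths of the surplus with cumulative outflow \<open>A\<close> (claims plus dividends). The equation is imposed
  up to and including the ruin time, so \<open>g\<close> only enters through its values on \<open>[0,\<infinity>)\<close>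
  (up to the single time of ruin). Afterwards the path is frozen at its value at ruin.
\<close>

definition surplus_path ::
  "(real \<Rightarrow> real) \<Rightarrow> real \<Rightarrow> (real \<Rightarrow> real) \<Rightarrow> (real \<Rightarrow> real) \<Rightarrow> bool" where
  "surplus_path g x A f \<longleftrightarrow> (\<forall>t\<ge>0.
     (ereal t \<le> ruin_time f \<longrightarrow>
        set_integrable lborel {0..t} (\<lambda>s. g (f s)) \<and>
        f t = x + (LBINT s:{0..t}. g (f s)) - A t) \<and>
     (ruin_time f < ereal t \<longrightarrow> f t = f (real_of_ereal (ruin_time f))))"

text \<open>
  The choice below is made scenario by scenario; for \<open>g\<close> positive and Lipschitz on \<open>[0,\<infinity>)\<close>, and
  rates below \<open>g\<close>, the path exists and is unique on \<open>[0,\<infinity>)\<close>.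
\<close>

definition surplus ::
  "(real \<Rightarrow> real) \<Rightarrow> (real \<Rightarrow> 'a \<Rightarrow> nat) \<Rightarrow> (nat \<Rightarrow> 'a \<Rightarrow> real) \<Rightarrow> real \<Rightarrow>
   (real \<Rightarrow> 'a \<Rightarrow> real) \<Rightarrow> real \<Rightarrow> 'a \<Rightarrow> real" where
  "surplus g N Y x u t \<omega> =
     (SOME f. surplus_path g x (\<lambda>s. aggregate_claims N Y s \<omega> + dividends u s \<omega>) f) t"

definition ruin ::
  "(real \<Rightarrow> real) \<Rightarrow> (real \<Rightarrow> 'a \<Rightarrow> nat) \<Rightarrow> (nat \<Rightarrow> 'a \<Rightarrow> real) \<Rightarrow> real \<Rightarrow>
   (real \<Rightarrow> 'a \<Rightarrow> real) \<Rightarrow> 'a \<Rightarrow> ereal" where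
  "ruin g N Y x u \<omega> = ruin_time (\<lambda>t. surplus g N Y x u t \<omega>)"

definition J ::
  "'a measure \<Rightarrow> (real \<Rightarrow> real) \<Rightarrow> (real \<Rightarrow> 'a \<Rightarrow> nat) \<Rightarrow> (nat \<Rightarrow> 'a \<Rightarrow> real) \<Rightarrow> real \<Rightarrow>
   real \<Rightarrow> (real \<Rightarrow> 'a \<Rightarrow> real) \<Rightarrow> real" where
  "J M g N Y \<delta> x u =
     (LINT \<omega>|M. (LBINT t:{t. 0 \<le> t \<and> ereal t \<le> ruin g N Y x u \<omega>}. exp (- \<delta> * t) * u t \<omega>))"

definition V_R ::
  "'a measure \<Rightarrow> (real \<Rightarrow> 'a measure) \<Rightarrow> (real \<Rightarrow> real) \<Rightarrow> (real \<Rightarrow> 'a \<Rightarrow> nat) \<Rightarrow>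
   (nat \<Rightarrow> 'a \<Rightarrow> real) \<Rightarrow> real \<Rightarrow> real \<Rightarrow> real \<Rightarrow> real" where
  "V_R M F g N Y \<delta> u0 x = (SUP u\<in>rates M F u0. J M g N Y \<delta> x u)"

definition optimal ::
  "'a measure \<Rightarrow> (real \<Rightarrow> 'a measure) \<Rightarrow> (real \<Rightarrow> real) \<Rightarrow> (real \<Rightarrow> 'a \<Rightarrow> nat) \<Rightarrow>
   (nat \<Rightarrow> 'a \<Rightarrow> real) \<Rightarrow> real \<Rightarrow> real \<Rightarrow> real \<Rightarrow> (real \<Rightarrow> 'a \<Rightarrow> real) \<Rightarrow> bool" where
  "optimal M F g N Y \<delta> u0 x u \<longleftrightarrow>
     u \<in> rates M F u0 \<and> J M g N Y \<delta> x u = V_R M F g N Y \<delta> u0 x"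

text \<open>
  A closed-loop condition on \<open>u\<close>: the surplus on the right-hand side is the one controlled by \<open>u\<close>.
\<close>

definition threshold_rate ::
  "'a measure \<Rightarrow> (real \<Rightarrow> real) \<Rightarrow> (real \<Rightarrow> 'a \<Rightarrow> nat) \<Rightarrow> (nat \<Rightarrow> 'a \<Rightarrow> real) \<Rightarrow>
   real \<Rightarrow> real \<Rightarrow> real \<Rightarrow> (real \<Rightarrow> 'a \<Rightarrow> real) \<Rightarrow> bool" where
  "threshold_rate M g N Y u0 d x u \<longleftrightarrow>
     (\<forall>t\<ge>0. \<forall>\<omega>\<in>space M. u t \<omega> = u0 * indicator {d..} (surplus g N Y x u t \<omega>))"

end

theory Submission imports Defs begin

text \<open>
  Differentiating the integro-differential equation turns it into a second-order linear ODE, and the two candidate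
  value functions (\<open>\<psi>\<^sub>1\<close> pasted to \<open>\<psi>\<^sub>2\<close> at the point where both slopes are \<open>1\<close>, or \<open>\<psi>\<^sub>2\<close>
  alone) solve the Hamilton-Jacobi-Bellman equation with a slope that is at least \<open>1\<close> below the barrier and at most
  \<open>1\<close> above. The sign conditions on \<open>g\<close> make \<open>\<psi>\<^sub>2\<close> concave and \<open>\<psi>\<^sub>1\<close> concave up to the
  barrier.

  Verification avoids stochastic integrals. For a scheme with surplus \<open>X\<close>, the discounted value of \<open>X\<close> plus the
  dividends paid so far changes over a step of length \<open>h\<close> by an amount whose mean is at most \<open>o(h)\<close>, uniformly on
  \<open>[0, T]\<close>, and also at least \<open>- o(h)\<close> for the threshold scheme: with no claim in the step the path is nearly
  linear, and the claims of the step are independent of the past. Summing over the steps and letting \<open>h\<close> tend to \<open>0\<close>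
  and then \<open>T\<close> to infinity compares the expected dividends with the candidate.
\<close>

section \<open>Calculus on the half-line\<close>

text \<open>One margin drives most estimates: \<open>c\<close>, the gap between the infimum of
  \<open>g\<close> and \<open>u0\<close>. Every controlled path climbs at speed at least
  \<open>c\<close> between claims. Hence nonnegativity persists to the right, the surplus is
  strictly negative at ruin, and a level is met at most once between two claims. The last fact
  resolves the closed-loop equation of the threshold scheme, whose drift jumps at the barrier:
  solutions with Lipschitz drifts decrease to a limit that spends no time at the barrier. It also
  yields the lower bound in the verification: within a claim-free step the threshold rate is
  constantly \<open>0\<close>, constantly \<open>u0\<close>, or the path passes the barrier, where
  \<open>v'\<close> is close to \<open>1\<close>.

  Since \<open>g\<close> matters on the nonnegative half-line only, paths are built with a globally
  Lipschitz extension of \<open>g\<close> and then frozen at ruin. The pasted candidate is only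
  known to be continuously differentiable, so the step estimates are of first order and rely on
  uniform continuity of \<open>v'\<close> on compact intervals; a deterministic bound on the surplus
  up to time \<open>T\<close> makes them uniform over scenarios.\<close>

abbreviation has_hderiv :: "(real \<Rightarrow> real) \<Rightarrow> (real \<Rightarrow> real) \<Rightarrow> bool" where
  "has_hderiv f f' \<equiv> \<forall>x\<ge>0. (f has_real_derivative f' x) (at x within {0..})"

lemma at_within_halfline_nontrivial:
  fixes x :: real
  assumes "0 \<le> x"
  shows "at x within {0..} \<noteq> bot"
proof -
  have "at_right x \<le> at x within {0..}" using assms by (intro at_le) auto
  then show ?thesis using trivial_limit_at_right_real[of x] by (auto simp: bot_unique)
qed

lemma hderiv_eqI:
  assumes "0 \<le> x" "(f has_real_derivative D) (at x within {0..})"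
  shows "hderiv f x = D"
proof -
  have "at x within {0..} \<noteq> bot"
    using at_within_halfline_nontrivial[of x] assms(1) by simp
  then show ?thesis
    using assms unfolding hderiv_def has_real_derivative_iff_has_vector_derivative
    by (rule_tac vector_derivative_within)
qed

lemma C1_halfline_hderiv: "C1_halfline f \<Longrightarrow> has_hderiv f (hderiv f)"
  unfolding C1_halfline_def hderiv_def differentiable_on_def
  by (auto simp: has_real_derivative_iff_has_vector_derivative vector_derivative_works)

lemma C1_halfline_hderiv_continuous: "C1_halfline f \<Longrightarrow> continuous_on {0..} (hderiv f)"
  unfolding C1_halfline_def by blast

lemma C1_halflineI:
  assumes "has_hderiv f f'" "continuous_on {0..} f'"
  shows "C1_halfline f"
proof -
  have "continuous_on {0..} (hderiv f)"
    by (rule continuous_on_eq[OF assms(2)]) (use assms(1) hderiv_eqI in auto)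
  moreover have "f differentiable_on {0..}"
    using assms(1) unfolding differentiable_on_def by (auto simp: real_differentiable_def)
  ultimately show ?thesis unfolding C1_halfline_def by blast
qed

lemma has_hderiv_cong:
  assumes "has_hderiv f f'" "\<And>x. 0 \<le> x \<Longrightarrow> f x = h x" "\<And>x. 0 \<le> x \<Longrightarrow> f' x = h' x"
  shows "has_hderiv h h'"
proof (intro allI impI)
  fix x :: real assume "0 \<le> x"
  then have "(f has_real_derivative f' x) (at x within {0..})" using assms(1) by blast
  then have "(h has_real_derivative f' x) (at x within {0..})"
    by (rule has_field_derivative_transform_within[where d = 1]) (use assms(2) \<open>0 \<le> x\<close> in auto)
  then show "(h has_real_derivative h' x) (at x within {0..})" using assms(3) \<open>0 \<le> x\<close> by simp
qed

lemma has_hderiv_continuous: "has_hderiv f f' \<Longrightarrow> continuous_on {0..} f"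
  using DERIV_continuous_on[of "{0..}" f f'] by auto

lemma C2_halflineI:
  assumes "has_hderiv f f'" "has_hderiv f' f''" "continuous_on {0..} f''"
  shows "C2_halfline f"
proof -
  have "has_hderiv (hderiv f) f''"
    by (rule has_hderiv_cong[OF assms(2)]) (use assms(1) hderiv_eqI in auto)
  then show ?thesis unfolding C2_halfline_def
    using C1_halflineI[OF _ assms(3)] C1_halflineI[OF assms(1)] has_hderiv_continuous[OF assms(2)] by blast
qed

lemma has_hderiv_at:
  assumes "has_hderiv f f'" "0 < x"
  shows "(f has_real_derivative f' x) (at x)"
proof -
  have "at x within {0..} = at x" using assms(2) by (intro at_within_interior) auto
  then show ?thesis using assms by (metis less_imp_le)
qed

lemma has_hderiv_mvt:
  assumes "has_hderiv f f'" "0 \<le> a" "a < b"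
  obtains z where "a < z" "z < b" "f b - f a = (b - a) * f' z"
proof -
  have "continuous_on {a..b} f"
    using has_hderiv_continuous[OF assms(1)] continuous_on_subset assms(2) by force
  moreover have "(f has_derivative (*) (f' x)) (at x)" if "a < x" for x
    using has_hderiv_at[OF assms(1), of x] that assms(2) has_field_derivative_def by auto
  ultimately show ?thesis using mvt[OF assms(3), of f "\<lambda>x. (*) (f' x)"] that by (metis mult.commute)
qed

text \<open>The equations are imposed for \<open>x > 0\<close> only; by continuity their residuals
  vanish at \<open>0\<close> too.\<close>

lemma continuous_halfline_zero:
  fixes f :: "real \<Rightarrow> real"
  assumes "continuous_on {0..} f" "\<And>x. 0 < x \<Longrightarrow> f x = 0"
  shows "f 0 = 0"
proof -
  have "(f \<longlongrightarrow> f 0) (at 0 within {0..})" using assms(1) by (auto simp: continuous_on)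
  then have "(f \<longlongrightarrow> f 0) (at_right 0)" by (rule tendsto_within_subset) auto
  moreover have "\<forall>\<^sub>F x in at_right 0. f x = 0"
    using assms(2) eventually_at_right_less[of "0::real"] by (rule eventually_mono[rotated]) 
  then have "(f \<longlongrightarrow> 0) (at_right 0)" by (simp add: tendsto_eventually)
  ultimately show ?thesis using tendsto_unique trivial_limit_at_right_real by blast
qed

text \<open>A maximum principle in disguise. At the first zero \<open>z\<close> of \<open>w1\<close>
  beyond \<open>a\<close>, \<open>w\<close> has grown to a positive value, so \<open>crit\<close>
  forces \<open>w1\<close> to increase through \<open>z\<close>, although it arrives there from
  above. It serves solutions of linear second-order equations with positive zeroth-order
  coefficient, and is also applied one derivative higher, to control curvature.\<close>

lemma sgn_propagation:
  assumes d1: "has_hderiv w w1" and d2: "has_hderiv w1 w2"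
    and crit: "\<And>x. 0 \<le> x \<Longrightarrow> w1 x = 0 \<Longrightarrow> 0 < w x \<Longrightarrow> 0 < w2 x"
    and a: "0 \<le> a" "0 \<le> w a" "0 \<le> w1 a" "0 < w a \<or> 0 < w1 a" and "a < x"
  shows "0 < w1 x"
proof (rule ccontr)
  assume neg: "\<not> 0 < w1 x"
  have cont: "continuous_on {0..} w1" using d2 by (rule has_hderiv_continuous)
  \<comment> \<open>At \<open>a\<close> the slope may vanish; then \<open>w a\<close> is positive
    and \<open>crit\<close> supplies the initial growth of \<open>w1\<close>.\<close>
  have "\<exists>e>0. \<forall>h>0. h < e \<longrightarrow> 0 < w1 (a + h)"
  proof (cases "w1 a = 0")
    case True
    then have "0 < w2 a" using crit[of a] a by auto
    then show ?thesis
      using has_real_derivative_pos_inc_right[of w1 "w2 a" a "{0..}"] d2 a True by (auto; smt (verit))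
  next
    case False
    then have "w1 a > 0" using a by simp
    then obtain e where e: "e > 0" "\<forall>y\<in>{0..}. dist y a < e \<longrightarrow> dist (w1 y) (w1 a) < w1 a"
      using cont[unfolded continuous_on_iff, rule_format, of a "w1 a"] a by auto
    have "0 < w1 (a + h)" if "h > 0" "h < e" for h
    proof -
      have "dist (w1 (a + h)) (w1 a) < w1 a" using e(2) that a by (auto simp: dist_real_def)
      then show ?thesis by (simp add: dist_real_def)
    qed
    then show ?thesis using e(1) by blast
  qed
  then obtain e where e: "e > 0" "\<And>h. 0 < h \<Longrightarrow> h < e \<Longrightarrow> 0 < w1 (a + h)" by blast
  define b where "b = a + min (e/2) ((x - a)/2)"
  have b: "a < b" "b < x" using e \<open>a < x\<close> by (auto simp: b_def min_def field_simps)
  have b_pos: "0 < w1 y" if "a < y" "y \<le> b" for y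
    using e(2)[of "y - a"] that e(1) by (auto simp: b_def)
  \<comment> \<open>The search for the first nonpositive slope starts at \<open>b\<close>, not at
    \<open>a\<close>, because \<open>w1 a = 0\<close> is allowed; \<open>Inf Z\<close> is attained
    and lies strictly beyond \<open>b\<close>.\<close>
  define Z where "Z = {y\<in>{b..x}. w1 y \<le> 0}"
  define z where "z = Inf Z"
  have "closed Z" unfolding Z_def
    using cont a b by (intro continuous_closed_preimage_constant continuous_on_closed_Collect_le[of "{b..x}" w1 "\<lambda>_. 0"])
      (auto intro: continuous_on_subset)
  moreover have "x \<in> Z" "bdd_below Z" using b neg by (auto simp: Z_def)
  ultimately have zZ: "z \<in> Z" unfolding z_def by (intro closed_contains_Inf) auto
  have zlow: "z \<le> y" if "y \<in> Z" for y
    unfolding z_def using that \<open>bdd_below Z\<close> by (rule cInf_lower)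
  have "z \<noteq> b" using zZ b_pos[of b] b by (auto simp: Z_def)
  then have z: "b < z" "z \<le> x" "w1 z \<le> 0" using zZ by (auto simp: Z_def)
  have pos: "0 < w1 y" if "a < y" "y < z" for y
    using b_pos[of y] zlow[of y] that z unfolding Z_def by (cases "y \<le> b"; cases "w1 y \<le> 0") auto
  have "\<exists>y\<ge>b. y \<le> z \<and> w1 y = 0"
    using b_pos[of b] b z a by (intro IVT2') (auto intro: continuous_on_subset[OF cont])
  then obtain y where y: "b \<le> y" "y \<le> z" "w1 y = 0" by blast
  have "y = z" using pos[of y] y b by (cases "y = z") auto
  then have z0: "w1 z = 0" using y by simp
  have "0 \<le> z" using a b z by simp
  have "0 < w z"
  proof -
    obtain y where "a < y" "y < z" "w z - w a = (z - a) * w1 y"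
      using has_hderiv_mvt[OF d1 a(1), of z] b z by auto
    then show ?thesis using pos[of y] a(2) by (smt (verit) mult_pos_pos)
  qed
  then have "0 < w2 z" using crit[of z] z0 a b z by auto
  then obtain c where c: "c > 0" "\<And>h. 0 < h \<Longrightarrow> z - h \<in> {0..} \<Longrightarrow> h < c \<Longrightarrow> w1 (z - h) < w1 z"
    using has_real_derivative_pos_inc_left[of w1 "w2 z" z "{0..}"] d2 \<open>0 \<le> z\<close> by blast
  define h where "h = min (c/2) ((z-a)/2)"
  have "0 < h" "h < c" "a < z - h" "z - h < z" using c b z by (auto simp: h_def min_def field_simps)
  then show False using c(2)[of h] pos[of "z - h"] z0 a by auto
qed

lemma concave_on_halfline:
  assumes d1: "has_hderiv f f1" and d2: "has_hderiv f1 f2" and "\<And>x. 0 \<le> x \<Longrightarrow> f2 x \<le> 0"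
  shows "concave_on {0..} f"
proof -
  have anti: "f1 y \<le> f1 x" if "0 \<le> x" "x \<le> y" for x y
  proof (cases "x = y")
    case False
    then have "x < y" using that by auto
    with that obtain z where "x < z" "f1 y - f1 x = (y - x) * f2 z"
      using has_hderiv_mvt[OF d2, of x y] by auto
    then show ?thesis using assms(3)[of z] that by (smt (verit) mult_nonneg_nonpos)
  qed auto
  have "convex_on {0..} (\<lambda>x. - f x)"
  proof (rule pos_convex_function[where f' = "\<lambda>x. - f1 x"])
    fix x y :: real assume xy: "x \<in> {0..}" "y \<in> {0..}"
    have "f y - f x \<le> f1 x * (y - x)"
    proof (cases rule: linorder_cases[of x y])
      case less
      then obtain z where "x < z" "f y - f x = (y - x) * f1 z"
        using has_hderiv_mvt[OF d1, of x y] xy by auto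
      then show ?thesis using anti[of x z] xy less by (simp add: mult.commute mult_left_mono)
    next
      case greater
      then obtain z where "y < z" "z < x" "f x - f y = (x - y) * f1 z"
        using has_hderiv_mvt[OF d1, of y x] xy by auto
      then have "f1 x \<le> f1 z" using anti[of z x] xy by auto
      then have "(x - y) * f1 x \<le> f x - f y" using greater \<open>f x - f y = _\<close> by (simp add: mult_left_mono)
      then show ?thesis by (simp add: algebra_simps)
    qed auto
    then show "- f1 x * (y - x) \<le> - f y - - f x" by simp
  qed auto
  then show ?thesis by (simp add: concave_on_def)
qed

lemma hderiv_pos_strict_mono:
  assumes "has_hderiv f f'" "\<And>x. 0 \<le> x \<Longrightarrow> 0 < f' x"
  shows "strict_mono_on {0..} f"
proof (rule strict_mono_onI)
  fix x y :: real assume "x \<in> {0..}" "y \<in> {0..}" "x < y"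
  then obtain z where "x < z" "f y - f x = (y - x) * f' z"
    using has_hderiv_mvt[OF assms(1), of x y] by auto
  then show "f x < f y" using assms(2)[of z] \<open>x < y\<close> \<open>x \<in> _\<close> by (smt (verit) atLeast_iff mult_pos_pos)
qed

lemma strict_mono_hderiv_nonneg:
  assumes "has_hderiv f f'" "strict_mono_on {0..} f" "0 \<le> x"
  shows "0 \<le> f' x"
proof (rule ccontr)
  assume "\<not> 0 \<le> f' x"
  then obtain d where "d > 0" "\<forall>h>0. x + h \<in> {0..} \<longrightarrow> h < d \<longrightarrow> f (x + h) < f x"
    using has_real_derivative_neg_dec_right[of f "f' x" x "{0..}"] assms by auto
  then have "f (x + d/2) < f x" using assms(3) by auto
  then show False using strict_mono_onD[OF assms(2), of x "x + d/2"] \<open>d > 0\<close> assms(3) by auto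
qed

section \<open>Integral equations\<close>

lemma set_integral_exp:
  fixes c t :: real
  assumes "0 \<le> t" "c \<noteq> 0"
  shows "(LBINT s:{0..t}. exp (c * s)) = (exp (c * t) - 1) / c"
    and "set_integrable lborel {0..t} (\<lambda>s. exp (c * s))"
proof -
  show "set_integrable lborel {0..t} (\<lambda>s. exp (c * s))"
    by (intro borel_integrable_atLeastAtMost' continuous_intros)
  have "(LBINT s:{0..t}. exp (c * s)) = exp (c * t) / c - exp (c * 0) / c"
    unfolding set_lebesgue_integral_def
    by (intro integral_FTC_Icc assms)
      (use assms in \<open>auto intro!: derivative_eq_intros continuous_intros simp flip: has_real_derivative_iff_has_vector_derivative\<close>)
  then show "(LBINT s:{0..t}. exp (c * s)) = (exp (c * t) - 1) / c" by (simp add: diff_divide_distrib)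
qed

lemma set_integral_bound:
  fixes k :: "real \<Rightarrow> 'a::{banach,second_countable_topology}"
  assumes "set_integrable lborel {a..b} h" "\<And>s. a \<le> s \<Longrightarrow> s \<le> b \<Longrightarrow> norm (k s) \<le> h s"
  shows "norm (LBINT s:{a..b}. k s) \<le> (LBINT s:{a..b}. h s)"
proof (cases "set_integrable lborel {a..b} k")
  case True
  have "norm (LBINT s:{a..b}. k s) \<le> (LBINT s:{a..b}. norm (k s))"
    using True by (rule set_integral_norm_bound)
  also have "\<dots> \<le> (LBINT s:{a..b}. h s)"
    using True assms by (intro set_integral_mono set_integrable_norm) auto
  finally show ?thesis .
next
  case False
  \<comment> \<open>A non-integrable \<open>k\<close> has integral \<open>0\<close>, so here only
    the sign of the right-hand side matters.\<close>
  have "0 \<le> (LBINT s:{a..b}. h s)"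
    unfolding set_lebesgue_integral_def
    using order_trans[OF norm_ge_zero assms(2)] by (intro integral_nonneg_AE AE_I2) (auto simp: indicator_def)
  with False show ?thesis
    by (simp add: set_lebesgue_integral_def set_integrable_def not_integrable_integral_eq)
qed

lemma set_integrable_bounded:
  fixes k :: "real \<Rightarrow> 'a::{banach,second_countable_topology}"
  assumes "set_borel_measurable borel {a..b} k" "\<And>s. a \<le> s \<Longrightarrow> s \<le> b \<Longrightarrow> norm (k s) \<le> B"
  shows "set_integrable lborel {a..b} k"
proof -
  have "set_integrable lborel {a..b} (\<lambda>_. B)" by (intro borel_integrable_atLeastAtMost' continuous_intros)
  moreover have "set_borel_measurable lborel {a..b} k"
    using assms(1) by (simp add: set_borel_measurable_def)
  moreover have "AE s in lborel. s \<in> {a..b} \<longrightarrow> norm (k s) \<le> norm B"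
  proof (intro AE_I2 impI)
    fix s assume "s \<in> {a..b}"
    then have "norm (k s) \<le> B" using assms(2) by auto
    then show "norm (k s) \<le> norm B" by simp
  qed
  ultimately show ?thesis by (rule set_integrable_bound)
qed

text \<open>The inequality is iterated instead of differentiated, so \<open>f\<close> needs neither
  continuity nor measurability; integrability is asked of \<open>k\<close> only. The bound on
  \<open>k\<close> leaves out the time \<open>T\<close>, because an integrand evaluated along a
  surplus path may misbehave at the instant of ruin.\<close>

lemma gronwall:
  fixes f k :: "real \<Rightarrow> real"
  assumes L: "0 < L" and a: "0 \<le> a"
    and bdd: "\<And>t. 0 \<le> t \<Longrightarrow> t \<le> T \<Longrightarrow> f t \<le> B"
    and int: "set_integrable lborel {0..T} k"
    and le: "\<And>t. 0 \<le> t \<Longrightarrow> t \<le> T \<Longrightarrow> f t \<le> a + (LBINT s:{0..t}. k s)"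
    and k: "\<And>s. 0 \<le> s \<Longrightarrow> s < T \<Longrightarrow> k s \<le> L * f s"
    and t: "0 \<le> t" "t \<le> T"
  shows "f t \<le> a * exp (L * t)"
proof -
  define B' where "B' = max B 0"
  \<comment> \<open>The crude bound \<open>B'\<close> is multiplied by \<open>1/2\<close> in each
    round, because integrating \<open>L * exp (2 * L * s)\<close> gives at most
    \<open>exp (2 * L * t) / 2\<close>.\<close>
  have step: "f t \<le> a * exp (L * t) + B' * (1/2) ^ n * exp (2 * L * t)" if "0 \<le> t" "t \<le> T" for n t
    using that
  proof (induction n arbitrary: t)
    case 0
    have "f t \<le> B' * exp (2 * L * t)"
      using bdd[OF 0] L 0 by (smt (verit) B'_def mult_le_cancel_left1 one_le_exp_iff mult_nonneg_nonneg)
    then show ?case using a by (simp add: add_increasing)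
  next
    case (Suc n)
    define h where "h = (\<lambda>s. L * a * exp (L * s) + L * B' * (1/2) ^ n * exp (2 * L * s))"
    have hint: "set_integrable lborel {0..t} h"
      unfolding h_def by (intro borel_integrable_atLeastAtMost' continuous_intros)
    have "(LBINT s:{0..t}. k s) \<le> (LBINT s:{0..t}. h s)"
    proof (rule set_integral_mono_AE[OF set_integrable_subset[OF int] hint])
      have "AE s in lborel. s \<noteq> T" by (rule AE_lborel_singleton)
      then show "AE s\<in>{0..t} in lborel. k s \<le> h s"
      proof (rule AE_mp, intro AE_I2 impI)
        fix s assume "s \<noteq> T" "s \<in> {0..t}"
        then have s: "0 \<le> s" "s < T" using Suc.prems by auto
        have "k s \<le> L * f s" using k s by auto
        also have "\<dots> \<le> L * (a * exp (L * s) + B' * (1/2) ^ n * exp (2 * L * s))"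
          using Suc.IH[of s] s L by (intro mult_left_mono) auto
        finally show "k s \<le> h s" by (simp add: h_def algebra_simps)
      qed
    qed (use Suc.prems in auto)
    also have "\<dots> = L * a * ((exp (L * t) - 1) / L) + L * B' * (1/2) ^ n * ((exp (2 * L * t) - 1) / (2 * L))"
      unfolding h_def using set_integral_exp[OF Suc.prems(1), of L] set_integral_exp[OF Suc.prems(1), of "2 * L"] L
      by (subst set_integral_add) auto
    also have "\<dots> = a * (exp (L * t) - 1) + B' * (1/2) ^ Suc n * (exp (2 * L * t) - 1)"
      using L by (simp add: field_simps)
    also have "\<dots> \<le> a * exp (L * t) - a + B' * (1/2) ^ Suc n * exp (2 * L * t)"
      by (simp add: B'_def algebra_simps)
    finally show ?case using le[OF Suc.prems] by simp
  qed
  have "(\<lambda>n. a * exp (L * t) + B' * (1/2) ^ n * exp (2 * L * t)) \<longlonglongrightarrow> a * exp (L * t) + B' * 0 * exp (2 * L * t)"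
    by (intro tendsto_intros LIMSEQ_power_zero) auto
  then show ?thesis using step[OF t] by (intro LIMSEQ_le_const) auto
qed

text \<open>Gronwall applied to the absolute difference, which is bounded by the integral of the
  absolute value of \<open>k\<close>. Both solutions may jump; common jumps cancel in the
  difference.\<close>

lemma integral_equation_unique:
  fixes f1 f2 k :: "real \<Rightarrow> real"
  assumes L: "0 < L"
    and int: "set_integrable lborel {0..T} k"
    and eq: "\<And>t. 0 \<le> t \<Longrightarrow> t \<le> T \<Longrightarrow> f1 t - f2 t = (LBINT s:{0..t}. k s)"
    and k: "\<And>s. 0 \<le> s \<Longrightarrow> s < T \<Longrightarrow> \<bar>k s\<bar> \<le> L * \<bar>f1 s - f2 s\<bar>"
    and t: "0 \<le> t" "t \<le> T"
  shows "f1 t = f2 t"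
proof -
  have le: "\<bar>f1 t - f2 t\<bar> \<le> (LBINT s:{0..t}. \<bar>k s\<bar>)" if "0 \<le> t" "t \<le> T" for t
    using set_integral_norm_bound[OF set_integrable_subset[OF int], of "{0..t}"] that eq[OF that] by simp
  have B: "\<bar>f1 t - f2 t\<bar> \<le> (LBINT s:{0..T}. \<bar>k s\<bar>)" if "0 \<le> t" "t \<le> T" for t
  proof -
    have "(LBINT s:{0..t}. \<bar>k s\<bar>) \<le> (LBINT s:{0..T}. \<bar>k s\<bar>)"
      unfolding set_lebesgue_integral_def
      using set_integrable_abs[OF int] set_integrable_abs[OF set_integrable_subset[OF int], of "{0..t}"] that
      by (intro integral_mono) (auto simp: set_integrable_def indicator_def)
    then show ?thesis using le[OF that] by simp
  qed
  have "\<bar>f1 t - f2 t\<bar> \<le> 0 * exp (L * t)"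
    by (rule gronwall[where T = T and k = "\<lambda>s. \<bar>k s\<bar>"]) (use assms le B in \<open>auto intro: set_integrable_abs\<close>)
  then show ?thesis by simp
qed

section \<open>Picard iteration for integral equations with a discontinuous forcing term\<close>

primrec picard :: "(real \<Rightarrow> 'a \<Rightarrow> 'a) \<Rightarrow> (real \<Rightarrow> 'a) \<Rightarrow> nat \<Rightarrow> real \<Rightarrow> 'a::{banach,second_countable_topology}" where
  "picard G r 0 = r"
| "picard G r (Suc n) = (\<lambda>t. r t + (LBINT s:{0..t}. G s (picard G r n s)))"

lemma borel_measurable_set_integral_Icc:
  fixes h :: "real \<Rightarrow> 'a::{banach,second_countable_topology}"
  assumes [measurable]: "h \<in> borel_measurable borel"
  shows "(\<lambda>t. LBINT s:{0..t}. h s) \<in> borel_measurable borel"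
  unfolding set_lebesgue_integral_def
proof (rule lborel.borel_measurable_lebesgue_integral)
  have "(\<lambda>(t, s). indicat_real {0..t} s *\<^sub>R h s) = (\<lambda>p. (if 0 \<le> snd p \<and> snd p \<le> fst p then 1 else 0) *\<^sub>R h (snd p))"
    by (auto simp: fun_eq_iff indicator_def)
  also have "\<dots> \<in> borel_measurable (borel \<Otimes>\<^sub>M lborel)" by measurable
  finally show "(\<lambda>(t, s). indicat_real {0..t} s *\<^sub>R h s) \<in> borel_measurable (borel \<Otimes>\<^sub>M lborel)" .
qed

text \<open>On each bounded interval successive iterates differ by at most a multiple of
  \<open>(1/2)^n * exp (2 * L * t)\<close>: the exponential weight turns the Lipschitz map into a
  contraction. The construction is kept pointwise and explicit because limits of iterates inherit
  measurability in the scenario. The forcing term \<open>r\<close> is only measurable and locally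
  bounded, since in the applications it contains the claims.\<close>

lemma picard_limit:
  fixes G :: "real \<Rightarrow> 'a \<Rightarrow> 'a::{banach,second_countable_topology}"
  assumes meas: "\<And>f. f \<in> borel_measurable borel \<Longrightarrow> (\<lambda>s. G s (f s)) \<in> borel_measurable borel"
    and lip: "\<And>T. \<exists>L. \<forall>s x y. 0 \<le> s \<longrightarrow> s \<le> T \<longrightarrow> norm (G s x - G s y) \<le> L * norm (x - y)"
    and r: "r \<in> borel_measurable borel"
    and bdd: "\<And>T. \<exists>B. \<forall>s. 0 \<le> s \<longrightarrow> s \<le> T \<longrightarrow> norm (G s (r s)) \<le> B"
  obtains X where "\<And>t. (\<lambda>n. picard G r n t) \<longlonglongrightarrow> X t" "X \<in> borel_measurable borel"
    "\<And>t. 0 \<le> t \<Longrightarrow> set_integrable lborel {0..t} (\<lambda>s. G s (X s))"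
    "\<And>t. 0 \<le> t \<Longrightarrow> X t = r t + (LBINT s:{0..t}. G s (X s))"
proof -
  have measP: "picard G r n \<in> borel_measurable borel" for n
    by (induction n) (auto intro!: borel_measurable_add r borel_measurable_set_integral_Icc meas)
  have measG: "set_borel_measurable borel {0..t} (\<lambda>s. G s (picard G r n s))" for n t
    unfolding set_borel_measurable_def using meas[OF measP] by (intro borel_measurable_scaleR) auto
  have main: "\<exists>C. (\<forall>n t. 0 \<le> t \<longrightarrow> t \<le> T \<longrightarrow> norm (picard G r (Suc n) t - picard G r n t) \<le> C * (1/2) ^ n)
      \<and> (\<forall>n t. 0 \<le> t \<longrightarrow> t \<le> T \<longrightarrow> norm (G t (picard G r n t)) \<le> C)
      \<and> (\<forall>t x y. 0 \<le> t \<longrightarrow> t \<le> T \<longrightarrow> norm (G t x - G t y) \<le> C * norm (x - y))" if T: "0 \<le> T" for T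
  proof -
    obtain L0 where L0: "\<And>s x y. 0 \<le> s \<Longrightarrow> s \<le> T \<Longrightarrow> norm (G s x - G s y) \<le> L0 * norm (x - y)"
      using lip[of T] by blast
    obtain B0 where B0: "\<And>s. 0 \<le> s \<Longrightarrow> s \<le> T \<Longrightarrow> norm (G s (r s)) \<le> B0" using bdd[of T] by blast
    define L where "L = max L0 1"
    have L: "norm (G s x - G s y) \<le> L * norm (x - y)" if "0 \<le> s" "s \<le> T" for s x y
      using L0[OF that, of x y] by (smt (verit) L_def mult_right_mono norm_ge_zero)
    have "0 < L" by (simp add: L_def)
    have "0 \<le> B0" using B0[of 0] T by (smt (verit) norm_ge_zero)
    define C where "C = B0 * T * exp (2 * L * T)"
    have "0 \<le> C" using \<open>0 \<le> B0\<close> T by (simp add: C_def)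
    \<comment> \<open>Three facts travel together: the geometric decay of the increments, a bound on
      \<open>G\<close> along the iterate, which gives integrability, and the distance to
      \<open>r\<close>, whose factor \<open>2\<close> is the sum of the geometric series.\<close>
    have step: "norm (picard G r (Suc n) t - picard G r n t) \<le> B0 * T * (1/2) ^ n * exp (2 * L * t) \<and>
       norm (G t (picard G r n t)) \<le> B0 + L * (2 * C * (1 - (1/2)^n)) \<and>
       norm (picard G r n t - r t) \<le> 2 * C * (1 - (1/2)^n)"
      if "0 \<le> t" "t \<le> T" for n t
      using that
    proof (induction n arbitrary: t)
      case 0
      have "norm (LBINT s:{0..t}. G s (r s)) \<le> (LBINT s:{0..t}. B0)"
        using B0 0 by (intro set_integral_bound) (auto intro!: borel_integrable_atLeastAtMost')
      also have "\<dots> = B0 * t" using 0 by (simp add: set_integral_const)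
      also have "\<dots> \<le> B0 * T * exp (2 * L * t)"
      proof -
        have "B0 * t \<le> B0 * T" using 0 \<open>0 \<le> B0\<close> by (simp add: mult_left_mono)
        also have "\<dots> * 1 \<le> B0 * T * exp (2 * L * t)"
          using 0 \<open>0 \<le> B0\<close> \<open>0 < L\<close> T by (intro mult_left_mono) auto
        finally show ?thesis by simp
      qed
      finally show ?case using B0 0 by simp
    next
      case (Suc n)
      have intG: "set_integrable lborel {0..t} (\<lambda>s. G s (picard G r n s))" if "t \<le> T" for t
        using Suc.IH that by (intro set_integrable_bounded[where B = "B0 + L * (2 * C * (1 - (1/2)^n))"] measG) auto
      have close: "norm (picard G r (Suc n) t - r t) \<le> 2 * C * (1 - (1/2)^Suc n)" if "0 \<le> t" "t \<le> T" for t
      proof -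
        have "B0 * T * (1/2) ^ n * exp (2 * L * t) \<le> B0 * T * (1/2) ^ n * exp (2 * L * T)"
          using that \<open>0 \<le> B0\<close> T \<open>0 < L\<close> by (intro mult_left_mono) auto
        then have "norm (picard G r (Suc n) t - picard G r n t) \<le> C * (1/2)^n"
          using Suc.IH[OF that] by (simp add: C_def algebra_simps)
        then have "norm ((picard G r (Suc n) t - picard G r n t) + (picard G r n t - r t)) \<le> C * (1/2)^n + 2 * C * (1 - (1/2)^n)"
          using Suc.IH[OF that] by (intro norm_triangle_mono) auto
        then show ?thesis by (simp add: algebra_simps)
      qed
      have bd: "norm (G t (picard G r (Suc n) t)) \<le> B0 + L * (2 * C * (1 - (1/2)^Suc n))" if "0 \<le> t" "t \<le> T" for t
      proof -
        have "norm (G t (r t) + (G t (picard G r (Suc n) t) - G t (r t))) \<le> B0 + L * (2 * C * (1 - (1/2)^Suc n))"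
          using B0[OF that] order_trans[OF L[OF that] mult_left_mono[OF close[OF that]]] \<open>0 < L\<close>
          by (intro norm_triangle_mono) auto
        then show ?thesis by simp
      qed
      have intG': "set_integrable lborel {0..t} (\<lambda>s. G s (picard G r (Suc n) s))" if "t \<le> T" for t
        using bd that by (intro set_integrable_bounded[where B = "B0 + L * (2 * C * (1 - (1/2)^Suc n))"] measG) auto
      have "norm (picard G r (Suc (Suc n)) t - picard G r (Suc n) t)
          = norm (LBINT s:{0..t}. G s (picard G r (Suc n) s) - G s (picard G r n s))"
        using intG[of t] intG'[of t] Suc.prems by (subst set_integral_diff) auto
      also have "\<dots> \<le> (LBINT s:{0..t}. L * (B0 * T * (1/2) ^ n) * exp (2 * L * s))"
      proof (rule set_integral_bound)
        fix s assume s: "0 \<le> s" "s \<le> t"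
        have "norm (G s (picard G r (Suc n) s) - G s (picard G r n s)) \<le> L * norm (picard G r (Suc n) s - picard G r n s)"
          using L s Suc.prems by auto
        also have "\<dots> \<le> L * (B0 * T * (1/2) ^ n * exp (2 * L * s))"
          using Suc.IH[of s] s Suc.prems \<open>0 < L\<close> by (intro mult_left_mono) auto
        finally show "norm (G s (picard G r (Suc n) s) - G s (picard G r n s)) \<le> L * (B0 * T * (1/2) ^ n) * exp (2 * L * s)"
          by (simp add: mult.assoc)
      qed (intro borel_integrable_atLeastAtMost' continuous_intros)
      also have "\<dots> = L * (B0 * T * (1/2) ^ n) * ((exp (2 * L * t) - 1) / (2 * L))"
        using set_integral_exp(1)[OF Suc.prems(1), of "2 * L"] \<open>0 < L\<close> by simp
      also have "\<dots> = B0 * T * (1/2) ^ Suc n * (exp (2 * L * t) - 1)" using \<open>0 < L\<close> by (simp add: field_simps)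
      also have "\<dots> \<le> B0 * T * (1/2) ^ Suc n * exp (2 * L * t)"
        using \<open>0 \<le> B0\<close> T by (intro mult_left_mono) auto
      finally show ?case using bd[OF Suc.prems] close[OF Suc.prems] by blast
    qed
    define C' where "C' = max C (max L (B0 + L * (2 * C)))"
    have "norm (picard G r (Suc n) t - picard G r n t) \<le> C' * (1/2) ^ n" if "0 \<le> t" "t \<le> T" for n t
    proof -
      have "B0 * T * (1/2) ^ n * exp (2 * L * t) \<le> B0 * T * (1/2) ^ n * exp (2 * L * T)"
        using that \<open>0 \<le> B0\<close> T \<open>0 < L\<close> by (intro mult_left_mono) auto
      then have "norm (picard G r (Suc n) t - picard G r n t) \<le> C * (1/2)^n"
        using step[OF that, of n] by (simp add: C_def algebra_simps)
      also have "\<dots> \<le> C' * (1/2)^n" by (intro mult_right_mono) (auto simp: C'_def)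
      finally show ?thesis .
    qed
    moreover have "norm (G t (picard G r n t)) \<le> C'" if "0 \<le> t" "t \<le> T" for n t
    proof -
      have "B0 + L * (2 * C * (1 - (1/2)^n)) \<le> B0 + L * (2 * C * 1)"
        using \<open>0 \<le> C\<close> \<open>0 < L\<close> by (intro add_left_mono mult_left_mono) auto
      then have "norm (G t (picard G r n t)) \<le> B0 + L * (2 * C * 1)" using step[OF that, of n] by linarith
      then show ?thesis by (simp add: C'_def)
    qed
    moreover have "norm (G t x - G t y) \<le> C' * norm (x - y)" if "0 \<le> t" "t \<le> T" for t x y
      using L[OF that, of x y] by (rule order_trans) (auto intro!: mult_right_mono simp: C'_def)
    ultimately show ?thesis by blast
  qed
  have "convergent (\<lambda>n. picard G r n t)" for t
  proof (cases "0 \<le> t")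
    case True
    obtain C where C: "\<And>n. norm (picard G r (Suc n) t - picard G r n t) \<le> C * (1/2) ^ n"
      using main[OF True] True by blast
    have "summable (\<lambda>n. picard G r (Suc n) t - picard G r n t)"
    proof (rule summable_norm_cancel, rule summable_comparison_test)
      show "\<exists>N. \<forall>n\<ge>N. norm (norm (picard G r (Suc n) t - picard G r n t)) \<le> C * (1/2)^n" using C by auto
      show "summable (\<lambda>n. C * (1/2::real)^n)" by (intro summable_mult summable_geometric) auto
    qed
    then have "convergent (\<lambda>n. \<Sum>i<n. picard G r (Suc i) t - picard G r i t)" by (simp add: summable_iff_convergent)
    then have "convergent (\<lambda>n. picard G r n t - picard G r 0 t)" by (simp only: sum_lessThan_telescope[of "\<lambda>i. picard G r i t"])
    from convergent_add[OF this convergent_const[of "picard G r 0 t"]] show ?thesis by simp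
  next
    case False
    \<comment> \<open>At negative times the domain of integration is empty.\<close>
    have "picard G r n t = r t" for n using False by (cases n) (auto simp: set_lebesgue_integral_def)
    then show ?thesis by (simp add: convergent_const)
  qed
  then obtain X where X: "\<And>t. (\<lambda>n. picard G r n t) \<longlonglongrightarrow> X t" unfolding convergent_def by metis
  have measX: "X \<in> borel_measurable borel" by (rule borel_measurable_LIMSEQ_metric[OF measP X])
  have "set_integrable lborel {0..t} (\<lambda>s. G s (X s)) \<and> X t = r t + (LBINT s:{0..t}. G s (X s))" if t: "0 \<le> t" for t
  proof -
    obtain C where C: "\<And>n s. 0 \<le> s \<Longrightarrow> s \<le> t \<Longrightarrow> norm (G s (picard G r n s)) \<le> C"
      "\<And>s x y. 0 \<le> s \<Longrightarrow> s \<le> t \<Longrightarrow> norm (G s x - G s y) \<le> C * norm (x - y)"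
      using main[OF t] by blast
    have lim: "(\<lambda>n. G s (picard G r n s)) \<longlonglongrightarrow> G s (X s)" if "0 \<le> s" "s \<le> t" for s
    proof -
      have "(\<lambda>n. C * norm (picard G r n s - X s)) \<longlonglongrightarrow> C * norm (X s - X s)" by (intro tendsto_intros X)
      then have "(\<lambda>n. C * norm (picard G r n s - X s)) \<longlonglongrightarrow> 0" by simp
      then have "(\<lambda>n. G s (picard G r n s) - G s (X s)) \<longlonglongrightarrow> 0"
        by (rule Lim_null_comparison[OF always_eventually[OF allI[OF C(2)[OF that]]]])
      then show ?thesis by (rule LIM_zero_cancel)
    qed
    have *: "(\<lambda>n. LINT s|lborel. indicat_real {0..t} s *\<^sub>R G s (picard G r n s)) \<longlonglongrightarrow> (LINT s|lborel. indicat_real {0..t} s *\<^sub>R G s (X s))"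
      "integrable lborel (\<lambda>s. indicat_real {0..t} s *\<^sub>R G s (X s))"
    proof -
      have 1: "(\<lambda>s. indicat_real {0..t} s *\<^sub>R G s (X s)) \<in> borel_measurable lborel"
        using meas[OF measX] by simp
      have 2: "(\<lambda>s. indicat_real {0..t} s *\<^sub>R G s (picard G r n s)) \<in> borel_measurable lborel" for n
        using meas[OF measP] by simp
      have 3: "integrable lborel (\<lambda>s. indicat_real {0..t} s *\<^sub>R C)"
        using borel_integrable_atLeastAtMost'[of 0 t "\<lambda>_. C"] by (auto simp: set_integrable_def)
      have 4: "AE s in lborel. (\<lambda>n. indicat_real {0..t} s *\<^sub>R G s (picard G r n s)) \<longlonglongrightarrow> indicat_real {0..t} s *\<^sub>R G s (X s)"
        using lim by (intro AE_I2) (auto simp: indicator_def)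
      have 5: "AE s in lborel. norm (indicat_real {0..t} s *\<^sub>R G s (picard G r n s)) \<le> indicat_real {0..t} s *\<^sub>R C" for n
        using C(1) by (intro AE_I2) (auto simp: indicator_def)
      show "(\<lambda>n. LINT s|lborel. indicat_real {0..t} s *\<^sub>R G s (picard G r n s)) \<longlonglongrightarrow> (LINT s|lborel. indicat_real {0..t} s *\<^sub>R G s (X s))"
        by (rule integral_dominated_convergence[OF 1 2 3 4 5])
      show "integrable lborel (\<lambda>s. indicat_real {0..t} s *\<^sub>R G s (X s))"
        by (rule integrable_dominated_convergence[OF 1 2 3 4 5])
    qed
    have "(\<lambda>n. picard G r (Suc n) t) \<longlonglongrightarrow> r t + (LBINT s:{0..t}. G s (X s))"
      using *(1) by (simp add: set_lebesgue_integral_def tendsto_add)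
    then have "X t = r t + (LBINT s:{0..t}. G s (X s))"
      using LIMSEQ_Suc[OF X] LIMSEQ_unique by blast
    then show ?thesis using *(2) by (simp add: set_integrable_def)
  qed
  then show ?thesis using that X measX by blast
qed

lemma has_vector_derivative_set_integral:
  fixes h :: "real \<Rightarrow> 'a::euclidean_space"
  assumes h: "continuous_on {0..} h" and x: "0 \<le> x"
  shows "((\<lambda>t. LBINT s:{0..t}. h s) has_vector_derivative h x) (at x within {0..})"
proof -
  have cont: "continuous_on {0..b} h" for b using h by (rule continuous_on_subset) auto
  have eq: "(LBINT s:{0..t}. h s) = integral {0..t} h" for t
    by (intro set_borel_integral_eq_integral borel_integrable_atLeastAtMost' cont)
  have "((\<lambda>t. integral {0..t} h) has_vector_derivative h x) (at x within {0..x + 1})"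
    using x by (intro integral_has_vector_derivative cont) auto
  moreover have "at x within {0..x + 1} = at x within {0..}"
    by (rule at_within_nhd[of _ "{..<x + 1}"]) auto
  ultimately show ?thesis by (simp add: eq)
qed

lemma has_hderiv_set_integral:
  assumes "continuous_on {0..} h"
  shows "has_hderiv (\<lambda>t. LBINT s:{0..t}. h s) h"
  using has_vector_derivative_set_integral[OF assms] by (simp add: has_real_derivative_iff_has_vector_derivative)

section \<open>Linear second-order equations and their decreasing solution\<close>

lemma continuous_on_halfline_extend:
  fixes a :: "real \<Rightarrow> real"
  assumes "continuous_on {0..} a"
  shows "continuous_on UNIV (\<lambda>t. a (max 0 t))"
  by (rule continuous_on_compose2[OF assms]) (auto intro!: continuous_intros)

text \<open>The equation is solved as a first-order system for \<open>y\<close> and its derivative.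
  The coefficients are continued to negative times by their value at \<open>0\<close>, so that the
  right-hand side is measurable on the whole line; as it is linear in the state, one growth bound
  serves both the Lipschitz and the boundedness requirement of the iteration.\<close>

lemma linear_ode2_exists:
  fixes a b :: "real \<Rightarrow> real"
  assumes a: "continuous_on {0..} a" and b: "continuous_on {0..} b"
  obtains y z where "has_hderiv y z" "has_hderiv z (\<lambda>x. a x * z x + b x * y x)" "y 0 = c0" "z 0 = c1"
proof -
  define G :: "real \<Rightarrow> real \<times> real \<Rightarrow> real \<times> real" where
    "G = (\<lambda>s p. (snd p, a (max 0 s) * snd p + b (max 0 s) * fst p))"
  define r :: "real \<Rightarrow> real \<times> real" where "r = (\<lambda>_. (c0, c1))"
  have [measurable]: "(\<lambda>s. a (max 0 s)) \<in> borel_measurable borel" "(\<lambda>s. b (max 0 s)) \<in> borel_measurable borel"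
    using a b by (auto intro!: borel_measurable_continuous_onI continuous_on_halfline_extend)
  have bound: "\<exists>C. \<forall>s. 0 \<le> s \<longrightarrow> s \<le> T \<longrightarrow> \<bar>h s\<bar> \<le> C" if "continuous_on {0..} h" for h :: "real \<Rightarrow> real" and T
  proof -
    have "compact (h ` {0..T})" using that by (intro compact_continuous_image) (auto elim: continuous_on_subset)
    then obtain C where "\<forall>x\<in>h ` {0..T}. norm x \<le> C" using compact_imp_bounded bounded_iff by metis
    then show ?thesis by (intro exI[of _ C]) auto
  qed
  have "\<exists>C. \<forall>s p. 0 \<le> s \<longrightarrow> s \<le> T \<longrightarrow> norm (G s p) \<le> C * norm p" for T
  proof -
    obtain Ca Cb where C: "\<And>s. 0 \<le> s \<Longrightarrow> s \<le> T \<Longrightarrow> \<bar>a s\<bar> \<le> Ca" "\<And>s. 0 \<le> s \<Longrightarrow> s \<le> T \<Longrightarrow> \<bar>b s\<bar> \<le> Cb"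
      using bound[OF a, of T] bound[OF b, of T] by auto
    have "norm (G s p) \<le> (1 + Ca + Cb) * norm p" if s: "0 \<le> s" "s \<le> T" for s p
    proof -
      have "norm (G s p) \<le> norm (snd p) + norm (a s * snd p + b s * fst p)"
        unfolding G_def using s by (auto intro: order_trans[OF norm_Pair_le])
      also have "\<dots> \<le> norm (snd p) + (\<bar>a s\<bar> * norm (snd p) + \<bar>b s\<bar> * norm (fst p))"
        using abs_triangle_ineq[of "a s * snd p" "b s * fst p"] by (simp add: abs_mult)
      also have "\<dots> \<le> norm p + (Ca * norm p + Cb * norm p)"
        using C[OF s] norm_snd_le[of "snd p" "fst p"] norm_fst_le[of "fst p" "snd p"]
        by (intro add_mono mult_mono) auto
      finally show ?thesis by (simp add: algebra_simps)
    qed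
    then show ?thesis by blast
  qed
  note GC = this
  have Gdiff: "G s x - G s y = G s (x - y)" for s x y by (simp add: G_def algebra_simps)
  obtain X where X: "X \<in> borel_measurable borel"
    "\<And>t. 0 \<le> t \<Longrightarrow> set_integrable lborel {0..t} (\<lambda>s. G s (X s))"
    "\<And>t. 0 \<le> t \<Longrightarrow> X t = r t + (LBINT s:{0..t}. G s (X s))"
  proof (rule picard_limit[of G r])
    fix f :: "real \<Rightarrow> real \<times> real" assume [measurable]: "f \<in> borel_measurable borel"
    have [measurable]: "(\<lambda>s. fst (f s)) \<in> borel_measurable borel" "(\<lambda>s. snd (f s)) \<in> borel_measurable borel"
      by (rule measurable_compose[of f _ borel]; intro borel_measurable_continuous_onI continuous_intros \<open>f \<in> _\<close>)+
    show "(\<lambda>s. G s (f s)) \<in> borel_measurable borel" unfolding G_def by (intro borel_measurable_Pair; measurable)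
  next
    fix T show "\<exists>L. \<forall>s x y. 0 \<le> s \<longrightarrow> s \<le> T \<longrightarrow> norm (G s x - G s y) \<le> L * norm (x - y)"
      using GC[of T] unfolding Gdiff by blast
  next
    fix T show "\<exists>B. \<forall>s. 0 \<le> s \<longrightarrow> s \<le> T \<longrightarrow> norm (G s (r s)) \<le> B"
      using GC[of T] unfolding r_def by blast
  qed (auto simp: r_def)
  have contX: "continuous_on {0..} X"
  proof -
    have c: "continuous_on {0..t} X" if "0 \<le> t" for t
    proof -
      have "continuous_on {0..t} (\<lambda>s. r s + integral {0..s} (\<lambda>s. G s (X s)))"
        using set_borel_integral_eq_integral(1)[OF X(2)[OF that]]
        by (intro continuous_intros indefinite_integral_continuous_1) (auto simp: r_def)
      then show ?thesis
      proof (rule continuous_on_eq)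
        fix s assume "s \<in> {0..t}"
        then have s: "0 \<le> s" by simp
        show "r s + integral {0..s} (\<lambda>s. G s (X s)) = X s"
          using set_borel_integral_eq_integral(2)[OF X(2)[OF s]] X(3)[OF s] by metis
      qed
    qed
    show ?thesis
      unfolding continuous_on_eq_continuous_within
    proof
      fix x :: real assume "x \<in> {0..}"
      then have "0 \<le> x" by simp
      show "continuous (at x within {0..}) X"
      proof -
        have "continuous (at x within {0..x + 1}) X"
          using c[of "x + 1"] \<open>0 \<le> x\<close> by (auto simp: continuous_on_eq_continuous_within)
        moreover have "at x within {0..x + 1} = at x within {0..}"
          by (rule at_within_nhd[of _ "{..<x + 1}"]) auto
        ultimately show ?thesis by simp
      qed
    qed
  qed
  have contG: "continuous_on {0..} (\<lambda>s. G s (X s))"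
  proof (rule continuous_on_eq)
    show "continuous_on {0..} (\<lambda>s. (snd (X s), a s * snd (X s) + b s * fst (X s)))"
      by (intro continuous_intros contX a b)
  qed (auto simp: G_def)
  have dX: "(X has_vector_derivative G x (X x)) (at x within {0..})" if "0 \<le> x" for x
  proof (rule has_vector_derivative_transform)
    show "((\<lambda>t. r t + (LBINT s:{0..t}. G s (X s))) has_vector_derivative G x (X x)) (at x within {0..})"
      using has_vector_derivative_add[OF has_vector_derivative_const has_vector_derivative_set_integral[OF contG that], of "(c0, c1)"]
      by (simp add: r_def)
  qed (use X(3) that in auto)
  show ?thesis
  proof
    show "has_hderiv (\<lambda>x. fst (X x)) (\<lambda>x. snd (X x))"
      using bounded_linear.has_vector_derivative[OF bounded_linear_fst dX]
      by (simp add: has_real_derivative_iff_has_vector_derivative G_def)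
    have "((\<lambda>x. snd (X x)) has_real_derivative a x * snd (X x) + b x * fst (X x)) (at x within {0..})" if "0 \<le> x" for x
      using bounded_linear.has_vector_derivative[OF bounded_linear_snd dX[OF that]] that
      by (simp add: has_real_derivative_iff_has_vector_derivative G_def)
    then show "has_hderiv (\<lambda>x. snd (X x)) (\<lambda>x. a x * snd (X x) + b x * fst (X x))" by blast
    show "fst (X 0) = c0" "snd (X 0) = c1" using X(3)[of 0] set_borel_integral_eq_integral(2)[OF X(2)[of 0]] by (auto simp: r_def)
  qed
qed

text \<open>This is the recessive solution. With \<open>y0\<close>, \<open>y1\<close> the
  fundamental solutions with data \<open>(1, 0)\<close> and \<open>(0, 1)\<close>, the combination
  \<open>y0 - r * y1\<close> is nonincreasing if \<open>r\<close> bounds every ratio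
  \<open>z0 / z1\<close> from above, and nonnegative if \<open>r\<close> is below every ratio
  \<open>y0 / y1\<close>. The first family lies below the second, so its supremum is a valid
  \<open>r\<close>; strictness is obtained afterwards.\<close>

lemma decreasing_solution_exists:
  fixes a b :: "real \<Rightarrow> real"
  assumes a: "continuous_on {0..} a" and b: "continuous_on {0..} b" and b_pos: "\<And>x. 0 \<le> x \<Longrightarrow> 0 < b x"
  obtains y z where "has_hderiv y z" "has_hderiv z (\<lambda>x. a x * z x + b x * y x)"
    "\<And>x. 0 \<le> x \<Longrightarrow> 0 < y x" "\<And>x. 0 \<le> x \<Longrightarrow> z x < 0"
proof -
  obtain y0 z0 where 0: "has_hderiv y0 z0" "has_hderiv z0 (\<lambda>x. a x * z0 x + b x * y0 x)" "y0 0 = 1" "z0 0 = 0"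
    using linear_ode2_exists[OF a b] by blast
  obtain y1 z1 where 1: "has_hderiv y1 z1" "has_hderiv z1 (\<lambda>x. a x * z1 x + b x * y1 x)" "y1 0 = 0" "z1 0 = 1"
    using linear_ode2_exists[OF a b] by blast
  have z0: "0 < z0 x" if "0 < x" for x
    by (rule sgn_propagation[OF 0(1,2) _ order_refl]) (use 0 b_pos that in auto)
  have z1: "0 < z1 x" if "0 \<le> x" for x
  proof (cases "x = 0")
    case False
    show ?thesis by (rule sgn_propagation[OF 1(1,2) _ order_refl]) (use False 1 b_pos that in auto)
  qed (use 1 in auto)
  have y1: "0 < y1 x" if "0 < x" for x
    using hderiv_pos_strict_mono[OF 1(1) z1] strict_mono_onD[of "{0..}" y1 0 x] that 1 by auto
  \<comment> \<open>Abel's formula: the Wronskian times \<open>exp (- p)\<close> is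
    constant.\<close>
  have wronskian: "0 < y0 x * z1 x - z0 x * y1 x" if x: "0 \<le> x" for x
  proof -
    define p where "p = (\<lambda>t. LBINT s:{0..t}. a s)"
    have p: "(p has_real_derivative a x) (at x within {0..})" if "0 \<le> x" for x
      using has_hderiv_set_integral[OF a] that by (simp add: p_def)
    define W where "W = (\<lambda>x. (y0 x * z1 x - z0 x * y1 x) * exp (- p x))"
    have "(W has_real_derivative 0) (at x within {0..})" if "x \<in> {0..}" for x
      unfolding W_def using that
      by (auto intro!: derivative_eq_intros p 0(1)[rule_format] 0(2)[rule_format] 1(1)[rule_format] 1(2)[rule_format] simp: algebra_simps)
    then obtain c where c: "\<And>x. x \<in> {0..} \<Longrightarrow> W x = c"
      using has_field_derivative_zero_constant[of "{0..}" W] by auto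
    have "W x = W 0" using c x by auto
    also have "W 0 > 0" by (simp add: W_def 0 1)
    finally show ?thesis by (simp add: W_def zero_less_mult_iff)
  qed
  have sols: "has_hderiv (\<lambda>x. y0 x - r * y1 x) (\<lambda>x. z0 x - r * z1 x)"
    "has_hderiv (\<lambda>x. z0 x - r * z1 x) (\<lambda>x. a x * (z0 x - r * z1 x) + b x * (y0 x - r * y1 x))" for r
    by (auto intro!: derivative_eq_intros 0(1)[rule_format] 0(2)[rule_format] 1(1)[rule_format] 1(2)[rule_format] simp: algebra_simps)
  \<comment> \<open>The combination \<open>\<phi>\<close> that vanishes at \<open>n\<close> cannot
    have positive slope before \<open>n\<close>. If it were nonnegative there, it would go on rising
    and miss its zero at \<open>n\<close>. If it were negative, it would have fallen below zero
    earlier, and \<open>- \<phi>\<close> would still be rising.\<close>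
  have key: "z0 x - y0 n / y1 n * z1 x \<le> 0" if x: "0 \<le> x" "x < n" for x n
  proof (rule ccontr)
    define \<phi> where "\<phi> = (\<lambda>x. y0 x - y0 n / y1 n * y1 x)"
    define \<phi>' where "\<phi>' = (\<lambda>x. z0 x - y0 n / y1 n * z1 x)"
    have d: "has_hderiv \<phi> \<phi>'" "has_hderiv \<phi>' (\<lambda>x. a x * \<phi>' x + b x * \<phi> x)"
      unfolding \<phi>_def \<phi>'_def by (rule sols)+
    have d': "has_hderiv (\<lambda>x. - \<phi> x) (\<lambda>x. - \<phi>' x)" "has_hderiv (\<lambda>x. - \<phi>' x) (\<lambda>x. - (a x * \<phi>' x + b x * \<phi> x))"
      by (auto intro!: derivative_eq_intros d(1)[rule_format] d(2)[rule_format])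
    have "\<phi> n = 0" "\<phi> 0 = 1" using y1[of n] x 0 1 by (auto simp: \<phi>_def)
    assume "\<not> z0 x - y0 n / y1 n * z1 x \<le> 0"
    then have pos: "0 < \<phi>' x" by (simp add: \<phi>'_def)
    show False
    proof (cases "0 \<le> \<phi> x")
      case True
      have up: "0 < \<phi>' y" if "x < y" for y
        by (rule sgn_propagation[OF d _ x(1)]) (use True pos b_pos that in auto)
      obtain y where "x < y" "\<phi> n - \<phi> x = (n - x) * \<phi>' y" using has_hderiv_mvt[OF d(1) x] by blast
      then have "0 < \<phi> n" using up[of y] x True by (smt (verit) mult_pos_pos)
      then show False using \<open>\<phi> n = 0\<close> by simp
    next
      case False
      \<comment> \<open>Beyond the last time \<open>s\<close> with nonnegative
        \<open>\<phi>\<close>, the mean value theorem gives a point \<open>y\<close> where value and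
        slope are both negative; from there the sign of the slope persists up to
        \<open>x\<close>.\<close>
      define Z where "Z = {y\<in>{0..x}. 0 \<le> \<phi> y}"
      have "closed Z" unfolding Z_def
        using continuous_on_subset[OF has_hderiv_continuous[OF d(1)], of "{0..x}"]
        by (intro continuous_on_closed_Collect_le continuous_intros) auto
      moreover have "0 \<in> Z" "bdd_above Z" using x \<open>\<phi> 0 = 1\<close> by (auto simp: Z_def)
      ultimately have sZ: "Sup Z \<in> Z" by (intro closed_contains_Sup) auto
      define s where "s = Sup Z"
      have s: "0 \<le> s" "s < x" "0 \<le> \<phi> s" using sZ False by (auto simp: Z_def s_def less_le)
      obtain y where y: "s < y" "y < x" "\<phi> x - \<phi> s = (x - s) * \<phi>' y" using has_hderiv_mvt[OF d(1) s(1,2)] by blast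
      have "\<phi> y < 0"
      proof (rule ccontr)
        assume "\<not> \<phi> y < 0"
        then have "y \<in> Z" using y s by (auto simp: Z_def)
        then have "y \<le> s" unfolding s_def using \<open>bdd_above Z\<close> by (rule cSup_upper)
        then show False using y by simp
      qed
      moreover have "\<phi>' y < 0" using y(3) False s by (smt (verit) mult_nonneg_nonneg)
      ultimately have "0 < - \<phi>' x"
        by (intro sgn_propagation[OF d' _ _ _ _ _ y(2)]) (use b_pos s y in \<open>auto simp: mult_pos_neg\<close>)
      then show False using pos by simp
    qed
  qed
  define r where "r = (SUP x\<in>{0..}. z0 x / z1 x)"
  have ratio: "z0 x / z1 x \<le> y0 n / y1 n" if "0 \<le> x" "x < n" for x n
    using key[OF that] z1[OF that(1)] by (simp add: field_simps)
  have y0_le: "y0 n \<ge> y0 m / y1 m * y1 n" if "0 < n" "n < m" for n m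
  proof -
    have "\<exists>y>n. y < m \<and> (y0 m - y0 m / y1 m * y1 m) - (y0 n - y0 m / y1 m * y1 n) = (m - n) * (z0 y - y0 m / y1 m * z1 y)"
      using has_hderiv_mvt[OF sols(1), of n m "y0 m / y1 m"] that by (metis less_imp_le)
    then obtain y where "n < y" "y < m" "(y0 m - y0 m / y1 m * y1 m) - (y0 n - y0 m / y1 m * y1 n) = (m - n) * (z0 y - y0 m / y1 m * z1 y)"
      by blast
    moreover from this have "(m - n) * (z0 y - y0 m / y1 m * z1 y) \<le> 0" using key[of y m] that by (intro mult_nonneg_nonpos) auto
    moreover have "y0 m / y1 m * y1 m = y0 m" using y1[of m] that by simp
    ultimately show ?thesis by linarith
  qed
  have ratio': "z0 x / z1 x \<le> y0 n / y1 n" if "0 \<le> x" "0 < n" for x n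
  proof -
    \<comment> \<open>\<open>ratio\<close> only compares \<open>x\<close> with later points, so the
      quotient is first taken at \<open>m\<close>, beyond both \<open>x\<close> and
      \<open>n\<close>; it is carried back to \<open>n\<close> because \<open>y0 / y1\<close> is
      nonincreasing.\<close>
    define m where "m = max x n + 1"
    have "z0 x / z1 x \<le> y0 m / y1 m" using that by (intro ratio) (auto simp: m_def)
    also have "\<dots> \<le> y0 n / y1 n" using y0_le[of n m] y1[of n] that by (simp add: field_simps m_def)
    finally show ?thesis .
  qed
  have bdd: "bdd_above ((\<lambda>x. z0 x / z1 x) ` {0..})" using ratio'[of _ 1] by (auto intro!: bdd_aboveI2)
  have r1: "z0 x - r * z1 x \<le> 0" if "0 \<le> x" for x
    using cSUP_upper[OF _ bdd, of x] z1[OF that] that by (simp add: r_def field_simps)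
  have r2: "0 \<le> y0 x - r * y1 x" if "0 \<le> x" for x
  proof (cases "x = 0")
    case False
    have "r \<le> y0 x / y1 x" unfolding r_def using ratio' False that by (intro cSUP_least) auto
    then show ?thesis using y1[of x] False that by (simp add: field_simps)
  qed (use 0 1 in auto)
  have ypos: "0 < y0 x - r * y1 x" if x: "0 \<le> x" for x
  proof (rule ccontr)
    assume "\<not> 0 < y0 x - r * y1 x"
    \<comment> \<open>At a zero of the solution the Wronskian rules out zero slope, so the slope is
      negative and the solution would become negative just after.\<close>
    then have eq: "y0 x = r * y1 x" using r2[OF x] by simp
    have "z0 x - r * z1 x < 0"
    proof (rule ccontr)
      assume "\<not> z0 x - r * z1 x < 0"
      then have "z0 x = r * z1 x" using r1[OF x] by simp
      then show False using wronskian[OF x] eq by simp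
    qed
    then obtain d where "d > 0" "\<forall>h>0. x + h \<in> {0..} \<longrightarrow> h < d \<longrightarrow> y0 (x + h) - r * y1 (x + h) < y0 x - r * y1 x"
      using has_real_derivative_neg_dec_right[of "\<lambda>x. y0 x - r * y1 x" "z0 x - r * z1 x" x "{0..}"] sols(1)[of r] x by blast
    then have "y0 (x + d/2) - r * y1 (x + d/2) < y0 x - r * y1 x" using x by auto
    then show False using r2[of "x + d/2"] eq x \<open>d > 0\<close> by auto
  qed
  have zneg: "z0 x - r * z1 x < 0" if x: "0 \<le> x" for x
  proof (rule ccontr)
    assume "\<not> z0 x - r * z1 x < 0"
    then have "z0 x - r * z1 x = 0" using r1[OF x] by simp
    \<comment> \<open>With zero slope and positive value the solution would turn upwards for
      good.\<close>
    then have "0 < z0 (x + 1) - r * z1 (x + 1)"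
      by (intro sgn_propagation[OF sols _ x]) (use ypos[OF x] b_pos in auto)
    then show False using r1[of "x + 1"] x by simp
  qed
  show ?thesis by (rule that[OF sols ypos zneg])
qed

section \<open>The dividend equations\<close>

definition exp_conv :: "real \<Rightarrow> (real \<Rightarrow> real) \<Rightarrow> real \<Rightarrow> real" where
  "exp_conv \<alpha> v x = (LBINT y:{0..x}. v (x - y) * (\<alpha> * exp (- \<alpha> * y)))"

text \<open>Substituting \<open>z = x - y\<close> moves \<open>x\<close> out of the integrand into
  the factor \<open>exp (- \<alpha> * x)\<close>, so that the fundamental theorem of calculus
  suffices for differentiation.\<close>

lemma exp_conv_eq:
  "exp_conv \<alpha> v x = \<alpha> * exp (- \<alpha> * x) * (LBINT z:{0..x}. v z * exp (\<alpha> * z))"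
proof -
  have "exp_conv \<alpha> v x = \<bar>-1\<bar> *\<^sub>R (\<integral>z. indicat_real {0..x} (x + (-1) * z) *\<^sub>R
      (v (x - (x + (-1) * z)) * (\<alpha> * exp (- \<alpha> * (x + (-1) * z)))) \<partial>lborel)"
    unfolding exp_conv_def set_lebesgue_integral_def by (rule lborel_integral_real_affine) simp
  also have "\<dots> = (LBINT z:{0..x}. \<alpha> * exp (- \<alpha> * x) * (v z * exp (\<alpha> * z)))"
    unfolding set_lebesgue_integral_def
    by (auto intro!: Bochner_Integration.integral_cong simp: indicator_def algebra_simps simp flip: exp_add)
  finally show ?thesis by simp
qed

text \<open>Convolution with an exponential density satisfies a first-order linear equation. This is
  what allows the integral term to be eliminated from the integro-differential equation.\<close>

lemma has_hderiv_exp_conv: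
  assumes "continuous_on {0..} v"
  shows "has_hderiv (exp_conv \<alpha> v) (\<lambda>x. \<alpha> * v x - \<alpha> * exp_conv \<alpha> v x)"
proof -
  have "continuous_on {0..} (\<lambda>z. v z * exp (\<alpha> * z))" by (intro continuous_intros assms)
  from has_hderiv_set_integral[OF this]
  have d: "((\<lambda>x. LBINT z:{0..x}. v z * exp (\<alpha> * z)) has_real_derivative v x * exp (\<alpha> * x)) (at x within {0..})"
    if "0 \<le> x" for x using that by blast
  have e: "exp (- (\<alpha> * x)) * exp (\<alpha> * x) = 1" for x by (simp flip: exp_add)
  have "((\<lambda>x. \<alpha> * exp (- \<alpha> * x) * (LBINT z:{0..x}. v z * exp (\<alpha> * z))) has_real_derivative
      \<alpha> * v x - \<alpha> * (\<alpha> * exp (- \<alpha> * x) * (LBINT z:{0..x}. v z * exp (\<alpha> * z)))) (at x within {0..})" if "0 \<le> x" for x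
    by (rule derivative_eq_intros d[OF that] refl)+ (use e[of x] in \<open>simp add: algebra_simps\<close>)
  then show ?thesis unfolding exp_conv_eq[abs_def] by blast
qed

lemma exp_conv_cong:
  assumes "\<And>z. 0 \<le> z \<Longrightarrow> z \<le> x \<Longrightarrow> v z = c * w z"
  shows "exp_conv \<alpha> v x = c * exp_conv \<alpha> w x"
proof -
  have "(LBINT z:{0..x}. v z * exp (\<alpha> * z)) = (LBINT z:{0..x}. c * (w z * exp (\<alpha> * z)))"
    by (intro set_lebesgue_integral_cong) (auto simp: assms)
  then show ?thesis by (simp add: exp_conv_eq)
qed

lemma exp_conv_0 [simp]: "exp_conv \<alpha> v 0 = 0"
proof -
  have "(LBINT z:{0..0}. v z * exp (\<alpha> * z)) = 0"
    unfolding set_lebesgue_integral_def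
    by (rule integral_eq_zero_AE) (use AE_lborel_singleton[of "0::real"] in eventually_elim, simp)
  then show ?thesis by (simp add: exp_conv_eq)
qed

section \<open>The two differential equations\<close>

locale dividend_equations =
  fixes g g1 g2 :: "real \<Rightarrow> real" and lam \<alpha> \<delta> u0 :: real
  assumes lam_pos: "0 < lam" and alpha_pos: "0 < \<alpha>" and delta_pos: "0 < \<delta>" and u0_pos: "0 < u0"
    and g1: "has_hderiv g g1" and g2: "has_hderiv g1 g2"
    and g_gt: "\<And>x. 0 \<le> x \<Longrightarrow> u0 < g x"
    and cond_0: "0 < \<alpha> * lam * g 0 + (g1 0 - lam - \<delta>) * (lam + \<delta>)"
    and cond_sup: "\<And>x. 0 \<le> x \<Longrightarrow> g2 x + \<alpha> * g1 x - \<alpha> * \<delta> < 0"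
begin

lemma g_pos: "0 \<le> x \<Longrightarrow> 0 < g x"
  using g_gt[of x] u0_pos by linarith

text \<open>The value \<open>k = u0\<close> is the equation of \<open>\<psi>2\<close>, and
  \<open>k = 0\<close> the one that results from differentiating the integro-differential equation.
  The derivatives are arguments, and the endpoint \<open>0\<close> is included.\<close>

definition ode :: "real \<Rightarrow> (real \<Rightarrow> real) \<Rightarrow> (real \<Rightarrow> real) \<Rightarrow> (real \<Rightarrow> real) \<Rightarrow> bool" where
  "ode k \<phi> \<phi>1 \<phi>2 \<longleftrightarrow> has_hderiv \<phi> \<phi>1 \<and> has_hderiv \<phi>1 \<phi>2 \<and>
     (\<forall>x\<ge>0. (g x - k) * \<phi>2 x + (\<alpha> * g x - \<alpha> * k + g1 x - (lam + \<delta>)) * \<phi>1 x - \<alpha> * \<delta> * \<phi> x = 0)"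

text \<open>Differentiating the equation yields a second-order equation for \<open>\<phi>1\<close> whose zeroth-order
  coefficient has a sign by the supremum condition.\<close>

lemma ode_third_derivative:
  assumes ode: "ode k \<phi> \<phi>1 \<phi>2" and k: "\<And>x. 0 \<le> x \<Longrightarrow> k < g x"
  obtains \<phi>3 where "has_hderiv \<phi>2 \<phi>3" "\<And>x. 0 \<le> x \<Longrightarrow> \<phi>2 x = 0 \<Longrightarrow> 0 < \<phi>1 x \<Longrightarrow> 0 < \<phi>3 x"
proof -
  have d: "has_hderiv \<phi> \<phi>1" "has_hderiv \<phi>1 \<phi>2" using ode by (auto simp: ode_def)
  define P where "P = (\<lambda>x. \<alpha> * g x - \<alpha> * k + g1 x - (lam + \<delta>))"
  define n where "n = (\<lambda>x. \<alpha> * \<delta> * \<phi> x - P x * \<phi>1 x)"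
  define n1 where "n1 = (\<lambda>x. \<alpha> * \<delta> * \<phi>1 x - ((\<alpha> * g1 x + g2 x) * \<phi>1 x + P x * \<phi>2 x))"
  have eq: "(g x - k) * \<phi>2 x = n x" if "0 \<le> x" for x
  proof -
    have "(g x - k) * \<phi>2 x + (\<alpha> * g x - \<alpha> * k + g1 x - (lam + \<delta>)) * \<phi>1 x - \<alpha> * \<delta> * \<phi> x = 0"
      using ode that by (simp add: ode_def)
    then show ?thesis unfolding n_def P_def by linarith
  qed
  have n: "(n has_real_derivative n1 x) (at x within {0..})" if "0 \<le> x" for x
    unfolding n_def n1_def P_def
    by (rule derivative_eq_intros d(1)[rule_format, OF that] d(2)[rule_format, OF that]
         g1[rule_format, OF that] g2[rule_format, OF that] refl)+ (simp add: algebra_simps)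
  have "((\<lambda>x. n x / (g x - k)) has_real_derivative (n1 x * (g x - k) - n x * g1 x) / ((g x - k) * (g x - k))) (at x within {0..})"
    if "0 \<le> x" for x
    by (rule derivative_eq_intros n[OF that] g1[rule_format, OF that] refl)+ (use k[OF that] in auto)
  then have "has_hderiv (\<lambda>x. n x / (g x - k)) (\<lambda>x. (n1 x * (g x - k) - n x * g1 x) / ((g x - k) * (g x - k)))"
    by blast
  moreover have "n x / (g x - k) = \<phi>2 x" if "0 \<le> x" for x
    using k[OF that] by (simp flip: eq[OF that])
  ultimately have "has_hderiv \<phi>2 (\<lambda>x. (n1 x * (g x - k) - n x * g1 x) / ((g x - k) * (g x - k)))"
    by (rule has_hderiv_cong) simp_all
  moreover have "0 < (n1 x * (g x - k) - n x * g1 x) / ((g x - k) * (g x - k))" if x: "0 \<le> x" "\<phi>2 x = 0" "0 < \<phi>1 x" for x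
  proof -
    have "n x = 0" using eq[OF x(1)] x(2) by simp
    moreover have "n1 x = \<phi>1 x * (\<alpha> * \<delta> - \<alpha> * g1 x - g2 x)" using x(2) by (simp add: n1_def algebra_simps)
    moreover have "0 < \<phi>1 x * (\<alpha> * \<delta> - \<alpha> * g1 x - g2 x)" using cond_sup[OF x(1)] x(3) by (intro mult_pos_pos) auto
    ultimately show ?thesis using k[OF x(1)] by simp
  qed
  ultimately show ?thesis by (rule that)
qed

text \<open>Sign propagation one derivative higher; the supremum condition enters through the third
  derivative.\<close>

lemma ode_curvature_propagation:
  assumes ode: "ode k \<phi> \<phi>1 \<phi>2" and k: "\<And>x. 0 \<le> x \<Longrightarrow> k < g x"
    and "0 \<le> a" "0 < \<phi>1 a" "0 \<le> \<phi>2 a" "a < x"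
  shows "0 < \<phi>2 x"
proof -
  obtain \<phi>3 where "has_hderiv \<phi>2 \<phi>3" "\<And>x. 0 \<le> x \<Longrightarrow> \<phi>2 x = 0 \<Longrightarrow> 0 < \<phi>1 x \<Longrightarrow> 0 < \<phi>3 x"
    using ode_third_derivative[OF ode k] by blast
  then show ?thesis using assms ode by (intro sgn_propagation[of \<phi>1 \<phi>2 \<phi>3 a]) (auto simp: ode_def)
qed

text \<open>Monotonicity alone leaves zeros of the slope possible. At such a zero the equation gives
  \<open>\<phi>2\<close> the sign of \<open>\<phi>\<close>, so the slope would be negative just to
  the right if \<open>\<phi> x < 0\<close>, and just to the left if \<open>\<phi> x > 0\<close>; the
  latter requires room to the left of \<open>x\<close>.\<close>

lemma ode_mono_imp_deriv_pos:
  assumes ode: "ode k \<phi> \<phi>1 \<phi>2" and k: "\<And>x. 0 \<le> x \<Longrightarrow> k < g x"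
    and mono: "strict_mono_on {0..} \<phi>" and x: "0 \<le> x" and nz: "\<phi> x < 0 \<or> 0 < x \<and> 0 < \<phi> x"
  shows "0 < \<phi>1 x"
proof (rule ccontr)
  assume neg: "\<not> 0 < \<phi>1 x"
  have d: "has_hderiv \<phi> \<phi>1" "has_hderiv \<phi>1 \<phi>2" using ode by (auto simp: ode_def)
  have nn: "0 \<le> \<phi>1 y" if "0 \<le> y" for y using strict_mono_hderiv_nonneg[OF d(1) mono that] .
  have 0: "\<phi>1 x = 0" using neg nn[OF x] by simp
  have eq: "(g x - k) * \<phi>2 x = \<alpha> * \<delta> * \<phi> x" using ode x 0 by (auto simp: ode_def)
  show False
  proof (cases "\<phi> x < 0")
    case True
    then have "(g x - k) * \<phi>2 x < 0" using alpha_pos delta_pos by (simp add: eq mult_pos_neg)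
    then have "\<phi>2 x < 0" using k[OF x] by (simp add: mult_less_0_iff)
    then obtain e where "e > 0" "\<forall>h>0. x + h \<in> {0..} \<longrightarrow> h < e \<longrightarrow> \<phi>1 (x + h) < \<phi>1 x"
      using has_real_derivative_neg_dec_right[of \<phi>1 "\<phi>2 x" x "{0..}"] d(2) x by blast
    then have "\<phi>1 (x + e/2) < 0" using 0 x by auto
    then show False using nn[of "x + e/2"] \<open>e > 0\<close> x by auto
  next
    case False
    with nz have "0 < x" "0 < \<phi> x" by auto
    then have "(g x - k) * \<phi>2 x > 0" using alpha_pos delta_pos by (simp add: eq)
    then have "\<phi>2 x > 0" using k[OF x] by (simp add: zero_less_mult_iff)
    then obtain e where e: "e > 0" "\<forall>h>0. x - h \<in> {0..} \<longrightarrow> h < e \<longrightarrow> \<phi>1 (x - h) < \<phi>1 x"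
      using has_real_derivative_pos_inc_left[of \<phi>1 "\<phi>2 x" x "{0..}"] d(2) x by blast
    define h where "h = min (e/2) (x/2)"
    have "0 < h" "h < e" "0 \<le> x - h" using e \<open>0 < x\<close> by (auto simp: h_def min_def)
    then have "\<phi>1 (x - h) < 0" using e 0 by auto
    then show False using nn[of "x - h"] \<open>0 \<le> x - h\<close> by auto
  qed
qed

text \<open>Nonnegative curvature at one point would persist, so from there on \<open>\<phi>\<close>
  would grow at least linearly and could not stay negative.\<close>

lemma negative_ode_concave:
  assumes ode: "ode u0 \<phi> \<phi>1 \<phi>2" and neg: "\<And>x. 0 \<le> x \<Longrightarrow> \<phi> x < 0" and pos: "\<And>x. 0 \<le> x \<Longrightarrow> 0 < \<phi>1 x" and x: "0 \<le> x"
  shows "\<phi>2 x < 0"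
proof (rule ccontr)
  assume "\<not> \<phi>2 x < 0"
  have d: "has_hderiv \<phi> \<phi>1" "has_hderiv \<phi>1 \<phi>2" using ode by (auto simp: ode_def)
  have up: "0 < \<phi>2 y" if "x < y" for y
    by (rule ode_curvature_propagation[OF ode g_gt x pos[OF x] _ that]) (use \<open>\<not> \<phi>2 x < 0\<close> in auto)
  have ge: "\<phi>1 x \<le> \<phi>1 y" if xy: "x < y" for y
  proof -
    obtain z where "x < z" "\<phi>1 y - \<phi>1 x = (y - x) * \<phi>2 z" using has_hderiv_mvt[OF d(2) x xy] by blast
    then show ?thesis using up[of z] xy by (smt (verit) mult_pos_pos)
  qed
  \<comment> \<open>Chosen so that the tangent at \<open>x\<close> takes the positive value
    \<open>\<phi>1 x\<close> at \<open>y\<close>.\<close>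
  define y where "y = x + 1 + (- \<phi> x) / \<phi>1 x"
  have "x < y" using neg[OF x] pos[OF x] by (simp add: y_def divide_neg_pos add_pos_nonneg add_strict_increasing)
  then obtain z where "x < z" "\<phi> y - \<phi> x = (y - x) * \<phi>1 z" using has_hderiv_mvt[OF d(1) x] by blast
  moreover from this have "(y - x) * \<phi>1 x \<le> (y - x) * \<phi>1 z" using ge[of z] \<open>x < y\<close> by (intro mult_left_mono) auto
  ultimately have "\<phi> y \<ge> \<phi> x + (y - x) * \<phi>1 x" by linarith
  also have "\<phi> x + (y - x) * \<phi>1 x = \<phi>1 x" using pos[OF x] by (simp add: y_def field_simps)
  finally show False using neg[of y] pos[OF x] x \<open>x < y\<close> by auto
qed

text \<open>Minus the recessive solution. Division by \<open>g x - u0\<close> puts the equation in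
  normal form with a positive zeroth-order coefficient.\<close>

lemma negative_increasing_solution_exists:
  obtains \<phi> \<phi>1 \<phi>2 where "ode u0 \<phi> \<phi>1 \<phi>2" "\<And>x. 0 \<le> x \<Longrightarrow> \<phi> x < 0" "\<And>x. 0 \<le> x \<Longrightarrow> 0 < \<phi>1 x"
proof -
  define a where "a = (\<lambda>x. - (\<alpha> * g x - \<alpha> * u0 + g1 x - (lam + \<delta>)) / (g x - u0))"
  define b where "b = (\<lambda>x. \<alpha> * \<delta> / (g x - u0))"
  have nz: "\<forall>x\<in>{0..}. g x - u0 \<noteq> 0" using g_gt by force
  have "continuous_on {0..} a" "continuous_on {0..} b" unfolding a_def b_def
    by (intro continuous_intros nz has_hderiv_continuous[OF g1] has_hderiv_continuous[OF g2])+
  moreover have "0 < b x" if "0 \<le> x" for x using g_gt[OF that] alpha_pos delta_pos by (simp add: b_def)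
  ultimately obtain y z where yz: "has_hderiv y z" "has_hderiv z (\<lambda>x. a x * z x + b x * y x)"
    "\<And>x. 0 \<le> x \<Longrightarrow> 0 < y x" "\<And>x. 0 \<le> x \<Longrightarrow> z x < 0"
    using decreasing_solution_exists by metis
  show ?thesis
  proof (rule that[of "\<lambda>x. - y x" "\<lambda>x. - z x" "\<lambda>x. - (a x * z x + b x * y x)"])
    have "(g x - u0) * (a x * z x + b x * y x) = - (\<alpha> * g x - \<alpha> * u0 + g1 x - (lam + \<delta>)) * z x + \<alpha> * \<delta> * y x"
      if "0 \<le> x" for x
    proof -
      have "(g x - u0) * a x = - (\<alpha> * g x - \<alpha> * u0 + g1 x - (lam + \<delta>))" "(g x - u0) * b x = \<alpha> * \<delta>"
        using g_gt[OF that] by (auto simp: a_def b_def)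
      moreover have "(g x - u0) * (a x * z x + b x * y x) = ((g x - u0) * a x) * z x + ((g x - u0) * b x) * y x"
        by (simp add: algebra_simps)
      ultimately show ?thesis by simp
    qed
    note key = this
    have "(g x - u0) * - (a x * z x + b x * y x) + (\<alpha> * g x - \<alpha> * u0 + g1 x - (lam + \<delta>)) * - z x
        - \<alpha> * \<delta> * - y x = 0" if "0 \<le> x" for x
      unfolding mult_minus_right using key[OF that] by linarith
    moreover have "has_hderiv (\<lambda>x. - y x) (\<lambda>x. - z x)" "has_hderiv (\<lambda>x. - z x) (\<lambda>x. - (a x * z x + b x * y x))"
      using yz(1,2) by (blast intro: DERIV_minus)+
    ultimately show "ode u0 (\<lambda>x. - y x) (\<lambda>x. - z x) (\<lambda>x. - (a x * z x + b x * y x))"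
      unfolding ode_def by blast
  qed (use yz in auto)
qed

lemma ode_solution_imp_ode:
  assumes sol: "ode_solution g lam \<alpha> \<delta> u0 \<phi>" and hg: "\<And>x. 0 \<le> x \<Longrightarrow> hderiv g x = g1 x"
  shows "ode u0 \<phi> (hderiv \<phi>) (hderiv (hderiv \<phi>))"
proof -
  have c2: "C1_halfline \<phi>" "C1_halfline (hderiv \<phi>)" using sol by (auto simp: ode_solution_def C2_halfline_def)
  note d = C1_halfline_hderiv[OF c2(1)] C1_halfline_hderiv[OF c2(2)]
  define e where "e = (\<lambda>x. (g x - u0) * hderiv (hderiv \<phi>) x
     + (\<alpha> * g x - \<alpha> * u0 + g1 x - (lam + \<delta>)) * hderiv \<phi> x - \<alpha> * \<delta> * \<phi> x)"
  have e: "e x = 0" if "0 < x" for x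
  proof -
    have "(g x - u0) * hderiv (hderiv \<phi>) x
       + (\<alpha> * g x - \<alpha> * u0 + hderiv g x - (lam + \<delta>)) * hderiv \<phi> x - \<alpha> * \<delta> * \<phi> x = 0"
      using sol that unfolding ode_solution_def by blast
    then show ?thesis unfolding e_def using hg[of x] that by simp
  qed
  have "continuous_on {0..} e" unfolding e_def
    by (intro continuous_intros has_hderiv_continuous[OF g1] has_hderiv_continuous[OF g2]
        has_hderiv_continuous[OF d(1)] has_hderiv_continuous[OF d(2)] C1_halfline_hderiv_continuous[OF c2(2)])
  then have "e 0 = 0" by (rule continuous_halfline_zero) (rule e)
  then have "e x = 0" if "0 \<le> x" for x using e[of x] that by (cases "x = 0") auto
  then show ?thesis using d by (simp add: ode_def e_def)
qed

lemma ode_imp_ode_solution: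
  assumes ode: "ode u0 \<phi> \<phi>1 \<phi>2" and hg: "\<And>x. 0 \<le> x \<Longrightarrow> hderiv g x = g1 x"
  shows "ode_solution g lam \<alpha> \<delta> u0 \<phi>"
proof -
  have d: "has_hderiv \<phi> \<phi>1" "has_hderiv \<phi>1 \<phi>2" using ode by (auto simp: ode_def)
  \<comment> \<open>The third derivative provides the continuity of \<open>\<phi>2\<close> that
    \<open>C2_halfline\<close> asks for.\<close>
  obtain \<phi>3 where "has_hderiv \<phi>2 \<phi>3" using ode_third_derivative[OF ode g_gt] by blast
  then have "C2_halfline \<phi>" using d by (intro C2_halflineI has_hderiv_continuous) auto
  moreover have h1: "hderiv \<phi> x = \<phi>1 x" if "0 \<le> x" for x using d(1) that by (intro hderiv_eqI) auto
  moreover have "has_hderiv (hderiv \<phi>) \<phi>2" by (rule has_hderiv_cong[OF d(2)]) (use h1 in auto)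
  then have "hderiv (hderiv \<phi>) x = \<phi>2 x" if "0 \<le> x" for x using that by (intro hderiv_eqI) auto
  ultimately show ?thesis using ode hg by (simp add: ode_solution_def ode_def)
qed

text \<open>By definition a solution is only once differentiable, but the equation writes its
  derivative as a quotient of differentiable functions. Eliminating the convolution from the
  differentiated quotient leaves \<open>ode 0\<close>. At \<open>0\<close> the convolution vanishes,
  so \<open>hderiv \<phi> 0\<close> is known explicitly, and \<open>cond_0\<close> says precisely
  that the second derivative is negative there.\<close>

lemma ide_solution_props:
  assumes sol: "ide_solution g lam \<alpha> \<delta> \<phi>" and pos: "\<And>x. 0 \<le> x \<Longrightarrow> 0 < \<phi> x"
    and mono: "strict_mono_on {0..} \<phi>"
  obtains \<phi>2 where "ode 0 \<phi> (hderiv \<phi>) \<phi>2" "\<And>x. 0 \<le> x \<Longrightarrow> 0 < hderiv \<phi> x"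
    "\<And>x. 0 \<le> x \<Longrightarrow> g x * hderiv \<phi> x - (lam + \<delta>) * \<phi> x + lam * exp_conv \<alpha> \<phi> x = 0" "\<phi>2 0 < 0"
proof -
  have c1: "C1_halfline \<phi>" using sol by (simp add: ide_solution_def)
  note d = C1_halfline_hderiv[OF c1]
  note conv = has_hderiv_exp_conv[OF has_hderiv_continuous[OF d], of \<alpha>]
  define e where "e = (\<lambda>x. g x * hderiv \<phi> x - (lam + \<delta>) * \<phi> x + lam * exp_conv \<alpha> \<phi> x)"
  have e: "e x = 0" if "0 < x" for x
    using sol that by (simp add: ide_solution_def e_def exp_conv_def)
  have "continuous_on {0..} e" unfolding e_def
    by (intro continuous_intros has_hderiv_continuous[OF g1] has_hderiv_continuous[OF d]
        has_hderiv_continuous[OF conv] C1_halfline_hderiv_continuous[OF c1])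
  then have "e 0 = 0" by (rule continuous_halfline_zero) (rule e)
  then have ide: "e x = 0" if "0 \<le> x" for x using e[of x] that by (cases "x = 0") auto
  have eq: "hderiv \<phi> x = ((lam + \<delta>) * \<phi> x - lam * exp_conv \<alpha> \<phi> x) / g x" if "0 \<le> x" for x
    using ide[OF that] g_pos[OF that] by (simp add: e_def field_simps)
  define \<phi>2 where "\<phi>2 = (\<lambda>x. (\<alpha> * \<delta> * \<phi> x - (\<alpha> * g x + g1 x - (lam + \<delta>)) * hderiv \<phi> x) / g x)"
  have d2: "has_hderiv (hderiv \<phi>) \<phi>2"
  proof (rule has_hderiv_cong)
    show "has_hderiv (\<lambda>x. ((lam + \<delta>) * \<phi> x - lam * exp_conv \<alpha> \<phi> x) / g x)
      (\<lambda>x. (((lam + \<delta>) * hderiv \<phi> x - lam * (\<alpha> * \<phi> x - \<alpha> * exp_conv \<alpha> \<phi> x)) * g x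
         - ((lam + \<delta>) * \<phi> x - lam * exp_conv \<alpha> \<phi> x) * g1 x) / (g x * g x))"
    proof (intro allI impI)
      fix x :: real assume x: "0 \<le> x"
      show "((\<lambda>x. ((lam + \<delta>) * \<phi> x - lam * exp_conv \<alpha> \<phi> x) / g x) has_real_derivative
        (((lam + \<delta>) * hderiv \<phi> x - lam * (\<alpha> * \<phi> x - \<alpha> * exp_conv \<alpha> \<phi> x)) * g x
         - ((lam + \<delta>) * \<phi> x - lam * exp_conv \<alpha> \<phi> x) * g1 x) / (g x * g x)) (at x within {0..})"
        by (rule derivative_eq_intros d[rule_format, OF x] conv[rule_format, OF x] g1[rule_format, OF x] refl)+
          (use g_pos[OF x] in auto)
    qed
  next
    fix x :: real assume x: "0 \<le> x"
    \<comment> \<open>\<open>A\<close> contains the convolution; the equation itself turns it into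
      \<open>g x * hderiv \<phi> x\<close>.\<close>
    define A where "A = (lam + \<delta>) * \<phi> x - lam * exp_conv \<alpha> \<phi> x"
    have A: "A = g x * hderiv \<phi> x" using ide[OF x] by (simp add: e_def A_def algebra_simps)
    have "((lam + \<delta>) * hderiv \<phi> x - lam * (\<alpha> * \<phi> x - \<alpha> * exp_conv \<alpha> \<phi> x)) * g x - A * g1 x
      = ((lam + \<delta>) * hderiv \<phi> x + \<alpha> * \<delta> * \<phi> x - \<alpha> * A) * g x - A * g1 x"
      by (simp add: A_def algebra_simps)
    also have "\<dots> = (\<alpha> * \<delta> * \<phi> x - (\<alpha> * g x + g1 x - (lam + \<delta>)) * hderiv \<phi> x) * g x"
      by (simp add: A algebra_simps)
    finally show "(((lam + \<delta>) * hderiv \<phi> x - lam * (\<alpha> * \<phi> x - \<alpha> * exp_conv \<alpha> \<phi> x)) * g x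
         - ((lam + \<delta>) * \<phi> x - lam * exp_conv \<alpha> \<phi> x) * g1 x) / (g x * g x) = \<phi>2 x"
      using g_pos[OF x] by (simp add: \<phi>2_def A_def)
  qed (use eq in auto)
  have ode: "ode 0 \<phi> (hderiv \<phi>) \<phi>2"
  proof -
    have "g x * \<phi>2 x = \<alpha> * \<delta> * \<phi> x - (\<alpha> * g x + g1 x - (lam + \<delta>)) * hderiv \<phi> x" if "0 \<le> x" for x
      using g_pos[OF that] by (simp add: \<phi>2_def)
    then have "\<forall>x\<ge>0. (g x - 0) * \<phi>2 x + (\<alpha> * g x - \<alpha> * 0 + g1 x - (lam + \<delta>)) * hderiv \<phi> x - \<alpha> * \<delta> * \<phi> x = 0"
      by simp
    then show ?thesis unfolding ode_def using d d2 by blast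
  qed
  have 0: "hderiv \<phi> 0 = (lam + \<delta>) * \<phi> 0 / g 0" using eq[of 0] by simp
  have dpos: "0 < hderiv \<phi> x" if "0 \<le> x" for x
  proof (cases "x = 0")
    case True
    then show ?thesis using 0 pos[of 0] g_pos[of 0] lam_pos delta_pos by simp
  next
    case False
    then show ?thesis using ode_mono_imp_deriv_pos[OF ode g_pos mono that] pos[OF that] that by auto
  qed
  have "\<phi>2 0 = - (\<phi> 0 / (g 0 * g 0)) * (\<alpha> * lam * g 0 + (g1 0 - lam - \<delta>) * (lam + \<delta>))"
    using g_pos[of 0] by (simp add: \<phi>2_def 0 field_simps)
  also have "\<dots> < 0" using cond_0 pos[of 0] g_pos[of 0] by (intro mult_neg_pos) auto
  finally show ?thesis using that[OF ode dpos] ide unfolding e_def by blast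
qed

section \<open>Smooth fit of the two solutions\<close>

context
  fixes p p1 p2 s s1 s2
  assumes p: "ode 0 p p1 p2" "\<And>x. 0 \<le> x \<Longrightarrow> 0 < p x" "\<And>x. 0 \<le> x \<Longrightarrow> 0 < p1 x" "p2 0 < 0"
    and s: "ode u0 s s1 s2" "\<And>x. 0 \<le> x \<Longrightarrow> s x < 0" "\<And>x. 0 \<le> x \<Longrightarrow> 0 < s1 x" "\<And>x. 0 \<le> x \<Longrightarrow> s2 x < 0"
begin

text \<open>Contrapositive of the propagation of curvature: the points where \<open>p\<close> has
  negative curvature form an initial interval.\<close>

lemma fit_concave_downward:
  assumes "0 \<le> x" "x \<le> y" "p2 y < 0"
  shows "p2 x < 0"
proof (rule ccontr)
  assume "\<not> p2 x < 0"
  with assms have "0 < p2 y"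
    using ode_curvature_propagation[OF p(1) g_pos assms(1) p(3)[OF assms(1)], of y] by (cases "x = y") auto
  then show False using assms by simp
qed

text \<open>Both equations are solved for the ratio of function to derivative. The terms
  \<open>\<alpha> * g x + g1 x - (lam + \<delta>)\<close> are common and cancel. Up to the factor
  \<open>\<alpha> * \<delta>\<close> this leaves the target \<open>u0 / \<delta>\<close> and two
  curvature terms.\<close>

lemma fit_identity:
  assumes "0 \<le> x"
  shows "\<alpha> * \<delta> * (p x / p1 x - s x / s1 x) = \<alpha> * u0 + g x * p2 x / p1 x - (g x - u0) * s2 x / s1 x"
proof -
  have "\<alpha> * \<delta> * p x = g x * p2 x + (\<alpha> * g x + g1 x - (lam + \<delta>)) * p1 x"
    using p(1) assms by (simp add: ode_def algebra_simps)
  then have 1: "\<alpha> * \<delta> * (p x / p1 x) = g x * p2 x / p1 x + (\<alpha> * g x + g1 x - (lam + \<delta>))"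
    using p(3)[OF assms] by (simp add: field_simps)
  have "(g x - u0) * s2 x + (\<alpha> * g x - \<alpha> * u0 + g1 x - (lam + \<delta>)) * s1 x - \<alpha> * \<delta> * s x = 0"
    using s(1) assms by (simp add: ode_def)
  then have "\<alpha> * \<delta> * s x = (g x - u0) * s2 x + (\<alpha> * g x - \<alpha> * u0 + g1 x - (lam + \<delta>)) * s1 x" by linarith
  then have 2: "\<alpha> * \<delta> * (s x / s1 x) = (g x - u0) * s2 x / s1 x + (\<alpha> * g x - \<alpha> * u0 + g1 x - (lam + \<delta>))"
    using s(3)[OF assms] by (simp add: add_divide_distrib)
  show ?thesis unfolding right_diff_distrib 1 2 by simp
qed

text \<open>Where \<open>p\<close> is not concave, both curvature terms of
  \<open>fit_identity\<close> push the difference above its target. A root therefore sits where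
  \<open>p\<close> is still concave, which is what the candidate needs below the barrier.\<close>

lemma fit_above:
  assumes x: "0 \<le> x" "0 \<le> p2 x"
  shows "u0 / \<delta> < p x / p1 x - s x / s1 x"
proof -
  have "0 \<le> g x * p2 x / p1 x" using p(3)[OF x(1)] g_pos[OF x(1)] x by simp
  moreover have "(g x - u0) * s2 x / s1 x < 0"
    using s(3,4)[OF x(1)] g_gt[OF x(1)] by (simp add: divide_neg_pos mult_pos_neg)
  ultimately have "\<alpha> * \<delta> * (p x / p1 x - s x / s1 x) > \<alpha> * u0" using fit_identity[OF x(1)] by linarith
  then have "\<alpha> * u0 < \<alpha> * (\<delta> * (p x / p1 x - s x / s1 x))" by (simp only: mult.assoc)
  then have "u0 < \<delta> * (p x / p1 x - s x / s1 x)" using alpha_pos by (simp only: mult_less_cancel_left_pos)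
  then show ?thesis using delta_pos by (simp add: field_simps)
qed

lemma fit_hderiv:
  "has_hderiv (\<lambda>x. p x / p1 x - s x / s1 x) (\<lambda>x. s x * s2 x / (s1 x)\<^sup>2 - p x * p2 x / (p1 x)\<^sup>2)"
proof (intro allI impI)
  fix x :: real assume x: "0 \<le> x"
  have d: "(p has_real_derivative p1 x) (at x within {0..})" "(p1 has_real_derivative p2 x) (at x within {0..})"
    "(s has_real_derivative s1 x) (at x within {0..})" "(s1 has_real_derivative s2 x) (at x within {0..})"
    using p(1) s(1) x by (auto simp: ode_def)
  have nz: "p1 x \<noteq> 0" "s1 x \<noteq> 0" using p(3)[OF x] s(3)[OF x] by auto
  show "((\<lambda>x. p x / p1 x - s x / s1 x) has_real_derivative s x * s2 x / (s1 x)\<^sup>2 - p x * p2 x / (p1 x)\<^sup>2) (at x within {0..})"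
    by (rule derivative_eq_intros d refl nz)+ (use nz in \<open>simp add: diff_divide_distrib power2_eq_square\<close>)
qed

text \<open>A ratio \<open>f / f'\<close> has derivative \<open>1 - f * f'' / f'^2\<close>. In the
  difference the ones cancel, and both remaining terms are positive as long as \<open>p\<close> is
  positive and concave, since \<open>s\<close> is negative and concave.\<close>

lemma fit_increasing:
  assumes "0 \<le> x" "x < y" "p2 y < 0"
  shows "p x / p1 x - s x / s1 x < p y / p1 y - s y / s1 y"
proof -
  obtain z where z: "x < z" "z < y"
    "(p y / p1 y - s y / s1 y) - (p x / p1 x - s x / s1 x) = (y - x) * (s z * s2 z / (s1 z)\<^sup>2 - p z * p2 z / (p1 z)\<^sup>2)"
    using has_hderiv_mvt[OF fit_hderiv assms(1,2)] by blast
  have z0: "0 \<le> z" using z assms by simp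
  have "p2 z < 0" using fit_concave_downward[of z y] z z0 assms by auto
  then have "p z * p2 z / (p1 z)\<^sup>2 < 0" using p(2,3)[OF z0] by (simp add: divide_neg_pos mult_pos_neg)
  moreover have "0 < s z * s2 z / (s1 z)\<^sup>2" using s(2,3,4)[OF z0] by (simp add: mult_neg_neg)
  ultimately show ?thesis using z(3) assms(2) by (smt (verit) mult_pos_pos)
qed

lemma fit_root_concave:
  assumes "0 \<le> d" "p d / p1 d - s d / s1 d = u0 / \<delta>"
  shows "p2 d < 0"
  using fit_above[of d] assms by force

lemma fit_root_unique:
  assumes "0 \<le> d" "p d / p1 d - s d / s1 d = u0 / \<delta>" "0 \<le> e" "p e / p1 e - s e / s1 e = u0 / \<delta>"
  shows "d = e"
  using fit_increasing[of d e] fit_increasing[of e d] fit_root_concave[of d] fit_root_concave[of e] assms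
  by (cases d e rule: linorder_cases) auto

text \<open>An upper point for the intermediate value theorem exists either because \<open>p\<close>
  stops being concave somewhere, or because it never does and then \<open>p / p1\<close> grows with
  slope at least \<open>1\<close>.\<close>

lemma fit_root_exists:
  assumes init: "p 0 / p1 0 - s 0 / s1 0 < u0 / \<delta>"
  shows "\<exists>d>0. p d / p1 d - s d / s1 d = u0 / \<delta>"
proof -
  have "\<exists>x>0. u0 / \<delta> \<le> p x / p1 x - s x / s1 x"
  proof (cases "\<exists>x\<ge>0. 0 \<le> p2 x")
    case True
    then obtain x where x: "0 \<le> x" "0 \<le> p2 x" by blast
    then have "x \<noteq> 0" using p(4) by auto
    then show ?thesis using fit_above[OF x] x by (intro exI[of _ x]) auto
  next
    case False
    have A: "has_hderiv (\<lambda>x. p x / p1 x) (\<lambda>x. 1 - p x * p2 x / (p1 x)\<^sup>2)"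
    proof (intro allI impI)
      fix x :: real assume x: "0 \<le> x"
      have d: "(p has_real_derivative p1 x) (at x within {0..})" "(p1 has_real_derivative p2 x) (at x within {0..})"
        using p(1) x by (auto simp: ode_def)
      have nz: "p1 x \<noteq> 0" using p(3)[OF x] by auto
      show "((\<lambda>x. p x / p1 x) has_real_derivative 1 - p x * p2 x / (p1 x)\<^sup>2) (at x within {0..})"
        by (rule derivative_eq_intros d refl nz)+ (use nz in \<open>simp add: diff_divide_distrib power2_eq_square\<close>)
    qed
    \<comment> \<open>With slope at least \<open>1\<close>, the distance
      \<open>u0 / \<delta>\<close> suffices to reach the target, since \<open>p / p1\<close> starts
      positive and \<open>s / s1\<close> is negative.\<close>
    define x where "x = u0 / \<delta>"
    have x: "0 < x" using u0_pos delta_pos by (simp add: x_def)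
    obtain z where z: "0 < z" "p x / p1 x - p 0 / p1 0 = (x - 0) * (1 - p z * p2 z / (p1 z)\<^sup>2)"
      using has_hderiv_mvt[OF A order_refl x] by blast
    have "p2 z < 0" using False z(1) by (metis less_imp_le not_le)
    then have "p z * p2 z / (p1 z)\<^sup>2 \<le> 0" using p(2,3)[of z] z(1)
      by (intro divide_nonpos_nonneg mult_nonneg_nonpos) auto
    then have "x * 1 \<le> (x - 0) * (1 - p z * p2 z / (p1 z)\<^sup>2)" using x by (intro mult_mono) auto
    moreover have "0 < p 0 / p1 0" using p(2,3)[of 0] by simp
    moreover have "s x / s1 x < 0" using s(2,3)[of x] x by (simp add: divide_neg_pos)
    ultimately have "u0 / \<delta> \<le> p x / p1 x - s x / s1 x" using z(2) unfolding x_def[symmetric] by linarith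
    then show ?thesis using x by blast
  qed
  then obtain x where x: "0 < x" "u0 / \<delta> \<le> p x / p1 x - s x / s1 x" by blast
  have "continuous_on {0..x} (\<lambda>x. p x / p1 x - s x / s1 x)"
    using has_hderiv_continuous[OF fit_hderiv] by (rule continuous_on_subset) auto
  then obtain d where d: "0 \<le> d" "d \<le> x" "p d / p1 d - s d / s1 d = u0 / \<delta>"
    using IVT'[of "\<lambda>x. p x / p1 x - s x / s1 x" 0 "u0 / \<delta>" x] init x by auto
  moreover have "d \<noteq> 0" using d(3) init by auto
  ultimately show ?thesis by (intro exI[of _ d]) auto
qed

end

end

section \<open>Candidate solutions of the Hamilton-Jacobi-Bellman equation\<close>

context dividend_equations begin

text \<open>The term \<open>u0 * max 0 (1 - v' x)\<close> is the supremum of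
  \<open>u * (1 - v' x)\<close> over rates \<open>u\<close> in \<open>[0, u0]\<close>, and the
  convolution stops at \<open>x\<close> because the value after ruin is \<open>0\<close>.
  Boundedness of \<open>v\<close> makes the discounted final value vanish in the limit. Only one
  derivative occurs, so a continuously differentiable pasting is enough.\<close>

definition hjb :: "real \<Rightarrow> (real \<Rightarrow> real) \<Rightarrow> (real \<Rightarrow> real) \<Rightarrow> bool" where
  "hjb d v v' \<longleftrightarrow> 0 \<le> d \<and> has_hderiv v v' \<and> continuous_on {0..} v' \<and> (\<exists>B. \<forall>x\<ge>0. \<bar>v x\<bar> \<le> B) \<and>
     (\<forall>x. 0 \<le> x \<longrightarrow> x < d \<longrightarrow> 1 \<le> v' x) \<and> (\<forall>x\<ge>d. v' x \<le> 1) \<and>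
     (\<forall>x\<ge>0. g x * v' x - (lam + \<delta>) * v x + lam * exp_conv \<alpha> v x + u0 * max 0 (1 - v' x) = 0)"

text \<open>The operator \<open>d/dx + \<alpha>\<close> turns the integro-differential equation into the ODE, so the residual of the
  former decays like \<open>exp (- \<alpha> x)\<close> above \<open>d\<close>, and vanishes there once it vanishes at \<open>d\<close>.\<close>

lemma residual_zero_above:
  assumes s: "ode u0 s s1 s2" and v: "continuous_on {0..} v" and d: "0 \<le> d" and K: "K \<noteq> 0"
    and v_eq: "\<And>x. d \<le> x \<Longrightarrow> v x = u0 / \<delta> + s x / K"
    and init: "(g d - u0) * (s1 d / K) - (lam + \<delta>) * v d + lam * exp_conv \<alpha> v d + u0 = 0"
    and x: "d \<le> x"
  shows "(g x - u0) * (s1 x / K) - (lam + \<delta>) * v x + lam * exp_conv \<alpha> v x + u0 = 0"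
proof -
  define e where "e = (\<lambda>x. (g x - u0) * (s1 x / K) - (lam + \<delta>) * (u0 / \<delta> + s x / K) + lam * exp_conv \<alpha> v x + u0)"
  have "((\<lambda>x. e x * exp (\<alpha> * x)) has_real_derivative 0) (at x within {d..})" if "d \<le> x" for x
  proof -
    have x: "0 \<le> x" using that d by simp
    have ds: "(s has_real_derivative s1 x) (at x within {0..})" "(s1 has_real_derivative s2 x) (at x within {0..})"
      using s x by (auto simp: ode_def)
    define D where "D = g1 x * (s1 x / K) + (g x - u0) * (s2 x / K) - (lam + \<delta>) * (s1 x / K)
        + lam * (\<alpha> * v x - \<alpha> * exp_conv \<alpha> v x)"
    have de: "(e has_real_derivative D) (at x within {0..})"
      unfolding e_def D_def
      by (rule derivative_eq_intros ds g1[rule_format, OF x] has_hderiv_exp_conv[OF v, rule_format, OF x] refl K)+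
        (use K in \<open>simp add: field_simps\<close>)
    have "(g x - u0) * s2 x + (\<alpha> * g x - \<alpha> * u0 + g1 x - (lam + \<delta>)) * s1 x - \<alpha> * \<delta> * s x = 0"
      using s x by (simp add: ode_def)
    then have "((g x - u0) * s2 x + (\<alpha> * g x - \<alpha> * u0 + g1 x - (lam + \<delta>)) * s1 x - \<alpha> * \<delta> * s x) / K = 0" by simp
    then have o: "(g x - u0) * (s2 x / K) + (\<alpha> * g x - \<alpha> * u0 + g1 x - (lam + \<delta>)) * (s1 x / K) - \<alpha> * \<delta> * (s x / K) = 0"
      by (simp add: add_divide_distrib diff_divide_distrib)
    have "D = - \<alpha> * e x"
    proof -
      have dd: "\<delta> * (u0 / \<delta>) = u0" using delta_pos by simp
      have "D + \<alpha> * e x = (g x - u0) * (s2 x / K) + (\<alpha> * g x - \<alpha> * u0 + g1 x - (lam + \<delta>)) * (s1 x / K)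
          - \<alpha> * \<delta> * (s x / K) + \<alpha> * (u0 - \<delta> * (u0 / \<delta>)) + lam * \<alpha> * (v x - (u0 / \<delta> + s x / K))"
        unfolding D_def e_def by (simp only: algebra_simps)
      also have "\<dots> = 0" unfolding o dd v_eq[OF that] by simp
      finally show ?thesis by simp
    qed
    then have "((\<lambda>x. e x * exp (\<alpha> * x)) has_real_derivative 0) (at x within {0..})"
      by (auto intro!: derivative_eq_intros de simp: algebra_simps)
    then show ?thesis by (rule DERIV_subset) (use d in auto)
  qed
  then obtain c where c: "\<And>x. d \<le> x \<Longrightarrow> e x * exp (\<alpha> * x) = c"
    using has_field_derivative_zero_constant[of "{d..}" "\<lambda>x. e x * exp (\<alpha> * x)"] by auto
  have "e d = 0" using init v_eq[of d] by (simp add: e_def)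
  then have "e x * exp (\<alpha> * x) = 0" using c[of d] c[OF x] by simp
  then show ?thesis using v_eq[OF x] by (simp add: e_def)
qed

text \<open>\<open>K\<close> is the normalisation for which the residual vanishes at
  \<open>0\<close>, where there is no convolution. Multiplying the hypothesis \<open>le\<close> by
  \<open>(lam + \<delta>) * s1 0\<close> turns it into \<open>s1 0 \<le> K\<close>; concavity of
  \<open>s\<close> then keeps the slope at most \<open>1\<close> everywhere.\<close>

lemma hjb_no_barrier:
  assumes s: "ode u0 s s1 s2" "\<And>x. 0 \<le> x \<Longrightarrow> s x < 0" "\<And>x. 0 \<le> x \<Longrightarrow> 0 < s1 x" "\<And>x. 0 \<le> x \<Longrightarrow> s2 x < 0"
    and le: "s 0 / s1 0 \<le> g 0 / (lam + \<delta>) - u0 / \<delta>"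
    and K: "K = ((g 0 - u0) * s1 0 - (lam + \<delta>) * s 0) / ((lam / \<delta>) * u0)"
  shows "hjb 0 (\<lambda>x. s x / K + u0 / \<delta>) (\<lambda>x. s1 x / K)"
proof -
  have d: "has_hderiv s s1" "has_hderiv s1 s2" using s(1) by (auto simp: ode_def)
  define m where "m = (lam / \<delta>) * u0"
  have m: "0 < m" using lam_pos delta_pos u0_pos by (simp add: m_def)
  have num: "0 < (g 0 - u0) * s1 0 - (lam + \<delta>) * s 0"
    using s(2,3)[of 0] g_gt[of 0] lam_pos delta_pos by (smt (verit) mult_pos_neg mult_pos_pos)
  have Kpos: "0 < K" using num m unfolding K m_def by (intro divide_pos_pos) auto
  have Km: "K * m = (g 0 - u0) * s1 0 - (lam + \<delta>) * s 0" unfolding K m_def[symmetric] using m by simp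
  have dv: "has_hderiv (\<lambda>x. s x / K + u0 / \<delta>) (\<lambda>x. s1 x / K)"
    using d(1) Kpos by (auto intro!: derivative_eq_intros)
  have "s1 0 \<le> K"
  proof -
    have "(s 0 / s1 0) * (lam + \<delta>) \<le> (g 0 / (lam + \<delta>) - u0 / \<delta>) * (lam + \<delta>)"
      using le lam_pos delta_pos by (intro mult_right_mono) auto
    also have "\<dots> = g 0 - u0 - m"
    proof -
      have "g 0 / (lam + \<delta>) * (lam + \<delta>) = g 0" "u0 / \<delta> * (lam + \<delta>) = m + u0"
        using lam_pos delta_pos by (auto simp: m_def field_simps)
      then show ?thesis by (simp add: left_diff_distrib)
    qed
    finally have "(s 0 / s1 0) * (lam + \<delta>) * s1 0 \<le> (g 0 - u0 - m) * s1 0"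
      using s(3)[of 0] by (intro mult_right_mono) auto
    moreover have "(s 0 / s1 0) * (lam + \<delta>) * s1 0 = s 0 * (lam + \<delta>)" using s(3)[of 0] by simp
    ultimately have "s 0 * (lam + \<delta>) \<le> (g 0 - u0 - m) * s1 0" by linarith
    then have "s1 0 * m \<le> K * m" unfolding Km by (simp add: algebra_simps)
    then show ?thesis using m by simp
  qed
  have le1: "s1 x / K \<le> 1" if x: "0 \<le> x" for x
  proof (cases "x = 0")
    case False
    with x have "0 < x" by simp
    then obtain z where "0 < z" "s1 x - s1 0 = (x - 0) * s2 z" using has_hderiv_mvt[OF d(2) order_refl] by blast
    then have "s1 x \<le> s1 0" using s(4)[of z] \<open>0 < x\<close> by (smt (verit) mult_pos_neg)
    then show ?thesis using \<open>s1 0 \<le> K\<close> Kpos by simp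
  qed (use \<open>s1 0 \<le> K\<close> Kpos in auto)
  have mono: "s 0 \<le> s x" if x: "0 \<le> x" for x
    using strict_mono_onD[OF hderiv_pos_strict_mono[OF d(1) s(3)], of 0 x] x by (cases "x = 0") auto
  have res: "(g x - u0) * (s1 x / K) - (lam + \<delta>) * (s x / K + u0 / \<delta>) + lam * exp_conv \<alpha> (\<lambda>x. s x / K + u0 / \<delta>) x + u0 = 0"
    if x: "0 \<le> x" for x
  proof (rule residual_zero_above[OF s(1) has_hderiv_continuous[OF dv] order_refl _ _ _ x])
    have "(g 0 - u0) * (s1 0 / K) - (lam + \<delta>) * (s 0 / K) = m"
    proof -
      have "(g 0 - u0) * (s1 0 / K) - (lam + \<delta>) * (s 0 / K) = (K * m) / K" unfolding Km by (simp add: diff_divide_distrib)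
      then show ?thesis using Kpos by simp
    qed
    moreover have "(lam + \<delta>) * (u0 / \<delta>) = m + u0" using delta_pos by (simp add: m_def field_simps)
    ultimately show "(g 0 - u0) * (s1 0 / K) - (lam + \<delta>) * (s 0 / K + u0 / \<delta>) + lam * exp_conv \<alpha> (\<lambda>x. s x / K + u0 / \<delta>) 0 + u0 = 0"
      by (simp add: distrib_left)
  qed (use Kpos in auto)
  have bd: "\<bar>s x / K + u0 / \<delta>\<bar> \<le> - s 0 / K + u0 / \<delta>" if x: "0 \<le> x" for x
  proof -
    have "s 0 / K \<le> s x / K" "s x / K \<le> 0" using mono[OF x] s(2)[OF x] Kpos by (auto simp: divide_right_mono divide_nonpos_pos)
    moreover have "0 < u0 / \<delta>" using u0_pos delta_pos by simp
    ultimately show ?thesis by (simp add: abs_le_iff)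
  qed
  have eq: "g x * (s1 x / K) - (lam + \<delta>) * (s x / K + u0 / \<delta>) + lam * exp_conv \<alpha> (\<lambda>x. s x / K + u0 / \<delta>) x
      + u0 * max 0 (1 - s1 x / K) = 0" if x: "0 \<le> x" for x
  proof -
    define c where "c = s1 x / K"
    define w where "w = s x / K + u0 / \<delta>"
    define i where "i = exp_conv \<alpha> (\<lambda>x. s x / K + u0 / \<delta>) x"
    have "max 0 (1 - c) = 1 - c" using le1[OF x] by (simp add: c_def)
    moreover have "(g x - u0) * c - (lam + \<delta>) * w + lam * i + u0 = 0"
      using res[OF x] by (simp only: c_def w_def i_def)
    ultimately have "g x * c - (lam + \<delta>) * w + lam * i + u0 * max 0 (1 - c) = 0" by (simp add: algebra_simps)
    then show ?thesis by (simp only: c_def w_def i_def)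
  qed
  have "continuous_on {0..} (\<lambda>x. s1 x / K)"
    using Kpos by (intro continuous_intros has_hderiv_continuous[OF d(2)]) auto
  then show ?thesis unfolding hjb_def using dv bd eq le1 by auto
qed

text \<open>Division by the derivatives at \<open>d\<close> gives both branches slope
  \<open>1\<close> there, and the fit equation makes their values agree. At \<open>d\<close> the
  factor \<open>1 - v'\<close> vanishes, so the equation inherited from \<open>p\<close> also starts
  the residual of the upper branch at \<open>0\<close>.\<close>

lemma hjb_barrier:
  assumes p: "ode 0 p p1 p2" "\<And>x. 0 \<le> x \<Longrightarrow> 0 < p x" "\<And>x. 0 \<le> x \<Longrightarrow> 0 < p1 x" "p2 0 < 0"
    and ide: "\<And>x. 0 \<le> x \<Longrightarrow> g x * p1 x - (lam + \<delta>) * p x + lam * exp_conv \<alpha> p x = 0"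
    and s: "ode u0 s s1 s2" "\<And>x. 0 \<le> x \<Longrightarrow> s x < 0" "\<And>x. 0 \<le> x \<Longrightarrow> 0 < s1 x" "\<And>x. 0 \<le> x \<Longrightarrow> s2 x < 0"
    and d: "0 < d" "p d / p1 d - s d / s1 d = u0 / \<delta>"
  shows "hjb d (\<lambda>x. if x < d then p x / p1 d else u0 / \<delta> + s x / s1 d) (\<lambda>x. if x < d then p1 x / p1 d else s1 x / s1 d)"
proof -
  define v where "v = (\<lambda>x. if x < d then p x / p1 d else u0 / \<delta> + s x / s1 d)"
  define v1 where "v1 = (\<lambda>x. if x < d then p1 x / p1 d else s1 x / s1 d)"
  have dp: "has_hderiv p p1" "has_hderiv p1 p2" using p(1) by (auto simp: ode_def)
  have ds: "has_hderiv s s1" "has_hderiv s1 s2" using s(1) by (auto simp: ode_def)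
  have pos: "0 < p1 d" "0 < s1 d" using p(3) s(3) d(1) by auto
  have fit: "p d / p1 d = u0 / \<delta> + s d / s1 d" using d(2) by simp
  have p2: "p2 x < 0" if "0 \<le> x" "x \<le> d" for x
    using fit_concave_downward[OF p s that] fit_root_concave[OF p s _ d(2)] d(1) by simp
  have dv: "has_hderiv v v1"
  proof -
    have "((\<lambda>x. if x \<in> {0..<d} then p x / p1 d else u0 / \<delta> + s x / s1 d) has_vector_derivative
        (if x \<in> {0..<d} then p1 x / p1 d else s1 x / s1 d)) (at x within {0..})" if x: "0 \<le> x" for x
    proof (rule has_vector_derivative_If_within_closures[where T = "{d..}"])
      show "x \<in> {0..<d} \<union> {d..}" "{0..} = {0..<d} \<union> {d..}" using d(1) x by auto
      show "((\<lambda>x. p x / p1 d) has_vector_derivative p1 x / p1 d) (at x within {0..<d} \<union> closure {0..<d} \<inter> closure {d..})"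
      proof -
        have "((\<lambda>x. p x / p1 d) has_real_derivative p1 x / p1 d) (at x within {0..})"
          using dp(1) x pos by (auto intro!: derivative_eq_intros)
        then have "((\<lambda>x. p x / p1 d) has_real_derivative p1 x / p1 d) (at x within {0..<d} \<union> closure {0..<d} \<inter> closure {d..})"
          by (rule DERIV_subset) (use d(1) in auto)
        then show ?thesis by (simp add: has_real_derivative_iff_has_vector_derivative)
      qed
      show "((\<lambda>x. u0 / \<delta> + s x / s1 d) has_vector_derivative s1 x / s1 d) (at x within {d..} \<union> closure {0..<d} \<inter> closure {d..})"
      proof -
        have "((\<lambda>x. u0 / \<delta> + s x / s1 d) has_real_derivative s1 x / s1 d) (at x within {0..})"
          using ds(1) x pos by (auto intro!: derivative_eq_intros)
        then have "((\<lambda>x. u0 / \<delta> + s x / s1 d) has_real_derivative s1 x / s1 d) (at x within {d..} \<union> closure {0..<d} \<inter> closure {d..})"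
          by (rule DERIV_subset) (use d(1) in auto)
        then show ?thesis by (simp add: has_real_derivative_iff_has_vector_derivative)
      qed
      assume "x \<in> closure {0..<d}" "x \<in> closure {d..}"
      then have "x = d" using d(1) by (auto simp: closure_atLeastLessThan)
      then show "p x / p1 d = u0 / \<delta> + s x / s1 d" "p1 x / p1 d = s1 x / s1 d" using fit pos by auto
    qed
    then have "has_hderiv (\<lambda>x. if x \<in> {0..<d} then p x / p1 d else u0 / \<delta> + s x / s1 d)
        (\<lambda>x. if x \<in> {0..<d} then p1 x / p1 d else s1 x / s1 d)"
      by (simp add: has_real_derivative_iff_has_vector_derivative)
    then show ?thesis by (rule has_hderiv_cong) (auto simp: v_def v1_def)
  qed
  have cont1: "continuous_on {0..} v1"
  proof -
    have "continuous_on ({0..d} \<union> {d..}) (\<lambda>x. if x \<le> d then p1 x / p1 d else s1 x / s1 d)"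
      using pos d(1)
      by (intro continuous_on_If continuous_intros continuous_on_subset[OF has_hderiv_continuous[OF dp(2)]]
          continuous_on_subset[OF has_hderiv_continuous[OF ds(2)]]) auto
    moreover have "{0..d} \<union> {d..} = {0..}" using d(1) by auto
    moreover have "(\<lambda>x. if x \<le> d then p1 x / p1 d else s1 x / s1 d) = v1"
      using pos by (auto simp: v1_def fun_eq_iff)
    ultimately show ?thesis by metis
  qed
  have ge1: "1 \<le> v1 x" if x: "0 \<le> x" "x < d" for x
  proof -
    obtain z where "x < z" "z < d" "p1 d - p1 x = (d - x) * p2 z" using has_hderiv_mvt[OF dp(2) x] by blast
    then have "p1 d \<le> p1 x" using p2[of z] x by (smt (verit) mult_pos_neg)
    then show ?thesis using x pos by (simp add: v1_def)
  qed
  have le1: "v1 x \<le> 1" if x: "d \<le> x" for x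
  proof (cases "x = d")
    case False
    with x have "d < x" by simp
    then obtain z where z: "d < z" "s1 x - s1 d = (x - d) * s2 z" using has_hderiv_mvt[OF ds(2) less_imp_le[OF d(1)]] by blast
    then have "s1 x \<le> s1 d" using s(4)[of z] \<open>d < x\<close> d(1) by (smt (verit) mult_pos_neg)
    then show ?thesis using x pos by (simp add: v1_def)
  qed (use pos in \<open>auto simp: v1_def\<close>)
  \<comment> \<open>Up to and including \<open>d\<close> the candidate is a multiple of
    \<open>p\<close>, and the convolution at \<open>x\<close> only sees arguments up to
    \<open>x\<close>.\<close>
  have ide_v: "g x * (p1 x / p1 d) - (lam + \<delta>) * v x + lam * exp_conv \<alpha> v x = 0" if x: "0 \<le> x" "x \<le> d" for x
  proof -
    define c where "c = 1 / p1 d"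
    have vp: "v z = c * p z" if "0 \<le> z" "z \<le> x" for z
      using that x fit by (cases "z = d") (auto simp: v_def c_def)
    have "exp_conv \<alpha> v x = c * exp_conv \<alpha> p x" by (rule exp_conv_cong) (rule vp)
    moreover have "v x = c * p x" using vp[OF x(1)] by simp
    moreover have "p1 x / p1 d = c * p1 x" by (simp add: c_def)
    ultimately have "g x * (p1 x / p1 d) - (lam + \<delta>) * v x + lam * exp_conv \<alpha> v x
        = c * (g x * p1 x - (lam + \<delta>) * p x + lam * exp_conv \<alpha> p x)"
      by (simp add: algebra_simps)
    then show ?thesis using ide[OF x(1)] by simp
  qed
  have above: "(g x - u0) * (s1 x / s1 d) - (lam + \<delta>) * v x + lam * exp_conv \<alpha> v x + u0 = 0" if x: "d \<le> x" for x
  proof (rule residual_zero_above[OF s(1) has_hderiv_continuous[OF dv] _ _ _ _ x])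
    show "(g d - u0) * (s1 d / s1 d) - (lam + \<delta>) * v d + lam * exp_conv \<alpha> v d + u0 = 0"
      using ide_v[of d] d(1) pos by (simp add: algebra_simps)
  qed (use d(1) pos in \<open>auto simp: v_def\<close>)
  have eq: "g x * v1 x - (lam + \<delta>) * v x + lam * exp_conv \<alpha> v x + u0 * max 0 (1 - v1 x) = 0" if x: "0 \<le> x" for x
  proof (cases "x < d")
    case True
    then have "max 0 (1 - v1 x) = 0" "v1 x = p1 x / p1 d" using ge1[OF x] by (auto simp: v1_def)
    then show ?thesis using ide_v[OF x] True by simp
  next
    case False
    then have "max 0 (1 - v1 x) = 1 - v1 x" "s1 x / s1 d = v1 x" using le1[of x] by (auto simp: v1_def)
    moreover from this have "(g x - u0) * v1 x - (lam + \<delta>) * v x + lam * exp_conv \<alpha> v x + u0 = 0"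
      using above[of x] False by simp
    ultimately show ?thesis by (simp add: algebra_simps)
  qed
  have bd: "\<bar>v x\<bar> \<le> u0 / \<delta> - s 0 / s1 d" if x: "0 \<le> x" for x
  proof -
    have u: "0 < u0 / \<delta>" using u0_pos delta_pos by simp
    have s0: "s 0 / s1 d < 0" using s(2)[of 0] pos by (simp add: divide_neg_pos)
    show ?thesis
    proof (cases "x < d")
      case True
      have "p x \<le> p d" using strict_mono_onD[OF hderiv_pos_strict_mono[OF dp(1) p(3)], of x d] x True by auto
      then have "p x / p1 d \<le> p d / p1 d" using pos by (simp add: divide_right_mono)
      moreover have "s d / s1 d < 0" using s(2)[of d] d(1) pos by (simp add: divide_neg_pos)
      moreover have "0 < p x / p1 d" using p(2)[OF x] pos by simp
      ultimately show ?thesis using True fit s0 by (simp add: v_def)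
    next
      case False
      have "s 0 \<le> s x" using strict_mono_onD[OF hderiv_pos_strict_mono[OF ds(1) s(3)], of 0 x] x by (cases "x = 0") auto
      then have "s 0 / s1 d \<le> s x / s1 d" using pos by (simp add: divide_right_mono)
      moreover have "s x / s1 d < 0" using s(2)[OF x] pos by (simp add: divide_neg_pos)
      ultimately show ?thesis using False u by (simp add: v_def abs_le_iff)
    qed
  qed
  have "hjb d v v1" unfolding hjb_def using d(1) dv cont1 bd ge1 le1 eq by (auto intro!: exI[of _ "u0 / \<delta> - s 0 / s1 d"])
  then show ?thesis by (simp add: v_def v1_def)
qed

end

section \<open>Ruin and surplus paths\<close>

lemma set_integral_Icc_split:
  fixes b :: "real \<Rightarrow> real"
  assumes "set_integrable lborel {0..t} b" "0 \<le> s" "s \<le> t"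
  shows "(LBINT r:{0..t}. b r) = (LBINT r:{0..s}. b r) + (LBINT r:{s..t}. b r)"
    and "set_integrable lborel {0..s} b" "set_integrable lborel {s..t} b"
proof -
  show i: "set_integrable lborel {0..s} b" "set_integrable lborel {s..t} b"
    using assms by (auto intro: set_integrable_subset)
  show "(LBINT r:{0..t}. b r) = (LBINT r:{0..s}. b r) + (LBINT r:{s..t}. b r)"
    using Henstock_Kurzweil_Integration.integral_combine[of 0 s t b] set_borel_integral_eq_integral[OF assms(1)]
      set_borel_integral_eq_integral(2)[OF i(1)] set_borel_integral_eq_integral(2)[OF i(2)] assms(2,3) by simp
qed

lemma set_integral_Icc_bounds:
  fixes b :: "real \<Rightarrow> real"
  assumes "set_integrable lborel {s..t} b" "s \<le> t"
  shows "(\<And>r. s \<le> r \<Longrightarrow> r \<le> t \<Longrightarrow> m \<le> b r) \<Longrightarrow> m * (t - s) \<le> (LBINT r:{s..t}. b r)"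
    and "(\<And>r. s \<le> r \<Longrightarrow> r \<le> t \<Longrightarrow> b r \<le> m) \<Longrightarrow> (LBINT r:{s..t}. b r) \<le> m * (t - s)"
proof -
  have c: "set_integrable lborel {s..t} (\<lambda>_. m)" by (intro borel_integrable_atLeastAtMost' continuous_intros)
  have e: "(LBINT r:{s..t}. m) = m * (t - s)" using assms(2) by (simp add: set_integral_const)
  show "m * (t - s) \<le> (LBINT r:{s..t}. b r)" if "\<And>r. s \<le> r \<Longrightarrow> r \<le> t \<Longrightarrow> m \<le> b r"
    unfolding e[symmetric] by (rule set_integral_mono[OF c assms(1)]) (use that in auto)
  show "(LBINT r:{s..t}. b r) \<le> m * (t - s)" if "\<And>r. s \<le> r \<Longrightarrow> r \<le> t \<Longrightarrow> b r \<le> m"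
    unfolding e[symmetric] by (rule set_integral_mono[OF assms(1) c]) (use that in auto)
qed

lemma set_integral_Icc_abs_le:
  fixes b :: "real \<Rightarrow> real"
  assumes "set_integrable lborel {0..t} b" "0 \<le> s" "s \<le> t"
  shows "\<bar>LBINT r:{0..s}. b r\<bar> \<le> (LBINT r:{0..t}. \<bar>b r\<bar>)"
proof -
  have "\<bar>LBINT r:{0..s}. b r\<bar> \<le> (LBINT r:{0..s}. \<bar>b r\<bar>)"
    using set_integral_norm_bound[OF set_integral_Icc_split(2)[OF assms]] by simp
  also have "\<dots> \<le> (LBINT r:{0..s}. \<bar>b r\<bar>) + (LBINT r:{s..t}. \<bar>b r\<bar>)"
    by (simp add: set_lebesgue_integral_def)
  also have "\<dots> = (LBINT r:{0..t}. \<bar>b r\<bar>)"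
    using set_integral_Icc_split(1)[OF set_integrable_abs[OF assms(1)] assms(2,3)] by simp
  finally show ?thesis .
qed

lemma continuous_on_set_integral_Icc:
  fixes b :: "real \<Rightarrow> real"
  assumes "set_integrable lborel {0..T} b"
  shows "continuous_on {0..T} (\<lambda>t. LBINT s:{0..t}. b s)"
proof (rule continuous_on_eq[OF indefinite_integral_continuous_1])
  show "b integrable_on {0..T}" by (rule set_borel_integral_eq_integral(1)[OF assms])
  fix t assume "t \<in> {0..T}"
  then show "integral {0..t} b = (LBINT s:{0..t}. b s)"
    using set_borel_integral_eq_integral(2)[OF set_integral_Icc_split(2)[OF assms, of t]] by simp
qed

text \<open>The positive part of \<open>f2 - f1\<close> is compared with its own integral, starting
  from the last time before \<open>t\<close> at which the difference was not positive, and Gronwall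
  forces it to be zero. The hypothesis \<open>le\<close> is one-sided and concerns the drifts as
  evaluated along the two solutions, so it covers two different drift functions.\<close>

lemma integral_equation_comparison:
  fixes f1 f2 b1 b2 :: "real \<Rightarrow> real"
  assumes L: "0 < L"
    and f1: "\<And>t. 0 \<le> t \<Longrightarrow> f1 t = r t + (LBINT s:{0..t}. b1 s)"
    and f2: "\<And>t. 0 \<le> t \<Longrightarrow> f2 t = r t + (LBINT s:{0..t}. b2 s)"
    and i1: "\<And>t. 0 \<le> t \<Longrightarrow> set_integrable lborel {0..t} b1"
    and i2: "\<And>t. 0 \<le> t \<Longrightarrow> set_integrable lborel {0..t} b2"
    and le: "\<And>s. 0 \<le> s \<Longrightarrow> b2 s - b1 s \<le> L * \<bar>f2 s - f1 s\<bar>"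
    and t: "0 \<le> t"
  shows "f2 t \<le> f1 t"
proof -
  define D where "D = (\<lambda>t. f2 t - f1 t)"
  define k where "k = (\<lambda>s. b2 s - b1 s)"
  have ik: "set_integrable lborel {0..t} k" if "0 \<le> t" for t
    unfolding k_def using i1[OF that] i2[OF that] by auto
  have D: "D t = (LBINT s:{0..t}. k s)" if "0 \<le> t" for t
    unfolding k_def D_def using f1[OF that] f2[OF that] i1[OF that] i2[OF that] by (subst set_integral_diff) auto
  have cD: "continuous_on {0..T} D" if "0 \<le> T" for T
    using continuous_on_set_integral_Icc[OF ik[OF that]] by (rule continuous_on_eq) (use D in auto)
  have cP: "continuous_on {0..T} (\<lambda>t. L * max 0 (D t))" if "0 \<le> T" for T
    by (intro continuous_intros cD that)
  have iP: "set_integrable lborel {s..T} (\<lambda>t. L * max 0 (D t))" if "0 \<le> s" "s \<le> T" for s T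
    by (rule borel_integrable_atLeastAtMost', rule continuous_on_subset[OF cP[of T]]) (use that in auto)
  have key: "max 0 (D t) \<le> (LBINT s:{0..t}. L * max 0 (D s))" if t: "0 \<le> t" for t
  proof (cases "D t \<le> 0")
    case True
    have "0 * (t - 0) \<le> (LBINT s:{0..t}. L * max 0 (D s))"
      by (rule set_integral_Icc_bounds(1)[OF iP[OF order_refl t] t]) (use L in auto)
    then show ?thesis using True by simp
  next
    case False
    \<comment> \<open>Continuity of \<open>D\<close> makes the last time \<open>s\<close> with
      \<open>D s \<le> 0\<close> attained; after \<open>s\<close> the absolute value in
      \<open>le\<close> is just \<open>D\<close>.\<close>
    define Z where "Z = {s\<in>{0..t}. D s \<le> 0}"
    have "closed Z" unfolding Z_def using cD[OF t]
      by (intro continuous_on_closed_Collect_le continuous_intros) auto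
    moreover have "D 0 = 0" using f1[of 0] f2[of 0] set_borel_integral_eq_integral(2)[OF i1[of 0]]
        set_borel_integral_eq_integral(2)[OF i2[of 0]] by (simp add: D_def)
    then have "0 \<in> Z" "bdd_above Z" using t by (auto simp: Z_def)
    ultimately have sZ: "Sup Z \<in> Z" by (intro closed_contains_Sup) auto
    define s where "s = Sup Z"
    have s: "0 \<le> s" "s \<le> t" "D s \<le> 0" using sZ by (auto simp: Z_def s_def)
    have pos: "0 < D r" if "s < r" "r \<le> t" for r
    proof (rule ccontr)
      assume "\<not> 0 < D r"
      then have "r \<in> Z" using that s by (auto simp: Z_def)
      then have "r \<le> s" unfolding s_def using \<open>bdd_above Z\<close> by (rule cSup_upper)
      then show False using that by simp
    qed
    have "D t \<le> D t - D s" using s by simp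
    also have "\<dots> = (LBINT r:{s..t}. k r)"
      using D[of t] D[of s] set_integral_Icc_split(1)[OF ik[OF t] s(1,2)] s t by simp
    also have "\<dots> \<le> (LBINT r:{s..t}. L * max 0 (D r))"
    proof (rule set_integral_mono_AE[OF set_integral_Icc_split(3)[OF ik[OF t] s(1,2)] iP[OF s(1,2)]])
      have "AE r in lborel. r \<noteq> s" by (rule AE_lborel_singleton)
      then show "AE r\<in>{s..t} in lborel. k r \<le> L * max 0 (D r)"
      proof (rule AE_mp, intro AE_I2 impI)
        fix r assume "r \<noteq> s" "r \<in> {s..t}"
        then show "k r \<le> L * max 0 (D r)" using pos[of r] le[of r] s by (auto simp: k_def D_def)
      qed
    qed
    also have "\<dots> \<le> (LBINT r:{0..s}. L * max 0 (D r)) + (LBINT r:{s..t}. L * max 0 (D r))"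
      using set_integral_Icc_bounds(1)[OF iP[OF order_refl s(1)], of 0] L s by simp
    also have "\<dots> = (LBINT r:{0..t}. L * max 0 (D r))"
      using set_integral_Icc_split(1)[OF iP[OF order_refl t] s(1,2)] by simp
    finally show ?thesis using False by simp
  qed
  obtain B where B: "\<And>s. s \<in> {0..t} \<Longrightarrow> norm (D s) \<le> B"
  proof -
    have "bounded (D ` {0..t})" by (intro compact_imp_bounded compact_continuous_image cD t) simp
    then obtain B where "\<forall>y\<in>D ` {0..t}. norm y \<le> B" unfolding bounded_iff by blast
    then show ?thesis by (intro that[of B]) auto
  qed
  have "max 0 (D t) \<le> 0 * exp (L * t)"
  proof (rule gronwall[where T = t and k = "\<lambda>s. L * max 0 (D s)" and B = "max 0 B"])
    fix s assume "0 \<le> s" "s \<le> t"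
    then show "max 0 (D s) \<le> max 0 B" using B[of s] by auto
    show "max 0 (D s) \<le> 0 + (LBINT s:{0..s}. L * max 0 (D s))" using key[OF \<open>0 \<le> s\<close>] by simp
  qed (use L t iP in auto)
  then show ?thesis by (simp add: D_def)
qed

text \<open>Given by an explicit limit rather than by a choice, so that measurability in the
  scenario can be followed through the iterates.\<close>

definition integral_path :: "(real \<Rightarrow> real) \<Rightarrow> (real \<Rightarrow> real) \<Rightarrow> real \<Rightarrow> real" where
  "integral_path G r t = lim (\<lambda>n. picard (\<lambda>_. G) r n t)"

lemma integral_path:
  assumes lip: "\<And>x y. \<bar>G x - G y\<bar> \<le> L * \<bar>x - y\<bar>"
    and r: "r \<in> borel_measurable borel"
    and bdd: "\<And>T. \<exists>B. \<forall>s. 0 \<le> s \<longrightarrow> s \<le> T \<longrightarrow> \<bar>r s\<bar> \<le> B"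
  shows "(\<lambda>n. picard (\<lambda>_. G) r n t) \<longlonglongrightarrow> integral_path G r t"
    and "integral_path G r \<in> borel_measurable borel"
    and "0 \<le> t \<Longrightarrow> set_integrable lborel {0..t} (\<lambda>s. G (integral_path G r s))"
    and "0 \<le> t \<Longrightarrow> integral_path G r t = r t + (LBINT s:{0..t}. G (integral_path G r s))"
proof -
  have "continuous_on UNIV G"
  proof (rule lipschitz_on_continuous_on[of "\<bar>L\<bar>"], rule lipschitz_onI)
    fix x y
    show "dist (G x) (G y) \<le> \<bar>L\<bar> * dist x y"
      using lip[of x y] by (simp add: dist_real_def) (smt (verit) mult_right_mono)
  qed simp
  then have Gm [measurable]: "G \<in> borel_measurable borel" by (rule borel_measurable_continuous_onI)
  have B: "\<exists>B. \<forall>s. 0 \<le> s \<longrightarrow> s \<le> T \<longrightarrow> norm (G (r s)) \<le> B" for T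
  proof -
    obtain B where B: "\<And>s. 0 \<le> s \<Longrightarrow> s \<le> T \<Longrightarrow> \<bar>r s\<bar> \<le> B" using bdd[of T] by blast
    have "\<bar>G (r s)\<bar> \<le> \<bar>G 0\<bar> + \<bar>L\<bar> * B" if "0 \<le> s" "s \<le> T" for s
    proof -
      have "\<bar>G (r s)\<bar> \<le> \<bar>G 0\<bar> + \<bar>G (r s) - G 0\<bar>" by linarith
      also have "\<bar>G (r s) - G 0\<bar> \<le> \<bar>L\<bar> * \<bar>r s\<bar>" using lip[of "r s" 0] by (smt (verit) mult_right_mono)
      also have "\<dots> \<le> \<bar>L\<bar> * B" using B[OF that] by (intro mult_left_mono) auto
      finally show ?thesis by simp
    qed
    then show ?thesis by (intro exI[of _ "\<bar>G 0\<bar> + \<bar>L\<bar> * B"]) auto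
  qed
  obtain X where X: "\<And>t. (\<lambda>n. picard (\<lambda>_. G) r n t) \<longlonglongrightarrow> X t" "X \<in> borel_measurable borel"
    "\<And>t. 0 \<le> t \<Longrightarrow> set_integrable lborel {0..t} (\<lambda>s. G (X s))"
    "\<And>t. 0 \<le> t \<Longrightarrow> X t = r t + (LBINT s:{0..t}. G (X s))"
    by (rule picard_limit[of "\<lambda>_. G" r]) (use lip r B in auto)
  have "integral_path G r = X" unfolding integral_path_def[abs_def] using X(1) by (intro ext limI)
  with X show "(\<lambda>n. picard (\<lambda>_. G) r n t) \<longlonglongrightarrow> integral_path G r t"
    "integral_path G r \<in> borel_measurable borel"
    "0 \<le> t \<Longrightarrow> set_integrable lborel {0..t} (\<lambda>s. G (integral_path G r s))"
    "0 \<le> t \<Longrightarrow> integral_path G r t = r t + (LBINT s:{0..t}. G (integral_path G r s))" by auto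
qed

section \<open>Ruin times of single paths\<close>

lemma ruin_time_nonneg: "0 \<le> ruin_time f"
  unfolding ruin_time_def by (rule INF_greatest) auto

lemma before_ruin: "0 \<le> t \<Longrightarrow> ereal t < ruin_time f \<Longrightarrow> 0 \<le> f t"
  unfolding ruin_time_def by (metis (no_types, lifting) INF_lower leD linorder_not_le mem_Collect_eq)

lemma after_ruin: "ruin_time f < ereal t \<Longrightarrow> \<exists>s. 0 \<le> s \<and> s < t \<and> f s < 0"
  unfolding ruin_time_def INF_less_iff by auto

lemma ruin_time_eqI:
  assumes "0 \<le> r" "f r < 0" "\<And>s. 0 \<le> s \<Longrightarrow> s < r \<Longrightarrow> 0 \<le> f s"
  shows "ruin_time f = ereal r"
proof (rule antisym)
  show "ruin_time f \<le> ereal r" unfolding ruin_time_def using assms by (intro INF_lower) auto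
  show "ereal r \<le> ruin_time f" unfolding ruin_time_def
    using assms(3) by (intro INF_greatest) (auto simp: not_le[symmetric])
qed

lemma ruin_time_infinite:
  assumes "\<And>s. 0 \<le> s \<Longrightarrow> 0 \<le> f s"
  shows "ruin_time f = \<infinity>"
  using after_ruin[of f] assms by (metis ereal_less_PInfty ereal_dense2 not_le linorder_not_less order_less_le)

text \<open>The part of right-continuity that matters for ruin: with it, a finite infimum in
  \<open>ruin_time\<close> is attained and the path is negative there. Surplus paths have it,
  because their drift is nonnegative and the claims stay constant for a while after each
  time.\<close>

definition right_persistent :: "(real \<Rightarrow> real) \<Rightarrow> bool" where
  "right_persistent f \<longleftrightarrow> (\<forall>t\<ge>0. 0 \<le> f t \<longrightarrow> (\<exists>e>0. \<forall>r. t \<le> r \<longrightarrow> r < t + e \<longrightarrow> 0 \<le> f r))"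

lemma ruin_attained:
  assumes "right_persistent f" "ruin_time f = ereal r"
  shows "0 \<le> r" "f r < 0"
proof -
  show r: "0 \<le> r" using ruin_time_nonneg[of f] assms(2) by simp
  show "f r < 0"
  proof (rule ccontr)
    assume "\<not> f r < 0"
    then obtain e where e: "e > 0" "\<And>s. r \<le> s \<Longrightarrow> s < r + e \<Longrightarrow> 0 \<le> f s"
      using assms(1) r unfolding right_persistent_def by (meson not_le)
    have "ruin_time f < ereal (r + e)" using assms(2) e by simp
    then obtain s where s: "0 \<le> s" "s < r + e" "f s < 0" using after_ruin by blast
    have "r \<le> s" using before_ruin[of s f] s assms(2) by (smt (verit) less_ereal.simps(1))
    then show False using e(2)[of s] s by simp
  qed
qed

lemma before_ruin_iff:
  assumes "right_persistent f" "0 \<le> t"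
  shows "ereal t < ruin_time f \<longleftrightarrow> (\<forall>s. 0 \<le> s \<longrightarrow> s \<le> t \<longrightarrow> 0 \<le> f s)"
proof
  assume a: "ereal t < ruin_time f"
  then show "\<forall>s. 0 \<le> s \<longrightarrow> s \<le> t \<longrightarrow> 0 \<le> f s"
    by (metis before_ruin ereal_less_eq(3) order_le_less_trans)
next
  assume nn: "\<forall>s. 0 \<le> s \<longrightarrow> s \<le> t \<longrightarrow> 0 \<le> f s"
  show "ereal t < ruin_time f"
  proof (rule ccontr)
    assume a: "\<not> ereal t < ruin_time f"
    then obtain r where r: "ruin_time f = ereal r"
      using ruin_time_nonneg[of f] by (cases "ruin_time f") auto
    then have "r \<le> t" using a by auto
    then show False using nn ruin_attained[OF assms(1) r] by force
  qed
qed

text \<open>The freezing convention of \<open>surplus_path\<close>, applied to a path that solves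
  its equation beyond ruin as well.\<close>

definition killed :: "(real \<Rightarrow> real) \<Rightarrow> real \<Rightarrow> real" where
  "killed f t = (if ereal t \<le> ruin_time f then f t else f (real_of_ereal (ruin_time f)))"

section \<open>Freezing solutions of the extended equation at ruin\<close>

context
  fixes g G X A :: "real \<Rightarrow> real" and x L :: real
  assumes L: "0 < L" and lip: "\<And>x y. \<bar>G x - G y\<bar> \<le> L * \<bar>x - y\<bar>" and G: "\<And>x. 0 \<le> x \<Longrightarrow> G x = g x"
    and int: "\<And>t. 0 \<le> t \<Longrightarrow> set_integrable lborel {0..t} (\<lambda>s. G (X s))"
    and eq: "\<And>t. 0 \<le> t \<Longrightarrow> X t = x + (LBINT s:{0..t}. G (X s)) - A t"
    and pers: "right_persistent X"
begin

lemma ruin_time_killed: "ruin_time (killed X) = ruin_time X"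
proof (cases "ruin_time X")
  case (real r)
  note a = ruin_attained[OF pers real]
  show ?thesis unfolding real
    by (rule ruin_time_eqI) (use a real before_ruin[of _ X] in \<open>auto simp: killed_def\<close>)
next
  case PInf
  then have "killed X = X" by (auto simp: killed_def)
  then show ?thesis by simp
next
  case MInf
  then show ?thesis using ruin_time_nonneg[of X] by simp
qed

lemma surplus_path_killed: "surplus_path g x A (killed X)"
  unfolding surplus_path_def ruin_time_killed
proof (intro allI impI conjI)
  fix t :: real assume t: "0 \<le> t"
  assume le: "ereal t \<le> ruin_time X"
  \<comment> \<open>At the final time the path may already be negative, where \<open>g\<close> and
    its extension can differ. Removing that single point leaves all integrals unchanged.\<close>
  define Z where "Z = {0..t} - {t}"
  have same: "g (killed X s) = G (X s)" if "s \<in> Z" for s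
  proof -
    have s: "0 \<le> s" "ereal s < ruin_time X" using that le by (auto simp: Z_def intro: less_le_trans[of _ "ereal t"])
    then show ?thesis using before_ruin[OF s] G less_imp_le[OF s(2)] by (simp add: killed_def)
  qed
  have "set_integrable lborel Z (\<lambda>s. G (X s))"
    unfolding Z_def by (rule set_integrable_subset[OF int[OF t]]) auto
  then have i: "set_integrable lborel Z (\<lambda>s. g (killed X s))"
    by (subst set_integrable_cong[OF refl refl same]) auto
  have d: "(LBINT s:{0..t}. h s) = (LBINT s:Z. h s)" for h :: "real \<Rightarrow> real"
    by (rule set_integral_discrete_difference[where X = "{t}"]) (auto simp: Z_def)
  have di: "set_integrable lborel {0..t} h = set_integrable lborel Z h" for h :: "real \<Rightarrow> real"
    by (rule set_integrable_discrete_difference[where X = "{t}"]) (auto simp: Z_def)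
  show "set_integrable lborel {0..t} (\<lambda>s. g (killed X s))" unfolding di by (rule i)
  have "(LBINT s:Z. g (killed X s)) = (LBINT s:Z. G (X s))"
    by (rule set_lebesgue_integral_cong) (use same in \<open>auto simp: Z_def\<close>)
  then show "killed X t = x + (LBINT s:{0..t}. g (killed X s)) - A t"
    using eq[OF t] le unfolding d by (simp add: killed_def)
next
  fix t :: real assume t: "0 \<le> t"
  assume lt: "ruin_time X < ereal t"
  then obtain r where r: "ruin_time X = ereal r" using ruin_time_nonneg[of X] by (cases "ruin_time X") auto
  then show "killed X t = killed X (real_of_ereal (ruin_time X))" using lt by (simp add: killed_def)
qed

text \<open>Makes the scenario-wise choice in \<open>surplus\<close> determinate. Up to the ruin
  time of \<open>f\<close>, uniqueness for the Lipschitz equation applies, the integrand at the ruin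
  time being negligible; afterwards both paths are constant once their ruin times are known to
  agree.\<close>

lemma surplus_path_unique:
  assumes f: "surplus_path g x A f" and t: "0 \<le> t"
  shows "f t = killed X t"
proof -
  have same: "f t = X t" if "0 \<le> t" "t \<le> T" "ereal T \<le> ruin_time f" for t T
  proof -
    have T: "0 \<le> T" using that by simp
    have fi: "set_integrable lborel {0..t} (\<lambda>s. g (f s))" "f t = x + (LBINT s:{0..t}. g (f s)) - A t" if "0 \<le> t" "t \<le> T" for t
    proof -
      have "ereal t \<le> ruin_time f" using that \<open>ereal T \<le> _\<close> by (auto intro: order_trans[of "ereal t" "ereal T"])
      then show "set_integrable lborel {0..t} (\<lambda>s. g (f s))" "f t = x + (LBINT s:{0..t}. g (f s)) - A t"
        using f that unfolding surplus_path_def by blast+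
    qed
    show ?thesis
    proof (rule integral_equation_unique[where ?f1.0 = f and ?f2.0 = X and k = "\<lambda>s. g (f s) - G (X s)" and T = T and L = L])
      show "set_integrable lborel {0..T} (\<lambda>s. g (f s) - G (X s))" using fi(1)[OF T order_refl] int[OF T] by auto
      fix s assume s: "0 \<le> s" "s < T"
      then have "ereal s < ruin_time f" using \<open>ereal T \<le> ruin_time f\<close> by (auto intro: less_le_trans[of _ "ereal T"])
      then have "g (f s) = G (f s)" using before_ruin[of s f] s G by simp
      then show "\<bar>g (f s) - G (X s)\<bar> \<le> L * \<bar>f s - X s\<bar>" using lip by simp
    next
      fix t assume t: "0 \<le> t" "t \<le> T"
      show "f t - X t = (LBINT s:{0..t}. g (f s) - G (X s))"
        using fi[OF t] int[OF t(1)] eq[OF t(1)] by (subst set_integral_diff) auto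
    qed (use L that in auto)
  qed
  show ?thesis
  proof (cases "ruin_time f")
    case (real r)
    have r: "0 \<le> r" using ruin_time_nonneg[of f] real by simp
    have fX: "f t = X t" if "0 \<le> t" "t \<le> r" for t using same[of t r] that real by simp
    have frozen: "f t = f r" if "r < t" for t
    proof -
      have "f t = f (real_of_ereal (ruin_time f))"
        using f that r unfolding surplus_path_def real by auto
      then show ?thesis by (simp add: real)
    qed
    \<comment> \<open>If \<open>f r\<close> were nonnegative, freezing would keep \<open>f\<close>
      nonnegative for ever, contradicting ruin at \<open>r\<close>.\<close>
    have "f r < 0"
    proof (rule ccontr)
      assume "\<not> f r < 0"
      have "ruin_time f < ereal (r + 1)" using real by simp
      then obtain s where s: "0 \<le> s" "f s < 0" using after_ruin by blast
      have "r \<le> s" using before_ruin[of s f] s real by (smt (verit) less_ereal.simps(1))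
      then show False using frozen[of s] s \<open>\<not> f r < 0\<close> by (cases "r = s") auto
    qed
    have "ruin_time X = ereal r"
    proof (rule ruin_time_eqI[OF r])
      show "X r < 0" using \<open>f r < 0\<close> fX[OF r order_refl] by simp
      fix s assume s: "0 \<le> s" "s < r"
      then show "0 \<le> X s" using before_ruin[of s f] real fX[of s] by simp
    qed
    then show ?thesis using fX[OF t] frozen[of t] fX[OF r] by (cases "t \<le> r") (auto simp: killed_def)
  next
    case PInf
    have fX: "f t = X t" if "0 \<le> t" for t using same[of t t] that PInf by simp
    have "ruin_time X = \<infinity>" 
    proof (rule ruin_time_infinite)
      fix s :: real assume s: "0 \<le> s"
      show "0 \<le> X s" using before_ruin[OF s, of f] fX[OF s] PInf by simp
    qed
    then show ?thesis using fX[OF t] by (simp add: killed_def)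
  next
    case MInf
    then show ?thesis using ruin_time_nonneg[of f] by simp
  qed
qed

end

section \<open>Persistence of signs and paths with a threshold drift\<close>

lemma step_right_persistent:
  fixes X S b :: "real \<Rightarrow> real"
  assumes step: "\<And>t. 0 \<le> t \<Longrightarrow> \<exists>e>0. \<forall>r. t \<le> r \<longrightarrow> r < t + e \<longrightarrow> S r = S t"
    and int: "\<And>t. 0 \<le> t \<Longrightarrow> set_integrable lborel {0..t} b"
    and eq: "\<And>t. 0 \<le> t \<Longrightarrow> X t = x - S t + (LBINT s:{0..t}. b s)"
    and nn: "\<And>s. 0 \<le> s \<Longrightarrow> 0 \<le> b s"
  shows "right_persistent X"
  unfolding right_persistent_def
proof (intro allI impI)
  fix t :: real assume t: "0 \<le> t" "0 \<le> X t"
  obtain e where e: "e > 0" "\<And>r. t \<le> r \<Longrightarrow> r < t + e \<Longrightarrow> S r = S t" using step[OF t(1)] by blast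
  have "0 \<le> X r" if r: "t \<le> r" "r < t + e" for r
  proof -
    have r0: "0 \<le> r" using t r by simp
    note sp = set_integral_Icc_split[OF int[OF r0] t(1) r(1)]
    have "0 * (r - t) \<le> (LBINT s:{t..r}. b s)"
      by (rule set_integral_Icc_bounds(1)[OF sp(3) r(1)]) (use nn t in auto)
    then show ?thesis using sp(1) eq[OF r0] eq[OF t(1)] e(2)[OF r] t by simp
  qed
  then show "\<exists>e>0. \<forall>r. t \<le> r \<longrightarrow> r < t + e \<longrightarrow> 0 \<le> X r" using e(1) by blast
qed

text \<open>Lipschitz approximations of the drift \<open>G y - u0 * indicator {d..} y\<close>. The
  ramp rises from \<open>0\<close> at \<open>d\<close> to \<open>1\<close> at
  \<open>d + 1 / n\<close>; placing it above \<open>d\<close> makes the drifts decrease in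
  \<open>n\<close> and converge to the intended one at every point except possibly \<open>d\<close>
  itself.\<close>

definition threshold_drift :: "(real \<Rightarrow> real) \<Rightarrow> real \<Rightarrow> real \<Rightarrow> nat \<Rightarrow> real \<Rightarrow> real" where
  "threshold_drift G u0 d n y = G y - u0 * min 1 (max 0 (real n * (y - d)))"

text \<open>Negative times receive the value at \<open>0\<close>, which permits joint measurability
  on the whole line.\<close>

definition threshold_path :: "(real \<Rightarrow> real) \<Rightarrow> real \<Rightarrow> real \<Rightarrow> (real \<Rightarrow> real) \<Rightarrow> real \<Rightarrow> real" where
  "threshold_path G u0 d r t = lim (\<lambda>n. integral_path (threshold_drift G u0 d n) r (max 0 t))"

lemma threshold_drift_lipschitz:
  assumes lip: "\<And>x y. \<bar>G x - G y\<bar> \<le> L * \<bar>x - y\<bar>" and u0: "0 \<le> u0"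
  shows "\<bar>threshold_drift G u0 d n x - threshold_drift G u0 d n y\<bar> \<le> (L + u0 * real n) * \<bar>x - y\<bar>"
proof -
  define m where "m = (\<lambda>y. min 1 (max 0 (real n * (y - d))))"
  have "\<bar>m x - m y\<bar> \<le> \<bar>real n * (x - d) - real n * (y - d)\<bar>" by (auto simp: m_def min_def max_def)
  also have "\<dots> = real n * \<bar>x - y\<bar>" by (simp add: abs_mult flip: right_diff_distrib)
  finally have "u0 * \<bar>m x - m y\<bar> \<le> u0 * (real n * \<bar>x - y\<bar>)" using u0 by (rule mult_left_mono)
  moreover have "\<bar>u0 * m x - u0 * m y\<bar> = u0 * \<bar>m x - m y\<bar>" using u0 by (simp add: abs_mult flip: right_diff_distrib)
  moreover have "\<bar>(G x - u0 * m x) - (G y - u0 * m y)\<bar> \<le> \<bar>G x - G y\<bar> + \<bar>u0 * m x - u0 * m y\<bar>" by linarith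
  ultimately have "\<bar>(G x - u0 * m x) - (G y - u0 * m y)\<bar> \<le> L * \<bar>x - y\<bar> + u0 * (real n * \<bar>x - y\<bar>)"
    using lip[of x y] by linarith
  then show ?thesis by (simp add: threshold_drift_def m_def algebra_simps)
qed

text \<open>By comparison the approximate solutions decrease in \<open>n\<close>, and they stay
  above \<open>x - S t\<close>, so they converge. To pass to the limit in the integral, the times
  with \<open>X s = d\<close> must be negligible: all drifts are at least \<open>c\<close>, so the
  limit increases strictly while \<open>N\<close> is constant and meets \<open>d\<close> at most
  once for each value of \<open>N\<close>.\<close>

lemma threshold_path:
  fixes S :: "real \<Rightarrow> real" and N :: "real \<Rightarrow> nat" and x d :: real
  assumes L: "0 < L" and lip: "\<And>x y. \<bar>G x - G y\<bar> \<le> L * \<bar>x - y\<bar>"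
    and u0: "0 \<le> u0" and c: "0 < c" and G_ge: "\<And>y. u0 + c \<le> G y"
    and S: "S \<in> borel_measurable borel" and bdd: "\<And>T. \<exists>B. \<forall>s. 0 \<le> s \<longrightarrow> s \<le> T \<longrightarrow> \<bar>S s\<bar> \<le> B"
    and const: "\<And>s t. 0 \<le> s \<Longrightarrow> s \<le> t \<Longrightarrow> N s = N t \<Longrightarrow> S s = S t" and mono: "mono_on {0..} N"
  defines "X \<equiv> threshold_path G u0 d (\<lambda>t. x - S t)"
  shows "(\<lambda>n. integral_path (threshold_drift G u0 d n) (\<lambda>t. x - S t) (max 0 t)) \<longlonglongrightarrow> X t"
    and "0 \<le> t \<Longrightarrow> set_integrable lborel {0..t} (\<lambda>s. G (X s) - u0 * indicator {d..} (X s))"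
    and "0 \<le> t \<Longrightarrow> X t = x - S t + (LBINT s:{0..t}. G (X s) - u0 * indicator {d..} (X s))"
proof -
  define Y where "Y = (\<lambda>n. integral_path (threshold_drift G u0 d n) (\<lambda>t. x - S t))"
  have bdd': "\<exists>B. \<forall>s. 0 \<le> s \<longrightarrow> s \<le> T \<longrightarrow> \<bar>x - S s\<bar> \<le> B" for T
  proof -
    obtain B where "\<forall>s. 0 \<le> s \<longrightarrow> s \<le> T \<longrightarrow> \<bar>S s\<bar> \<le> B" using bdd by blast
    then have "\<forall>s. 0 \<le> s \<longrightarrow> s \<le> T \<longrightarrow> \<bar>x - S s\<bar> \<le> \<bar>x\<bar> + B" by (smt (verit))
    then show ?thesis by blast
  qed
  have S': "(\<lambda>t. x - S t) \<in> borel_measurable borel" using S by simp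
  have Ym: "Y n \<in> borel_measurable borel" for n
    unfolding Y_def by (rule integral_path(2)[OF threshold_drift_lipschitz[OF lip u0] S' bdd'])
  have Yi: "set_integrable lborel {0..t} (\<lambda>s. threshold_drift G u0 d n (Y n s))" if "0 \<le> t" for n t
    unfolding Y_def by (rule integral_path(3)[OF threshold_drift_lipschitz[OF lip u0] S' bdd' that])
  have Ye: "Y n t = (x - S t) + (LBINT s:{0..t}. threshold_drift G u0 d n (Y n s))" if "0 \<le> t" for n t
    unfolding Y_def by (rule integral_path(4)[OF threshold_drift_lipschitz[OF lip u0] S' bdd' that])
  have drift_ge: "c \<le> threshold_drift G u0 d n y" for n y
  proof -
    have "u0 * min 1 (max 0 (real n * (y - d))) \<le> u0 * 1" using u0 by (intro mult_left_mono) auto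
    then show ?thesis using G_ge[of y] by (simp add: threshold_drift_def)
  qed
  have drift_antimono: "threshold_drift G u0 d (Suc n) y \<le> threshold_drift G u0 d n y" for n y
  proof -
    have "max 0 (real n * (y - d)) \<le> max 0 (real (Suc n) * (y - d))"
    proof (cases "d \<le> y")
      case True
      then have "real n * (y - d) \<le> real (Suc n) * (y - d)" by (intro mult_right_mono) auto
      then show ?thesis by (rule max.mono[OF order_refl])
    next
      case False
      then have "real n * (y - d) \<le> 0" by (intro mult_nonneg_nonpos) auto
      then show ?thesis by simp
    qed
    then have "u0 * min 1 (max 0 (real n * (y - d))) \<le> u0 * min 1 (max 0 (real (Suc n) * (y - d)))"
      using u0 by (intro mult_left_mono) auto
    then show ?thesis by (simp add: threshold_drift_def)
  qed
  have Y_dec: "Y (Suc n) t \<le> Y n t" if t: "0 \<le> t" for n t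
  proof (rule integral_equation_comparison[where L = "L + u0 * real (Suc n)", OF _ Ye Ye Yi Yi _ t])
    show "0 < L + u0 * real (Suc n)" using L u0 by (simp add: add_pos_nonneg)
    fix s :: real
    show "threshold_drift G u0 d (Suc n) (Y (Suc n) s) - threshold_drift G u0 d n (Y n s)
      \<le> (L + u0 * real (Suc n)) * \<bar>Y (Suc n) s - Y n s\<bar>"
      using threshold_drift_lipschitz[OF lip u0, of d "Suc n" "Y (Suc n) s" "Y n s"] drift_antimono[of n "Y n s"] by linarith
  qed
  have Y_ge: "x - S t \<le> Y n t" if t: "0 \<le> t" for n t
  proof -
    have "0 * (t - 0) \<le> (LBINT s:{0..t}. threshold_drift G u0 d n (Y n s))"
      by (rule set_integral_Icc_bounds(1)[OF Yi[OF t] t]) (rule order_trans[OF less_imp_le[OF c] drift_ge])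
    then show ?thesis using Ye[OF t, of n] by simp
  qed
  have Y_le0: "Y n t \<le> Y 0 t" if t: "0 \<le> t" for n t
    by (induction n) (auto intro: order_trans[OF Y_dec[OF t]])
  have conv: "(\<lambda>n. Y n (max 0 t)) \<longlonglongrightarrow> X t" for t
  proof -
    have "decseq (\<lambda>n. Y n (max 0 t))" using Y_dec[of "max 0 t"] by (intro decseq_SucI) simp
    moreover have "\<And>n. x - S (max 0 t) \<le> Y n (max 0 t)" using Y_ge[of "max 0 t"] by simp
    ultimately have "convergent (\<lambda>n. Y n (max 0 t))"
      using decseq_convergent[of "\<lambda>n. Y n (max 0 t)" "x - S (max 0 t)"] by (metis convergentI)
    then show ?thesis unfolding X_def threshold_path_def Y_def by (simp add: convergent_LIMSEQ_iff)
  qed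
  then show "(\<lambda>n. integral_path (threshold_drift G u0 d n) (\<lambda>t. x - S t) (max 0 t)) \<longlonglongrightarrow> X t"
    by (simp add: Y_def)
  have conv0: "(\<lambda>n. Y n t) \<longlonglongrightarrow> X t" if "0 \<le> t" for t using conv[of t] that by simp
  have X_le: "X t \<le> Y n t" if "0 \<le> t" for n t
  proof (rule decseq_ge[OF _ conv0[OF that]])
    show "decseq (\<lambda>n. Y n t)" using Y_dec[OF that] by (intro decseq_SucI)
  qed
  have X_ge: "x - S t \<le> X t" if "0 \<le> t" for t
    by (rule LIMSEQ_le_const[OF conv0[OF that]]) (use Y_ge[OF that] in auto)
  have increase: "c * (t - s) \<le> X t - X s" if st: "0 \<le> s" "s \<le> t" "N s = N t" for s t
  proof -
    have t0: "0 \<le> t" using st by simp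
    have "c * (t - s) \<le> Y n t - Y n s" for n
      using set_integral_Icc_bounds(1)[OF set_integral_Icc_split(3)[OF Yi[OF t0] st(1,2)] st(2) drift_ge, of n]
        Ye[OF t0, of n] Ye[OF st(1), of n] set_integral_Icc_split(1)[OF Yi[OF t0] st(1,2), of n] const[OF st] by linarith
    then show ?thesis by (intro LIMSEQ_le_const[OF tendsto_diff[OF conv0[OF t0] conv0[OF st(1)]]]) auto
  qed
  \<comment> \<open>The counter separates the visits to \<open>d\<close>, which makes them
    countable.\<close>
  have "inj_on N {s. 0 \<le> s \<and> X s = d}"
  proof (rule inj_onI)
    have *: "t \<le> s" if "0 \<le> s" "X s = d" "X t = d" "N s = N t" for s t
    proof (rule ccontr)
      assume "\<not> t \<le> s"
      then have "c * (t - s) \<le> 0" using increase[of s t] that by simp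
      then show False using c \<open>\<not> t \<le> s\<close> by (simp add: mult_le_0_iff)
    qed
    fix s t assume st: "s \<in> {s. 0 \<le> s \<and> X s = d}" "t \<in> {s. 0 \<le> s \<and> X s = d}" "N s = N t"
    have "t \<le> s" by (rule *) (use st in auto)
    moreover have "s \<le> t" by (rule *) (use st in auto)
    ultimately show "s = t" by simp
  qed
  then have cnt: "countable {s. 0 \<le> s \<and> X s = d}" by (rule countableI')
  have drift_lim: "(\<lambda>n. threshold_drift G u0 d n (Y n s)) \<longlonglongrightarrow> G (X s) - u0 * indicator {d..} (X s)"
    if s: "0 \<le> s" "X s \<noteq> d" for s
  proof -
    have "(\<lambda>n. G (Y n s)) \<longlonglongrightarrow> G (X s)"
    proof (rule LIM_zero_cancel, rule Lim_null_comparison)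
      show "\<forall>\<^sub>F n in sequentially. norm (G (Y n s) - G (X s)) \<le> L * \<bar>Y n s - X s\<bar>" using lip by simp
      have "(\<lambda>n. L * \<bar>Y n s - X s\<bar>) \<longlonglongrightarrow> L * \<bar>X s - X s\<bar>" by (intro tendsto_intros conv0 s)
      then show "(\<lambda>n. L * \<bar>Y n s - X s\<bar>) \<longlonglongrightarrow> 0" by simp
    qed
    \<comment> \<open>Below \<open>d\<close>, convergence eventually brings \<open>Y n s\<close>
      under \<open>d\<close>. Above \<open>d\<close>, every \<open>Y n s\<close> is at least
      \<open>X s\<close>, so the ramp saturates for large \<open>n\<close>.\<close>
    moreover have "(\<lambda>n. min 1 (max 0 (real n * (Y n s - d)))) \<longlonglongrightarrow> indicator {d..} (X s)"
    proof (rule tendsto_eventually)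
      show "\<forall>\<^sub>F n in sequentially. min 1 (max 0 (real n * (Y n s - d))) = indicator {d..} (X s)"
      proof (cases "X s < d")
        case True
        then have "\<forall>\<^sub>F n in sequentially. Y n s < d" using order_tendstoD(2)[OF conv0[OF s(1)]] by simp
        then show ?thesis
        proof eventually_elim
          case (elim n)
          then have "real n * (Y n s - d) \<le> 0" by (intro mult_nonneg_nonpos) auto
          then show ?case using True by simp
        qed
      next
        case False
        then have pos: "0 < X s - d" using s by simp
        obtain m where m: "1 / (X s - d) < real m" using reals_Archimedean2 by blast
        have "min 1 (max 0 (real n * (Y n s - d))) = 1" if n: "m \<le> n" for n
        proof -
          have "1 \<le> real m * (X s - d)" using m pos by (simp add: field_simps)
          also have "\<dots> \<le> real n * (Y n s - d)" using n X_le[OF s(1), of n] pos by (intro mult_mono) auto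
          finally show ?thesis by simp
        qed
        then show ?thesis using False by (auto simp: eventually_sequentially)
      qed
    qed
    ultimately show ?thesis unfolding threshold_drift_def by (intro tendsto_intros)
  qed
  have Xm: "X \<in> borel_measurable borel"
    by (rule borel_measurable_LIMSEQ_real[OF conv]) (rule measurable_compose[OF _ Ym], simp)
  have "continuous_on UNIV G"
    by (rule lipschitz_on_continuous_on[of L], rule lipschitz_onI) (use lip L in \<open>auto simp: dist_real_def\<close>)
  then have Gm [measurable]: "G \<in> borel_measurable borel" by (rule borel_measurable_continuous_onI)
  have main: "set_integrable lborel {0..t} (\<lambda>s. G (X s) - u0 * indicator {d..} (X s)) \<and>
    X t = x - S t + (LBINT s:{0..t}. G (X s) - u0 * indicator {d..} (X s))" if t: "0 \<le> t" for t
  proof -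
    obtain B where B: "\<And>s. 0 \<le> s \<Longrightarrow> s \<le> t \<Longrightarrow> \<bar>x - S s\<bar> \<le> B" using bdd'[of t] by blast
    define C where "C = B + (LBINT r:{0..t}. \<bar>threshold_drift G u0 d 0 (Y 0 r)\<bar>)"
    have YC: "\<bar>Y n s\<bar> \<le> C" if s: "0 \<le> s" "s \<le> t" for n s
    proof -
      have "\<bar>Y 0 s\<bar> \<le> C" using Ye[OF s(1), of 0] set_integral_Icc_abs_le[OF Yi[OF t, of 0] s] B[OF s]
        unfolding C_def by linarith
      moreover have "- C \<le> x - S s" using B[OF s] unfolding C_def
        using set_integral_Icc_abs_le[OF Yi[OF t, of 0] s] by linarith
      ultimately show ?thesis using Y_le0[OF s(1), of n] Y_ge[OF s(1), of n] by linarith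
    qed
    have DC: "\<bar>threshold_drift G u0 d n (Y n s)\<bar> \<le> \<bar>G 0\<bar> + L * C + u0" if s: "0 \<le> s" "s \<le> t" for n s
    proof -
      have "\<bar>G (Y n s)\<bar> \<le> \<bar>G 0\<bar> + L * \<bar>Y n s\<bar>" using lip[of "Y n s" 0] by simp
      also have "\<dots> \<le> \<bar>G 0\<bar> + L * C" using YC[OF s] L by (intro add_left_mono mult_left_mono) auto
      finally have "\<bar>G (Y n s)\<bar> \<le> \<bar>G 0\<bar> + L * C" .
      moreover have "0 \<le> u0 * min 1 (max 0 (real n * (Y n s - d)))" using u0 by simp
      moreover have "u0 * min 1 (max 0 (real n * (Y n s - d))) \<le> u0 * 1" by (intro mult_left_mono u0) simp
      ultimately show ?thesis unfolding threshold_drift_def by linarith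
    qed
    have 1: "(\<lambda>s. indicat_real {0..t} s *\<^sub>R (G (X s) - u0 * indicator {d..} (X s))) \<in> borel_measurable lborel"
      using Xm by simp
    have 2: "(\<lambda>s. indicat_real {0..t} s *\<^sub>R threshold_drift G u0 d n (Y n s)) \<in> borel_measurable lborel" for n
      using Yi[OF t, of n] by (simp add: set_integrable_def borel_measurable_integrable)
    have 3: "integrable lborel (\<lambda>s. indicat_real {0..t} s *\<^sub>R (\<bar>G 0\<bar> + L * C + u0))"
      using borel_integrable_atLeastAtMost'[of 0 t "\<lambda>_. \<bar>G 0\<bar> + L * C + u0"] by (auto simp: set_integrable_def)
    have ne: "AE s in lborel. s \<notin> {s. 0 \<le> s \<and> X s = d}"
      using cnt by (intro AE_not_in countable_imp_null_set_lborel)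
    have 4: "AE s in lborel. (\<lambda>n. indicat_real {0..t} s *\<^sub>R threshold_drift G u0 d n (Y n s))
        \<longlonglongrightarrow> indicat_real {0..t} s *\<^sub>R (G (X s) - u0 * indicator {d..} (X s))"
      using ne
    proof eventually_elim
      case (elim s)
      then show ?case using drift_lim[of s] by (cases "s \<in> {0..t}") auto
    qed
    have 5: "AE s in lborel. norm (indicat_real {0..t} s *\<^sub>R threshold_drift G u0 d n (Y n s)) \<le> indicat_real {0..t} s *\<^sub>R (\<bar>G 0\<bar> + L * C + u0)" for n
      using DC by (intro AE_I2) (auto simp: indicator_def)
    have lim: "(\<lambda>n. LBINT s:{0..t}. threshold_drift G u0 d n (Y n s)) \<longlonglongrightarrow> (LBINT s:{0..t}. G (X s) - u0 * indicator {d..} (X s))"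
      unfolding set_lebesgue_integral_def by (rule integral_dominated_convergence[OF 1 2 3 4 5])
    have int: "set_integrable lborel {0..t} (\<lambda>s. G (X s) - u0 * indicator {d..} (X s))"
      unfolding set_integrable_def by (rule integrable_dominated_convergence[OF 1 2 3 4 5])
    have "(\<lambda>n. Y n t) \<longlonglongrightarrow> x - S t + (LBINT s:{0..t}. G (X s) - u0 * indicator {d..} (X s))"
      unfolding Ye[OF t] by (intro tendsto_intros lim)
    then have "X t = x - S t + (LBINT s:{0..t}. G (X s) - u0 * indicator {d..} (X s))"
      using conv0[OF t] LIMSEQ_unique by blast
    with int show ?thesis by blast
  qed
  show "0 \<le> t \<Longrightarrow> set_integrable lborel {0..t} (\<lambda>s. G (X s) - u0 * indicator {d..} (X s))"
    "0 \<le> t \<Longrightarrow> X t = x - S t + (LBINT s:{0..t}. G (X s) - u0 * indicator {d..} (X s))"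
    using main by auto
qed

section \<open>Adaptedness of time integrals and of solution paths\<close>

context usual_filtered_prob_space begin

lemma space_F: "0 \<le> t \<Longrightarrow> space (F t) = space M"
  using subalgebra_F by (auto simp: subalgebra_def)

lemma measurable_F_M: "f \<in> measurable (F t) K \<Longrightarrow> 0 \<le> t \<Longrightarrow> f \<in> measurable M K"
  using measurable_from_subalg[OF subalgebra_F] by blast

lemma measurable_F_mono: "f \<in> measurable (F s) K \<Longrightarrow> 0 \<le> s \<Longrightarrow> s \<le> t \<Longrightarrow> f \<in> measurable (F t) K"
  using mono_F[of s t] space_F[of s] space_F[of t] by (auto simp: measurable_def)

text \<open>The usual conditions act here: the exceptional set and all its subsets belong to
  \<open>F 0\<close>, hence to \<open>F t\<close>.\<close>

lemma measurable_F_AE_eq: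
  fixes f h :: "'a \<Rightarrow> real"
  assumes h: "h \<in> borel_measurable (F t)" and f: "f \<in> borel_measurable M" and ae: "AE w in M. f w = h w" and t: "0 \<le> t"
  shows "f \<in> borel_measurable (F t)"
proof (rule measurableI)
  fix B :: "real set" assume B: "B \<in> sets borel"
  have [measurable]: "h \<in> borel_measurable M" "f \<in> borel_measurable M" using h f t measurable_F_M by auto
  have null: "A \<in> sets (F t)" if "A \<in> null_sets M" for A
    using that null_sets_F mono_F[of 0 t] t by auto
  define D where "D = {w\<in>space M. f w \<noteq> h w}"
  have D: "D \<in> null_sets M" using ae unfolding D_def by (intro AE_iff_null[THEN iffD1]) auto
  have "f -` B \<inter> D \<in> null_sets M" using D by (intro complete2[OF _ D]) auto
  then have "f -` B \<inter> D \<in> sets (F t)" "D \<in> sets (F t)" using null D by auto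
  moreover have "h -` B \<inter> space M \<in> sets (F t)" using measurable_sets[OF h B] space_F[OF t] by simp
  moreover have "f -` B \<inter> space (F t) = (h -` B \<inter> space M - D) \<union> (f -` B \<inter> D)"
    using space_F[OF t] by (auto simp: D_def)
  ultimately show "f -` B \<inter> space (F t) \<in> sets (F t)" by auto
qed simp

end

context usual_filtered_prob_space begin

lemma measurable_joint_section:
  assumes "(\<lambda>(s, w). Z s w) \<in> borel_measurable (borel \<Otimes>\<^sub>M M)" "w \<in> space M"
  shows "(\<lambda>s. Z s w) \<in> borel_measurable borel"
  using measurable_compose[OF measurable_Pair2'[OF assms(2)] assms(1)] by simp

lemma measurable_joint_set_integral:
  fixes Z :: "real \<Rightarrow> 'a \<Rightarrow> real"
  assumes Z: "(\<lambda>(s, w). Z s w) \<in> borel_measurable (borel \<Otimes>\<^sub>M M)"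
  shows "(\<lambda>(t, w). LBINT s:{0..t}. Z s w) \<in> borel_measurable (borel \<Otimes>\<^sub>M M)"
proof -
  have [measurable]: "(\<lambda>p. Z (snd p) (snd (fst p))) \<in> borel_measurable ((borel \<Otimes>\<^sub>M M) \<Otimes>\<^sub>M lborel)"
  proof -
    have "(\<lambda>p. (snd p, snd (fst p))) \<in> measurable ((borel \<Otimes>\<^sub>M M) \<Otimes>\<^sub>M lborel) (borel \<Otimes>\<^sub>M M)" by measurable
    from measurable_compose[OF this Z] show ?thesis by (simp add: split_def)
  qed
  have "(\<lambda>q. \<integral>s. (if 0 \<le> s \<and> s \<le> fst q then 1 else 0) * Z s (snd q) \<partial>lborel) \<in> borel_measurable (borel \<Otimes>\<^sub>M M)"
    by (rule lborel.borel_measurable_lebesgue_integral) (simp add: split_def)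
  moreover have "(\<lambda>q. \<integral>s. (if 0 \<le> s \<and> s \<le> fst q then 1 else 0) * Z s (snd q) \<partial>lborel) = (\<lambda>(t, w). LBINT s:{0..t}. Z s w)"
    by (auto simp: set_lebesgue_integral_def indicator_def fun_eq_iff intro!: Bochner_Integration.integral_cong)
  ultimately show ?thesis by simp
qed

text \<open>Adaptedness and joint measurability do not give progressive measurability. Instead, the integral \<open>I\<close> is shown
  to agree almost surely with its conditional expectation \<open>W\<close>: by Fubini, both \<open>I\<close> and \<open>W\<close> are orthogonal to \<open>I - W\<close>.\<close>

lemma adapted_set_integral_bounded:
  fixes Z :: "real \<Rightarrow> 'a \<Rightarrow> real"
  assumes Z: "(\<lambda>(s, w). Z s w) \<in> borel_measurable (borel \<Otimes>\<^sub>M M)"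
    and ad: "\<And>s. 0 \<le> s \<Longrightarrow> s \<le> t \<Longrightarrow> Z s \<in> borel_measurable (F t)"
    and bd: "\<And>s w. w \<in> space M \<Longrightarrow> \<bar>Z s w\<bar> \<le> B" and t: "0 \<le> t"
  shows "(\<lambda>w. LBINT s:{0..t}. Z s w) \<in> borel_measurable (F t)"
proof -
  interpret fs: finite_measure_subalgebra M "F t"
    by (intro finite_measure_subalgebra.intro finite_measure_subalgebra_axioms.intro subalgebra_F t finite_measure_axioms)
  define I where "I = (\<lambda>w. LBINT s:{0..t}. Z s w)"
  define W where "W = real_cond_exp M (F t) I"
  define H where "H = (\<lambda>w. I w - W w)"
  have [measurable]: "I \<in> borel_measurable M"
    using measurable_compose[OF measurable_Pair1' measurable_joint_set_integral[OF Z], of t] by (simp add: I_def)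
  have sec: "(\<lambda>s. Z s w) \<in> borel_measurable borel" if "w \<in> space M" for w using measurable_joint_section[OF Z that] .
  have Zs: "Z s \<in> borel_measurable M" for s
    using measurable_compose[OF measurable_Pair1' Z, of s] by simp
  obtain w0 where "w0 \<in> space M" using not_empty by blast
  then have B: "0 \<le> B" using bd[of w0 0] by linarith
  have Ib: "\<bar>I w\<bar> \<le> B * t" if w: "w \<in> space M" for w
  proof -
    have "norm (LBINT s:{0..t}. Z s w) \<le> (LBINT s:{0..t}. B)"
      using bd[OF w] by (intro set_integral_bound) (auto intro!: borel_integrable_atLeastAtMost')
    then show ?thesis using t by (simp add: I_def set_integral_const mult.commute)
  qed
  have Iint: "integrable M I" by (rule integrable_const_bound[of _ "B * t"]) (use Ib in auto)
  have Wint: "integrable M W" unfolding W_def by (rule fs.real_cond_exp_int(1)[OF Iint])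
  have [measurable]: "W \<in> borel_measurable (F t)" unfolding W_def by simp
  have Wm [measurable]: "W \<in> borel_measurable M" using Wint by simp
  have Hint: "integrable M H" unfolding H_def using Iint Wint by simp
  have Hm [measurable]: "H \<in> borel_measurable M" using Hint by simp
  have bounded_mult: "integrable M (\<lambda>w. f w * h w)"
    if "f \<in> borel_measurable M" "\<And>w. w \<in> space M \<Longrightarrow> \<bar>f w\<bar> \<le> C" "integrable M h" for f h :: "'a \<Rightarrow> real" and C
  proof (rule Bochner_Integration.integrable_bound[of M "\<lambda>w. C * h w"])
    show "integrable M (\<lambda>w. C * h w)" using that by simp
    show "(\<lambda>w. f w * h w) \<in> borel_measurable M" using that by simp
    show "AE w in M. norm (f w * h w) \<le> norm (C * h w)"
    proof (rule AE_I2)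
      fix w assume "w \<in> space M"
      then have "\<bar>f w\<bar> \<le> \<bar>C\<bar>" using that(2) by force
      then show "norm (f w * h w) \<le> norm (C * h w)" by (simp add: abs_mult mult_right_mono)
    qed
  qed
  \<comment> \<open>\<open>I\<close> is bounded, whereas \<open>W\<close> is so far only integrable.
    Integrability of \<open>W * W\<close> then comes out of the defining property of the conditional
    expectation, in \<open>WI\<close>.\<close>
  have IW: "integrable M (\<lambda>w. W w * I w)"
  proof -
    have "integrable M (\<lambda>w. I w * W w)" by (rule bounded_mult[OF _ Ib Wint]) simp
    moreover have "(\<lambda>w. I w * W w) = (\<lambda>w. W w * I w)" by (auto simp: mult.commute)
    ultimately show ?thesis by simp
  qed
  note WI = fs.real_cond_exp_intg[OF IW, folded W_def]
  have WH: "(\<integral>w. W w * H w \<partial>M) = 0"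
    unfolding H_def right_diff_distrib using WI IW by (subst Bochner_Integration.integral_diff) auto
  have ZH: "(\<integral>w. Z s w * H w \<partial>M) = 0" if s: "0 \<le> s" "s \<le> t" for s
  proof -
    have 1: "integrable M (\<lambda>w. Z s w * I w)" by (rule bounded_mult[OF Zs bd Iint])
    note 2 = fs.real_cond_exp_intg[OF 1 ad[OF s], folded W_def]
    show ?thesis unfolding H_def right_diff_distrib using 1 2 by (subst Bochner_Integration.integral_diff) auto
  qed
  interpret P: pair_sigma_finite M lborel ..
  define f where "f = (\<lambda>w s. indicat_real {0..t} s * (Z s w * H w))"
  have fm: "case_prod f \<in> borel_measurable (M \<Otimes>\<^sub>M lborel)"
  proof -
    have "(\<lambda>p. (snd p, fst p)) \<in> measurable (M \<Otimes>\<^sub>M lborel) (borel \<Otimes>\<^sub>M M)" by measurable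
    from measurable_compose[OF this Z] have [measurable]: "(\<lambda>p. Z (snd p) (fst p)) \<in> borel_measurable (M \<Otimes>\<^sub>M lborel)"
      by simp
    have "(\<lambda>p. indicat_real {0..t} (snd p) * (Z (snd p) (fst p) * H (fst p))) \<in> borel_measurable (M \<Otimes>\<^sub>M lborel)"
      by measurable
    then show ?thesis by (simp add: f_def split_def)
  qed
  have secint: "integrable lborel (\<lambda>s. indicat_real {0..t} s * (Z s w * k))" if "w \<in> space M" for w k
  proof -
    have "set_integrable lborel {0..t} (\<lambda>s. Z s w)"
      using bd[OF that] sec[OF that] by (intro set_integrable_bounded[where B = B]) (auto simp: set_borel_measurable_def)
    then have "integrable lborel (\<lambda>s. (indicat_real {0..t} s * Z s w) * k)" by (simp add: set_integrable_def)
    then show ?thesis by (simp add: mult.assoc)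
  qed
  have fint: "integrable (M \<Otimes>\<^sub>M lborel) (case_prod f)"
  proof (rule P.Fubini_integrable[OF fm])
    show "AE w in M. integrable lborel (\<lambda>s. case_prod f (w, s))"
      using secint by (intro AE_I2) (simp add: f_def)
    show "integrable M (\<lambda>w. \<integral>s. norm (case_prod f (w, s)) \<partial>lborel)"
    proof (rule Bochner_Integration.integrable_bound[of M "\<lambda>w. B * t * H w"])
      show "integrable M (\<lambda>w. B * t * H w)" using Hint by simp
      have "(\<lambda>p. norm (case_prod f p)) \<in> borel_measurable (M \<Otimes>\<^sub>M lborel)" using fm by measurable
      then show "(\<lambda>w. \<integral>s. norm (case_prod f (w, s)) \<partial>lborel) \<in> borel_measurable M"
        by (intro lborel.borel_measurable_lebesgue_integral) (simp add: split_def)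
      show "AE w in M. norm (\<integral>s. norm (case_prod f (w, s)) \<partial>lborel) \<le> norm (B * t * H w)"
      proof (rule AE_I2)
        fix w assume w: "w \<in> space M"
        have "norm (\<integral>s. norm (case_prod f (w, s)) \<partial>lborel) = norm (LBINT s:{0..t}. \<bar>Z s w * H w\<bar>)"
        proof -
          have "norm (case_prod f (w, s)) = indicat_real {0..t} s * \<bar>Z s w * H w\<bar>" for s
            by (simp add: f_def abs_mult)
          then show ?thesis by (simp add: set_lebesgue_integral_def)
        qed
        also have "\<dots> \<le> (LBINT s:{0..t}. B * \<bar>H w\<bar>)"
          using bd[OF w] by (intro set_integral_bound) (auto intro!: borel_integrable_atLeastAtMost' mult_right_mono simp: abs_mult)
        also have "\<dots> = norm (B * t * H w)" using t B by (simp add: set_integral_const abs_mult)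
        finally show "norm (\<integral>s. norm (case_prod f (w, s)) \<partial>lborel) \<le> norm (B * t * H w)" .
      qed
    qed
  qed
  have IH: "(\<integral>w. I w * H w \<partial>M) = 0"
  proof -
    have "(\<integral>w. I w * H w \<partial>M) = (\<integral>w. (\<integral>s. f w s \<partial>lborel) \<partial>M)"
    proof (rule Bochner_Integration.integral_cong[OF refl])
      fix w
      show "I w * H w = (\<integral>s. f w s \<partial>lborel)"
        by (simp add: I_def f_def set_lebesgue_integral_def flip: mult.assoc)
    qed
    also have "\<dots> = (\<integral>s. (\<integral>w. f w s \<partial>M) \<partial>lborel)" using P.Fubini_integral[OF fint] by simp
    also have "\<dots> = 0"
    proof -
      have "(\<integral>w. f w s \<partial>M) = 0" for s using ZH[of s] by (cases "s \<in> {0..t}") (auto simp: f_def)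
      then show ?thesis by simp
    qed
    finally show ?thesis .
  qed
  have i1: "integrable M (\<lambda>w. I w * H w)" by (rule bounded_mult[OF _ Ib Hint]) simp
  have i2: "integrable M (\<lambda>w. W w * H w)"
    unfolding H_def right_diff_distrib using WI IW by (intro Bochner_Integration.integrable_diff) auto
  have sq: "integrable M (\<lambda>w. H w * H w)" "(\<integral>w. H w * H w \<partial>M) = 0"
  proof -
    have e: "H w * H w = I w * H w - W w * H w" for w by (simp add: H_def algebra_simps)
    show "integrable M (\<lambda>w. H w * H w)" unfolding e using i1 i2 by simp
    show "(\<integral>w. H w * H w \<partial>M) = 0" unfolding e using i1 i2 IH WH by simp
  qed
  then have "AE w in M. H w * H w = 0"
    using integral_nonneg_eq_0_iff_AE[OF sq(1)] by simp
  then have "AE w in M. I w = W w" by eventually_elim (simp add: H_def)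
  then have "I \<in> borel_measurable (F t)"
    using measurable_F_AE_eq[OF \<open>W \<in> borel_measurable (F t)\<close> \<open>I \<in> borel_measurable M\<close> _ t] by blast
  then show ?thesis by (simp add: I_def)
qed

text \<open>The bound may depend on the scenario, so the integrand is truncated at level
  \<open>k\<close>. In a fixed scenario the truncation is inactive for large
  \<open>k\<close>.\<close>

lemma adapted_set_integral:
  fixes Z :: "real \<Rightarrow> 'a \<Rightarrow> real"
  assumes Z: "(\<lambda>(s, w). Z s w) \<in> borel_measurable (borel \<Otimes>\<^sub>M M)"
    and ad: "\<And>s. 0 \<le> s \<Longrightarrow> s \<le> t \<Longrightarrow> Z s \<in> borel_measurable (F t)"
    and bd: "\<And>w. w \<in> space M \<Longrightarrow> \<exists>B. \<forall>s. 0 \<le> s \<longrightarrow> s \<le> t \<longrightarrow> \<bar>Z s w\<bar> \<le> B" and t: "0 \<le> t"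
  shows "(\<lambda>w. LBINT s:{0..t}. Z s w) \<in> borel_measurable (F t)"
proof (rule borel_measurable_LIMSEQ_real)
  define C where "C = (\<lambda>(k::nat) s w. max (- real k) (min (real k) (Z s w)))"
  fix k
  have "(\<lambda>p. max (- real k) (min (real k) (case_prod Z p))) \<in> borel_measurable (borel \<Otimes>\<^sub>M M)"
    using Z by measurable
  then have "(\<lambda>(s, w). C k s w) \<in> borel_measurable (borel \<Otimes>\<^sub>M M)" by (simp add: C_def split_def)
  then show "(\<lambda>w. LBINT s:{0..t}. max (- real k) (min (real k) (Z s w))) \<in> borel_measurable (F t)"
    unfolding C_def using ad t by (intro adapted_set_integral_bounded[where B = "real k"]) (auto simp: max_def min_def)
next
  fix w assume "w \<in> space (F t)"
  then obtain B where B: "\<And>s. 0 \<le> s \<Longrightarrow> s \<le> t \<Longrightarrow> \<bar>Z s w\<bar> \<le> B" using bd space_F[OF t] by blast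
  obtain m :: nat where m: "B \<le> real m" using real_arch_simple by blast
  have "(LBINT s:{0..t}. max (- real k) (min (real k) (Z s w))) = (LBINT s:{0..t}. Z s w)" if "m \<le> k" for k
  proof (rule set_lebesgue_integral_cong)
    show "\<forall>s. s \<in> {0..t} \<longrightarrow> max (- real k) (min (real k) (Z s w)) = Z s w"
    proof (intro allI impI)
      fix s assume "s \<in> {0..t}"
      then have "\<bar>Z s w\<bar> \<le> real k" using B[of s] m that by (smt (verit) atLeastAtMost_iff of_nat_mono)
      then show "max (- real k) (min (real k) (Z s w)) = Z s w" by auto
    qed
  qed simp
  then show "(\<lambda>k. LBINT s:{0..t}. max (- real k) (min (real k) (Z s w))) \<longlonglongrightarrow> (LBINT s:{0..t}. Z s w)"
    by (intro tendsto_eventually) (auto simp: eventually_sequentially)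
qed

text \<open>All Picard iterates are adapted, and so is their limit. Joint measurability, adaptedness
  and boundedness on bounded intervals go through the induction together, because integrating one
  iterate uses all three.\<close>

lemma integral_path_adapted:
  fixes R :: "real \<Rightarrow> 'a \<Rightarrow> real"
  assumes lip: "\<And>x y. \<bar>G x - G y\<bar> \<le> L * \<bar>x - y\<bar>"
    and R: "(\<lambda>(t, w). R t w) \<in> borel_measurable (borel \<Otimes>\<^sub>M M)"
    and ad: "\<And>t. 0 \<le> t \<Longrightarrow> R t \<in> borel_measurable (F t)"
    and bd: "\<And>w T. w \<in> space M \<Longrightarrow> \<exists>B. \<forall>s. 0 \<le> s \<longrightarrow> s \<le> T \<longrightarrow> \<bar>R s w\<bar> \<le> B"
  shows "(\<lambda>(t, w). integral_path G (\<lambda>t. R t w) t) \<in> borel_measurable (borel \<Otimes>\<^sub>M M)"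
    and "\<And>t. 0 \<le> t \<Longrightarrow> (\<lambda>w. integral_path G (\<lambda>t. R t w) t) \<in> borel_measurable (F t)"
proof -
  define P where "P = (\<lambda>n t w. picard (\<lambda>_. G) (\<lambda>t. R t w) n t)"
  have P0: "P 0 = R" and PS: "P (Suc n) = (\<lambda>t w. R t w + (LBINT s:{0..t}. G (P n s w)))" for n
    by (auto simp: P_def fun_eq_iff)
  have "continuous_on UNIV G"
  proof (rule lipschitz_on_continuous_on[of "\<bar>L\<bar>"], rule lipschitz_onI)
    fix x y
    show "dist (G x) (G y) \<le> \<bar>L\<bar> * dist x y"
      using lip[of x y] by (simp add: dist_real_def) (smt (verit) mult_right_mono)
  qed simp
  then have Gm [measurable]: "G \<in> borel_measurable borel" by (rule borel_measurable_continuous_onI)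
  have inv: "(\<lambda>(t, w). P n t w) \<in> borel_measurable (borel \<Otimes>\<^sub>M M) \<and> (\<forall>t\<ge>0. P n t \<in> borel_measurable (F t)) \<and>
     (\<forall>w\<in>space M. \<forall>T. \<exists>B. \<forall>s. 0 \<le> s \<longrightarrow> s \<le> T \<longrightarrow> \<bar>P n s w\<bar> \<le> B)" for n
  proof (induction n)
    case 0
    then show ?case using R ad bd by (auto simp: P0)
  next
    case (Suc n)
    have GP: "(\<lambda>(t, w). G (P n t w)) \<in> borel_measurable (borel \<Otimes>\<^sub>M M)"
    proof -
      have "(\<lambda>(t, w). P n t w) \<in> borel_measurable (borel \<Otimes>\<^sub>M M)" using Suc by blast
      from measurable_compose[OF this Gm] show ?thesis by (simp add: split_def)
    qed
    have GB: "\<exists>B. \<forall>s. 0 \<le> s \<longrightarrow> s \<le> T \<longrightarrow> \<bar>G (P n s w)\<bar> \<le> B" if w: "w \<in> space M" for w T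
    proof -
      obtain B where B: "\<And>s. 0 \<le> s \<Longrightarrow> s \<le> T \<Longrightarrow> \<bar>P n s w\<bar> \<le> B" using Suc w by blast
      have "\<bar>G (P n s w)\<bar> \<le> \<bar>G 0\<bar> + \<bar>L\<bar> * B" if s: "0 \<le> s" "s \<le> T" for s
      proof -
        have "\<bar>G (P n s w)\<bar> \<le> \<bar>G 0\<bar> + L * \<bar>P n s w\<bar>" using lip[of "P n s w" 0] by simp
        also have "L * \<bar>P n s w\<bar> \<le> \<bar>L\<bar> * B" using B[OF s] by (intro mult_mono) auto
        finally show ?thesis by simp
      qed
      then show ?thesis by blast
    qed
    have "(\<lambda>(t, w). P (Suc n) t w) \<in> borel_measurable (borel \<Otimes>\<^sub>M M)"
      using borel_measurable_add[OF R measurable_joint_set_integral[OF GP]] by (simp add: PS split_def)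
    moreover have "P (Suc n) t \<in> borel_measurable (F t)" if t: "0 \<le> t" for t
    proof -
      have "(\<lambda>w. LBINT s:{0..t}. G (P n s w)) \<in> borel_measurable (F t)"
      proof (rule adapted_set_integral[OF GP _ GB t])
        fix s assume s: "0 \<le> s" "s \<le> t"
        have "P n s \<in> borel_measurable (F t)" using Suc s measurable_F_mono by blast
        then show "(\<lambda>w. G (P n s w)) \<in> borel_measurable (F t)" by (rule measurable_compose) (rule Gm)
      qed
      then show ?thesis unfolding PS by (intro borel_measurable_add ad t)
    qed
    moreover have "\<exists>B. \<forall>s. 0 \<le> s \<longrightarrow> s \<le> T \<longrightarrow> \<bar>P (Suc n) s w\<bar> \<le> B" if w: "w \<in> space M" for w T
    proof -
      obtain B1 B2 where B: "\<And>s. 0 \<le> s \<Longrightarrow> s \<le> T \<Longrightarrow> \<bar>R s w\<bar> \<le> B1" "\<And>s. 0 \<le> s \<Longrightarrow> s \<le> T \<Longrightarrow> \<bar>G (P n s w)\<bar> \<le> B2"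
        using bd[OF w, of T] GB[OF w, of T] by auto
      have "\<bar>P (Suc n) s w\<bar> \<le> B1 + \<bar>B2\<bar> * T" if s: "0 \<le> s" "s \<le> T" for s
      proof -
        have "norm (LBINT r:{0..s}. G (P n r w)) \<le> (LBINT r:{0..s}. \<bar>B2\<bar>)"
          using B(2) s by (intro set_integral_bound borel_integrable_atLeastAtMost' continuous_intros)
              (simp, smt (verit))
        also have "\<dots> = \<bar>B2\<bar> * s" using s by (simp add: set_integral_const)
        also have "\<dots> \<le> \<bar>B2\<bar> * T" using s by (intro mult_left_mono) auto
        finally show ?thesis using B(1)[OF s] by (simp add: PS)
      qed
      then show ?thesis by blast
    qed
    ultimately show ?case by blast
  qed
  have Rm: "(\<lambda>t. R t w) \<in> borel_measurable borel" if "w \<in> space M" for w by (rule measurable_joint_section[OF R that])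
  have lim: "(\<lambda>n. P n t w) \<longlonglongrightarrow> integral_path G (\<lambda>t. R t w) t" if "w \<in> space M" for t w
    unfolding P_def by (rule integral_path(1)[OF lip Rm[OF that] bd[OF that]])
  show "(\<lambda>(t, w). integral_path G (\<lambda>t. R t w) t) \<in> borel_measurable (borel \<Otimes>\<^sub>M M)"
  proof (rule borel_measurable_LIMSEQ_real[of _ "\<lambda>n (t, w). P n t w"])
    fix p assume "p \<in> space (borel \<Otimes>\<^sub>M M :: (real \<times> 'a) measure)"
    then show "(\<lambda>n. case p of (t, w) \<Rightarrow> P n t w) \<longlonglongrightarrow> (case p of (t, w) \<Rightarrow> integral_path G (\<lambda>t. R t w) t)"
      using lim by (auto simp: space_pair_measure)
  qed (use inv in blast)
  show "(\<lambda>w. integral_path G (\<lambda>t. R t w) t) \<in> borel_measurable (F t)" if t: "0 \<le> t" for t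
    by (rule borel_measurable_LIMSEQ_real[of _ "\<lambda>n. P n t"]) (use inv lim space_F[OF t] t in auto)
qed

end

text \<open>The mirror image of \<open>right_persistent\<close>; it lets ruin be detected at
  countably many times.\<close>

definition negative_persistent :: "(real \<Rightarrow> real) \<Rightarrow> bool" where
  "negative_persistent f \<longleftrightarrow> (\<forall>t\<ge>0. f t < 0 \<longrightarrow> (\<exists>e>0. \<forall>r. t \<le> r \<longrightarrow> r < t + e \<longrightarrow> f r < 0))"

lemma step_negative_persistent:
  fixes X S b :: "real \<Rightarrow> real"
  assumes step: "\<And>t. 0 \<le> t \<Longrightarrow> \<exists>e>0. \<forall>r. t \<le> r \<longrightarrow> r < t + e \<longrightarrow> S r = S t"
    and int: "\<And>t. 0 \<le> t \<Longrightarrow> set_integrable lborel {0..t} b"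
    and eq: "\<And>t. 0 \<le> t \<Longrightarrow> X t = x - S t + (LBINT s:{0..t}. b s)"
  shows "negative_persistent X"
  unfolding negative_persistent_def
proof (intro allI impI)
  fix t :: real assume t: "0 \<le> t" "X t < 0"
  obtain e where e: "e > 0" "\<And>r. t \<le> r \<Longrightarrow> r < t + e \<Longrightarrow> S r = S t" using step[OF t(1)] by blast
  define I where "I = (\<lambda>t. LBINT s:{0..t}. b s)"
  have "continuous_on {0..t + 1} I" unfolding I_def
    using t by (intro continuous_on_set_integral_Icc int) auto
  then obtain e' where e': "e' > 0" "\<forall>r\<in>{0..t + 1}. dist r t < e' \<longrightarrow> dist (I r) (I t) < - X t"
    unfolding continuous_on_iff using t by (metis atLeastAtMost_iff neg_0_less_iff_less less_add_one less_imp_le)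
  have "X r < 0" if r: "t \<le> r" "r < t + min e (min e' 1)" for r
  proof -
    have "dist (I r) (I t) < - X t" using e'(2) r t by (auto simp: dist_real_def)
    then show ?thesis using eq[of r] eq[of t] e(2)[of r] r t by (simp add: I_def dist_real_def)
  qed
  then show "\<exists>e>0. \<forall>r. t \<le> r \<longrightarrow> r < t + e \<longrightarrow> X r < 0" using e e' by (intro exI[of _ "min e (min e' 1)"]) auto
qed

text \<open>A negative value spreads to the right and so reaches a rational time, except at the
  endpoint \<open>t\<close>, which is therefore tested separately.\<close>

lemma nonneg_on_Icc_iff_rational:
  assumes "negative_persistent f" "0 \<le> t"
  shows "(\<forall>s. 0 \<le> s \<longrightarrow> s \<le> t \<longrightarrow> 0 \<le> f s) \<longleftrightarrow> (\<forall>q\<in>insert t (\<rat> \<inter> {0..t}). 0 \<le> f q)"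
proof
  assume q: "\<forall>q\<in>insert t (\<rat> \<inter> {0..t}). 0 \<le> f q"
  show "\<forall>s. 0 \<le> s \<longrightarrow> s \<le> t \<longrightarrow> 0 \<le> f s"
  proof (intro allI impI, rule ccontr)
    fix s assume s: "0 \<le> s" "s \<le> t" "\<not> 0 \<le> f s"
    then have "s < t" using q by (cases "s = t") auto
    obtain e where e: "e > 0" "\<And>r. s \<le> r \<Longrightarrow> r < s + e \<Longrightarrow> f r < 0"
      using assms(1) s unfolding negative_persistent_def by (meson not_le)
    obtain r where r: "r \<in> \<rat>" "s < r" "r < min t (s + e)"
      using Rats_dense_in_real[of s "min t (s + e)"] \<open>s < t\<close> e(1) by auto
    then show False using e(2)[of r] q s by force
  qed
qed (use assms(2) in auto)

lemma ruin_time_cong: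
  assumes "\<And>t. 0 \<le> t \<Longrightarrow> f t = h t"
  shows "ruin_time f = ruin_time h"
proof -
  have "{t. 0 \<le> t \<and> f t < 0} = {t. 0 \<le> t \<and> h t < 0}" using assms by auto
  then show ?thesis by (simp add: ruin_time_def)
qed

section \<open>Measurability of the ruin time\<close>

context usual_filtered_prob_space begin

lemma ruin_measurable:
  assumes ad: "\<And>t. 0 \<le> t \<Longrightarrow> Z t \<in> borel_measurable (F t)"
    and pers: "\<And>w. w \<in> space M \<Longrightarrow> right_persistent (\<lambda>t. Z t w)"
    and neg: "\<And>w. w \<in> space M \<Longrightarrow> negative_persistent (\<lambda>t. Z t w)"
  shows "\<And>t. 0 \<le> t \<Longrightarrow> {w\<in>space M. ereal t < ruin_time (\<lambda>t. Z t w)} \<in> sets (F t)"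
    and "(\<lambda>w. ruin_time (\<lambda>t. Z t w)) \<in> borel_measurable M"
proof -
  show a: "{w\<in>space M. ereal t < ruin_time (\<lambda>t. Z t w)} \<in> sets (F t)" if t: "0 \<le> t" for t
  proof -
    have "{w\<in>space M. ereal t < ruin_time (\<lambda>t. Z t w)} = {w\<in>space (F t). \<forall>q\<in>insert t (\<rat> \<inter> {0..t}). 0 \<le> Z q w}"
      using before_ruin_iff[OF pers t] nonneg_on_Icc_iff_rational[OF neg t] space_F[OF t] by auto
    also have "\<dots> \<in> sets (F t)"
    proof (rule sets.sets_Collect_countable_All')
      show "countable (insert t (\<rat> \<inter> {0..t}))" by (simp add: countable_rat countable_Int1)
      fix q assume "q \<in> insert t (\<rat> \<inter> {0..t})"
      then have "Z q \<in> borel_measurable (F t)" using ad t measurable_F_mono[of "Z q" q borel t] by auto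
      then show "{w\<in>space (F t). 0 \<le> Z q w} \<in> sets (F t)" by measurable
    qed
    finally show ?thesis .
  qed
  show "(\<lambda>w. ruin_time (\<lambda>t. Z t w)) \<in> borel_measurable M"
  proof (rule borel_measurableI_greater)
    fix y :: ereal
    have all: "{w\<in>space M. y < ruin_time (\<lambda>t. Z t w)} = space M" if "y < 0"
      using that ruin_time_nonneg by (auto intro: less_le_trans)
    show "{w\<in>space M. y < ruin_time (\<lambda>t. Z t w)} \<in> sets M"
    proof (cases y)
      case (real r)
      show ?thesis
      proof (cases "0 \<le> r")
        case True
        have "sets (F r) \<subseteq> sets M" using subalgebra_F[OF True] by (simp add: subalgebra_def)
        then show ?thesis using a[OF True] real by auto
      next
        case False
        then show ?thesis using all real by simp
      qed
    next
      case MInf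
      then show ?thesis using all by simp
    qed simp
  qed
qed

end

section \<open>The controlled surplus\<close>

locale dividend_model = risk_model M F N Y lam \<alpha>
  for M :: "'a measure" and F N Y lam \<alpha> +
  fixes g :: "real \<Rightarrow> real" and \<delta> u0 c L :: real
  assumes delta_pos: "0 < \<delta>" and u0_pos: "0 < u0" and c_pos: "0 < c" and g_ge: "\<And>x. 0 \<le> x \<Longrightarrow> u0 + c \<le> g x"
    and L_pos: "0 < L" and g_lip: "\<And>x y. 0 \<le> x \<Longrightarrow> 0 \<le> y \<Longrightarrow> \<bar>g x - g y\<bar> \<le> L * \<bar>x - y\<bar>"
begin

text \<open>Constant continuation to the left keeps the Lipschitz constant and the lower bound
  \<open>u0 + c\<close>, so solutions exist for all times and go on rising between claims after
  ruin.\<close>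

definition G :: "real \<Rightarrow> real" where "G x = g (max 0 x)"

lemma G_eq: "0 \<le> x \<Longrightarrow> G x = g x" by (simp add: G_def)

lemma G_ge: "u0 + c \<le> G x" by (simp add: G_def g_ge)

lemma G_lip: "\<bar>G x - G y\<bar> \<le> L * \<bar>x - y\<bar>"
proof -
  have "\<bar>G x - G y\<bar> \<le> L * \<bar>max 0 x - max 0 y\<bar>" unfolding G_def by (intro g_lip) auto
  also have "\<dots> \<le> L * \<bar>x - y\<bar>" using L_pos by (intro mult_left_mono) auto
  finally show ?thesis .
qed

lemma G_measurable [measurable]: "G \<in> borel_measurable borel"
proof -
  have "continuous_on UNIV G"
    by (rule lipschitz_on_continuous_on[of L], rule lipschitz_onI) (use G_lip L_pos in \<open>auto simp: dist_real_def\<close>)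
  then show ?thesis by (rule borel_measurable_continuous_onI)
qed

text \<open>Times before \<open>0\<close> are mapped to \<open>0\<close>; joint measurability can
  then be stated on the whole line.\<close>

definition S :: "real \<Rightarrow> 'a \<Rightarrow> real" where "S t w = aggregate_claims N Y (max 0 t) w"

lemma N_mono: "w \<in> space M \<Longrightarrow> 0 \<le> s \<Longrightarrow> s \<le> t \<Longrightarrow> N s w \<le> N t w"
  using poisson_N unfolding poisson_process_def by (auto simp: mono_on_def)

text \<open>In the discrete topology, right-continuity means being constant on an interval to the
  right.\<close>

lemma N_step:
  assumes w: "w \<in> space M" and t: "0 \<le> t"
  shows "\<exists>e>0. \<forall>r. t \<le> r \<longrightarrow> r < t + e \<longrightarrow> N r w = N t w"
proof -
  have "continuous (at_right t) (\<lambda>s. N s w)" using poisson_N w t unfolding poisson_process_def by blast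
  then have "((\<lambda>s. N s w) \<longlongrightarrow> N t w) (at_right t)" by (simp add: continuous_within)
  then have "\<forall>\<^sub>F s in at_right t. N s w = N t w" by (simp only: tendsto_discrete)
  then obtain b where b: "t < b" "\<And>s. t < s \<Longrightarrow> s < b \<Longrightarrow> N s w = N t w"
    unfolding eventually_at_right_field by auto
  have "N r w = N t w" if "t \<le> r" "r < t + (b - t)" for r
    using b(2)[of r] that by (cases "r = t") auto
  moreover have "0 < b - t" using b(1) by simp
  ultimately show ?thesis by blast
qed

lemma S_const: "0 \<le> s \<Longrightarrow> s \<le> t \<Longrightarrow> N s w = N t w \<Longrightarrow> S s w = S t w"
  by (simp add: S_def aggregate_claims_def)

lemma S_step:
  assumes w: "w \<in> space M" and t: "0 \<le> t"
  shows "\<exists>e>0. \<forall>r. t \<le> r \<longrightarrow> r < t + e \<longrightarrow> S r w = S t w"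
proof -
  obtain e where e: "e > 0" "\<And>r. t \<le> r \<Longrightarrow> r < t + e \<Longrightarrow> N r w = N t w" using N_step[OF assms] by blast
  have "S r w = S t w" if "t \<le> r" "r < t + e" for r using S_const[OF t that(1)] e(2)[OF that] by simp
  then show ?thesis using e(1) by blast
qed

lemma S_bounded:
  assumes w: "w \<in> space M"
  shows "\<exists>B. \<forall>s. 0 \<le> s \<longrightarrow> s \<le> T \<longrightarrow> \<bar>S s w\<bar> \<le> B"
proof -
  have "\<bar>S s w\<bar> \<le> (\<Sum>i=1..N T w. \<bar>Y i w\<bar>)" if s: "0 \<le> s" "s \<le> T" for s
  proof -
    have "\<bar>S s w\<bar> \<le> (\<Sum>i=1..N s w. \<bar>Y i w\<bar>)" using s by (simp add: S_def aggregate_claims_def)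
    also have "\<dots> \<le> (\<Sum>i=1..N T w. \<bar>Y i w\<bar>)" using N_mono[OF w s] by (intro sum_mono2) auto
    finally show ?thesis .
  qed
  then show ?thesis by blast
qed

lemma S_adapted: "0 \<le> t \<Longrightarrow> S t \<in> borel_measurable (F t)"
  using adapted_claims[of t] by (simp add: S_def[abs_def])

lemma S_0 [simp]: "w \<in> space M \<Longrightarrow> S 0 w = 0"
  using poisson_N unfolding poisson_process_def by (auto simp: S_def aggregate_claims_def)

text \<open>The paths of \<open>S\<close> are locally constant to the right, so sampling at a nearby
  grid point to the right of \<open>t\<close> gives \<open>S t\<close> once the grid is fine. The
  sampled process uses countably many random variables and is jointly measurable.\<close>

lemma S_joint: "(\<lambda>(t, w). S t w) \<in> borel_measurable (borel \<Otimes>\<^sub>M M)"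
proof -
  \<comment> \<open>The summand \<open>1\<close> selects the right end of the cell, a point after
    \<open>t\<close>, where right-continuity applies.\<close>
  define h where "h = (\<lambda>(n::nat) (t::real). (of_int \<lfloor>max 0 t * real (Suc n)\<rfloor> + 1) / real (Suc n))"
  have Sm: "S t \<in> borel_measurable M" for t
    using S_adapted[of "max 0 t"] measurable_F_M[of "S (max 0 t)" "max 0 t" borel] by (simp add: S_def[abs_def])
  show ?thesis
  proof (rule borel_measurable_LIMSEQ_real[of _ "\<lambda>n p. S (h n (fst p)) (snd p)"])
    fix n
    have "(\<lambda>p. (\<lambda>(i::int) p. S ((of_int i + 1) / real (Suc n)) (snd p)) \<lfloor>max 0 (fst p) * real (Suc n)\<rfloor> p) \<in> borel_measurable (borel \<Otimes>\<^sub>M M)"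
    proof (rule measurable_compose_countable[of "\<lambda>(i::int) p. S ((of_int i + 1) / real (Suc n)) (snd p)"])
      fix i :: int
      show "(\<lambda>p. S ((of_int i + 1) / real (Suc n)) (snd p)) \<in> borel_measurable ((borel::real measure) \<Otimes>\<^sub>M M)"
        by (rule measurable_compose[OF measurable_snd Sm])
    qed measurable
    then show "(\<lambda>p. S (h n (fst p)) (snd p)) \<in> borel_measurable (borel \<Otimes>\<^sub>M M)" by (simp add: h_def)
  next
    fix p :: "real \<times> 'a" assume "p \<in> space (borel \<Otimes>\<^sub>M M)"
    then obtain t w where p: "p = (t, w)" "w \<in> space M" by (auto simp: space_pair_measure)
    define t' where "t' = max 0 t"
    obtain e where e: "e > 0" "\<And>r. t' \<le> r \<Longrightarrow> r < t' + e \<Longrightarrow> S r w = S t' w"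
      using S_step[OF p(2), of t'] by (auto simp: t'_def)
    obtain m :: nat where m: "1 / e < real m" using reals_Archimedean2 by blast
    have "S (h n t) w = S t' w" if n: "m \<le> n" for n
    proof (rule e(2))
      have fl: "of_int \<lfloor>t' * real (Suc n)\<rfloor> \<le> t' * real (Suc n)" "t' * real (Suc n) < of_int \<lfloor>t' * real (Suc n)\<rfloor> + 1"
        by linarith+
      have hn: "h n t * real (Suc n) = of_int \<lfloor>t' * real (Suc n)\<rfloor> + 1" by (simp add: h_def t'_def)
      have "t' * real (Suc n) \<le> h n t * real (Suc n)" using fl hn by simp
      then show "t' \<le> h n t" by (simp add: mult_le_cancel_right del: of_nat_Suc)
      have "1 < e * real m" using m e(1) by (simp add: field_simps)
      also have "\<dots> \<le> e * real (Suc n)" using n e(1) by (intro mult_left_mono) auto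
      finally have "1 < e * real (Suc n)" .
      then have "h n t * real (Suc n) < (t' + e) * real (Suc n)" unfolding hn distrib_right using fl(1) by linarith
      then show "h n t < t' + e" by (simp add: mult_less_cancel_right del: of_nat_Suc)
    qed
    moreover have "S t' w = S t w" by (simp add: S_def t'_def)
    ultimately show "(\<lambda>n. S (h n (fst p)) (snd p)) \<longlonglongrightarrow> (case p of (t, w) \<Rightarrow> S t w)"
      using p by (intro tendsto_eventually) (auto simp: eventually_sequentially)
  qed
qed

context
  fixes u :: "real \<Rightarrow> 'a \<Rightarrow> real" and x :: real
  assumes u: "u \<in> rates M F u0"
begin

definition rate :: "real \<Rightarrow> 'a \<Rightarrow> real" where "rate t w = u (max 0 t) w"

lemma rate_bounds: "w \<in> space M \<Longrightarrow> 0 \<le> rate t w" "w \<in> space M \<Longrightarrow> rate t w \<le> u0"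
  using u by (auto simp: rates_def rate_def)

lemma rate_adapted: "0 \<le> t \<Longrightarrow> rate t \<in> borel_measurable (F t)"
  using u by (auto simp: rates_def rate_def[abs_def])

lemma rate_joint: "(\<lambda>(t, w). rate t w) \<in> borel_measurable (borel \<Otimes>\<^sub>M M)"
proof -
  have "(\<lambda>p. (max 0 (fst p), snd p)) \<in> measurable ((borel :: real measure) \<Otimes>\<^sub>M M) (restrict_space borel {0..} \<Otimes>\<^sub>M M)"
    by (intro measurable_Pair measurable_restrict_space2) auto
  moreover have "(\<lambda>(t, w). u t w) \<in> borel_measurable (restrict_space borel {0..} \<Otimes>\<^sub>M M)" using u by (simp add: rates_def)
  ultimately have "(\<lambda>p. (\<lambda>(t, w). u t w) (max 0 (fst p), snd p)) \<in> borel_measurable (borel \<Otimes>\<^sub>M M)"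
    by (rule measurable_compose)
  then show ?thesis by (simp add: rate_def split_def)
qed

lemma rate_integrable:
  assumes "w \<in> space M"
  shows "set_integrable lborel {a..b} (\<lambda>s. rate s w)"
proof (rule set_integrable_bounded[where B = u0])
  show "set_borel_measurable borel {a..b} (\<lambda>s. rate s w)"
    using measurable_joint_section[OF rate_joint assms] by (simp add: set_borel_measurable_def)
  show "norm (rate s w) \<le> u0" for s using rate_bounds[OF assms, of s] by simp
qed

text \<open>The forcing term of the surplus equation: initial capital minus claims and dividends, to
  which the integral of the drift is added.\<close>

definition outflow :: "real \<Rightarrow> 'a \<Rightarrow> real" where
  "outflow t w = x - S t w - (LBINT s:{0..t}. rate s w)"

text \<open>The solution with the extended drift, continued beyond ruin; freezing it at ruin gives
  \<open>surplus\<close>.\<close>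

definition free_surplus :: "real \<Rightarrow> 'a \<Rightarrow> real" where
  "free_surplus t w = integral_path G (\<lambda>t. outflow t w) t"

lemma outflow_joint: "(\<lambda>(t, w). outflow t w) \<in> borel_measurable (borel \<Otimes>\<^sub>M M)"
  using S_joint measurable_joint_set_integral[OF rate_joint] by (auto simp: outflow_def split_def)

lemma outflow_adapted: "0 \<le> t \<Longrightarrow> outflow t \<in> borel_measurable (F t)"
proof -
  assume t: "0 \<le> t"
  have "(\<lambda>w. LBINT s:{0..t}. rate s w) \<in> borel_measurable (F t)"
  proof (rule adapted_set_integral_bounded[OF rate_joint _ _ t])
    show "rate s \<in> borel_measurable (F t)" if "0 \<le> s" "s \<le> t" for s
      using rate_adapted that measurable_F_mono by blast
    show "\<bar>rate s w\<bar> \<le> u0" if "w \<in> space M" for s w using rate_bounds[OF that, of s] by simp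
  qed
  then show ?thesis unfolding outflow_def[abs_def] using S_adapted[OF t] by simp
qed

lemma outflow_bounded:
  assumes w: "w \<in> space M"
  shows "\<exists>B. \<forall>s. 0 \<le> s \<longrightarrow> s \<le> T \<longrightarrow> \<bar>outflow s w\<bar> \<le> B"
proof -
  obtain B where B: "\<And>s. 0 \<le> s \<Longrightarrow> s \<le> T \<Longrightarrow> \<bar>S s w\<bar> \<le> B" using S_bounded[OF w] by blast
  have "\<bar>outflow s w\<bar> \<le> \<bar>x\<bar> + B + u0 * T" if s: "0 \<le> s" "s \<le> T" for s
  proof -
    have "\<bar>LBINT r:{0..s}. rate r w\<bar> \<le> u0 * T"
    proof -
      have "0 * (s - 0) \<le> (LBINT r:{0..s}. rate r w)" "(LBINT r:{0..s}. rate r w) \<le> u0 * (s - 0)"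
        by (rule set_integral_Icc_bounds[OF rate_integrable[OF w] s(1)], rule rate_bounds[OF w])+
      moreover have "u0 * s \<le> u0 * T" using u0_pos s by (intro mult_left_mono) auto
      ultimately show ?thesis by simp
    qed
    then show ?thesis using B[OF s] by (simp add: outflow_def)
  qed
  then show ?thesis by blast
qed

lemma free_surplus_adapted: "0 \<le> t \<Longrightarrow> free_surplus t \<in> borel_measurable (F t)"
  using integral_path_adapted(2)[OF G_lip outflow_joint outflow_adapted outflow_bounded] by (simp add: free_surplus_def[abs_def])

lemma
  assumes w: "w \<in> space M" and t: "0 \<le> t"
  shows free_surplus_integrable: "set_integrable lborel {0..t} (\<lambda>s. G (free_surplus s w))"
    and free_surplus_eq': "free_surplus t w = outflow t w + (LBINT s:{0..t}. G (free_surplus s w))"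
  using integral_path(3,4)[OF G_lip measurable_joint_section[OF outflow_joint w] outflow_bounded[OF w] t]
  by (auto simp: free_surplus_def)

lemma drift_integrable:
  "w \<in> space M \<Longrightarrow> 0 \<le> t \<Longrightarrow> set_integrable lborel {0..t} (\<lambda>s. G (free_surplus s w) - rate s w)"
  using free_surplus_integrable rate_integrable by auto

lemma free_surplus_eq:
  assumes w: "w \<in> space M" and t: "0 \<le> t"
  shows "free_surplus t w = x - S t w + (LBINT s:{0..t}. G (free_surplus s w) - rate s w)"
  using free_surplus_eq'[OF w t] free_surplus_integrable[OF w t] rate_integrable[OF w, of 0 t]
  by (subst set_integral_diff) (auto simp: outflow_def)

lemma drift_ge: "w \<in> space M \<Longrightarrow> c \<le> G (free_surplus s w) - rate s w"
  using G_ge[of "free_surplus s w"] rate_bounds(2)[of w s] by linarith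

lemma free_surplus_persistent:
  assumes w: "w \<in> space M"
  shows "right_persistent (\<lambda>t. free_surplus t w)" "negative_persistent (\<lambda>t. free_surplus t w)"
proof -
  show "right_persistent (\<lambda>t. free_surplus t w)"
    by (rule step_right_persistent[OF S_step[OF w] drift_integrable[OF w] free_surplus_eq[OF w]])
      (auto intro: order_trans[OF less_imp_le[OF c_pos] drift_ge[OF w]] simp del: diff_ge_0_iff_ge)
  show "negative_persistent (\<lambda>t. free_surplus t w)"
    by (rule step_negative_persistent[OF S_step[OF w] drift_integrable[OF w] free_surplus_eq[OF w]])
qed

lemma dividends_eq: "0 \<le> t \<Longrightarrow> dividends u t w = (LBINT s:{0..t}. rate s w)"
  unfolding dividends_def rate_def by (rule set_lebesgue_integral_cong) auto

lemma free_surplus_equation: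
  assumes "w \<in> space M" "0 \<le> t"
  shows "free_surplus t w = x + (LBINT s:{0..t}. G (free_surplus s w)) - (aggregate_claims N Y t w + dividends u t w)"
  using free_surplus_eq'[OF assms] dividends_eq[OF assms(2)] assms(2) by (simp add: outflow_def S_def)

lemma surplus_path_unique_free:
  assumes w: "w \<in> space M" and f: "surplus_path g x (\<lambda>s. aggregate_claims N Y s w + dividends u s w) f" and t: "0 \<le> t"
  shows "f t = killed (\<lambda>t. free_surplus t w) t"
  by (rule surplus_path_unique[OF L_pos G_lip G_eq free_surplus_integrable[OF w] free_surplus_equation[OF w] free_surplus_persistent(1)[OF w] f t])

lemma surplus_eq:
  assumes w: "w \<in> space M" and t: "0 \<le> t"
  shows "surplus g N Y x u t w = killed (\<lambda>t. free_surplus t w) t"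
proof -
  have "surplus_path g x (\<lambda>s. aggregate_claims N Y s w + dividends u s w) (killed (\<lambda>t. free_surplus t w))"
    by (rule surplus_path_killed[OF L_pos G_lip G_eq free_surplus_integrable[OF w] free_surplus_equation[OF w] free_surplus_persistent(1)[OF w]])
  from someI[of "surplus_path g x (\<lambda>s. aggregate_claims N Y s w + dividends u s w)", OF this]
  show ?thesis unfolding surplus_def by (rule surplus_path_unique_free[OF w _ t])
qed

lemma ruin_eq:
  assumes w: "w \<in> space M"
  shows "ruin g N Y x u w = ruin_time (\<lambda>t. free_surplus t w)"
proof -
  have "ruin g N Y x u w = ruin_time (killed (\<lambda>t. free_surplus t w))"
    unfolding ruin_def by (rule ruin_time_cong) (rule surplus_eq[OF w])
  also have "\<dots> = ruin_time (\<lambda>t. free_surplus t w)"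
    by (rule ruin_time_killed[OF L_pos G_lip G_eq free_surplus_integrable[OF w] free_surplus_equation[OF w] free_surplus_persistent(1)[OF w]])
  finally show ?thesis .
qed

lemma free_ruin_measurable:
  shows "0 \<le> t \<Longrightarrow> {w\<in>space M. ereal t < ruin_time (\<lambda>t. free_surplus t w)} \<in> sets (F t)"
    and "(\<lambda>w. ruin_time (\<lambda>t. free_surplus t w)) \<in> borel_measurable M"
  using ruin_measurable[of free_surplus, OF free_surplus_adapted free_surplus_persistent] by auto

end

lemma threshold_rate_exists:
  assumes d: "0 < d"
  shows "\<exists>u\<in>rates M F u0. threshold_rate M g N Y u0 d x u"
proof -
  define T where "T = (\<lambda>t w. threshold_path G u0 d (\<lambda>t. x - S t w) t)"
  define \<rho> where "\<rho> = (\<lambda>w. ruin_time (\<lambda>t. T t w))"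
  define u where "u = (\<lambda>t w. if ereal t < \<rho> w then u0 * indicator {d..} (T t w) else 0)"
  define b where "b = (\<lambda>w s. G (T s w) - u0 * indicator {d..} (T s w))"
  have Sm: "(\<lambda>t. S t w) \<in> borel_measurable borel" if "w \<in> space M" for w by (rule measurable_joint_section[OF S_joint that])
  have mono: "mono_on {0..} (\<lambda>t. N t w)" if "w \<in> space M" for w
    using poisson_N that unfolding poisson_process_def by blast
  have conv: "(\<lambda>n. integral_path (threshold_drift G u0 d n) (\<lambda>t. x - S t w) (max 0 t)) \<longlonglongrightarrow> T t w"
    if "w \<in> space M" for t w unfolding T_def
    by (rule threshold_path(1)[OF L_pos G_lip less_imp_le[OF u0_pos] c_pos G_ge Sm[OF that(1)] S_bounded[OF that(1)] S_const mono[OF that(1)]])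
  have Ti: "set_integrable lborel {0..t} (b w)" if "w \<in> space M" "0 \<le> t" for t w unfolding b_def T_def
    by (rule threshold_path(2)[OF L_pos G_lip less_imp_le[OF u0_pos] c_pos G_ge Sm[OF that(1)] S_bounded[OF that(1)] S_const mono[OF that(1)] that(2)])
  have Te: "T t w = x - S t w + (LBINT s:{0..t}. b w s)" if "w \<in> space M" "0 \<le> t" for t w unfolding b_def T_def
    by (rule threshold_path(3)[OF L_pos G_lip less_imp_le[OF u0_pos] c_pos G_ge Sm[OF that(1)] S_bounded[OF that(1)] S_const mono[OF that(1)] that(2)])
  have b_ge: "c \<le> b w s" for w s
    using G_ge[of "T s w"] u0_pos by (auto simp: b_def indicator_def)
  have Rj: "(\<lambda>(t, w). x - S t w) \<in> borel_measurable (borel \<Otimes>\<^sub>M M)" using S_joint by (simp add: split_def)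
  have Ra: "(\<lambda>w. x - S t w) \<in> borel_measurable (F t)" if "0 \<le> t" for t using S_adapted[OF that] by simp
  have Rb: "\<exists>B. \<forall>s. 0 \<le> s \<longrightarrow> s \<le> T \<longrightarrow> \<bar>x - S s w\<bar> \<le> B" if w: "w \<in> space M" for w T
  proof -
    obtain B where B: "\<And>s. 0 \<le> s \<Longrightarrow> s \<le> T \<Longrightarrow> \<bar>S s w\<bar> \<le> B" using S_bounded[OF w] by blast
    have "\<bar>x - S s w\<bar> \<le> \<bar>x\<bar> + B" if "0 \<le> s" "s \<le> T" for s using B[OF that] by linarith
    then show ?thesis by blast
  qed
  note ipa = integral_path_adapted[OF threshold_drift_lipschitz[OF G_lip less_imp_le[OF u0_pos]] Rj Ra Rb]
  have Tj: "(\<lambda>(t, w). T t w) \<in> borel_measurable (borel \<Otimes>\<^sub>M M)"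
  proof (rule borel_measurable_LIMSEQ_real[of _ "\<lambda>n p. integral_path (threshold_drift G u0 d n) (\<lambda>t. x - S t (snd p)) (max 0 (fst p))"])
    fix n
    have "(\<lambda>p. (max 0 (fst p), snd p)) \<in> measurable ((borel :: real measure) \<Otimes>\<^sub>M M) (borel \<Otimes>\<^sub>M M)" by measurable
    from measurable_compose[OF this ipa(1)[of d n]]
    show "(\<lambda>p. integral_path (threshold_drift G u0 d n) (\<lambda>t. x - S t (snd p)) (max 0 (fst p))) \<in> borel_measurable (borel \<Otimes>\<^sub>M M)"
      by simp
  next
    fix p :: "real \<times> 'a" assume "p \<in> space (borel \<Otimes>\<^sub>M M)"
    then show "(\<lambda>n. integral_path (threshold_drift G u0 d n) (\<lambda>t. x - S t (snd p)) (max 0 (fst p))) \<longlonglongrightarrow> (case p of (t, w) \<Rightarrow> T t w)"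
      using conv by (auto simp: space_pair_measure)
  qed
  have Ta: "T t \<in> borel_measurable (F t)" if t: "0 \<le> t" for t
  proof (rule borel_measurable_LIMSEQ_real[of _ "\<lambda>n w. integral_path (threshold_drift G u0 d n) (\<lambda>t. x - S t w) t"])
    show "(\<lambda>w. integral_path (threshold_drift G u0 d n) (\<lambda>t. x - S t w) t) \<in> borel_measurable (F t)" for n
      by (rule ipa(2)) (auto simp: t)
    show "(\<lambda>n. integral_path (threshold_drift G u0 d n) (\<lambda>t. x - S t w) t) \<longlonglongrightarrow> T t w" if "w \<in> space (F t)" for w
      using conv[of w t] that space_F[OF t] t by simp
  qed
  have pers: "right_persistent (\<lambda>t. T t w)" "negative_persistent (\<lambda>t. T t w)" if w: "w \<in> space M" for w
  proof -
    show "right_persistent (\<lambda>t. T t w)"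
      by (rule step_right_persistent[OF S_step[OF w] Ti[OF w] Te[OF w]]) (auto intro: order_trans[OF less_imp_le[OF c_pos] b_ge])
    show "negative_persistent (\<lambda>t. T t w)"
      by (rule step_negative_persistent[OF S_step[OF w] Ti[OF w] Te[OF w]])
  qed
  have rm: "{w\<in>space M. ereal t < \<rho> w} \<in> sets (F t)" "\<rho> \<in> borel_measurable M" if "0 \<le> t" for t
    using ruin_measurable[of T, OF Ta pers] that by (auto simp: \<rho>_def[abs_def])
  have u_rates: "u \<in> rates M F u0"
    unfolding rates_def
  proof (intro CollectI conjI allI impI ballI)
    have [measurable]: "(\<lambda>p. T (fst p) (snd p)) \<in> borel_measurable (restrict_space borel {0..} \<Otimes>\<^sub>M M)"
    proof -
      have "(\<lambda>p. (fst p, snd p)) \<in> measurable (restrict_space borel {0..} \<Otimes>\<^sub>M M) ((borel :: real measure) \<Otimes>\<^sub>M M)"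
        by (intro measurable_Pair measurable_compose[OF measurable_fst measurable_restrict_space1] measurable_snd) simp
      from measurable_compose[OF this Tj] show ?thesis by simp
    qed
    have [measurable]: "(\<lambda>p. \<rho> (snd p)) \<in> borel_measurable (restrict_space borel {0..} \<Otimes>\<^sub>M M :: (real \<times> 'a) measure)"
      by (rule measurable_compose[OF measurable_snd]) (use rm(2) in auto)
    have [measurable]: "(\<lambda>p. ereal (fst p)) \<in> borel_measurable (restrict_space borel {0..} \<Otimes>\<^sub>M M :: (real \<times> 'a) measure)"
      by (intro measurable_compose[OF measurable_fst measurable_restrict_space1]) simp
    have "(\<lambda>p. if ereal (fst p) < \<rho> (snd p) then u0 * indicator {d..} (T (fst p) (snd p)) else 0)
        \<in> borel_measurable (restrict_space borel {0..} \<Otimes>\<^sub>M M)" by measurable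
    then show "(\<lambda>(t, w). u t w) \<in> borel_measurable (restrict_space borel {0..} \<Otimes>\<^sub>M M)" by (simp add: u_def split_def)
  next
    fix t :: real assume t: "0 \<le> t"
    have [measurable]: "T t \<in> borel_measurable (F t)" by (rule Ta[OF t])
    have "{w\<in>space (F t). ereal t < \<rho> w} \<in> sets (F t)" using rm(1)[OF t] space_F[OF t] by simp
    then have [measurable]: "Measurable.pred (F t) (\<lambda>w. ereal t < \<rho> w)" by (simp add: pred_def)
    show "u t \<in> borel_measurable (F t)" unfolding u_def by measurable
  next
    fix t :: real and w assume "0 \<le> t" "w \<in> space M"
    show "0 \<le> u t w" "u t w \<le> u0" using u0_pos by (auto simp: u_def indicator_def)
  qed
  have killed_path: "surplus_path g x (\<lambda>s. aggregate_claims N Y s w + dividends u s w) (killed (\<lambda>t. T t w))" if w: "w \<in> space M" for w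
  proof -
    define A where "A = (\<lambda>t. aggregate_claims N Y t w + (LBINT s:{0..t}. u0 * indicator {d..} (T s w)))"
    have ind_int: "set_integrable lborel {0..t} (\<lambda>s. u0 * indicator {d..} (T s w))" for t
      using measurable_joint_section[OF Tj w] u0_pos
      by (intro set_integrable_bounded[where B = u0]) (auto simp: set_borel_measurable_def indicator_def)
    have Gi: "set_integrable lborel {0..t} (\<lambda>s. G (T s w))" if "0 \<le> t" for t
      using set_integral_add(1)[OF Ti[OF w that] ind_int[of t]] by (simp add: b_def)
    have A_eq: "T t w = x + (LBINT s:{0..t}. G (T s w)) - A t" if t: "0 \<le> t" for t
    proof -
      have "(LBINT s:{0..t}. b w s) = (LBINT s:{0..t}. G (T s w)) - (LBINT s:{0..t}. u0 * indicator {d..} (T s w))"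
        unfolding b_def by (rule set_integral_diff(2)[OF Gi[OF t] ind_int])
      then show ?thesis using Te[OF w t] t by (simp add: A_def S_def)
    qed
    have sp: "surplus_path g x A (killed (\<lambda>t. T t w))"
      by (rule surplus_path_killed[OF L_pos G_lip G_eq Gi A_eq pers(1)[OF w]])
    have rk: "ruin_time (killed (\<lambda>t. T t w)) = \<rho> w"
      unfolding \<rho>_def by (rule ruin_time_killed[OF L_pos G_lip G_eq Gi A_eq pers(1)[OF w]])
    \<comment> \<open>Strictly before ruin the two rates agree; the time \<open>t\<close> may be the
      ruin time itself and is left out of the integral.\<close>
    have same: "aggregate_claims N Y t w + dividends u t w = A t" if t: "0 \<le> t" "ereal t \<le> \<rho> w" for t
    proof -
      have "(LBINT s:{0..t}. u s w) = (LBINT s:{0..t} - {t}. u s w)"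
        by (rule set_integral_discrete_difference[where X = "{t}"]) auto
      also have "\<dots> = (LBINT s:{0..t} - {t}. u0 * indicator {d..} (T s w))"
      proof (rule set_lebesgue_integral_cong)
        show "\<forall>s. s \<in> {0..t} - {t} \<longrightarrow> u s w = u0 * indicator {d..} (T s w)"
        proof (intro allI impI)
          fix s assume "s \<in> {0..t} - {t}"
          then have "ereal s < ereal t" by simp
          then have "ereal s < \<rho> w" using t(2) by (rule less_le_trans)
          then show "u s w = u0 * indicator {d..} (T s w)" by (simp add: u_def)
        qed
      qed simp
      also have "\<dots> = (LBINT s:{0..t}. u0 * indicator {d..} (T s w))"
        by (rule set_integral_discrete_difference[where X = "{t}"]) auto
      finally show ?thesis by (simp add: A_def dividends_def)
    qed
    show ?thesis using sp same unfolding surplus_path_def rk by metis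
  qed
  have "threshold_rate M g N Y u0 d x u"
    unfolding threshold_rate_def
  proof (intro allI impI ballI)
    fix t :: real and w assume t: "0 \<le> t" and w: "w \<in> space M"
    have s: "surplus g N Y x u t w = killed (\<lambda>t. T t w) t"
      using surplus_path_unique_free[OF u_rates w killed_path[OF w] t] surplus_eq[OF u_rates w t] by metis
    show "u t w = u0 * indicator {d..} (surplus g N Y x u t w)"
    proof (cases "ereal t < \<rho> w")
      case True
      then have "killed (\<lambda>t. T t w) t = T t w" by (simp add: killed_def \<rho>_def less_imp_le)
      then have "surplus g N Y x u t w = T t w" using s by simp
      moreover have "u t w = u0 * indicator {d..} (T t w)" using True by (simp add: u_def)
      ultimately show ?thesis by simp
    next
      case False
      then obtain r where r: "\<rho> w = ereal r" "r \<le> t" using ruin_time_nonneg[of "\<lambda>t. T t w"]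
        by (cases "\<rho> w") (auto simp: \<rho>_def)
      have "T r w < 0" using ruin_attained(2)[OF pers(1)[OF w]] r(1) by (simp add: \<rho>_def)
      moreover have "killed (\<lambda>t. T t w) t = T r w" using r by (auto simp: killed_def \<rho>_def)
      ultimately have "surplus g N Y x u t w < d" using s d by simp
      moreover have "u t w = 0" using False by (simp add: u_def)
      ultimately show ?thesis by simp
    qed
  qed
  then show ?thesis using u_rates by blast
qed

end

section \<open>Increments of the compound Poisson process\<close>

lemma exp_minus_bounds:
  fixes m :: real
  assumes "0 \<le> m"
  shows "0 \<le> exp (- m) - (1 - m)" "exp (- m) - (1 - m) \<le> m\<^sup>2"
proof -
  show "0 \<le> exp (- m) - (1 - m)" using exp_ge_add_one_self[of "- m"] by simp
  have "exp (- m) \<le> 1 / (1 + m)"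
    using exp_ge_add_one_self[of m] assms by (simp add: exp_minus inverse_eq_divide frac_le)
  also have "\<dots> \<le> 1 - m + m\<^sup>2"
  proof -
    have "1 \<le> (1 - m + m\<^sup>2) * (1 + m)" using assms by (simp add: algebra_simps power2_eq_square)
    then show ?thesis using assms by (simp add: divide_le_eq)
  qed
  finally show "exp (- m) - (1 - m) \<le> m\<^sup>2" by simp
qed

context dividend_model begin

definition claim_mean :: "(real \<Rightarrow> real) \<Rightarrow> real" where
  "claim_mean \<phi> = (\<integral>y. exponential_density \<alpha> y * \<phi> y \<partial>lborel)"

lemma Y_measurable: "1 \<le> i \<Longrightarrow> Y i \<in> borel_measurable M"
  using distributed_measurable[OF exponential_Y] by simp

lemma Y_mean:
  assumes "1 \<le> i" "\<phi> \<in> borel_measurable borel"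
  shows "(\<integral>w. \<phi> (Y i w) \<partial>M) = claim_mean \<phi>"
  unfolding claim_mean_def
  using distributed_integral[OF exponential_Y[OF assms(1)], of \<phi>] assms(2) alpha_pos
  by (simp add: exponential_density_nonneg)

lemma N_0 [simp]: "w \<in> space M \<Longrightarrow> N 0 w = 0"
  using poisson_N unfolding poisson_process_def by blast

text \<open>Measurability of the counts is contained in the independence of increments, taken at the
  times \<open>0, t, t, ...\<close>.\<close>

lemma N_measurable: "0 \<le> t \<Longrightarrow> N t \<in> measurable M (count_space UNIV)"
proof -
  assume t: "0 \<le> t"
  define r where "r = (\<lambda>i::nat. if i = 0 then 0 else t)"
  have "incseq r" "0 \<le> r 0" using t by (auto simp: r_def incseq_def)
  then have "indep_vars (\<lambda>_. count_space UNIV) (\<lambda>i w. N (r (Suc i)) w - N (r i) w) (UNIV :: nat set)"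
    using poisson_N unfolding poisson_process_def by blast
  then have "(\<lambda>w. N (r (Suc 0)) w - N (r 0) w) \<in> measurable M (count_space UNIV)"
    unfolding indep_vars_def by blast
  then show ?thesis by (subst measurable_cong[where g = "\<lambda>w. N (r (Suc 0)) w - N (r 0) w"]) (auto simp: r_def)
qed

lemma claims_pos_AE: "AE w in M. \<forall>i\<ge>1. 0 < Y i w"
proof -
  have "AE w in M. 1 \<le> i \<longrightarrow> 0 < Y i w" for i
  proof (cases "1 \<le> i")
    case True
    have "(AE w in M. 0 < Y i w) = (AE y in lborel. 0 < ennreal (exponential_density \<alpha> y) \<longrightarrow> 0 < y)"
      by (rule distributed_AE2[OF exponential_Y[OF True]]) simp
    moreover have "AE y in lborel. 0 < ennreal (exponential_density \<alpha> y) \<longrightarrow> 0 < y"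
      using AE_lborel_singleton[of "0::real"] by eventually_elim (auto simp: exponential_density_def)
    ultimately show ?thesis by simp
  qed simp
  then show ?thesis by (simp add: AE_all_countable)
qed

text \<open>With positive claims, growth of the counter can be read off the aggregate claims. The
  filtration is tied to the aggregate claims, so this is the bridge between the increments of
  \<open>S\<close> and those of \<open>N\<close>.\<close>

lemma S_mono_pos:
  assumes w: "w \<in> space M" and pos: "\<forall>i\<ge>1. 0 < Y i w" and st: "0 \<le> s" "s \<le> t"
  shows "S s w \<le> S t w" "S s w < S t w \<longleftrightarrow> N s w < N t w"
proof -
  have le: "N s w \<le> N t w" by (rule N_mono[OF w st])
  have "{1..N t w} = {1..N s w} \<union> {Suc (N s w)..N t w}" using le by auto
  then have "(\<Sum>i=1..N t w. Y i w) = (\<Sum>i=1..N s w. Y i w) + (\<Sum>i=Suc (N s w)..N t w. Y i w)"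
    by (simp add: sum.union_disjoint)
  then have eq: "S t w = S s w + (\<Sum>i=Suc (N s w)..N t w. Y i w)" using st by (simp add: S_def aggregate_claims_def)
  have nn: "0 \<le> (\<Sum>i=Suc (N s w)..N t w. Y i w)" by (rule sum_nonneg) (use pos in \<open>force intro: less_imp_le\<close>)
  then show "S s w \<le> S t w" using eq by simp
  show "S s w < S t w \<longleftrightarrow> N s w < N t w"
  proof
    assume "N s w < N t w"
    then have "0 < (\<Sum>i=Suc (N s w)..N t w. Y i w)" by (intro sum_pos) (use pos in auto)
    then show "S s w < S t w" using eq by simp
  next
    assume "S s w < S t w"
    then show "N s w < N t w" using eq le by (cases "N s w = N t w") auto
  qed
qed

lemma S_mono_AE: "AE w in M. \<forall>s t. 0 \<le> s \<longrightarrow> s \<le> t \<longrightarrow> S s w \<le> S t w"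
  using claims_pos_AE AE_space by eventually_elim (use S_mono_pos(1) in blast)

lemma claim_mean_bound:
  assumes "\<phi> \<in> borel_measurable borel" "\<And>y. \<bar>\<phi> y\<bar> \<le> B"
  shows "\<bar>claim_mean \<phi>\<bar> \<le> B"
proof -
  have "\<bar>\<integral>w. \<phi> (Y 1 w) \<partial>M\<bar> \<le> B"
  proof -
    have i: "integrable M (\<lambda>w. \<phi> (Y 1 w))"
      using measurable_compose[OF Y_measurable[of 1] assms(1)] assms(2) by (intro integrable_const_bound[of _ B]) auto
    have b: "- B \<le> \<phi> y" "\<phi> y \<le> B" for y using assms(2)[of y] by (auto simp: abs_le_iff)
    have "(\<integral>w. \<phi> (Y 1 w) \<partial>M) \<le> B" by (rule integral_le_const[OF i]) (simp add: b)
    moreover have "- B \<le> (\<integral>w. \<phi> (Y 1 w) \<partial>M)" by (rule integral_ge_const[OF i]) (simp add: b)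
    ultimately show ?thesis by simp
  qed
  then show ?thesis using Y_mean[of 1 \<phi>] assms(1) by simp
qed

context
  fixes s t :: real
  assumes st: "0 \<le> s" "s \<le> t"
begin

lemma increment_measurable: "(\<lambda>w. S t w - S s w) \<in> borel_measurable M"
proof -
  have "S r \<in> borel_measurable M" if "0 \<le> r" for r using S_adapted[OF that] measurable_F_M that by blast
  then show ?thesis using st by simp
qed

lemma increment_prob:
  assumes "s < t"
  shows "prob {w\<in>space M. N t w - N s w = k} = (lam * (t - s)) ^ k / fact k * exp (- (lam * (t - s)))"
proof -
  have m: "(\<lambda>w. N t w - N s w) \<in> measurable M (count_space UNIV)"
    using N_measurable[of s] N_measurable[of t] st by (intro measurable_compose_countable'[where f = "\<lambda>i w. i - N s w" and g = "N t"]) auto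
  have "distr M (count_space UNIV) (\<lambda>w. N t w - N s w) = measure_pmf (poisson_pmf (lam * (t - s)))"
    using poisson_N st assms unfolding poisson_process_def by blast
  then have "measure (distr M (count_space UNIV) (\<lambda>w. N t w - N s w)) {k} = pmf (poisson_pmf (lam * (t - s))) k"
    by (simp add: pmf.rep_eq)
  moreover have "measure (distr M (count_space UNIV) (\<lambda>w. N t w - N s w)) {k} = prob ((\<lambda>w. N t w - N s w) -` {k} \<inter> space M)"
    by (rule measure_distr[OF m]) simp
  moreover have "(\<lambda>w. N t w - N s w) -` {k} \<inter> space M = {w\<in>space M. N t w - N s w = k}" by auto
  ultimately show ?thesis using lam_pos assms by (simp add: pmf_poisson)
qed

lemma increment_event: "{w\<in>space M. P (N t w - N s w)} \<in> sets M"
proof -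
  have "(\<lambda>w. N t w - N s w) \<in> measurable M (count_space UNIV)"
    using N_measurable[of s] N_measurable[of t] st by (intro measurable_compose_countable'[where f = "\<lambda>i w. i - N s w" and g = "N t"]) auto
  then have "(\<lambda>w. N t w - N s w) -` {k. P k} \<inter> space M \<in> sets M" by (rule measurable_sets) simp
  moreover have "(\<lambda>w. N t w - N s w) -` {k. P k} \<inter> space M = {w\<in>space M. P (N t w - N s w)}" by auto
  ultimately show ?thesis by simp
qed

lemma increment_tail_prob:
  "prob {w\<in>space M. 1 \<le> N t w - N s w} \<le> lam * (t - s)"
  "prob {w\<in>space M. 2 \<le> N t w - N s w} \<le> (lam * (t - s))\<^sup>2"
proof -
  define m where "m = lam * (t - s)"
  have m: "0 \<le> m" using lam_pos st by (simp add: m_def)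
  have "prob {w\<in>space M. 1 \<le> N t w - N s w} \<le> m \<and> prob {w\<in>space M. 2 \<le> N t w - N s w} \<le> m\<^sup>2"
  proof (cases "s = t")
    case False
    then have "s < t" using st by simp
    note p = increment_prob[OF this, folded m_def]
    have 1: "{w\<in>space M. 1 \<le> N t w - N s w} = space M - {w\<in>space M. N t w - N s w = 0}" by auto
    have p1: "prob {w\<in>space M. 1 \<le> N t w - N s w} = 1 - exp (- m)"
      unfolding 1 using prob_compl[OF increment_event[of "\<lambda>k. k = 0"]] p[of 0] by simp
    have 2: "{w\<in>space M. 1 \<le> N t w - N s w} = {w\<in>space M. N t w - N s w = 1} \<union> {w\<in>space M. 2 \<le> N t w - N s w}" by auto
    have "prob {w\<in>space M. 1 \<le> N t w - N s w} = m * exp (- m) + prob {w\<in>space M. 2 \<le> N t w - N s w}"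
      unfolding 2 using increment_event[of "\<lambda>k. k = 1"] increment_event[of "\<lambda>k. 2 \<le> k"] p[of 1]
      by (subst finite_measure_Union) auto
    then have p2: "prob {w\<in>space M. 2 \<le> N t w - N s w} = 1 - (1 + m) * exp (- m)" using p1 by (simp add: algebra_simps)
    \<comment> \<open>The bound \<open>exp (- m) \<ge> 1 - m\<close> gives
      \<open>1 - (1 + m) * exp (- m) \<le> m^2\<close>.\<close>
    have "(1 + m) * (1 - m) \<le> (1 + m) * exp (- m)" using exp_minus_bounds(1)[OF m] m by (intro mult_left_mono) auto
    then show ?thesis using exp_minus_bounds(1)[OF m] p1 p2 by (simp add: algebra_simps power2_eq_square)
  qed (use m in auto)
  then show "prob {w\<in>space M. 1 \<le> N t w - N s w} \<le> lam * (t - s)"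
    "prob {w\<in>space M. 2 \<le> N t w - N s w} \<le> (lam * (t - s))\<^sup>2" by (auto simp: m_def)
qed

lemma increment_mean_abs_le:
  assumes [measurable]: "\<phi> \<in> borel_measurable borel" and bd: "\<And>y. \<bar>\<phi> y\<bar> \<le> B" and "\<phi> 0 = 0"
  shows "\<bar>\<integral>w. \<phi> (S t w - S s w) \<partial>M\<bar> \<le> B * (lam * (t - s))" "integrable M (\<lambda>w. \<phi> (S t w - S s w))"
proof -
  have B: "0 \<le> B" using bd[of 0] by linarith
  define A where "A = {w\<in>space M. 1 \<le> N t w - N s w}"
  have [measurable]: "A \<in> sets M" unfolding A_def by (rule increment_event)
  show i: "integrable M (\<lambda>w. \<phi> (S t w - S s w))"
    using measurable_compose[OF increment_measurable, of \<phi>] bd by (intro integrable_const_bound[of _ B]) auto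
  have iA: "integrable M (\<lambda>w. B * indicator A w)"
    by (rule integrable_const_bound[of _ B]) (use B in \<open>auto simp: indicator_def\<close>)
  have "\<bar>\<integral>w. \<phi> (S t w - S s w) \<partial>M\<bar> \<le> (\<integral>w. \<bar>\<phi> (S t w - S s w)\<bar> \<partial>M)" by (rule integral_abs_bound)
  also have "\<dots> \<le> (\<integral>w. B * indicator A w \<partial>M)"
  proof (rule integral_mono)
    fix w assume w: "w \<in> space M"
    have "S t w = S s w" if "w \<notin> A" using that w N_mono[OF w st] S_const[OF st, of w] by (auto simp: A_def)
    then show "\<bar>\<phi> (S t w - S s w)\<bar> \<le> B * indicator A w" using bd B assms(3) by (auto simp: indicator_def)
  qed (use i iA in auto)
  also have "\<dots> = B * prob A" by (simp add: Int_absorb2)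
  also have "\<dots> \<le> B * (lam * (t - s))" using increment_tail_prob(1) B by (intro mult_left_mono) (auto simp: A_def)
  finally show "\<bar>\<integral>w. \<phi> (S t w - S s w) \<partial>M\<bar> \<le> B * (lam * (t - s))" .
qed

text \<open>Replaces conditioning on the past: \<open>W\<close> is known at time \<open>s\<close>,
  the increment is independent of the events of \<open>F s\<close>, and Fubini for the product law
  allows \<open>W\<close> to be frozen. The bound \<open>K\<close> must hold for every frozen
  value.\<close>

lemma expectation_independent_le:
  fixes W :: "'a \<Rightarrow> real" and \<Phi> :: "real \<Rightarrow> real \<Rightarrow> real"
  assumes W: "W \<in> borel_measurable (F s)"
    and \<Phi>: "case_prod \<Phi> \<in> borel_measurable (borel \<Otimes>\<^sub>M borel)" and bd: "\<And>x y. \<bar>\<Phi> x y\<bar> \<le> B"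
    and le: "\<And>x. (\<integral>w. \<Phi> x (S t w - S s w) \<partial>M) \<le> K"
  shows "(\<integral>w. \<Phi> (W w) (S t w - S s w) \<partial>M) \<le> K" "integrable M (\<lambda>w. \<Phi> (W w) (S t w - S s w))"
proof -
  define D where "D = (\<lambda>w. S t w - S s w)"
  have Dm [measurable]: "D \<in> borel_measurable M" unfolding D_def by (rule increment_measurable)
  have Wm [measurable]: "W \<in> borel_measurable M" using W st measurable_F_M by blast
  have D: "D = (\<lambda>w. aggregate_claims N Y t w - aggregate_claims N Y s w)" using st by (simp add: D_def S_def fun_eq_iff)
  have "indep_set {W -` A \<inter> space M | A. A \<in> sets borel} {D -` A \<inter> space M | A. A \<in> sets borel}"
  proof (rule indep_setI)
    have ind: "indep_set (sets (F s)) {D -` B \<inter> space M | B. B \<in> sets borel}"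
      unfolding D using indep_increments_claims st by simp
    fix a b assume "a \<in> {W -` A \<inter> space M | A. A \<in> sets borel}" and b: "b \<in> {D -` A \<inter> space M | A. A \<in> sets borel}"
    then have "a \<in> sets (F s)" using measurable_sets[OF W] space_F[of s] st by auto
    then show "prob (a \<inter> b) = prob a * prob b" using indep_setD[OF ind _ b] by blast
  qed (auto intro!: measurable_sets[OF Wm] measurable_sets[OF Dm])
  then have "indep_set (sigma_sets (space M) {W -` A \<inter> space M | A. A \<in> sets borel}) (sigma_sets (space M) {D -` A \<inter> space M | A. A \<in> sets borel})"
  proof (rule indep_set_sigma_sets)
    have "Int_stable {f -` A \<inter> space M | A. A \<in> sets borel}" for f :: "'a \<Rightarrow> real"
    proof (rule Int_stableI)
      fix a b assume "a \<in> {f -` A \<inter> space M | A. A \<in> sets borel}" "b \<in> {f -` A \<inter> space M | A. A \<in> sets borel}"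
      then obtain A B where AB: "a = f -` A \<inter> space M" "b = f -` B \<inter> space M" "A \<in> sets borel" "B \<in> sets borel" by blast
      then have "a \<inter> b = f -` (A \<inter> B) \<inter> space M" "A \<inter> B \<in> sets borel" by auto
      then show "a \<inter> b \<in> {f -` A \<inter> space M | A. A \<in> sets borel}" by blast
    qed
    then show "Int_stable {W -` A \<inter> space M | A. A \<in> sets borel}" "Int_stable {D -` A \<inter> space M | A. A \<in> sets borel}" by auto
  qed
  then have "indep_var borel W borel D" unfolding indep_var_eq using Wm Dm by blast
  then have joint: "distr M (borel \<Otimes>\<^sub>M borel) (\<lambda>w. (W w, D w)) = distr M borel W \<Otimes>\<^sub>M distr M borel D"
    unfolding indep_var_distribution_eq by simp
  interpret P1: prob_space "distr M borel W" by (rule prob_space_distr) fact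
  interpret P2: prob_space "distr M borel D" by (rule prob_space_distr) fact
  interpret P: pair_prob_space "distr M borel W" "distr M borel D" ..
  have sm: "(\<lambda>y. \<Phi> x y) \<in> borel_measurable borel" for x
    using measurable_compose[OF measurable_Pair1' \<Phi>, of x] by simp
  have fi: "integrable (distr M borel W \<Otimes>\<^sub>M distr M borel D) (case_prod \<Phi>)"
  proof (rule P.integrable_const_bound[of _ B])
    show "case_prod \<Phi> \<in> borel_measurable (distr M borel W \<Otimes>\<^sub>M distr M borel D)"
      using \<Phi> measurable_cong_sets[OF sets_pair_measure_cong[OF sets_distr sets_distr] refl] by blast
  qed (use bd in auto)
  have "(\<integral>w. case_prod \<Phi> (W w, D w) \<partial>M) = integral\<^sup>L (distr M borel W \<Otimes>\<^sub>M distr M borel D) (case_prod \<Phi>)"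
    unfolding joint[symmetric] by (rule integral_distr[symmetric]) (use \<Phi> in measurable)
  also have "\<dots> = (\<integral>x. (\<integral>y. \<Phi> x y \<partial>distr M borel D) \<partial>distr M borel W)" using P.integral_fst'[OF fi] by simp
  also have "\<dots> \<le> K"
  proof (rule P1.integral_le_const)
    show "integrable (distr M borel W) (\<lambda>x. \<integral>y. \<Phi> x y \<partial>distr M borel D)" using P.integrable_fst'[OF fi] by simp
    show "AE x in distr M borel W. (\<integral>y. \<Phi> x y \<partial>distr M borel D) \<le> K"
    proof (rule AE_I2)
      fix x
      have "(\<integral>y. \<Phi> x y \<partial>distr M borel D) = (\<integral>w. \<Phi> x (D w) \<partial>M)" by (rule integral_distr[OF Dm sm])
      then show "(\<integral>y. \<Phi> x y \<partial>distr M borel D) \<le> K" using le[of x] by (simp add: D_def)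
    qed
  qed
  finally show "(\<integral>w. \<Phi> (W w) (S t w - S s w) \<partial>M) \<le> K" by (simp add: D_def)
  have "(\<lambda>w. case_prod \<Phi> (W w, D w)) \<in> borel_measurable M" by (rule measurable_compose[OF _ \<Phi>]) measurable
  then show "integrable M (\<lambda>w. \<Phi> (W w) (S t w - S s w))"
    using bd by (intro integrable_const_bound[of _ B]) (auto simp: D_def)
qed

end

end

section \<open>Increments of the aggregate claims on a grid\<close>

context dividend_model begin

lemma integral_diff_le:
  fixes f h :: "'a \<Rightarrow> real"
  assumes f: "integrable M f" and h: "integrable M h" and A: "A \<in> sets M"
    and ae: "AE w in M. \<bar>f w - h w\<bar> \<le> C * indicator A w"
  shows "\<bar>(\<integral>w. f w \<partial>M) - (\<integral>w. h w \<partial>M)\<bar> \<le> C * prob A"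
proof -
  have iA: "integrable M (\<lambda>w. C * indicator A w)"
    by (rule integrable_const_bound[of _ "\<bar>C\<bar>"]) (use A in \<open>auto simp: indicator_def\<close>)
  have "\<bar>(\<integral>w. f w \<partial>M) - (\<integral>w. h w \<partial>M)\<bar> = \<bar>\<integral>w. f w - h w \<partial>M\<bar>" using f h by simp
  also have "\<dots> \<le> (\<integral>w. \<bar>f w - h w\<bar> \<partial>M)" by (rule integral_abs_bound)
  also have "\<dots> \<le> (\<integral>w. C * indicator A w \<partial>M)" using f h iA ae by (intro integral_mono_AE) auto
  also have "\<dots> = C * prob A" using A by (simp add: Int_absorb2 sets.sets_into_space)
  finally show ?thesis .
qed

text \<open>Each increment is independent of the events up to its left end. Joint independence
  follows by splitting off the last cell, the intersection of the earlier events being known at that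
  time.\<close>

lemma indep_grid:
  assumes p: "\<And>j. j < n \<Longrightarrow> p j \<le> p (Suc j)" and p0: "0 \<le> p 0"
  shows "indep_vars (\<lambda>_. borel) (\<lambda>j w. S (p (Suc j)) w - S (p j) w) {..<n}"
proof (cases "n = 0")
  case True
  then show ?thesis by (auto simp: indep_vars_def2 indep_sets_def)
next
  case False
  define X where "X = (\<lambda>j w. S (p (Suc j)) w - S (p j) w)"
  have pn: "0 \<le> p j" if "j \<le> n" for j
    using that
  proof (induction j)
    case 0
    then show ?case using p0 by simp
  next
    case (Suc j)
    then show ?case using p[of j] by simp
  qed
  have Xm: "X j \<in> borel_measurable M" if "j < n" for j
    unfolding X_def using increment_measurable[OF pn p] that by auto
  define E where "E = (\<lambda>j. {X j -` A \<inter> space M | A. A \<in> sets (borel :: real measure)})"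
  have "indep_sets E {..<n}"
  proof (subst indep_sets_finite)
    show "{..<n} \<noteq> {}" using False by auto
    show "E i \<subseteq> events" if "i \<in> {..<n}" for i
      using Xm[of i] that unfolding E_def by (auto intro: measurable_sets)
    show "space M \<in> E i" for i unfolding E_def by (intro CollectI exI[of _ UNIV]) auto
    show "\<forall>A\<in>Pi {..<n} E. prob (\<Inter>j\<in>{..<n}. A j) = (\<Prod>j\<in>{..<n}. prob (A j))"
    proof
      fix A assume A: "A \<in> Pi {..<n} E"
      have AF: "A j \<in> sets (F (p (Suc j)))" if j: "j < n" for j
      proof -
        have "A j \<in> E j" using A j by (auto simp: Pi_iff)
        then obtain B where B: "A j = X j -` B \<inter> space M" "B \<in> sets borel" unfolding E_def by blast
        have "S (p j) \<in> borel_measurable (F (p (Suc j)))"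
          using measurable_F_mono[OF S_adapted[OF pn[of j]] pn[of j] p[OF j]] j by simp
        then have "X j \<in> borel_measurable (F (p (Suc j)))" unfolding X_def using S_adapted[OF pn[of "Suc j"]] j by simp
        then show ?thesis using B space_F[OF pn[of "Suc j"]] j by (auto dest: measurable_sets)
      qed
      \<comment> \<open>Intersecting with \<open>space M\<close> gives the empty intersection its
        proper meaning at \<open>k = 0\<close>.\<close>
      have "(space M \<inter> (\<Inter>j\<in>{..<k}. A j)) \<in> sets (F (p k)) \<and> prob (space M \<inter> (\<Inter>j\<in>{..<k}. A j)) = (\<Prod>j\<in>{..<k}. prob (A j))"
        if "k \<le> n" for k
        using that
      proof (induction k)
        case 0
        then show ?case using sets.top[of "F (p 0)"] space_F[OF p0] by (simp add: prob_space)
      next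
        case (Suc k)
        define Q where "Q = space M \<inter> (\<Inter>j\<in>{..<k}. A j)"
        have k: "k < n" using Suc by simp
        have Q: "Q \<in> sets (F (p k))" "prob Q = (\<Prod>j\<in>{..<k}. prob (A j))" using Suc by (auto simp: Q_def)
        have eq: "space M \<inter> (\<Inter>j\<in>{..<Suc k}. A j) = Q \<inter> A k" by (auto simp: Q_def lessThan_Suc)
        have "Q \<in> sets (F (p (Suc k)))" using Q(1) mono_F[OF pn[of k] p[OF k]] k by auto
        then have 1: "Q \<inter> A k \<in> sets (F (p (Suc k)))" using AF[OF k] by blast
        have "A k \<in> E k" using A k by (auto simp: Pi_iff)
        then obtain B where B: "A k = X k -` B \<inter> space M" "B \<in> sets borel" unfolding E_def by blast
        have ind: "indep_set (sets (F (p k))) {(\<lambda>w. aggregate_claims N Y (p (Suc k)) w - aggregate_claims N Y (p k) w) -` B \<inter> space M | B. B \<in> sets borel}"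
          using indep_increments_claims[OF pn[of k] p[OF k]] k by simp
        have "A k \<in> {(\<lambda>w. aggregate_claims N Y (p (Suc k)) w - aggregate_claims N Y (p k) w) -` B \<inter> space M | B. B \<in> sets borel}"
          using B pn[of k] pn[of "Suc k"] k by (auto simp: X_def S_def)
        then have "prob (Q \<inter> A k) = prob Q * prob (A k)" using indep_setD[OF ind Q(1)] by blast
        then show ?case unfolding eq using 1 Q(2) by (simp add: lessThan_Suc mult.commute)
      qed
      from this[OF order_refl] have "prob (space M \<inter> (\<Inter>j\<in>{..<n}. A j)) = (\<Prod>j\<in>{..<n}. prob (A j))" by blast
      moreover have "space M \<inter> (\<Inter>j\<in>{..<n}. A j) = (\<Inter>j\<in>{..<n}. A j)"
      proof -
        have "A 0 \<in> E 0" using A False by (auto simp: Pi_iff)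
        then obtain B where "A 0 = X 0 -` B \<inter> space M" unfolding E_def by blast
        then show ?thesis using False by auto
      qed
      ultimately show "prob (\<Inter>j\<in>{..<n}. A j) = (\<Prod>j\<in>{..<n}. prob (A j))" by simp
    qed
  qed simp
  then show ?thesis unfolding indep_vars_def2 X_def[symmetric] E_def using Xm by auto
qed

text \<open>\<open>cn\<close> counts the cells with a positive increment other than cell
  \<open>k\<close>; leaving out \<open>k\<close> is what makes it independent of
  \<open>X k\<close>.\<close>

lemma grid_product_mean:
  fixes \<phi> :: "real \<Rightarrow> real" and m :: real
  assumes p: "\<And>j. j < n \<Longrightarrow> p j \<le> p (Suc j)" and p0: "0 \<le> p 0"
    and \<phi>: "\<phi> \<in> borel_measurable borel" and bd: "\<And>y. \<bar>\<phi> y\<bar> \<le> B" and k: "k < n"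
  defines "X \<equiv> (\<lambda>j w. S (p (Suc j)) w - S (p j) w)"
  defines "cn \<equiv> (\<lambda>w. (\<Sum>j\<in>{..<n} - {k}. if 0 < X j w then 1 else 0))"
  shows "(\<integral>w. \<phi> (X k w) * (if cn w = m then 1 else 0) \<partial>M) = (\<integral>w. \<phi> (X k w) \<partial>M) * prob {w\<in>space M. cn w = m}"
    and "{w\<in>space M. cn w = m} \<in> sets M"
proof -
  define C where "C = (\<lambda>v :: nat \<Rightarrow> real. (\<Sum>j\<in>{..<n} - {k}. if 0 < v j then 1 else 0 :: real))"
  have Xm: "X j \<in> borel_measurable M" if "j < n" for j
    using indep_grid[OF p p0] that unfolding indep_vars_def2 X_def by auto
  have "(\<lambda>v :: nat \<Rightarrow> real. if 0 < v j then 1 else 0 :: real) \<in> borel_measurable (\<Pi>\<^sub>M j\<in>{..<n} - {k}. borel)" if "j \<in> {..<n} - {k}" for j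
  proof -
    have 1: "(\<lambda>v. v j :: real) \<in> borel_measurable (\<Pi>\<^sub>M j\<in>{..<n} - {k}. borel)"
      using that by (rule measurable_component_singleton)
    have "(\<lambda>y::real. if 0 < y then 1 else 0 :: real) \<in> borel_measurable borel" by measurable
    from measurable_compose[OF 1 this] show ?thesis .
  qed
  then have [measurable]: "C \<in> borel_measurable (\<Pi>\<^sub>M j\<in>{..<n} - {k}. borel)" unfolding C_def by (rule borel_measurable_sum)
  have f2: "(\<lambda>v. if C v = m then 1 else 0 :: real) \<in> borel_measurable (\<Pi>\<^sub>M j\<in>{..<n} - {k}. borel)" by measurable
  have f1: "(\<lambda>v. \<phi> (v k)) \<in> borel_measurable (\<Pi>\<^sub>M j\<in>{k}. borel)"
    by (rule measurable_compose[where f = "\<lambda>v. v k", OF _ \<phi>]) (rule measurable_component_singleton, simp)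
  have iv: "indep_var (\<Pi>\<^sub>M j\<in>{k}. borel) (\<lambda>w. restrict (\<lambda>j. X j w) {k}) (\<Pi>\<^sub>M j\<in>{..<n} - {k}. borel) (\<lambda>w. restrict (\<lambda>j. X j w) ({..<n} - {k}))"
    unfolding X_def using k by (intro indep_var_restrict[OF indep_grid[OF p p0]]) auto
  have eqC: "C (restrict (\<lambda>j. X j w) ({..<n} - {k})) = cn w" for w
    unfolding C_def cn_def by (rule sum.cong) auto
  have eqk: "restrict (\<lambda>j. X j w) {k} k = X k w" for w by simp
  from indep_var_compose[OF iv f1 f2]
  have ind: "indep_var borel (\<lambda>w. \<phi> (X k w)) borel (\<lambda>w. if cn w = m then 1 else 0)"
    by (simp only: comp_def eqC eqk)
  have cm [measurable]: "cn \<in> borel_measurable M"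
    unfolding cn_def by (intro borel_measurable_sum measurable_If) (use Xm in auto)
  show ev: "{w\<in>space M. cn w = m} \<in> sets M" by measurable
  have "(\<integral>w. \<phi> (X k w) * (if cn w = m then 1 else 0) \<partial>M) = (\<integral>w. \<phi> (X k w) \<partial>M) * (\<integral>w. (if cn w = m then 1 else 0) \<partial>M)"
  proof (rule indep_var_lebesgue_integral[OF ind])
    show "integrable M (\<lambda>w. \<phi> (X k w))"
      using measurable_compose[OF Xm[OF k] \<phi>] bd by (intro integrable_const_bound[of _ B]) auto
    show "integrable M (\<lambda>w. if cn w = m then 1 else 0 :: real)"
      by (rule integrable_const_bound[of _ 1]) auto
  qed
  also have "(\<integral>w. (if cn w = m then 1 else 0) \<partial>M) = (\<integral>w. indicator {w\<in>space M. cn w = m} w \<partial>M)"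
    by (rule Bochner_Integration.integral_cong[OF refl]) (auto simp: indicator_def)
  also have "\<dots> = prob {w\<in>space M. cn w = m}" using ev by (simp add: Int_absorb2)
  finally show "(\<integral>w. \<phi> (X k w) * (if cn w = m then 1 else 0) \<partial>M) = (\<integral>w. \<phi> (X k w) \<partial>M) * prob {w\<in>space M. cn w = m}" .
qed

lemma sum_consecutive_blocks:
  fixes f :: "nat \<Rightarrow> real" and q :: "nat \<Rightarrow> nat"
  assumes "a \<le> b" "\<And>j. a \<le> j \<Longrightarrow> j < b \<Longrightarrow> q j \<le> q (Suc j)"
  shows "(\<Sum>k=a..<b. \<Sum>i=Suc (q k)..q (Suc k). f i) = (\<Sum>i=Suc (q a)..q b. f i) \<and> q a \<le> q b"
  using assms
proof (induction b rule: dec_induct)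
  case base
  then show ?case by simp
next
  case (step n)
  then have IH: "(\<Sum>k=a..<n. \<Sum>i=Suc (q k)..q (Suc k). f i) = (\<Sum>i=Suc (q a)..q n. f i)" "q a \<le> q n" by auto
  have le: "q n \<le> q (Suc n)" using step by auto
  have "{Suc (q a)..q (Suc n)} = {Suc (q a)..q n} \<union> {Suc (q n)..q (Suc n)}" using IH(2) le by auto
  then have "(\<Sum>i=Suc (q a)..q (Suc n). f i) = (\<Sum>i=Suc (q a)..q n. f i) + (\<Sum>i=Suc (q n)..q (Suc n). f i)"
    by (simp add: sum.union_disjoint)
  then show ?case using IH le step(1) by simp
qed

text \<open>Only the counts \<open>N H\<close> at integer times \<open>H\<close> are known to be independent of the claims, because of the
  coercions in the model assumption. The law of the increments of \<open>S\<close> is recovered from the independence of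
  these increments: on a fine grid, at most one claim occurs per cell, and the number of cells with a claim is \<open>N H\<close>.\<close>

lemma grid_estimate:
  fixes p :: "nat \<Rightarrow> real" and H J a b m :: nat
  assumes p: "\<And>j. j < J \<Longrightarrow> p j \<le> p (Suc j)" and p0: "p 0 = 0" and pJ: "p J = real H"
    and mesh: "\<And>j. j < J \<Longrightarrow> p (Suc j) - p j \<le> \<eta>" and eta: "0 \<le> \<eta>" and ab: "a \<le> b" "b \<le> J"
    and \<phi>: "\<phi> \<in> borel_measurable borel" and bd: "\<And>y. \<bar>\<phi> y\<bar> \<le> B" and \<phi>0: "\<phi> 0 = 0"
  shows "\<bar>(\<integral>w. (\<Sum>i=Suc (N (p a) w)..N (p b) w. \<phi> (Y i w)) * (if N H w = Suc m then 1 else 0) \<partial>M)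
      - (\<Sum>k=a..<b. \<integral>w. \<phi> (S (p (Suc k)) w - S (p k) w) \<partial>M) * prob {w\<in>space M. N H w = m}\<bar>
    \<le> (2 * B * Suc m * (lam\<^sup>2 * H) + B * (lam * H) * (lam\<^sup>2 * H + lam)) * \<eta>" (is "?lhs \<le> _")
proof -
  have B: "0 \<le> B" using bd[of 0] by linarith
  have p0': "0 \<le> p 0" by (simp add: p0)
  have pm: "p i \<le> p j" if "i \<le> j" "j \<le> J" for i j
    using that
  proof (induction j rule: dec_induct)
    case (step k)
    then show ?case using p[of k] by simp
  qed simp
  have pn: "0 \<le> p j" if "j \<le> J" for j using pm[of 0 j] that p0 by simp
  define X where "X = (\<lambda>j w. S (p (Suc j)) w - S (p j) w)"
  define \<Delta> where "\<Delta> = (\<lambda>j w. N (p (Suc j)) w - N (p j) w)"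
  define \<xi> where "\<xi> = (\<lambda>j w. if 0 < X j w then 1 else 0 :: real)"
  define ck where "ck = (\<lambda>k w. \<Sum>j\<in>{..<J} - {k}. \<xi> j w)"
  define cnt where "cnt = (\<lambda>w. \<Sum>j<J. \<xi> j w)"
  define \<Phi> where "\<Phi> = (\<lambda>w. \<Sum>i=Suc (N (p a) w)..N (p b) w. \<phi> (Y i w))"
  \<comment> \<open>Outside \<open>bad\<close> no cell contains two claims: the increment over a
    cell is then \<open>0\<close> or one single claim, and \<open>N H\<close> is the number of cells
    with a claim. The probability of \<open>bad\<close> is of the order of the mesh.\<close>
  define bad where "bad = (\<Union>j<J. {w\<in>space M. 2 \<le> \<Delta> j w})"
  have bad_ev [measurable]: "bad \<in> sets M"
    unfolding bad_def \<Delta>_def using increment_event[OF pn p] by (intro sets.finite_UN) auto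
  have len: "(\<Sum>j<k. p (Suc j) - p j) = p k" for k by (simp add: sum_lessThan_telescope p0)
  have badP: "prob bad \<le> lam\<^sup>2 * H * \<eta>"
  proof -
    have "prob bad \<le> (\<Sum>j<J. prob {w\<in>space M. 2 \<le> \<Delta> j w})"
      unfolding bad_def \<Delta>_def using increment_event[OF pn p] by (intro finite_measure_subadditive_finite) auto
    also have "\<dots> \<le> (\<Sum>j<J. lam\<^sup>2 * \<eta> * (p (Suc j) - p j))"
    proof (rule sum_mono)
      fix j assume "j \<in> {..<J}"
      then have j: "j < J" by simp
      have "prob {w\<in>space M. 2 \<le> \<Delta> j w} \<le> (lam * (p (Suc j) - p j))\<^sup>2"
        unfolding \<Delta>_def using increment_tail_prob(2)[OF pn p] j by simp
      also have "\<dots> = lam\<^sup>2 * ((p (Suc j) - p j) * (p (Suc j) - p j))" by (simp add: power2_eq_square algebra_simps)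
      also have "\<dots> \<le> lam\<^sup>2 * (\<eta> * (p (Suc j) - p j))" using mesh[OF j] p[OF j] by (intro mult_left_mono mult_right_mono) auto
      finally show "prob {w\<in>space M. 2 \<le> \<Delta> j w} \<le> lam\<^sup>2 * \<eta> * (p (Suc j) - p j)" by (simp add: algebra_simps)
    qed
    also have "\<dots> = lam\<^sup>2 * \<eta> * p J" by (simp only: sum_distrib_left[symmetric] len)
    finally show ?thesis by (simp add: pJ algebra_simps)
  qed
  have Xm: "X j \<in> borel_measurable M" if "j < J" for j
    unfolding X_def using increment_measurable[OF pn p] that by auto
  have Xi: "integrable M (\<lambda>w. \<phi> (X k w))" "\<bar>\<integral>w. \<phi> (X k w) \<partial>M\<bar> \<le> B * (lam * (p (Suc k) - p k))" if "k < J" for k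
    unfolding X_def using increment_mean_abs_le[OF pn p \<phi> bd \<phi>0] that by auto
  have \<xi>m: "\<xi> j \<in> borel_measurable M" if "j < J" for j unfolding \<xi>_def using Xm[OF that] by measurable
  have cm [measurable]: "cnt \<in> borel_measurable M" unfolding cnt_def using \<xi>m by (intro borel_measurable_sum) auto
  have Nm [measurable]: "N H \<in> measurable M (count_space UNIV)" by (rule N_measurable) simp
  have path: "(\<forall>j<J. \<xi> j w = (if 1 \<le> \<Delta> j w then 1 else 0)) \<and> (\<forall>j<J. \<xi> j w = 0 \<longrightarrow> X j w = 0) \<and>
      cnt w \<le> N H w \<and> (w \<notin> bad \<longrightarrow> cnt w = N H w) \<and>
      (w \<notin> bad \<longrightarrow> (\<Sum>k=a..<b. \<phi> (X k w)) = \<Phi> w) \<and> \<bar>\<Sum>k=a..<b. \<phi> (X k w)\<bar> \<le> B * cnt w \<and> \<bar>\<Phi> w\<bar> \<le> B * N H w"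
    if w: "w \<in> space M" and pos: "\<forall>i\<ge>1. 0 < Y i w" for w
  proof -
    have Nle: "N (p j) w \<le> N (p (Suc j)) w" if "j < J" for j using N_mono[OF w pn p] that by simp
    have x1: "\<xi> j w = (if 1 \<le> \<Delta> j w then 1 else 0)" if "j < J" for j
      using S_mono_pos(2)[OF w pos pn p] that by (auto simp: \<xi>_def X_def \<Delta>_def)
    have x2: "X j w = 0" if "j < J" "\<xi> j w = 0" for j
    proof -
      have "S (p j) w \<le> S (p (Suc j)) w" by (rule S_mono_pos(1)[OF w pos pn p]) (use that in auto)
      then show ?thesis using that(2) by (simp add: \<xi>_def X_def split: if_splits)
    qed
    have "(\<Sum>k=0..<J. \<Sum>i=Suc (N (p k) w)..N (p (Suc k)) w. 1::real) = (\<Sum>i=Suc (N (p 0) w)..N (p J) w. 1)"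
      using sum_consecutive_blocks[of 0 J "\<lambda>k. N (p k) w" "\<lambda>_. 1"] Nle by auto
    then have tot: "(\<Sum>k<J. real (\<Delta> k w)) = N H w"
      using w Nle by (simp add: p0 pJ \<Delta>_def atLeast0LessThan of_nat_diff)
    have c1: "cnt w \<le> N H w"
      unfolding cnt_def tot[symmetric] by (rule sum_mono) (use x1 in auto)
    have c2: "cnt w = N H w" if "w \<notin> bad"
      unfolding cnt_def tot[symmetric]
    proof (rule sum.cong[OF refl])
      fix j assume j: "j \<in> {..<J}"
      then have "\<Delta> j w < 2" using that w by (force simp: bad_def)
      then show "\<xi> j w = real (\<Delta> j w)" using x1[of j] j by auto
    qed
    have f1: "(\<Sum>k=a..<b. \<phi> (X k w)) = \<Phi> w" if nb: "w \<notin> bad"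
    proof -
      have "(\<Sum>k=a..<b. \<phi> (X k w)) = (\<Sum>k=a..<b. \<Sum>i=Suc (N (p k) w)..N (p (Suc k)) w. \<phi> (Y i w))"
      proof (rule sum.cong[OF refl])
        fix k assume "k \<in> {a..<b}"
        then have k: "k < J" using ab by simp
        have "\<Delta> k w < 2" using nb w k by (force simp: bad_def)
        then have "N (p (Suc k)) w = N (p k) w \<or> N (p (Suc k)) w = Suc (N (p k) w)"
          using Nle[OF k] unfolding \<Delta>_def by arith
        then consider "N (p (Suc k)) w = N (p k) w" | "N (p (Suc k)) w = Suc (N (p k) w)" by blast
        then show "\<phi> (X k w) = (\<Sum>i=Suc (N (p k) w)..N (p (Suc k)) w. \<phi> (Y i w))"
        proof cases
          case 1
          then show ?thesis using S_const[OF pn p, of k w] k \<phi>0 by (simp add: X_def)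
        next
          case 2
          then have "X k w = Y (Suc (N (p k) w)) w" using pn[of k] pn[of "Suc k"] k
            by (simp add: X_def S_def aggregate_claims_def)
          then show ?thesis using 2 by simp
        qed
      qed
      also have "\<dots> = \<Phi> w" unfolding \<Phi>_def
        using sum_consecutive_blocks[of a b "\<lambda>k. N (p k) w" "\<lambda>i. \<phi> (Y i w)"] ab Nle by auto
      finally show ?thesis .
    qed
    have f2: "\<bar>\<Sum>k=a..<b. \<phi> (X k w)\<bar> \<le> B * cnt w"
    proof -
      have "\<bar>\<Sum>k=a..<b. \<phi> (X k w)\<bar> \<le> (\<Sum>k=a..<b. \<bar>\<phi> (X k w)\<bar>)" by (rule sum_abs)
      also have "\<dots> \<le> (\<Sum>k=a..<b. B * \<xi> k w)"
      proof (rule sum_mono)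
        fix k assume "k \<in> {a..<b}"
        then have k: "k < J" using ab by simp
        show "\<bar>\<phi> (X k w)\<bar> \<le> B * \<xi> k w"
          using x2[OF k] bd[of "X k w"] \<phi>0 B by (cases "\<xi> k w = 0") (auto simp: \<xi>_def)
      qed
      also have "\<dots> \<le> (\<Sum>k<J. B * \<xi> k w)" using ab B by (intro sum_mono2) (auto simp: \<xi>_def)
      finally show ?thesis by (simp add: cnt_def sum_distrib_left)
    qed
    have f3: "\<bar>\<Phi> w\<bar> \<le> B * N H w"
    proof -
      have "\<bar>\<Phi> w\<bar> \<le> (\<Sum>i=Suc (N (p a) w)..N (p b) w. B)"
        unfolding \<Phi>_def using bd by (intro order_trans[OF sum_abs] sum_mono) auto
      also have "\<dots> = (N (p b) w - N (p a) w) * B" by simp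
      also have "\<dots> \<le> N H w * B"
        using N_mono[OF w pn[of b] pm[of b J]] ab B by (intro mult_right_mono) (auto simp: pJ)
      finally show ?thesis by (simp add: mult.commute)
    qed
    show ?thesis using x1 x2 c1 c2 f1 f2 f3 by blast
  qed
  \<comment> \<open>\<open>L2\<close> is the quantity to be estimated and \<open>L1\<close> its
    version on the grid; almost surely they differ on \<open>bad\<close> only.\<close>
  define L1 where "L1 = (\<lambda>w. (\<Sum>k=a..<b. \<phi> (X k w)) * (if cnt w = Suc m then 1 else 0))"
  define L2 where "L2 = (\<lambda>w. \<Phi> w * (if N H w = Suc m then 1 else 0))"
  have d12: "AE w in M. \<bar>L2 w - L1 w\<bar> \<le> 2 * B * Suc m * indicator bad w"
    using claims_pos_AE AE_space
  proof eventually_elim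
    case (elim w)
    note f = path[OF elim(2,1)]
    have 1: "\<bar>L1 w\<bar> \<le> B * Suc m" using f B by (auto simp: L1_def)
    have 2: "\<bar>L2 w\<bar> \<le> B * Suc m" using f B by (auto simp: L2_def)
    show ?case
    proof (cases "w \<in> bad")
      case True
      then show ?thesis using 1 2 by (simp add: algebra_simps)
    next
      case False
      then have "L2 w = L1 w" using f by (auto simp: L1_def L2_def)
      then show ?thesis using False by simp
    qed
  qed
  have sX: "(\<lambda>w. \<Sum>k=a..<b. \<phi> (X k w)) \<in> borel_measurable M"
    using Xi(1) ab by (intro borel_measurable_sum) auto
  have L1m: "L1 \<in> borel_measurable M" unfolding L1_def using sX by measurable
  have \<Phi>m: "\<Phi> \<in> borel_measurable M"
  proof -
    have "(\<lambda>w. (\<lambda>(q::nat \<times> nat) w. \<Sum>i=Suc (fst q)..snd q. \<phi> (Y i w)) (N (p a) w, N (p b) w) w) \<in> borel_measurable M"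
    proof (rule measurable_compose_countable[of "\<lambda>(q::nat \<times> nat) w. \<Sum>i=Suc (fst q)..snd q. \<phi> (Y i w)"])
      show "(\<lambda>w. \<Sum>i=Suc (fst q)..snd q. \<phi> (Y i w)) \<in> borel_measurable M" for q :: "nat \<times> nat"
        by (intro borel_measurable_sum measurable_compose[OF Y_measurable \<phi>]) auto
      have [measurable]: "N (p a) \<in> measurable M (count_space UNIV)" "N (p b) \<in> measurable M (count_space UNIV)"
        using N_measurable pn ab by auto
      have "(\<lambda>w. (N (p a) w, N (p b) w)) \<in> measurable M (count_space UNIV \<Otimes>\<^sub>M count_space UNIV)" by measurable
      then show "(\<lambda>w. (N (p a) w, N (p b) w)) \<in> measurable M (count_space UNIV)"
        by (simp add: pair_measure_countable)
    qed
    then show ?thesis by (simp add: \<Phi>_def)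
  qed
  have L2m: "L2 \<in> borel_measurable M" unfolding L2_def using \<Phi>m by measurable
  have "AE w in M. \<bar>L1 w\<bar> \<le> B * Suc m \<and> \<bar>L2 w\<bar> \<le> B * Suc m"
    using claims_pos_AE AE_space
  proof eventually_elim
    case (elim w)
    note f = path[OF elim(2,1)]
    have 1: "\<bar>L1 w\<bar> \<le> B * Suc m" using f B by (auto simp: L1_def)
    have 2: "\<bar>L2 w\<bar> \<le> B * Suc m" using f B by (auto simp: L2_def)
    show ?case using 1 2 by blast
  qed
  then have bnds: "AE w in M. norm (L1 w) \<le> B * Suc m" "AE w in M. norm (L2 w) \<le> B * Suc m" by auto
  have L1i: "integrable M L1" and L2i: "integrable M L2"
    using integrable_const_bound[OF bnds(1) L1m] integrable_const_bound[OF bnds(2) L2m] by auto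
  have e1: "\<bar>(\<integral>w. L2 w \<partial>M) - (\<integral>w. L1 w \<partial>M)\<bar> \<le> 2 * B * Suc m * prob bad"
    by (rule integral_diff_le[OF L2i L1i bad_ev d12])
  define P where "P = prob {w\<in>space M. N H w = m}"
  \<comment> \<open>A cell contributes only if it contains a claim, and then
    \<open>cnt w = Suc m\<close> means that the other cells account for \<open>m\<close>; their
    count is independent of this cell. This is the origin of the shift from \<open>Suc m\<close> to
    \<open>m\<close>.\<close>
  have pk: "(\<integral>w. \<phi> (X k w) * (if cnt w = Suc m then 1 else 0) \<partial>M) = (\<integral>w. \<phi> (X k w) \<partial>M) * prob {w\<in>space M. ck k w = m}"
    "{w\<in>space M. ck k w = m} \<in> sets M" if k: "k < J" for k
  proof -
    note gp = grid_product_mean[OF p p0' \<phi> bd k, of "real m"]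
    show "{w\<in>space M. ck k w = m} \<in> sets M" using gp(2) by (simp add: ck_def \<xi>_def X_def)
    have "(\<integral>w. \<phi> (X k w) * (if cnt w = Suc m then 1 else 0) \<partial>M) = (\<integral>w. \<phi> (X k w) * (if ck k w = m then 1 else 0) \<partial>M)"
    proof (rule integral_cong_AE)
      have [measurable]: "ck k \<in> borel_measurable M" unfolding ck_def using \<xi>m by (intro borel_measurable_sum) auto
      have [measurable]: "(\<lambda>w. \<phi> (X k w)) \<in> borel_measurable M" using Xi(1)[OF k] by simp
      show "(\<lambda>w. \<phi> (X k w) * (if cnt w = Suc m then 1 else 0)) \<in> borel_measurable M"
        "(\<lambda>w. \<phi> (X k w) * (if ck k w = m then 1 else 0)) \<in> borel_measurable M" by measurable
      show "AE w in M. \<phi> (X k w) * (if cnt w = Suc m then 1 else 0) = \<phi> (X k w) * (if ck k w = m then 1 else 0)"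
        using claims_pos_AE AE_space
      proof eventually_elim
        case (elim w)
        have cs: "cnt w = \<xi> k w + ck k w" unfolding cnt_def ck_def using k by (simp add: sum.remove)
        show ?case
        proof (cases "\<xi> k w = 0")
          case True
          then show ?thesis using path[OF elim(2,1)] k \<phi>0 by auto
        next
          case False
          then have "\<xi> k w = 1" by (simp add: \<xi>_def split: if_splits)
          then show ?thesis using cs by simp
        qed
      qed
    qed
    also have "\<dots> = (\<integral>w. \<phi> (X k w) \<partial>M) * prob {w\<in>space M. ck k w = m}" using gp(1) by (simp add: ck_def \<xi>_def X_def)
    finally show "(\<integral>w. \<phi> (X k w) * (if cnt w = Suc m then 1 else 0) \<partial>M) = (\<integral>w. \<phi> (X k w) \<partial>M) * prob {w\<in>space M. ck k w = m}" .
  qed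
  \<comment> \<open>Dropping cell \<open>k\<close> from the count, and counting cells instead of
    claims, matters only if this cell has a claim or \<open>bad\<close> occurs.\<close>
  have qk: "\<bar>prob {w\<in>space M. ck k w = m} - P\<bar> \<le> (lam\<^sup>2 * H + lam) * \<eta>" if k: "k < J" for k
  proof -
    define A where "A = bad \<union> {w\<in>space M. 1 \<le> \<Delta> k w}"
    have ev: "{w\<in>space M. 1 \<le> \<Delta> k w} \<in> sets M" unfolding \<Delta>_def using increment_event[OF pn p] k by simp
    then have Am: "A \<in> sets M" unfolding A_def by simp
    have "AE w in M. \<bar>indicat_real {w\<in>space M. ck k w = m} w - indicator {w\<in>space M. N H w = m} w\<bar> \<le> 1 * indicator A w"
      using claims_pos_AE AE_space
    proof eventually_elim
      case (elim w)
      have cs: "cnt w = \<xi> k w + ck k w" unfolding cnt_def ck_def using k by (simp add: sum.remove)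
      show ?case
      proof (cases "w \<in> A")
        case False
        then have "\<xi> k w = 0" "cnt w = N H w" using path[OF elim(2,1)] elim k by (auto simp: A_def)
        then have "ck k w = N H w" using cs by simp
        then show ?thesis by (auto simp: indicator_def)
      qed (auto simp: indicator_def)
    qed
    then have "\<bar>(\<integral>w. indicat_real {w\<in>space M. ck k w = m} w \<partial>M) - (\<integral>w. indicat_real {w\<in>space M. N H w = m} w \<partial>M)\<bar> \<le> 1 * prob A"
      using pk(2)[OF k] Am by (intro integral_diff_le) (auto intro!: integrable_const_bound[of _ 1] simp: indicator_def)
    then have "\<bar>prob {w\<in>space M. ck k w = m} - P\<bar> \<le> prob A" using pk(2)[OF k] by (simp add: P_def Int_absorb2)
    also have "\<dots> \<le> prob bad + prob {w\<in>space M. 1 \<le> \<Delta> k w}"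
      unfolding A_def using ev by (intro measure_Un_le) auto
    also have "prob {w\<in>space M. 1 \<le> \<Delta> k w} \<le> lam * (p (Suc k) - p k)"
      unfolding \<Delta>_def using increment_tail_prob(1)[OF pn p] k by simp
    also have "\<dots> \<le> lam * \<eta>" using mesh[OF k] lam_pos by (intro mult_left_mono) auto
    finally show ?thesis using badP by (simp add: algebra_simps)
  qed
  have "(\<integral>w. L1 w \<partial>M) = (\<integral>w. (\<Sum>k=a..<b. \<phi> (X k w) * (if cnt w = Suc m then 1 else 0)) \<partial>M)"
    by (simp add: L1_def sum_distrib_right)
  also have "\<dots> = (\<Sum>k=a..<b. \<integral>w. \<phi> (X k w) * (if cnt w = Suc m then 1 else 0) \<partial>M)"
  proof (rule Bochner_Integration.integral_sum)
    fix k assume "k \<in> {a..<b}"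
    then have [measurable]: "(\<lambda>w. \<phi> (X k w)) \<in> borel_measurable M" using Xi(1)[of k] ab by simp
    show "integrable M (\<lambda>w. \<phi> (X k w) * (if cnt w = Suc m then 1 else 0))"
      by (rule integrable_const_bound[of _ B]) (use bd B in auto)
  qed
  also have "\<dots> = (\<Sum>k=a..<b. (\<integral>w. \<phi> (X k w) \<partial>M) * prob {w\<in>space M. ck k w = m})"
    using pk(1) ab by (intro sum.cong) auto
  finally have L1e: "(\<integral>w. L1 w \<partial>M) = \<dots>" .
  have e2: "\<bar>(\<integral>w. L1 w \<partial>M) - (\<Sum>k=a..<b. \<integral>w. \<phi> (X k w) \<partial>M) * P\<bar> \<le> B * (lam * H) * ((lam\<^sup>2 * H + lam) * \<eta>)"
  proof -
    have "(\<integral>w. L1 w \<partial>M) - (\<Sum>k=a..<b. \<integral>w. \<phi> (X k w) \<partial>M) * P = (\<Sum>k=a..<b. (\<integral>w. \<phi> (X k w) \<partial>M) * (prob {w\<in>space M. ck k w = m} - P))"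
      unfolding L1e by (simp add: sum_distrib_right right_diff_distrib sum_subtractf)
    also have "\<bar>\<dots>\<bar> \<le> (\<Sum>k=a..<b. B * lam * (p (Suc k) - p k) * ((lam\<^sup>2 * H + lam) * \<eta>))"
    proof (rule order_trans[OF sum_abs sum_mono])
      fix k assume "k \<in> {a..<b}"
      then have k: "k < J" using ab by simp
      show "\<bar>(\<integral>w. \<phi> (X k w) \<partial>M) * (prob {w\<in>space M. ck k w = m} - P)\<bar> \<le> B * lam * (p (Suc k) - p k) * ((lam\<^sup>2 * H + lam) * \<eta>)"
        unfolding abs_mult using Xi(2)[OF k] qk[OF k] p[OF k] B lam_pos by (intro mult_mono) (auto simp: mult.assoc)
    qed
    also have "\<dots> = B * lam * (\<Sum>k=a..<b. p (Suc k) - p k) * ((lam\<^sup>2 * H + lam) * \<eta>)"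
      by (simp only: sum_distrib_left sum_distrib_right)
    also have "(\<Sum>k=a..<b. p (Suc k) - p k) = p b - p a" using ab by (simp add: sum_Suc_diff')
    also have "B * lam * (p b - p a) * ((lam\<^sup>2 * H + lam) * \<eta>) \<le> B * lam * H * ((lam\<^sup>2 * H + lam) * \<eta>)"
    proof (rule mult_right_mono)
      show "B * lam * (p b - p a) \<le> B * lam * H" using pn[of a] pm[of b J] ab B lam_pos by (intro mult_left_mono) (auto simp: pJ)
      show "0 \<le> (lam\<^sup>2 * H + lam) * \<eta>" using eta lam_pos by simp
    qed
    finally show ?thesis by (simp add: algebra_simps)
  qed
  have "?lhs = \<bar>(\<integral>w. L2 w \<partial>M) - (\<Sum>k=a..<b. \<integral>w. \<phi> (X k w) \<partial>M) * P\<bar>" by (simp add: L2_def \<Phi>_def X_def P_def)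
  also have "\<dots> \<le> 2 * B * Suc m * prob bad + B * (lam * H) * ((lam\<^sup>2 * H + lam) * \<eta>)" using e1 e2 by linarith
  also have "\<dots> \<le> 2 * B * Suc m * (lam\<^sup>2 * H * \<eta>) + B * (lam * H) * ((lam\<^sup>2 * H + lam) * \<eta>)"
    using badP B by (intro add_right_mono mult_left_mono) auto
  finally show ?thesis by (simp add: algebra_simps)
qed

end

section \<open>The mean of a function of an increment\<close>

context dividend_model begin

text \<open>When one more cell is added, \<open>\<phi> (U + V)\<close> and
  \<open>\<phi> U + \<phi> V\<close> agree unless both increments are nonzero, which has probability
  at most \<open>lam^2\<close> times the product of the lengths. These products add up to at most
  the square of the total length.\<close>

lemma near_additive:
  fixes p :: "nat \<Rightarrow> real"
  assumes p: "\<And>j. a \<le> j \<Longrightarrow> j < b \<Longrightarrow> p j \<le> p (Suc j)" and pa: "0 \<le> p a" and ab: "a \<le> b"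
    and \<phi>: "\<phi> \<in> borel_measurable borel" and bd: "\<And>y. \<bar>\<phi> y\<bar> \<le> B" and \<phi>0: "\<phi> 0 = 0"
  shows "p a \<le> p b \<and> \<bar>(\<integral>w. \<phi> (S (p b) w - S (p a) w) \<partial>M) - (\<Sum>k=a..<b. \<integral>w. \<phi> (S (p (Suc k)) w - S (p k) w) \<partial>M)\<bar>
    \<le> 3 * B * lam\<^sup>2 * (p b - p a)\<^sup>2"
  using ab p
proof (induction b rule: dec_induct)
  case base
  then show ?case by (simp add: \<phi>0)
next
  case (step n)
  have B: "0 \<le> B" using bd[of 0] by linarith
  have IH: "p a \<le> p n" "\<bar>(\<integral>w. \<phi> (S (p n) w - S (p a) w) \<partial>M) - (\<Sum>k=a..<n. \<integral>w. \<phi> (S (p (Suc k)) w - S (p k) w) \<partial>M)\<bar>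
    \<le> 3 * B * lam\<^sup>2 * (p n - p a)\<^sup>2" using step by auto
  have le: "p n \<le> p (Suc n)" using step by auto
  have pn: "0 \<le> p n" using IH(1) pa by simp
  define U where "U = (\<lambda>w. S (p n) w - S (p a) w)"
  define V where "V = (\<lambda>w. S (p (Suc n)) w - S (p n) w)"
  define A where "A = {w\<in>space M. U w \<noteq> 0}"
  define C where "C = {w\<in>space M. V w \<noteq> 0}"
  have "U \<in> borel_measurable (F (p n))"
    unfolding U_def using S_adapted[OF pn] measurable_F_mono[OF S_adapted[OF pa] pa IH(1)] by simp
  then have AF: "A \<in> sets (F (p n))" using space_F[OF pn] unfolding A_def by (simp flip: space_F[OF pn])
  have Vm [measurable]: "V \<in> borel_measurable M" unfolding V_def by (rule increment_measurable[OF pn le])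
  have Um [measurable]: "U \<in> borel_measurable M" unfolding U_def by (rule increment_measurable[OF pa IH(1)])
  have [measurable]: "A \<in> sets M" "C \<in> sets M" unfolding A_def C_def by measurable
  have PA: "prob A \<le> lam * (p n - p a)"
  proof -
    have "A \<subseteq> {w\<in>space M. 1 \<le> N (p n) w - N (p a) w}"
    proof
      fix w assume w: "w \<in> A"
      then have "N (p a) w \<noteq> N (p n) w" using S_const[OF pa IH(1), of w] by (auto simp: A_def U_def)
      then show "w \<in> {w\<in>space M. 1 \<le> N (p n) w - N (p a) w}" using w N_mono[OF _ pa IH(1), of w] by (auto simp: A_def)
    qed
    then have "prob A \<le> prob {w\<in>space M. 1 \<le> N (p n) w - N (p a) w}"
      using increment_event[OF pa IH(1)] by (intro finite_measure_mono) auto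
    then show ?thesis using increment_tail_prob(1)[OF pa IH(1)] by linarith
  qed
  have PC: "prob C \<le> lam * (p (Suc n) - p n)"
  proof -
    have "C \<subseteq> {w\<in>space M. 1 \<le> N (p (Suc n)) w - N (p n) w}"
    proof
      fix w assume w: "w \<in> C"
      then have "N (p n) w \<noteq> N (p (Suc n)) w" using S_const[OF pn le, of w] by (auto simp: C_def V_def)
      then show "w \<in> {w\<in>space M. 1 \<le> N (p (Suc n)) w - N (p n) w}" using w N_mono[OF _ pn le, of w] by (auto simp: C_def)
    qed
    then have "prob C \<le> prob {w\<in>space M. 1 \<le> N (p (Suc n)) w - N (p n) w}"
      using increment_event[OF pn le] by (intro finite_measure_mono) auto
    then show ?thesis using increment_tail_prob(1)[OF pn le] by linarith
  qed
  have "C = V -` (- {0}) \<inter> space M" by (auto simp: C_def)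
  then have "C \<in> {(\<lambda>w. aggregate_claims N Y (p (Suc n)) w - aggregate_claims N Y (p n) w) -` B \<inter> space M | B. B \<in> sets borel}"
    using pn le by (intro CollectI exI[of _ "- {0}"]) (simp add: V_def S_def)
  then have PAC: "prob (A \<inter> C) = prob A * prob C"
    using indep_setD[OF indep_increments_claims[OF pn le] AF] by blast
  have i: "integrable M (\<lambda>w. \<phi> (U w))" "integrable M (\<lambda>w. \<phi> (V w))" "integrable M (\<lambda>w. \<phi> (S (p (Suc n)) w - S (p a) w))"
    unfolding U_def V_def using increment_mean_abs_le(2)[OF _ _ \<phi> bd \<phi>0] pa IH(1) pn le by auto
  have "\<bar>(\<integral>w. \<phi> (S (p (Suc n)) w - S (p a) w) \<partial>M) - (\<integral>w. \<phi> (U w) + \<phi> (V w) \<partial>M)\<bar> \<le> 3 * B * prob (A \<inter> C)"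
  proof (rule integral_diff_le)
    show "AE w in M. \<bar>\<phi> (S (p (Suc n)) w - S (p a) w) - (\<phi> (U w) + \<phi> (V w))\<bar> \<le> 3 * B * indicator (A \<inter> C) w"
    proof (rule AE_I2)
      fix w assume w: "w \<in> space M"
      have e: "S (p (Suc n)) w - S (p a) w = U w + V w" by (simp add: U_def V_def)
      show "\<bar>\<phi> (S (p (Suc n)) w - S (p a) w) - (\<phi> (U w) + \<phi> (V w))\<bar> \<le> 3 * B * indicator (A \<inter> C) w"
      proof (cases "w \<in> A \<inter> C")
        case True
        then show ?thesis using bd[of "U w"] bd[of "V w"] bd[of "S (p (Suc n)) w - S (p a) w"] by simp
      next
        case False
        then have "U w = 0 \<or> V w = 0" using w by (auto simp: A_def C_def)
        then show ?thesis unfolding e using False \<phi>0 by auto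
      qed
    qed
  qed (use i in auto)
  also have "\<dots> \<le> 3 * B * (lam * (p n - p a) * (lam * (p (Suc n) - p n)))"
    unfolding PAC using PA PC B by (intro mult_left_mono mult_mono) (auto intro: order_trans[OF measure_nonneg])
  finally have "\<bar>(\<integral>w. \<phi> (S (p (Suc n)) w - S (p a) w) \<partial>M) - ((\<integral>w. \<phi> (U w) \<partial>M) + (\<integral>w. \<phi> (V w) \<partial>M))\<bar>
      \<le> 3 * B * lam\<^sup>2 * ((p n - p a) * (p (Suc n) - p n))"
    using i by (simp add: power2_eq_square algebra_simps)
  moreover have "3 * B * lam\<^sup>2 * (p n - p a)\<^sup>2 + 3 * B * lam\<^sup>2 * ((p n - p a) * (p (Suc n) - p n)) \<le> 3 * B * lam\<^sup>2 * (p (Suc n) - p a)\<^sup>2"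
  proof -
    have "(p n - p a)\<^sup>2 + (p n - p a) * (p (Suc n) - p n) = (p n - p a) * (p (Suc n) - p a)" by (simp add: power2_eq_square algebra_simps)
    also have "\<dots> \<le> (p (Suc n) - p a) * (p (Suc n) - p a)" using IH(1) le by (intro mult_right_mono) auto
    finally have "3 * B * lam\<^sup>2 * ((p n - p a)\<^sup>2 + (p n - p a) * (p (Suc n) - p n)) \<le> 3 * B * lam\<^sup>2 * (p (Suc n) - p a)\<^sup>2"
      using B by (intro mult_left_mono) (auto simp: power2_eq_square)
    then show ?thesis by (simp add: distrib_left)
  qed
  moreover have "(\<Sum>k=a..<Suc n. \<integral>w. \<phi> (S (p (Suc k)) w - S (p k) w) \<partial>M)
      = (\<Sum>k=a..<n. \<integral>w. \<phi> (S (p (Suc k)) w - S (p k) w) \<partial>M) + (\<integral>w. \<phi> (V w) \<partial>M)"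
    using step(1) by (simp add: V_def)
  ultimately show ?case using IH le unfolding U_def by linarith
qed

lemma claim_count_independent:
  assumes i: "1 \<le> i" and \<phi>: "\<phi> \<in> borel_measurable borel" and bd: "\<And>y. \<bar>\<phi> y\<bar> \<le> B"
  shows "(\<integral>w. \<phi> (Y i w) * (if N (real H) w = n then 1 else 0) \<partial>M) = claim_mean \<phi> * prob {w\<in>space M. N (real H) w = n}"
proof -
  have f1: "(\<lambda>v. \<phi> (v i)) \<in> borel_measurable (\<Pi>\<^sub>M i\<in>{1..}. borel)"
    by (rule measurable_compose[where f = "\<lambda>v. v i", OF _ \<phi>]) (rule measurable_component_singleton, use i in simp)
  have f2: "(\<lambda>v. if v H = real n then 1 else 0 :: real) \<in> borel_measurable (\<Pi>\<^sub>M t\<in>{0..}. count_space UNIV)"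
    by (rule measurable_compose[where f = "\<lambda>v. v H" and g = "\<lambda>y. if y = real n then 1 else 0"])
      (rule measurable_component_singleton, simp_all)
  from indep_var_compose[OF indep_Y_N f1 f2]
  have ind: "indep_var borel (\<lambda>w. \<phi> (Y i w)) borel (\<lambda>w. if N (real H) w = n then 1 else 0)"
    using i by (simp add: comp_def)
  have [measurable]: "N (real H) \<in> measurable M (count_space UNIV)" by (rule N_measurable) simp
  have ev: "{w\<in>space M. N (real H) w = n} \<in> sets M" by measurable
  have "(\<integral>w. \<phi> (Y i w) * (if N (real H) w = n then 1 else 0) \<partial>M) = (\<integral>w. \<phi> (Y i w) \<partial>M) * (\<integral>w. (if N (real H) w = n then 1 else 0) \<partial>M)"
  proof (rule indep_var_lebesgue_integral[OF ind])
    show "integrable M (\<lambda>w. \<phi> (Y i w))"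
      using measurable_compose[OF Y_measurable[OF i] \<phi>] bd by (intro integrable_const_bound[of _ B]) auto
    show "integrable M (\<lambda>w. if N (real H) w = n then 1 else 0 :: real)"
      by (rule integrable_const_bound[of _ 1]) auto
  qed
  also have "(\<integral>w. (if N (real H) w = n then 1 else 0) \<partial>M) = (\<integral>w. indicator {w\<in>space M. N (real H) w = n} w \<partial>M)"
    by (rule Bochner_Integration.integral_cong[OF refl]) (auto simp: indicator_def)
  also have "\<dots> = prob {w\<in>space M. N (real H) w = n}" using ev by (simp add: Int_absorb2)
  also have "(\<integral>w. \<phi> (Y i w) \<partial>M) = claim_mean \<phi>" by (rule Y_mean[OF i \<phi>])
  finally show ?thesis .
qed

lemma count_prob: "0 < t \<Longrightarrow> prob {w\<in>space M. N t w = k} = (lam * t) ^ k / fact k * exp (- (lam * t))"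
proof -
  assume t: "0 < t"
  have "{w\<in>space M. N t w = k} = {w\<in>space M. N t w - N 0 w = k}" by auto
  then show ?thesis using increment_prob[of 0 t k] t by simp
qed

text \<open>Given \<open>n\<close> claims up to \<open>h\<close>, the number up to \<open>s\<close>
  is binomial with parameter \<open>s / h\<close>. The Bernstein basis polynomial is its weight, so
  the known moment sums of Bernstein polynomials become available.\<close>

lemma binomial_thinning:
  assumes s: "0 < s" "s < h" and j: "j \<le> n"
  shows "prob {w\<in>space M. N s w = j \<and> N h w = n} = Bernstein n j (s / h) * prob {w\<in>space M. N h w = n}"
proof -
  \<comment> \<open>The times \<open>0, s, h, h, ...\<close> yield the independence of the two
    increments.\<close>
  define r where "r = (\<lambda>i::nat. if i = 0 then 0 else if i = 1 then s else h)"
  have "incseq r" "0 \<le> r 0" using s by (auto simp: r_def incseq_def)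
  then have iv: "indep_vars (\<lambda>_. count_space UNIV) (\<lambda>i w. N (r (Suc i)) w - N (r i) w) (UNIV :: nat set)"
    using poisson_N unfolding poisson_process_def by blast
  define A where "A = (\<lambda>i::nat. if i = 0 then {j} else {n - j})"
  have "prob (\<Inter>i\<in>{0,1::nat}. (\<lambda>w. N (r (Suc i)) w - N (r i) w) -` A i \<inter> space M)
      = (\<Prod>i\<in>{0,1::nat}. prob ((\<lambda>w. N (r (Suc i)) w - N (r i) w) -` A i \<inter> space M))"
    by (rule indep_varsD[OF iv]) auto
  moreover have "(\<Inter>i\<in>{0,1::nat}. (\<lambda>w. N (r (Suc i)) w - N (r i) w) -` A i \<inter> space M) = {w\<in>space M. N s w = j \<and> N h w = n}"
    using N_mono[of _ s h] s j by (auto simp: A_def r_def) (metis le_add_diff_inverse)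
  moreover have "(\<lambda>w. N (r (Suc 0)) w - N (r 0) w) -` A 0 \<inter> space M = {w\<in>space M. N s w = j}"
    by (auto simp: A_def r_def)
  moreover have "(\<lambda>w. N (r (Suc 1)) w - N (r 1) w) -` A 1 \<inter> space M = {w\<in>space M. N h w - N s w = n - j}"
    by (auto simp: A_def r_def)
  ultimately have "prob {w\<in>space M. N s w = j \<and> N h w = n} = prob {w\<in>space M. N s w = j} * prob {w\<in>space M. N h w - N s w = n - j}"
    by simp
  also have "\<dots> = ((lam * s) ^ j / fact j * exp (- (lam * s))) * ((lam * (h - s)) ^ (n - j) / fact (n - j) * exp (- (lam * (h - s))))"
    using count_prob[OF s(1)] increment_prob[of s h "n - j"] s by simp
  also have "\<dots> = (lam ^ j * lam ^ (n - j)) * s ^ j * (h - s) ^ (n - j) / (fact j * fact (n - j)) * (exp (- (lam * s)) * exp (- (lam * (h - s))))"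
    by (simp add: power_mult_distrib)
  also have "exp (- (lam * s)) * exp (- (lam * (h - s))) = exp (- (lam * h))" by (simp add: algebra_simps flip: exp_add)
  also have "lam ^ j * lam ^ (n - j) = lam ^ n" using j by (simp flip: power_add)
  finally have 1: "prob {w\<in>space M. N s w = j \<and> N h w = n} = lam ^ n * s ^ j * (h - s) ^ (n - j) / (fact j * fact (n - j)) * exp (- (lam * h))" .
  have "Bernstein n j (s / h) = fact n / (fact j * fact (n - j)) * (s / h) ^ j * ((h - s) / h) ^ (n - j)"
    using j s by (simp add: Bernstein_def binomial_fact diff_divide_distrib)
  also have "(s / h) ^ j * ((h - s) / h) ^ (n - j) = s ^ j * (h - s) ^ (n - j) / h ^ n"
    using j s by (simp add: power_divide flip: power_add)
  then have "fact n / (fact j * fact (n - j)) * (s / h) ^ j * ((h - s) / h) ^ (n - j) = fact n / (fact j * fact (n - j)) * (s ^ j * (h - s) ^ (n - j) / h ^ n)"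
    by (simp only: mult.assoc)
  finally have "Bernstein n j (s / h) * prob {w\<in>space M. N h w = n} = fact n / (fact j * fact (n - j)) * (s ^ j * (h - s) ^ (n - j) / h ^ n) * ((lam * h) ^ n / fact n * exp (- (lam * h)))"
    using count_prob[of h n] s by simp
  also have "\<dots> = lam ^ n * s ^ j * (h - s) ^ (n - j) / (fact j * fact (n - j)) * exp (- (lam * h))"
    using s by (simp add: power_mult_distrib)
  finally show ?thesis using 1 by simp
qed

text \<open>In place of the Cauchy-Schwarz inequality,
  \<open>y \<le> (y^2 / sqrt n + sqrt n) / 2\<close> reduces the mean absolute deviation of a
  binomial variable to its variance \<open>n * x * (1 - x)\<close>, which is at most
  \<open>n\<close>.\<close>

lemma count_deviation:
  assumes s: "0 \<le> s" "s \<le> h" and h: "0 < h" and n: "1 \<le> n"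
  shows "(\<integral>w. \<bar>real (N s w) - n * (s / h)\<bar> * (if N h w = n then 1 else 0) \<partial>M) \<le> sqrt n * prob {w\<in>space M. N h w = n}"
    and "integrable M (\<lambda>w. \<bar>real (N s w) - n * (s / h)\<bar> * (if N h w = n then 1 else 0))"
proof -
  define x where "x = s / h"
  have x: "0 \<le> x" "x \<le> 1" using s h by (auto simp: x_def)
  define P where "P = prob {w\<in>space M. N h w = n}"
  have P0: "0 \<le> P" by (simp add: P_def)
  define D where "D = (\<lambda>w. \<bar>real (N s w) - n * x\<bar> * (if N h w = n then 1 else 0 :: real))"
  have [measurable]: "N s \<in> measurable M (count_space UNIV)" "N h \<in> measurable M (count_space UNIV)"
    using N_measurable s h by auto
  have Db: "\<bar>D w\<bar> \<le> 2 * n" if w: "w \<in> space M" for w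
  proof (cases "N h w = n")
    case True
    then have "N s w \<le> n" using N_mono[OF w s] by simp
    moreover have "0 \<le> n * x" "n * x \<le> n" using x by (auto simp: mult_left_le)
    ultimately show ?thesis unfolding D_def by (simp add: abs_le_iff)
  qed (simp add: D_def)
  have Di: "integrable M D"
    unfolding D_def by (rule integrable_const_bound[of _ "2 * n"]) (use Db in \<open>auto simp: D_def\<close>)
  then show "integrable M (\<lambda>w. \<bar>real (N s w) - n * (s / h)\<bar> * (if N h w = n then 1 else 0))" by (simp add: D_def x_def)
  have "(\<integral>w. D w \<partial>M) \<le> sqrt n * P"
  proof (cases "s = 0 \<or> s = h")
    case True
    have "(\<integral>w. D w \<partial>M) = (\<integral>w. 0 \<partial>M)"
      by (rule Bochner_Integration.integral_cong[OF refl]) (use True h in \<open>auto simp: D_def x_def\<close>)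
    then show ?thesis using P0 by simp
  next
    case False
    then have s': "0 < s" "s < h" using s by auto
    define E where "E = (\<lambda>j. {w\<in>space M. N s w = j \<and> N h w = n})"
    have E [measurable]: "E j \<in> sets M" for j unfolding E_def by measurable
    have EP: "prob (E j) = Bernstein n j x * P" if "j \<le> n" for j
      using binomial_thinning[OF s' that] by (simp add: E_def x_def P_def)
    have Bn: "0 \<le> Bernstein n j x" for j using Bernstein_nonneg[OF x] .
    have "(\<integral>w. D w \<partial>M) = (\<integral>w. (\<Sum>j\<le>n. \<bar>real j - n * x\<bar> * indicator (E j) w) \<partial>M)"
    proof (rule Bochner_Integration.integral_cong[OF refl])
      fix w assume w: "w \<in> space M"
      show "D w = (\<Sum>j\<le>n. \<bar>real j - n * x\<bar> * indicator (E j) w)"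
      proof (cases "N h w = n")
        case True
        then have le: "N s w \<le> n" using N_mono[OF w s] by simp
        have "(\<Sum>j\<le>n. \<bar>real j - n * x\<bar> * indicator (E j) w) = (\<Sum>j\<le>n. if j = N s w then \<bar>real j - n * x\<bar> else 0)"
          by (rule sum.cong[OF refl]) (use True w in \<open>auto simp: E_def indicator_def\<close>)
        also have "\<dots> = \<bar>real (N s w) - n * x\<bar>" using le by simp
        finally show ?thesis using True by (simp add: D_def)
      next
        case False
        then have "indicator (E j) w = (0::real)" for j by (simp add: E_def)
        then show ?thesis using False by (simp add: D_def)
      qed
    qed
    also have "\<dots> = (\<Sum>j\<le>n. \<integral>w. \<bar>real j - n * x\<bar> * indicator (E j) w \<partial>M)"
      by (rule Bochner_Integration.integral_sum, rule integrable_mult_right, rule integrable_const_bound[of _ 1]) (auto simp: indicator_def)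
    also have "\<dots> = (\<Sum>j\<le>n. \<bar>real j - n * x\<bar> * (Bernstein n j x * P))"
      by (rule sum.cong[OF refl]) (use EP E in \<open>simp add: Int_absorb2 sets.sets_into_space\<close>)
    also have "\<dots> \<le> (\<Sum>j\<le>n. ((real j - n * x)\<^sup>2 / sqrt n + sqrt n) / 2 * (Bernstein n j x * P))"
    proof (rule sum_mono, rule mult_right_mono)
      fix j
      define y where "y = \<bar>real j - n * x\<bar>"
      have q: "0 < sqrt n" using n by simp
      have "0 \<le> (y - sqrt n)\<^sup>2" by simp
      then have "2 * y * sqrt n \<le> y\<^sup>2 + sqrt n * sqrt n" by (simp add: power2_eq_square algebra_simps)
      then have "2 * y \<le> (y\<^sup>2 + sqrt n * sqrt n) / sqrt n" using q by (simp add: le_divide_eq)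
      also have "\<dots> = y\<^sup>2 / sqrt n + sqrt n" by (simp add: add_divide_distrib real_div_sqrt)
      finally show "\<bar>real j - n * x\<bar> \<le> ((real j - n * x)\<^sup>2 / sqrt n + sqrt n) / 2" by (simp add: y_def)
      show "0 \<le> Bernstein n j x * P" using Bn P0 by simp
    qed
    also have "\<dots> = (\<Sum>j\<le>n. P / (2 * sqrt n) * ((real j - n * x)\<^sup>2 * Bernstein n j x) + sqrt n / 2 * P * Bernstein n j x)"
    proof (rule sum.cong[OF refl])
      fix j
      define k where "k = 1 / (2 * sqrt n)"
      define y where "y = (real j - n * x)\<^sup>2"
      have "y / sqrt n = 2 * k * y" "P / (2 * sqrt n) = P * k" by (auto simp: k_def)
      then have "(y / sqrt n + sqrt n) / 2 * (Bernstein n j x * P) = P / (2 * sqrt n) * (y * Bernstein n j x) + sqrt n / 2 * P * Bernstein n j x"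
        by (simp only:) (simp add: algebra_simps)
      then show "((real j - n * x)\<^sup>2 / sqrt n + sqrt n) / 2 * (Bernstein n j x * P) = P / (2 * sqrt n) * ((real j - n * x)\<^sup>2 * Bernstein n j x) + sqrt n / 2 * P * Bernstein n j x"
        by (simp only: y_def)
    qed
    also have "\<dots> = P / (2 * sqrt n) * (\<Sum>j\<le>n. (real j - n * x)\<^sup>2 * Bernstein n j x) + sqrt n / 2 * P * (\<Sum>j\<le>n. Bernstein n j x)"
      by (simp only: sum.distrib sum_distrib_left[symmetric])
    also have "(\<Sum>j\<le>n. (real j - n * x)\<^sup>2 * Bernstein n j x) = n * x * (1 - x)"
    proof -
      have "(\<Sum>j\<le>n. (real j - n * x)\<^sup>2 * Bernstein n j x)
        = (\<Sum>j\<le>n. real j * (real j - 1) * Bernstein n j x + (1 - 2 * n * x) * (real j * Bernstein n j x) + (n * x)\<^sup>2 * Bernstein n j x)"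
        by (rule sum.cong[OF refl]) (simp add: power2_eq_square algebra_simps)
      also have "\<dots> = real n * (real n - 1) * x\<^sup>2 + (1 - 2 * n * x) * (n * x) + (n * x)\<^sup>2"
        by (simp add: sum.distrib sum_distrib_left[symmetric])
      finally show ?thesis by (simp add: power2_eq_square algebra_simps)
    qed
    also have "P / (2 * sqrt n) * (n * x * (1 - x)) + sqrt n / 2 * P * (\<Sum>j\<le>n. Bernstein n j x) \<le> sqrt n * P"
    proof -
      have "x * (1 - x) \<le> 1" using x by (simp add: mult_le_one)
      then have "real n * (x * (1 - x)) \<le> real n * 1" by (intro mult_left_mono) auto
      then have "P / (2 * sqrt n) * (n * x * (1 - x)) \<le> P / (2 * sqrt n) * n" using P0 by (intro mult_left_mono) (auto simp: mult.assoc)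
      also have "\<dots> = (real n / sqrt n) / 2 * P" by (simp add: mult.commute)
      also have "\<dots> = sqrt n / 2 * P" by (simp add: real_div_sqrt)
      finally show ?thesis by (simp add: field_simps)
    qed
    finally show ?thesis .
  qed
  then show "(\<integral>w. \<bar>real (N s w) - n * (s / h)\<bar> * (if N h w = n then 1 else 0) \<partial>M) \<le> sqrt n * prob {w\<in>space M. N h w = n}"
    by (simp add: D_def x_def P_def)
qed

end

context dividend_model begin

lemma sum_diff_le_dist:
  fixes f :: "nat \<Rightarrow> real"
  assumes "\<And>i. \<bar>f i\<bar> \<le> B"
  shows "\<bar>(\<Sum>i=1..a. f i) - (\<Sum>i=1..b. f i)\<bar> \<le> B * \<bar>real a - real b\<bar>"
proof -
  have *: "\<bar>(\<Sum>i=1..a. f i) - (\<Sum>i=1..b. f i)\<bar> \<le> B * (real a - real b)" if "b \<le> a" for a b :: nat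
    using that
  proof (induction a rule: dec_induct)
    case (step n)
    have "(\<Sum>i=1..Suc n. f i) = (\<Sum>i=1..n. f i) + f (Suc n)" by simp
    then show ?case using step assms[of "Suc n"] by (simp add: algebra_simps)
  qed simp
  show ?thesis using *[of a b] *[of b a] by (cases "a \<le> b") (auto simp: abs_minus_commute)
qed

lemma sum_block_eq_diff:
  fixes f :: "nat \<Rightarrow> real"
  assumes "a \<le> b"
  shows "(\<Sum>i=Suc a..b. f i) = (\<Sum>i=1..b. f i) - (\<Sum>i=1..a. f i)"
proof -
  have "{1..b} = {1..a} \<union> {Suc a..b}" using assms by auto
  then show ?thesis by (simp add: sum.union_disjoint)
qed

text \<open>For a fixed horizon \<open>H\<close>, the mean \<open>l m\<close> of the sum of
  \<open>\<phi>\<close> over the claims after \<open>s\<close> and up to \<open>t\<close>,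
  restricted to \<open>N H = m + 1\<close>, is computed twice. On the grid it is close to
  \<open>e * P m\<close>, with an error of second order in \<open>t - s\<close>. On the other hand,
  each claim is independent of \<open>N H\<close>, and given \<open>n = m + 1\<close> claims those
  with indices between about \<open>n * s / H\<close> and \<open>n * t / H\<close> fall into the
  interval; this gives \<open>lam * (t - s) * q * P m\<close> up to an error of order
  \<open>sqrt n * P n\<close>. Since \<open>P n / P m = lam * H / n\<close>, the latter error is
  negligible compared with \<open>P m\<close> as \<open>m\<close> tends to infinity.\<close>

lemma increment_mean_zero:
  assumes st: "0 \<le> s" "s \<le> t" and \<phi>: "\<phi> \<in> borel_measurable borel" and bd: "\<And>y. \<bar>\<phi> y\<bar> \<le> B" and \<phi>0: "\<phi> 0 = 0"
  shows "\<bar>(\<integral>w. \<phi> (S t w - S s w) \<partial>M) - lam * (t - s) * claim_mean \<phi>\<bar> \<le> 3 * B * lam\<^sup>2 * (t - s)\<^sup>2"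
proof -
  have B: "0 \<le> B" using bd[of 0] by linarith
  define H where "H = Suc (nat \<lceil>t\<rceil>)"
  have tH: "t < real H" unfolding H_def by linarith
  have Hpos: "0 < real H" by (simp add: H_def)
  define e where "e = (\<integral>w. \<phi> (S t w - S s w) \<partial>M)"
  define \<Phi> where "\<Phi> = (\<lambda>w. \<Sum>i=Suc (N s w)..N t w. \<phi> (Y i w))"
  define P where "P = (\<lambda>n. prob {w\<in>space M. N (real H) w = n})"
  define l where "l = (\<lambda>m. \<integral>w. \<Phi> w * (if N (real H) w = Suc m then 1 else 0) \<partial>M)"
  define q where "q = claim_mean \<phi>"
  have qB: "\<bar>q\<bar> \<le> B" unfolding q_def by (rule claim_mean_bound[OF \<phi> bd])
  have Pv: "P n = (lam * H) ^ n / fact n * exp (- (lam * H))" for n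
    unfolding P_def using count_prob[of "real H" n] Hpos by simp
  have Ppos: "0 < P n" for n using lam_pos Hpos by (simp add: Pv)
  have Pstep: "P (Suc m) = P m * (lam * H / Suc m)" for m by (simp add: Pv field_simps)
  have step1: "\<bar>l m - e * P m\<bar> \<le> 3 * B * lam\<^sup>2 * (t - s)\<^sup>2 * P m" for m
  proof -
    define C where "C = 2 * B * Suc m * (lam\<^sup>2 * H) + B * (lam * H) * (lam\<^sup>2 * H + lam)"
    have "\<bar>l m - e * P m\<bar> \<le> C * (H / Suc k) + 3 * B * lam\<^sup>2 * (t - s)\<^sup>2 * P m" for k
    proof -
      define K where "K = Suc k"
      \<comment> \<open>Truncated subtraction and the minimum make \<open>r a\<close> a ramp from
        \<open>0\<close> at index \<open>a\<close> to \<open>1\<close> at index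
        \<open>a + K\<close>; \<open>p\<close> then traverses \<open>[0, s]\<close>,
        \<open>[s, t]\<close> and \<open>[t, H]\<close> with \<open>K\<close> cells each.\<close>
      define r where "r = (\<lambda>a j. real (min (j - a) K) / K)"
      define p where "p = (\<lambda>j. s * r 0 j + (t - s) * r K j + (H - t) * r (2 * K) j)"
      have r: "0 \<le> r a (Suc j) - r a j" "r a (Suc j) - r a j \<le> 1 / K" for a j
      proof -
        have "min (j - a) K \<le> min (Suc j - a) K" "min (Suc j - a) K \<le> Suc (min (j - a) K)" by auto
        then have "0 \<le> real (min (Suc j - a) K) - real (min (j - a) K)" "real (min (Suc j - a) K) - real (min (j - a) K) \<le> 1" by linarith+
        then show "0 \<le> r a (Suc j) - r a j" "r a (Suc j) - r a j \<le> 1 / K"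
          unfolding r_def diff_divide_distrib[symmetric] by (auto intro!: divide_nonneg_nonneg divide_right_mono)
      qed
      have pd: "p (Suc j) - p j = s * (r 0 (Suc j) - r 0 j) + (t - s) * (r K (Suc j) - r K j) + (H - t) * (r (2 * K) (Suc j) - r (2 * K) j)" for j
        by (simp add: p_def algebra_simps)
      have mono: "p j \<le> p (Suc j)" for j
      proof -
        have "0 \<le> s * (r 0 (Suc j) - r 0 j) + (t - s) * (r K (Suc j) - r K j) + (H - t) * (r (2 * K) (Suc j) - r (2 * K) j)"
          using st tH r(1) by (intro add_nonneg_nonneg mult_nonneg_nonneg) auto
        then show ?thesis using pd[of j] by linarith
      qed
      have mesh: "p (Suc j) - p j \<le> H / K" for j
      proof -
        have "s * (r 0 (Suc j) - r 0 j) + (t - s) * (r K (Suc j) - r K j) + (H - t) * (r (2 * K) (Suc j) - r (2 * K) j)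
          \<le> s * (1 / K) + (t - s) * (1 / K) + (H - t) * (1 / K)"
          using st tH r(2) by (intro add_mono mult_left_mono) auto
        also have "\<dots> = H / K" by (simp add: add_divide_distrib[symmetric])
        finally show ?thesis using pd[of j] by simp
      qed
      have Kp: "0 < real K" by (simp add: K_def)
      have p0: "p 0 = 0" and pK: "p K = s" and p2K: "p (2 * K) = t" and p3K: "p (3 * K) = H"
        using Kp by (auto simp: p_def r_def)
      define sg where "sg = (\<Sum>k=K..<2 * K. \<integral>w. \<phi> (S (p (Suc k)) w - S (p k) w) \<partial>M)"
      have 1: "\<bar>l m - sg * P m\<bar> \<le> C * (H / K)"
        using grid_estimate[OF mono p0 p3K mesh _ _ _ \<phi> bd \<phi>0, of K "2 * K" m]
        unfolding l_def \<Phi>_def P_def sg_def C_def pK p2K by simp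
      have 2: "\<bar>e - sg\<bar> \<le> 3 * B * lam\<^sup>2 * (t - s)\<^sup>2"
        using near_additive[of K "2 * K" p \<phi> B, OF mono _ _ \<phi> bd \<phi>0] st unfolding e_def sg_def pK p2K by simp
      have "\<bar>(e - sg) * P m\<bar> \<le> 3 * B * lam\<^sup>2 * (t - s)\<^sup>2 * P m"
        unfolding abs_mult using 2 Ppos[of m] by (intro mult_mono) auto
      moreover have "l m - e * P m = (l m - sg * P m) - (e - sg) * P m" by (simp add: algebra_simps)
      ultimately show ?thesis using 1 unfolding K_def by linarith
    qed
    moreover have "(\<lambda>k. C * (H / Suc k) + 3 * B * lam\<^sup>2 * (t - s)\<^sup>2 * P m) \<longlonglongrightarrow> C * 0 + 3 * B * lam\<^sup>2 * (t - s)\<^sup>2 * P m"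
    proof (intro tendsto_intros)
      have "(\<lambda>k. real H * (1 / real (Suc k))) \<longlonglongrightarrow> real H * 0" by (intro tendsto_intros LIMSEQ_Suc[OF lim_1_over_n])
      then show "(\<lambda>k. real H / real (Suc k)) \<longlonglongrightarrow> 0" by simp
    qed
    ultimately show ?thesis using LIMSEQ_le_const by force
  qed
  have step2: "\<bar>l m - lam * (t - s) * q * P m\<bar> \<le> B * (2 * sqrt (Suc m) + 4) * P (Suc m)" for m
  proof -
    define n where "n = Suc m"
    \<comment> \<open>Deterministic indices replace the random ones \<open>N s w\<close> and
      \<open>N t w\<close>; rounding costs at most \<open>1\<close> at each end.\<close>
    define a where "a = nat \<lfloor>n * (s / H)\<rfloor>"
    define b where "b = nat \<lfloor>n * (t / H)\<rfloor>"
    have fl: "real a \<le> n * (s / H)" "n * (s / H) < real a + 1" "real b \<le> n * (t / H)" "n * (t / H) < real b + 1"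
      using st Hpos unfolding a_def b_def by (auto simp: of_nat_nat)
    have "n * (s / H) \<le> n * (t / H)" using st Hpos by (intro mult_left_mono divide_right_mono) auto
    then have ab: "a \<le> b" unfolding a_def b_def by (intro nat_mono floor_mono)
    define I where "I = (\<lambda>w. if N (real H) w = n then 1 else 0 :: real)"
    define \<Psi> where "\<Psi> = (\<lambda>w. \<Sum>i=Suc a..b. \<phi> (Y i w))"
    define D where "D = (\<lambda>r w. \<bar>real (N r w) - n * (r / H)\<bar> * I w)"
    have [measurable]: "N (real H) \<in> measurable M (count_space UNIV)" by (rule N_measurable) simp
    have Im [measurable]: "I \<in> borel_measurable M" unfolding I_def by measurable
    have Ii: "integrable M I" by (rule integrable_const_bound[of _ 1]) (auto simp: I_def)
    have IP: "(\<integral>w. I w \<partial>M) = P n"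
    proof -
      have "(\<integral>w. I w \<partial>M) = (\<integral>w. indicator {w\<in>space M. N (real H) w = n} w \<partial>M)"
        by (rule Bochner_Integration.integral_cong[OF refl]) (auto simp: I_def indicator_def)
      moreover have "{w\<in>space M. N (real H) w = n} \<in> sets M" by measurable
      ultimately show ?thesis by (simp add: P_def Int_absorb2)
    qed
    have D: "integrable M (D r)" "(\<integral>w. D r w \<partial>M) \<le> sqrt n * P n" if "0 \<le> r" "r \<le> real H" for r :: real
      using count_deviation[OF that Hpos, of n] by (auto simp: D_def I_def P_def n_def)
    have \<Psi>I: "integrable M (\<lambda>w. \<Psi> w * I w)" "(\<integral>w. \<Psi> w * I w \<partial>M) = (real b - real a) * q * P n"
    proof -
      have i: "integrable M (\<lambda>w. \<phi> (Y i w) * I w)" if "1 \<le> i" for i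
        using measurable_compose[OF Y_measurable[OF that] \<phi>] bd B by (intro integrable_const_bound[of _ B]) (auto simp: I_def)
      show "integrable M (\<lambda>w. \<Psi> w * I w)" unfolding \<Psi>_def sum_distrib_right using i by (intro Bochner_Integration.integrable_sum) auto
      have "(\<integral>w. \<Psi> w * I w \<partial>M) = (\<Sum>i=Suc a..b. \<integral>w. \<phi> (Y i w) * I w \<partial>M)"
        unfolding \<Psi>_def sum_distrib_right using i by (intro Bochner_Integration.integral_sum) auto
      also have "\<dots> = (\<Sum>i=Suc a..b. q * P n)"
        using claim_count_independent[OF _ \<phi> bd, of _ H n] by (intro sum.cong) (auto simp: I_def q_def P_def)
      finally show "(\<integral>w. \<Psi> w * I w \<partial>M) = (real b - real a) * q * P n" using ab by (simp add: of_nat_diff)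
    qed
    have bound: "\<bar>\<Phi> w * I w - \<Psi> w * I w\<bar> \<le> B * (D s w + D t w + 2 * I w)" if w: "w \<in> space M" for w
    proof (cases "N (real H) w = n")
      case True
      define f where "f = (\<lambda>j. \<Sum>i=1..j. \<phi> (Y i w))"
      have "\<Phi> w = f (N t w) - f (N s w)" "\<Psi> w = f b - f a"
        unfolding \<Phi>_def \<Psi>_def f_def using sum_block_eq_diff[OF N_mono[OF w st]] sum_block_eq_diff[OF ab] by auto
      moreover have "\<bar>f i - f j\<bar> \<le> B * \<bar>real i - real j\<bar>" for i j unfolding f_def by (rule sum_diff_le_dist) (rule bd)
      from this[of "N t w" b] this[of "N s w" a]
      have "\<bar>(f (N t w) - f (N s w)) - (f b - f a)\<bar> \<le> B * \<bar>real (N t w) - real b\<bar> + B * \<bar>real (N s w) - real a\<bar>" by linarith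
      moreover have "B * \<bar>real (N t w) - real b\<bar> \<le> B * (\<bar>real (N t w) - n * (t / H)\<bar> + 1)" using fl B by (intro mult_left_mono) auto
      moreover have "B * \<bar>real (N s w) - real a\<bar> \<le> B * (\<bar>real (N s w) - n * (s / H)\<bar> + 1)" using fl B by (intro mult_left_mono) auto
      ultimately have "\<bar>\<Phi> w - \<Psi> w\<bar> \<le> B * (\<bar>real (N t w) - n * (t / H)\<bar> + 1) + B * (\<bar>real (N s w) - n * (s / H)\<bar> + 1)" by simp
      then show ?thesis using True by (simp add: I_def D_def algebra_simps)
    qed (simp add: I_def D_def)
    have Di: "integrable M (\<lambda>w. B * (D s w + D t w + 2 * I w))" using D(1)[of s] D(1)[of t] Ii st tH by simp
    have \<Phi>m: "\<Phi> \<in> borel_measurable M"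
    proof -
      have "\<And>w. w \<in> space M \<Longrightarrow> \<Phi> w = (\<lambda>j w. \<Sum>i=1..j. \<phi> (Y i w)) (N t w) w - (\<lambda>j w. \<Sum>i=1..j. \<phi> (Y i w)) (N s w) w"
        unfolding \<Phi>_def using sum_block_eq_diff[OF N_mono[OF _ st]] by auto
      moreover have "(\<lambda>w. (\<lambda>j w. \<Sum>i=1..j. \<phi> (Y i w)) (N r w) w) \<in> borel_measurable M" if "0 \<le> r" for r
        by (rule measurable_compose_countable[of "\<lambda>j w. \<Sum>i=1..j. \<phi> (Y i w)"])
          (auto intro!: borel_measurable_sum measurable_compose[OF Y_measurable \<phi>] N_measurable that)
      then have "(\<lambda>w. (\<lambda>j w. \<Sum>i=1..j. \<phi> (Y i w)) (N t w) w - (\<lambda>j w. \<Sum>i=1..j. \<phi> (Y i w)) (N s w) w) \<in> borel_measurable M"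
        using st by (intro borel_measurable_diff) auto
      ultimately show ?thesis by (subst measurable_cong) auto
    qed
    have \<Phi>I: "integrable M (\<lambda>w. \<Phi> w * I w)"
    proof -
      have "integrable M (\<lambda>w. \<Phi> w * I w - \<Psi> w * I w)"
      proof (rule Bochner_Integration.integrable_bound[OF Di])
        show "(\<lambda>w. \<Phi> w * I w - \<Psi> w * I w) \<in> borel_measurable M" by (rule borel_measurable_diff[OF borel_measurable_times[OF \<Phi>m Im] borel_measurable_integrable[OF \<Psi>I(1)]])
        show "AE w in M. norm (\<Phi> w * I w - \<Psi> w * I w) \<le> norm (B * (D s w + D t w + 2 * I w))"
          using order_trans[OF bound abs_ge_self] by (intro AE_I2) simp
      qed
      from Bochner_Integration.integrable_add[OF this \<Psi>I(1)] show ?thesis by simp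
    qed
    have "\<bar>(\<integral>w. \<Phi> w * I w \<partial>M) - (\<integral>w. \<Psi> w * I w \<partial>M)\<bar> = \<bar>\<integral>w. \<Phi> w * I w - \<Psi> w * I w \<partial>M\<bar>" using \<Phi>I \<Psi>I(1) by simp
    also have "\<dots> \<le> (\<integral>w. \<bar>\<Phi> w * I w - \<Psi> w * I w\<bar> \<partial>M)" by (rule integral_abs_bound)
    also have "\<dots> \<le> (\<integral>w. B * (D s w + D t w + 2 * I w) \<partial>M)"
      using \<Phi>I \<Psi>I(1) Di bound by (intro integral_mono) auto
    also have "\<dots> = B * ((\<integral>w. D s w \<partial>M) + (\<integral>w. D t w \<partial>M) + 2 * P n)" using D(1)[of s] D(1)[of t] Ii st tH IP by simp
    also have "\<dots> \<le> B * (sqrt n * P n + sqrt n * P n + 2 * P n)" using D(2)[of s] D(2)[of t] st tH B by (intro mult_left_mono add_mono) auto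
    finally have 1: "\<bar>l m - (real b - real a) * q * P n\<bar> \<le> B * (2 * sqrt n + 2) * P n"
      unfolding \<Psi>I(2) by (simp add: l_def I_def n_def algebra_simps)
    \<comment> \<open>The factor \<open>n\<close> and the horizon \<open>H\<close> cancel against
      the ratio of consecutive Poisson weights, so both computations can be compared at the same
      weight \<open>P m\<close>.\<close>
    have 2: "lam * (t - s) * q * P m = n * ((t - s) / H) * q * P n"
      using Hpos unfolding n_def Pstep[of m] by simp
    have d: "n * ((t - s) / H) = n * (t / H) - n * (s / H)" by (simp add: diff_divide_distrib right_diff_distrib)
    have 3: "\<bar>((real b - real a) - n * ((t - s) / H)) * (q * P n)\<bar> \<le> 2 * (B * P n)"
      proof -
      have "\<bar>(real b - real a) - n * ((t - s) / H)\<bar> \<le> 2" unfolding d using fl by linarith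
      moreover have "\<bar>q * P n\<bar> \<le> B * P n" using qB Ppos[of n] by (simp add: abs_mult)
      ultimately show ?thesis unfolding abs_mult[of _ "q * P n"] by (intro mult_mono) auto
    qed
    have "l m - lam * (t - s) * q * P m = (l m - (real b - real a) * q * P n) + ((real b - real a) - n * ((t - s) / H)) * (q * P n)"
      unfolding 2 by (simp add: algebra_simps)
    then have "\<bar>l m - lam * (t - s) * q * P m\<bar> \<le> B * (2 * sqrt n + 2) * P n + 2 * (B * P n)" using 1 3 by linarith
    then show ?thesis by (simp add: n_def algebra_simps)
  qed
  have "\<bar>e - lam * (t - s) * q\<bar> \<le> 3 * B * lam\<^sup>2 * (t - s)\<^sup>2 + \<epsilon>" if \<epsilon>: "0 < \<epsilon>" for \<epsilon>
  proof -
    \<comment> \<open>\<open>k / sqrt n\<close> is the error relative to \<open>P m\<close>: it is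
      \<open>B * 6 * sqrt n\<close> times the ratio \<open>lam * H / n\<close> of the
      weights.\<close>
    define k where "k = 6 * B * lam * H"
    have k: "0 \<le> k" using B lam_pos by (simp add: k_def)
    obtain m :: nat where m: "(k / \<epsilon>)\<^sup>2 \<le> real m" using real_arch_simple by blast
    define n where "n = real (Suc m)"
    have n: "1 \<le> n" "(k / \<epsilon>)\<^sup>2 \<le> n" using m by (auto simp: n_def)
    then have sq: "k / \<epsilon> \<le> sqrt n" "1 \<le> sqrt n" by (auto intro: real_le_rsqrt)
    have "\<bar>(e - lam * (t - s) * q) * P m\<bar> \<le> 3 * B * lam\<^sup>2 * (t - s)\<^sup>2 * P m + B * (2 * sqrt n + 4) * P (Suc m)"
      using step1[of m] step2[of m] unfolding n_def[symmetric] left_diff_distrib by linarith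
    also have "B * (2 * sqrt n + 4) * P (Suc m) \<le> B * (6 * sqrt n) * P (Suc m)"
      using sq B Ppos[of "Suc m"] by (intro mult_right_mono mult_left_mono) auto
    also have "B * (6 * sqrt n) * P (Suc m) = k * (sqrt n / n) * P m" unfolding Pstep[of m] n_def[symmetric] by (simp add: k_def)
    also have "sqrt n / n = 1 / sqrt n" using n(1) by (simp add: field_simps)
    also have "k * (1 / sqrt n) * P m \<le> \<epsilon> * P m"
    proof (rule mult_right_mono)
      have "k \<le> \<epsilon> * sqrt n" using sq(1) \<epsilon> by (simp add: field_simps)
      then show "k * (1 / sqrt n) \<le> \<epsilon>" using sq(2) by (simp add: divide_le_eq)
    qed (use Ppos[of m] in simp)
    finally have "\<bar>e - lam * (t - s) * q\<bar> * P m \<le> (3 * B * lam\<^sup>2 * (t - s)\<^sup>2 + \<epsilon>) * P m"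
      using Ppos[of m] by (simp add: abs_mult distrib_right)
    then show ?thesis using Ppos[of m] by simp
  qed
  then show ?thesis unfolding e_def q_def by (rule field_le_epsilon)
qed

lemma increment_mean:
  assumes st: "0 \<le> s" "s \<le> t" and \<phi>: "\<phi> \<in> borel_measurable borel" and bd: "\<And>y. \<bar>\<phi> y\<bar> \<le> B"
  shows "\<bar>(\<integral>w. \<phi> (S t w - S s w) \<partial>M) - ((1 - lam * (t - s)) * \<phi> 0 + lam * (t - s) * claim_mean \<phi>)\<bar> \<le> 6 * B * lam\<^sup>2 * (t - s)\<^sup>2"
proof -
  \<comment> \<open>Subtracting the value at \<open>0\<close> doubles the bound on the function,
    which turns the constant \<open>3\<close> into \<open>6\<close>.\<close>
  define \<psi> where "\<psi> = (\<lambda>y. \<phi> y - \<phi> 0)"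
  have \<psi>: "\<psi> \<in> borel_measurable borel" using \<phi> by (simp add: \<psi>_def)
  have \<psi>b: "\<bar>\<psi> y\<bar> \<le> 2 * B" for y using bd[of y] bd[of 0] unfolding \<psi>_def by linarith
  have i: "integrable M (\<lambda>w. \<phi> (S t w - S s w))"
    using measurable_compose[OF increment_measurable[OF st] \<phi>] bd by (intro integrable_const_bound[of _ B]) auto
  have j: "integrable M (\<lambda>w. \<phi> (Y 1 w))"
    using measurable_compose[OF Y_measurable[of 1] \<phi>] bd by (intro integrable_const_bound[of _ B]) auto
  have c: "claim_mean \<psi> = claim_mean \<phi> - \<phi> 0"
    using Y_mean[OF _ \<psi>, of 1] Y_mean[OF _ \<phi>, of 1] j by (simp add: \<psi>_def prob_space)
  have m: "(\<integral>w. \<psi> (S t w - S s w) \<partial>M) = (\<integral>w. \<phi> (S t w - S s w) \<partial>M) - \<phi> 0"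
    using i by (simp add: \<psi>_def prob_space)
  have eq: "(\<integral>w. \<psi> (S t w - S s w) \<partial>M) - lam * (t - s) * claim_mean \<psi>
      = (\<integral>w. \<phi> (S t w - S s w) \<partial>M) - ((1 - lam * (t - s)) * \<phi> 0 + lam * (t - s) * claim_mean \<phi>)"
    unfolding c m by (simp add: algebra_simps)
  have "\<psi> 0 = 0" by (simp add: \<psi>_def)
  from increment_mean_zero[OF st \<psi> \<psi>b this] show ?thesis unfolding eq by simp
qed

end

section \<open>One-step estimates for a candidate value function\<close>

context dividend_model begin

lemma G_le: "0 \<le> y \<Longrightarrow> G y \<le> g 0 + L * y"
  using G_lip[of y 0] by (simp add: G_def abs_le_iff)

context
  fixes v v' :: "real \<Rightarrow> real" and Bv :: real
  assumes hv: "has_hderiv v v'" and cv': "continuous_on {0..} v'" and vB: "\<And>y. 0 \<le> y \<Longrightarrow> \<bar>v y\<bar> \<le> Bv"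
    and hjb_eq: "\<And>y. 0 \<le> y \<Longrightarrow> g y * v' y - (lam + \<delta>) * v y + lam * exp_conv \<alpha> v y + u0 * max 0 (1 - v' y) = 0"
begin

text \<open>The value after ruin is \<open>0\<close>; with this continuation the convolution over
  \<open>[0, y]\<close> becomes a full mean over the claim size.\<close>

definition vb :: "real \<Rightarrow> real" where "vb y = (if y < 0 then 0 else v y)"

lemma Bv_nonneg: "0 \<le> Bv"
  using vB[of 0] by linarith

lemma vb_bound: "\<bar>vb y\<bar> \<le> Bv"
  using vB[of y] Bv_nonneg by (simp add: vb_def)

lemma vb_measurable [measurable]: "vb \<in> borel_measurable borel"
proof -
  have [measurable]: "(\<lambda>y. v (max 0 y)) \<in> borel_measurable borel"
    by (intro borel_measurable_continuous_onI continuous_on_halfline_extend has_hderiv_continuous[OF hv])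
  have "(\<lambda>y. if y < 0 then 0 else v (max 0 y)) \<in> borel_measurable borel" by measurable
  moreover have "(\<lambda>y. if y < 0 then 0 else v (max 0 y)) = vb" by (auto simp: vb_def fun_eq_iff)
  ultimately show ?thesis by simp
qed

lemma claim_mean_vb:
  assumes "0 \<le> y"
  shows "claim_mean (\<lambda>z. vb (y - z)) = exp_conv \<alpha> v y"
  unfolding claim_mean_def exp_conv_def set_lebesgue_integral_def
  by (rule Bochner_Integration.integral_cong[OF refl])
    (auto simp: vb_def exponential_density_def indicator_def mult.commute)

text \<open>\<open>h0\<close> depends neither on the path nor on the rate: uniform continuity of
  \<open>v'\<close> on \<open>[0, K]\<close> takes the place of a bound on a second derivative. The
  term with \<open>1 - v'\<close> keeps the dividends actually paid, so that a scheme can be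
  compared with the maximising rate afterwards.\<close>

lemma no_jump_step:
  assumes K: "0 \<le> K" and \<epsilon>: "0 < \<epsilon>"
  obtains h0 where "0 < h0"
    "\<And>h t X r. 0 < h \<Longrightarrow> h \<le> h0 \<Longrightarrow> set_integrable lborel {t..t + h} (\<lambda>s. G (X s)) \<Longrightarrow> set_integrable lborel {t..t + h} r \<Longrightarrow>
      (\<And>s. t \<le> s \<Longrightarrow> s \<le> t + h \<Longrightarrow> 0 \<le> X t \<and> X t \<le> X s \<and> X s \<le> K \<and> X s = X t + (LBINT q:{t..s}. G (X q) - r q)) \<Longrightarrow>
      (\<And>s. 0 \<le> r s \<and> r s \<le> u0) \<Longrightarrow>
      \<bar>exp (- \<delta> * h) * v (X (t + h)) - v (X t) + (LBINT s:{t..t + h}. exp (- \<delta> * (s - t)) * r s)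
        - (h * (g (X t) * v' (X t) - \<delta> * v (X t)) + (LBINT s:{t..t + h}. r s) * (1 - v' (X t)))\<bar> \<le> \<epsilon> * h"
proof -
  define Gm where "Gm = g 0 + L * K"
  have Gm: "0 < Gm" using g_ge[of 0] u0_pos c_pos L_pos K by (simp add: Gm_def add_pos_nonneg)
  have Gb: "G y \<le> Gm" if "0 \<le> y" "y \<le> K" for y
  proof -
    have "L * y \<le> L * K" using that L_pos by (intro mult_left_mono) auto
    then show ?thesis using G_le[OF that(1)] by (simp add: Gm_def)
  qed
  have ck: "continuous_on {0..K} v'" using cv' by (rule continuous_on_subset) auto
  have "compact (v' ` {0..K})" by (intro compact_continuous_image ck) simp
  then obtain V0 where V0: "\<forall>y\<in>v' ` {0..K}. norm y \<le> V0" using compact_imp_bounded bounded_iff by metis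
  define V1 where "V1 = max V0 0"
  have V1: "\<bar>v' y\<bar> \<le> V1" if "0 \<le> y" "y \<le> K" for y using V0 that by (auto simp: V1_def intro: max.coboundedI1)
  have V1n: "0 \<le> V1" by (simp add: V1_def)
  \<comment> \<open>Half of the error is reserved for the oscillation of \<open>v'\<close> over an
    increment of at most \<open>Gm * h\<close>, the other half for the quadratic terms collected in
    \<open>C2\<close>.\<close>
  define \<epsilon>1 where "\<epsilon>1 = \<epsilon> / (2 * (Gm + 1))"
  have \<epsilon>1: "0 < \<epsilon>1" using \<epsilon> Gm by (simp add: \<epsilon>1_def)
  have "uniformly_continuous_on {0..K} v'" by (rule compact_uniformly_continuous[OF ck]) simp
  then obtain \<eta> where \<eta>: "0 < \<eta>" "\<And>y z. y \<in> {0..K} \<Longrightarrow> z \<in> {0..K} \<Longrightarrow> dist z y < \<eta> \<Longrightarrow> dist (v' z) (v' y) < \<epsilon>1"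
    unfolding uniformly_continuous_on_def using \<epsilon>1 by metis
  \<comment> \<open>The first two summands come from discounting the value (\<open>T1\<close>), the
    third from the Lipschitz drift (\<open>T2\<close>), the last from the discount inside the
    dividend integral (\<open>T3\<close>).\<close>
  define C2 where "C2 = \<delta>\<^sup>2 * Bv + \<delta> * V1 * Gm + V1 * L * Gm + \<delta> * u0"
  have C2: "0 \<le> C2" unfolding C2_def using Bv_nonneg V1n Gm delta_pos L_pos u0_pos by (intro add_nonneg_nonneg mult_nonneg_nonneg) auto
  define h0 where "h0 = min (\<eta> / (2 * (Gm + 1))) (\<epsilon> / (2 * (C2 + 1)))"
  have h0: "0 < h0" using \<eta>(1) Gm \<epsilon> C2 by (simp add: h0_def)
  show ?thesis
  proof (rule that[OF h0])
    fix h t :: real and X r :: "real \<Rightarrow> real"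
    assume h: "0 < h" "h \<le> h0" and iG: "set_integrable lborel {t..t + h} (\<lambda>s. G (X s))" and ir: "set_integrable lborel {t..t + h} r"
      and X: "\<And>s. t \<le> s \<Longrightarrow> s \<le> t + h \<Longrightarrow> 0 \<le> X t \<and> X t \<le> X s \<and> X s \<le> K \<and> X s = X t + (LBINT q:{t..s}. G (X q) - r q)"
      and r: "\<And>s. 0 \<le> r s \<and> r s \<le> u0"
    define a where "a = X t"
    define b where "b = X (t + h)"
    define U where "U = (LBINT s:{t..t + h}. r s)"
    define I where "I = (LBINT s:{t..t + h}. G (X s))"
    have th: "t \<le> t + h" using h by simp
    have a: "0 \<le> a" "a \<le> K" using X[of t] h by (auto simp: a_def)
    have b: "a \<le> b" "b \<le> K" "0 \<le> b" using X[of "t + h"] h by (auto simp: a_def b_def)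
    have "0 * (t + h - t) \<le> U" unfolding U_def by (rule set_integral_Icc_bounds(1)[OF ir th]) (use r in auto)
    moreover have "U \<le> u0 * (t + h - t)" unfolding U_def by (rule set_integral_Icc_bounds(2)[OF ir th]) (use r in auto)
    ultimately have U: "0 \<le> U" "U \<le> u0 * h" by simp_all
    have bI: "b - a = I - U"
      using X[of "t + h"] h set_integral_diff(2)[OF iG ir] by (simp add: a_def b_def I_def U_def)
    have Xs: "X s - a \<le> Gm * h" if s: "t \<le> s" "s \<le> t + h" for s
    proof -
      have i: "set_integrable lborel {t..s} (\<lambda>q. G (X q) - r q)"
        by (rule set_integrable_subset[of _ "{t..t + h}"]) (use iG ir s in auto)
      have "(LBINT q:{t..s}. G (X q) - r q) \<le> Gm * (s - t)"
      proof (rule set_integral_Icc_bounds(2)[OF i s(1)])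
        fix q assume "t \<le> q" "q \<le> s"
        then show "G (X q) - r q \<le> Gm" using Gb[of "X q"] X[of q] r[of q] s by fastforce
      qed
      also have "\<dots> \<le> Gm * h" using s Gm by (intro mult_left_mono) auto
      finally show ?thesis using X[OF s] by (simp add: a_def)
    qed
    have Gmh: "Gm * h < \<eta>"
    proof -
      have "h * (2 * (Gm + 1)) \<le> \<eta>" using h(2) Gm by (simp add: h0_def field_simps)
      moreover have "0 < Gm * h" using h Gm by simp
      then have "Gm * h < h * (2 * (Gm + 1))" using h by (simp add: algebra_simps)
      ultimately show ?thesis by simp
    qed
    have I: "\<bar>I - h * g a\<bar> \<le> L * Gm * h * h"
    proof -
      have G1: "\<bar>G (X s) - g a\<bar> \<le> L * Gm * h" if s: "t \<le> s" "s \<le> t + h" for s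
      proof -
        have "\<bar>G (X s) - G a\<bar> \<le> L * \<bar>X s - a\<bar>" by (rule G_lip)
        also have "\<dots> \<le> L * (Gm * h)" using Xs[OF s] X[OF s] L_pos by (intro mult_left_mono) (auto simp: a_def)
        finally show ?thesis using G_eq[OF a(1)] by (simp add: mult.assoc)
      qed
      have "(g a - L * Gm * h) * (t + h - t) \<le> I" unfolding I_def
        by (rule set_integral_Icc_bounds(1)[OF iG th]) (use G1 in \<open>force simp: abs_le_iff\<close>)
      moreover have "I \<le> (g a + L * Gm * h) * (t + h - t)" unfolding I_def
        by (rule set_integral_Icc_bounds(2)[OF iG th]) (use G1 in \<open>force simp: abs_le_iff\<close>)
      ultimately show ?thesis by (simp add: abs_le_iff algebra_simps)
    qed
    obtain \<xi> where \<xi>: "a \<le> \<xi>" "\<xi> \<le> b" "v b - v a = v' \<xi> * (b - a)"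
    proof (cases "a = b")
      case False
      then have "a < b" using b by simp
      then obtain z where "a < z" "z < b" "v b - v a = (b - a) * v' z" using has_hderiv_mvt[OF hv a(1)] by blast
      then show ?thesis using that[of z] by (simp add: mult.commute)
    qed (use that[of a] in simp)
    have ba: "0 \<le> b - a" "b - a \<le> Gm * h" using b Xs[of "t + h"] h by (auto simp: b_def)
    have vd: "\<bar>v' \<xi> - v' a\<bar> \<le> \<epsilon>1"
      using \<eta>(2)[of a \<xi>] \<xi> a b ba Gmh by (force simp: dist_real_def)
    define T2 where "T2 = v b - v a - v' a * (h * g a - U)"
    have T2: "\<bar>T2\<bar> \<le> \<epsilon>1 * (Gm * h) + V1 * (L * Gm * h * h)"
    proof -
      have e: "T2 = (v' \<xi> - v' a) * (b - a) + v' a * (I - h * g a)" unfolding T2_def \<xi>(3) bI by (simp add: algebra_simps)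
      have "\<bar>(v' \<xi> - v' a) * (b - a)\<bar> \<le> \<epsilon>1 * (Gm * h)" unfolding abs_mult using vd ba \<epsilon>1 by (intro mult_mono) auto
      moreover have "\<bar>v' a * (I - h * g a)\<bar> \<le> V1 * (L * Gm * h * h)" unfolding abs_mult using V1[OF a] I V1n by (intro mult_mono) auto
      ultimately show ?thesis unfolding e by linarith
    qed
    define T1 where "T1 = (exp (- \<delta> * h) - 1) * v b + \<delta> * h * v a"
    have T1: "\<bar>T1\<bar> \<le> (\<delta> * h)\<^sup>2 * Bv + \<delta> * h * (V1 * (Gm * h))"
    proof -
      have e: "T1 = (exp (- (\<delta> * h)) - (1 - \<delta> * h)) * v b - \<delta> * h * (v b - v a)" by (simp add: T1_def algebra_simps)
      have "\<bar>(exp (- (\<delta> * h)) - (1 - \<delta> * h)) * v b\<bar> \<le> (\<delta> * h)\<^sup>2 * Bv"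
        unfolding abs_mult using exp_minus_bounds[of "\<delta> * h"] delta_pos h vB[OF b(3)] by (intro mult_mono) auto
      moreover have "\<bar>\<delta> * h * (v b - v a)\<bar> \<le> \<delta> * h * (V1 * (Gm * h))"
      proof -
        have "\<bar>v b - v a\<bar> \<le> V1 * (Gm * h)" unfolding \<xi>(3) abs_mult using V1[of \<xi>] \<xi> a b ba V1n by (intro mult_mono) auto
        then show ?thesis using delta_pos h by (simp add: abs_mult mult_left_mono)
      qed
      ultimately show ?thesis unfolding e by linarith
    qed
    define E where "E = (LBINT s:{t..t + h}. exp (- \<delta> * (s - t)) * r s)"
    have iE: "set_integrable lborel {t..t + h} (\<lambda>s. exp (- \<delta> * (s - t)) * r s)"
    proof (rule set_integrable_bound[OF ir])
      have "set_borel_measurable lborel {t..t + h} r" using ir by (simp add: set_integrable_def set_borel_measurable_def borel_measurable_integrable)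
      then have "(\<lambda>s. exp (- \<delta> * (s - t)) * (indicat_real {t..t + h} s *\<^sub>R r s)) \<in> borel_measurable lborel"
        unfolding set_borel_measurable_def by (intro borel_measurable_times) auto
      then show "set_borel_measurable lborel {t..t + h} (\<lambda>s. exp (- \<delta> * (s - t)) * r s)"
        by (simp add: set_borel_measurable_def mult.left_commute)
      show "AE s in lborel. s \<in> {t..t + h} \<longrightarrow> norm (exp (- \<delta> * (s - t)) * r s) \<le> norm (r s)"
        using delta_pos r by (intro AE_I2) (auto simp: abs_mult intro!: mult_left_le_one_le)
    qed
    have T3: "\<bar>E - U\<bar> \<le> \<delta> * h * (u0 * h)"
    proof -
      have "E \<le> U" unfolding E_def U_def
        by (rule set_integral_mono[OF iE ir]) (use delta_pos r in \<open>auto intro!: mult_left_le_one_le\<close>)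
      moreover have "(1 - \<delta> * h) * U \<le> E"
      proof -
        have "(LBINT s:{t..t + h}. (1 - \<delta> * h) * r s) \<le> E" unfolding E_def
        proof (rule set_integral_mono[OF _ iE])
          show "set_integrable lborel {t..t + h} (\<lambda>s. (1 - \<delta> * h) * r s)" using ir by simp
          fix s assume s: "s \<in> {t..t + h}"
          have "1 - \<delta> * h \<le> 1 - \<delta> * (s - t)" using s delta_pos by simp
          also have "\<dots> \<le> exp (- \<delta> * (s - t))" using exp_ge_add_one_self[of "- \<delta> * (s - t)"] by simp
          finally show "(1 - \<delta> * h) * r s \<le> exp (- \<delta> * (s - t)) * r s" using r[of s] by (intro mult_right_mono) auto
        qed
        then show ?thesis by (simp add: U_def)
      qed
      moreover have "\<delta> * h * U \<le> \<delta> * h * (u0 * h)" using U delta_pos h by (intro mult_left_mono) auto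
      ultimately show ?thesis by (simp add: abs_le_iff algebra_simps)
    qed
    have "exp (- \<delta> * h) * v b - v a + E - (h * (g a * v' a - \<delta> * v a) + U * (1 - v' a)) = T1 + T2 + (E - U)"
      by (simp add: T1_def T2_def algebra_simps)
    moreover have "\<bar>T1 + T2 + (E - U)\<bar> \<le> \<epsilon>1 * (Gm * h) + C2 * (h * h)"
    proof -
      have "(\<delta> * h)\<^sup>2 * Bv + \<delta> * h * (V1 * (Gm * h)) + V1 * (L * Gm * h * h) + \<delta> * h * (u0 * h) = C2 * (h * h)"
        by (simp add: C2_def power2_eq_square algebra_simps)
      then show ?thesis using T1 T2 T3 by linarith
    qed
    moreover have "\<epsilon>1 * (Gm * h) + C2 * (h * h) \<le> \<epsilon> * h"
    proof -
      have "\<epsilon>1 * Gm \<le> \<epsilon> / 2" using \<epsilon> Gm by (simp add: \<epsilon>1_def field_simps)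
      moreover have "C2 * h \<le> \<epsilon> / 2"
      proof -
        have "h * (2 * (C2 + 1)) \<le> \<epsilon>" using h(2) C2 by (simp add: h0_def field_simps)
        then show ?thesis using h C2 by (simp add: algebra_simps)
      qed
      ultimately have "(\<epsilon>1 * Gm + C2 * h) * h \<le> \<epsilon> * h" using h by (intro mult_right_mono) auto
      then show ?thesis by (simp add: algebra_simps)
    qed
    ultimately show "\<bar>exp (- \<delta> * h) * v (X (t + h)) - v (X t) + (LBINT s:{t..t + h}. exp (- \<delta> * (s - t)) * r s)
        - (h * (g (X t) * v' (X t) - \<delta> * v (X t)) + (LBINT s:{t..t + h}. r s) * (1 - v' (X t)))\<bar> \<le> \<epsilon> * h"
      unfolding a_def b_def E_def U_def by linarith
  qed
qed

text \<open>First-order bound for the change of the discounted value over a step of length \<open>h\<close>, given the surplus \<open>w\<close>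
  and the claims \<open>y\<close> of the step; the last term covers claims that may or may not cause ruin. A negative
  \<open>w\<close> stands for a ruined path, and \<open>\<sigma> = \<plusminus> 1\<close> yields upper and lower bounds.\<close>

definition step_bound :: "real \<Rightarrow> real \<Rightarrow> real \<Rightarrow> real \<Rightarrow> real \<Rightarrow> real \<Rightarrow> real" where
  "step_bound \<sigma> \<epsilon> Gm h w y = (if w < 0 then 0
     else if y = 0 then \<sigma> * (h * (lam * (vb w - claim_mean (\<lambda>z. vb (w - z))))) + \<epsilon> * h
     else \<sigma> * (vb (w - y) - vb w) + \<epsilon> + Bv * (if w < y \<and> y \<le> w + Gm * h then 1 else 0))"

lemma step_bound_measurable: "case_prod (step_bound \<sigma> \<epsilon> Gm h) \<in> borel_measurable (borel \<Otimes>\<^sub>M borel)"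
proof -
  have [measurable]: "(\<lambda>w. claim_mean (\<lambda>z. vb (w - z))) \<in> borel_measurable borel"
    unfolding claim_mean_def by (rule lborel.borel_measurable_lebesgue_integral) measurable
  have "(\<lambda>p. if fst p < 0 then 0
     else if snd p = 0 then \<sigma> * (h * (lam * (vb (fst p) - claim_mean (\<lambda>z. vb (fst p - z))))) + \<epsilon> * h
     else \<sigma> * (vb (fst p - snd p) - vb (fst p)) + \<epsilon> + Bv * (if fst p < snd p \<and> snd p \<le> fst p + Gm * h then 1 else 0))
     \<in> borel_measurable (borel \<Otimes>\<^sub>M borel)"
    by measurable
  then show ?thesis by (simp add: step_bound_def split_def)
qed

lemma step_bound_bounded:
  assumes \<sigma>: "\<bar>\<sigma>\<bar> = 1" and \<epsilon>: "0 \<le> \<epsilon>" "\<epsilon> \<le> 1" and h: "0 \<le> h" "h \<le> 1"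
  shows "\<bar>step_bound \<sigma> \<epsilon> Gm h w y\<bar> \<le> 2 * lam * Bv + 3 * Bv + 1"
proof -
  have cm: "\<bar>claim_mean (\<lambda>z. vb (w - z))\<bar> \<le> Bv" by (rule claim_mean_bound) (simp_all add: vb_bound)
  have "\<bar>vb w - claim_mean (\<lambda>z. vb (w - z))\<bar> \<le> 2 * Bv" using cm vb_bound[of w] by linarith
  then have "lam * \<bar>vb w - claim_mean (\<lambda>z. vb (w - z))\<bar> \<le> lam * (2 * Bv)" using lam_pos by (intro mult_left_mono) auto
  then have "h * (lam * \<bar>vb w - claim_mean (\<lambda>z. vb (w - z))\<bar>) \<le> 1 * (lam * (2 * Bv))"
    using h lam_pos by (intro mult_mono) auto
  then have 1: "\<bar>\<sigma> * (h * (lam * (vb w - claim_mean (\<lambda>z. vb (w - z)))))\<bar> \<le> 2 * lam * Bv"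
    using \<sigma> h lam_pos by (simp add: abs_mult)
  have 2: "\<bar>\<sigma> * (vb (w - y) - vb w)\<bar> \<le> 2 * Bv" using \<sigma> vb_bound[of w] vb_bound[of "w - y"] by (simp add: abs_mult) 
  have 3: "0 \<le> \<epsilon> * h" "\<epsilon> * h \<le> 1" using \<epsilon> h by (auto intro: mult_le_one)
  have 4: "0 \<le> 2 * lam * Bv" using lam_pos Bv_nonneg by simp
  show ?thesis using 1 2 3 4 \<epsilon> Bv_nonneg unfolding step_bound_def by (auto simp: abs_le_iff)
qed

text \<open>The main terms cancel to first order: without a claim there is
  \<open>h * lam * (vb w - m)\<close>, and with probability about \<open>lam * h\<close> there is
  \<open>m - vb w\<close>, where \<open>m\<close> is the mean value after a claim. What remains is a
  multiple of \<open>\<epsilon> * h\<close> or of order \<open>h^2\<close>; for the indicator this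
  holds because a claim falls into a window of length \<open>Gm * h\<close> with probability at most
  \<open>\<alpha> * Gm * h\<close>.\<close>

lemma step_bound_mean:
  assumes \<sigma>: "\<bar>\<sigma>\<bar> = 1" and \<epsilon>: "0 < \<epsilon>" "\<epsilon> \<le> 1" and Gm: "0 \<le> Gm"
  obtains h1 where "0 < h1" "\<And>h s w. 0 < h \<Longrightarrow> h \<le> h1 \<Longrightarrow> 0 \<le> s \<Longrightarrow>
    (\<integral>z. step_bound \<sigma> \<epsilon> Gm h w (S (s + h) z - S s z) \<partial>M) \<le> (2 + lam) * \<epsilon> * h"
proof -
  define B where "B = 2 * lam * Bv + 3 * Bv + 1"
  have B: "0 \<le> B" using lam_pos Bv_nonneg by (simp add: B_def)
  \<comment> \<open>Collects the coefficients of \<open>h^2\<close>: the no-claim term times the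
    probability of a claim, the ruin window, and the error of \<open>increment_mean\<close>.\<close>
  define C where "C = lam * (2 * lam * Bv) + lam * (Bv * (\<alpha> * Gm)) + 6 * B * lam\<^sup>2"
  have C: "0 \<le> C" unfolding C_def using lam_pos Bv_nonneg alpha_pos Gm B by simp
  define h1 where "h1 = min (min 1 (1 / lam)) (\<epsilon> / (C + 1))"
  have h1: "0 < h1" using C \<epsilon> lam_pos by (simp add: h1_def)
  show ?thesis
  proof (rule that[OF h1])
    fix h s w :: real assume h: "0 < h" "h \<le> h1" and s: "0 \<le> s"
    have h': "h \<le> 1" "lam * h \<le> 1" "C * h \<le> \<epsilon>"
    proof -
      show "h \<le> 1" using h by (simp add: h1_def)
      have "h \<le> 1 / lam" using h by (simp add: h1_def)
      then show "lam * h \<le> 1" using lam_pos by (simp add: field_simps)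
      have "h \<le> \<epsilon> / (C + 1)" using h by (simp add: h1_def)
      then have "h * (C + 1) \<le> \<epsilon>" using C by (simp add: field_simps)
      then show "C * h \<le> \<epsilon>" using h C by (simp add: algebra_simps)
    qed
    define \<phi> where "\<phi> = step_bound \<sigma> \<epsilon> Gm h w"
    have \<phi>m [measurable]: "\<phi> \<in> borel_measurable borel"
      using measurable_compose[OF measurable_Pair1' step_bound_measurable, of w \<sigma> \<epsilon> Gm h] by (simp add: \<phi>_def)
    have \<phi>b: "\<bar>\<phi> y\<bar> \<le> B" for y unfolding \<phi>_def B_def using step_bound_bounded[OF \<sigma> _ \<epsilon>(2) _ h'(1)] \<epsilon> h by simp
    have "(\<integral>z. \<phi> (S (s + h) z - S s z) \<partial>M) \<le> (1 - lam * h) * \<phi> 0 + lam * h * claim_mean \<phi> + 6 * B * lam\<^sup>2 * h\<^sup>2"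
      using increment_mean[OF s _ \<phi>m \<phi>b, of "s + h"] h by (simp add: abs_le_iff)
    also have "\<dots> \<le> (2 + lam) * \<epsilon> * h"
    proof (cases "w < 0")
      case True
      then have z: "\<phi> y = 0" for y by (simp add: \<phi>_def step_bound_def)
      then have "claim_mean \<phi> = 0" by (simp add: claim_mean_def)
      have "6 * B * lam\<^sup>2 * h \<le> C * h" using h lam_pos Bv_nonneg alpha_pos Gm by (intro mult_right_mono) (auto simp: C_def)
      moreover have "0 \<le> lam * \<epsilon>" using lam_pos \<epsilon> by simp
      ultimately have "6 * B * lam\<^sup>2 * h \<le> (2 + lam) * \<epsilon>" unfolding distrib_right using h'(3) \<epsilon> by linarith
      then have "6 * B * lam\<^sup>2 * h * h \<le> (2 + lam) * \<epsilon> * h" using h by (intro mult_right_mono) auto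
      then show ?thesis using z \<open>claim_mean \<phi> = 0\<close> by (simp add: power2_eq_square mult.assoc)
    next
      case False
      then have w: "0 \<le> w" by simp
      define m where "m = claim_mean (\<lambda>z. vb (w - z))"
      define ind where "ind = (\<lambda>y. if w < y \<and> y \<le> w + Gm * h then 1 else 0 :: real)"
      have iv: "integrable lborel (\<lambda>y. exponential_density \<alpha> y * f y)" if [measurable]: "f \<in> borel_measurable borel" and "\<And>y. \<bar>f y\<bar> \<le> D" for f D
      proof (rule Bochner_Integration.integrable_bound[of lborel "\<lambda>y. D * exponential_density \<alpha> y"])
        have "integrable lborel (exponential_density \<alpha>)"
        proof -
          interpret E: prob_space "density lborel (exponential_density \<alpha>)" by (rule prob_space_exponential_density[OF alpha_pos])
          have "integrable (density lborel (exponential_density \<alpha>)) (\<lambda>_. 1::real)" by simp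
          then show ?thesis using alpha_pos by (subst (asm) integrable_density) (auto simp: exponential_density_nonneg)
        qed
        then show "integrable lborel (\<lambda>y. D * exponential_density \<alpha> y)" by simp
        show "AE y in lborel. norm (exponential_density \<alpha> y * f y) \<le> norm (D * exponential_density \<alpha> y)"
        proof (rule AE_I2)
          fix y
          have "\<bar>f y\<bar> \<le> \<bar>D\<bar>" using that(2)[of y] by linarith
          then show "norm (exponential_density \<alpha> y * f y) \<le> norm (D * exponential_density \<alpha> y)"
            by (simp add: abs_mult mult.commute mult_right_mono)
        qed
      qed measurable
      have mI: "claim_mean ind \<le> \<alpha> * (Gm * h)"
      proof -
        have "claim_mean ind \<le> (\<integral>y. indicator {w..w + Gm * h} y * \<alpha> \<partial>lborel)" unfolding claim_mean_def
        proof (rule integral_mono)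
          show "integrable lborel (\<lambda>y. exponential_density \<alpha> y * ind y)" by (rule iv[of _ 1]) (auto simp: ind_def)
          show "integrable lborel (\<lambda>y. indicator {w..w + Gm * h} y * \<alpha>)"
            using borel_integrable_atLeastAtMost'[of w "w + Gm * h" "\<lambda>_. \<alpha>"] by (simp add: set_integrable_def)
          fix y
          have "exponential_density \<alpha> y \<le> \<alpha>" using alpha_pos by (auto simp: exponential_density_def)
          then show "exponential_density \<alpha> y * ind y \<le> indicator {w..w + Gm * h} y * \<alpha>"
            using alpha_pos by (auto simp: ind_def indicator_def)
        qed
        also have "\<dots> = \<alpha> * (Gm * h)" using Gm h by simp
        finally show ?thesis .
      qed
      have \<phi>0: "\<phi> 0 = \<sigma> * (h * (lam * (vb w - m))) + \<epsilon> * h" using w by (simp add: \<phi>_def step_bound_def m_def)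
      have \<phi>c: "claim_mean \<phi> = \<sigma> * (m - vb w) + \<epsilon> + Bv * claim_mean ind"
      proof -
        have "claim_mean \<phi> = claim_mean (\<lambda>y. \<sigma> * (vb (w - y) - vb w) + \<epsilon> + Bv * ind y)"
          unfolding claim_mean_def
        proof (rule integral_cong_AE)
          \<comment> \<open>The special value of \<open>step_bound\<close> at \<open>y = 0\<close>
            does not affect the mean over the claim size, which has a density.\<close>
          show "AE y in lborel. exponential_density \<alpha> y * \<phi> y = exponential_density \<alpha> y * (\<sigma> * (vb (w - y) - vb w) + \<epsilon> + Bv * ind y)"
            using AE_lborel_singleton[of "0::real"] by eventually_elim (use w in \<open>simp add: \<phi>_def step_bound_def ind_def\<close>)
        qed (simp_all add: ind_def)
        also have "\<dots> = (\<integral>y. \<sigma> * (exponential_density \<alpha> y * vb (w - y)) + (\<epsilon> - \<sigma> * vb w) * (exponential_density \<alpha> y * 1) + Bv * (exponential_density \<alpha> y * ind y) \<partial>lborel)"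
          unfolding claim_mean_def by (rule Bochner_Integration.integral_cong[OF refl]) (simp add: algebra_simps)
        also have "\<dots> = \<sigma> * m + (\<epsilon> - \<sigma> * vb w) * claim_mean (\<lambda>_. 1) + Bv * claim_mean ind"
          unfolding m_def claim_mean_def
          using iv[of "\<lambda>y. vb (w - y)" Bv] iv[of "\<lambda>_. 1" 1] iv[of ind 1] vb_bound by (simp add: ind_def)
        also have "claim_mean (\<lambda>_. 1) = 1" using Y_mean[of 1 "\<lambda>_. 1"] by (simp add: prob_space)
        finally show ?thesis by (simp add: algebra_simps)
      qed
      have cm: "\<bar>m\<bar> \<le> Bv" unfolding m_def by (rule claim_mean_bound) (simp_all add: vb_bound)
      have cross: "- (lam * h * (\<sigma> * (h * (lam * (vb w - m))))) \<le> lam * h * (h * (2 * lam * Bv))"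
      proof -
        have "\<bar>\<sigma> * (h * (lam * (vb w - m)))\<bar> \<le> h * (lam * (2 * Bv))"
          unfolding abs_mult \<sigma> using cm vb_bound[of w] h lam_pos by (auto intro!: mult_left_mono)
        then have "- (\<sigma> * (h * (lam * (vb w - m)))) \<le> h * (2 * lam * Bv)" by (simp add: abs_le_iff algebra_simps)
        then have "lam * h * - (\<sigma> * (h * (lam * (vb w - m)))) \<le> lam * h * (h * (2 * lam * Bv))" using h lam_pos by (intro mult_left_mono) auto
        then show ?thesis by simp
      qed
      have ii: "lam * h * (Bv * claim_mean ind) \<le> lam * h * (Bv * (\<alpha> * (Gm * h)))"
        using mI h lam_pos Bv_nonneg by (intro mult_left_mono) auto
      have "(1 - lam * h) * \<phi> 0 + lam * h * claim_mean \<phi> + 6 * B * lam\<^sup>2 * h\<^sup>2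
        = - (lam * h * (\<sigma> * (h * (lam * (vb w - m))))) + (1 - lam * h) * (\<epsilon> * h) + lam * h * \<epsilon> + lam * h * (Bv * claim_mean ind) + 6 * B * lam\<^sup>2 * h\<^sup>2"
        unfolding \<phi>0 \<phi>c by (simp add: algebra_simps)
      also have "\<dots> \<le> lam * h * (h * (2 * lam * Bv)) + \<epsilon> * h + lam * h * \<epsilon> + lam * h * (Bv * (\<alpha> * (Gm * h))) + 6 * B * lam\<^sup>2 * h\<^sup>2"
      proof -
        have "(1 - lam * h) * (\<epsilon> * h) \<le> 1 * (\<epsilon> * h)" using lam_pos h \<epsilon> by (intro mult_right_mono) auto
        then show ?thesis using cross ii by linarith
      qed
      also have "\<dots> = (\<epsilon> + lam * \<epsilon> + C * h) * h" by (simp add: C_def power2_eq_square algebra_simps)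
      also have "\<dots> \<le> (\<epsilon> + lam * \<epsilon> + \<epsilon>) * h" using h'(3) h by (intro mult_right_mono add_left_mono) auto
      finally show ?thesis by (simp add: algebra_simps)
    qed
    finally show "(\<integral>z. step_bound \<sigma> \<epsilon> Gm h w (S (s + h) z - S s z) \<partial>M) \<le> (2 + lam) * \<epsilon> * h" by (simp add: \<phi>_def)
  qed
qed

end

end

section \<open>The surplus up to ruin and the dividends paid\<close>

context dividend_model begin

context
  fixes u :: "real \<Rightarrow> 'a \<Rightarrow> real" and x :: real
  assumes u: "u \<in> rates M F u0" and x: "0 \<le> x"
begin

text \<open>Strictly before ruin, which by persistence means nonnegative up to and including
  \<open>t\<close>, an event of \<open>F t\<close>.\<close>

definition alive :: "real \<Rightarrow> 'a \<Rightarrow> bool" where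
  "alive t w \<longleftrightarrow> ereal t < ruin_time (\<lambda>t. free_surplus u x t w)"

lemma alive_iff:
  "w \<in> space M \<Longrightarrow> 0 \<le> t \<Longrightarrow> alive t w \<longleftrightarrow> (\<forall>s. 0 \<le> s \<longrightarrow> s \<le> t \<longrightarrow> 0 \<le> free_surplus u x s w)"
  unfolding alive_def by (rule before_ruin_iff[OF free_surplus_persistent(1)[OF u]])

lemma alive_earlier: "alive t w \<Longrightarrow> s \<le> t \<Longrightarrow> alive s w"
  unfolding alive_def by (metis ereal_less_eq(3) order_le_less_trans)

lemma free_surplus_increment:
  assumes w: "w \<in> space M" and st: "0 \<le> s" "s \<le> t"
  shows "free_surplus u x t w = free_surplus u x s w - (S t w - S s w) + (LBINT q:{s..t}. G (free_surplus u x q w) - rate u q w)"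
    and "c * (t - s) \<le> (LBINT q:{s..t}. G (free_surplus u x q w) - rate u q w)"
    and "set_integrable lborel {s..t} (\<lambda>q. G (free_surplus u x q w) - rate u q w)"
proof -
  have t: "0 \<le> t" using st by simp
  note sp = set_integral_Icc_split[OF drift_integrable[OF u w t, where x = x] st]
  show "set_integrable lborel {s..t} (\<lambda>q. G (free_surplus u x q w) - rate u q w)" by (rule sp(3))
  show "free_surplus u x t w = free_surplus u x s w - (S t w - S s w) + (LBINT q:{s..t}. G (free_surplus u x q w) - rate u q w)"
    using free_surplus_eq[OF u w t, where x = x] free_surplus_eq[OF u w st(1), where x = x] sp(1) by linarith
  show "c * (t - s) \<le> (LBINT q:{s..t}. G (free_surplus u x q w) - rate u q w)"
    by (rule set_integral_Icc_bounds(1)[OF sp(3) st(2)]) (rule drift_ge[OF u w])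
qed

text \<open>Gronwall's bound for the growth \<open>y' = g 0 + L * y\<close> from \<open>x\<close>,
  without subtracting the shift \<open>g 0 / L\<close>. Being deterministic, it confines the step
  estimates of all scenarios to one compact interval.\<close>

definition cap :: "real \<Rightarrow> real" where "cap T = (x + g 0 / L) * exp (L * T)"

definition slope :: "real \<Rightarrow> real" where "slope T = g 0 + L * cap T"

lemma cap_nonneg: "0 \<le> cap T" and slope_pos: "0 < slope T"
proof -
  have g0: "0 < g 0" using g_ge[of 0] u0_pos c_pos by simp
  then show c: "0 \<le> cap T" using x L_pos by (simp add: cap_def)
  show "0 < slope T" using g0 c L_pos by (simp add: slope_def add_pos_nonneg)
qed

lemma free_surplus_le_cap:
  assumes w: "w \<in> space M" and mono: "\<forall>s t. 0 \<le> s \<longrightarrow> s \<le> t \<longrightarrow> S s w \<le> S t w"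
    and al: "alive t w" and t: "0 \<le> t" "t \<le> T"
  shows "free_surplus u x t w \<le> cap T"
proof -
  let ?X = "\<lambda>s. free_surplus u x s w"
  have g0: "0 < g 0" using g_ge[of 0] u0_pos c_pos by simp
  have a: "0 \<le> x + g 0 / L" using x g0 L_pos by simp
  have S0: "0 \<le> S s w" if "0 \<le> s" for s using mono[rule_format, of 0 s] that w by simp
  have "?X t + g 0 / L \<le> (x + g 0 / L) * exp (L * t)"
  proof (rule gronwall[OF L_pos a])
    fix s assume s: "0 \<le> s" "s \<le> t"
    \<comment> \<open>Gronwall asks for a bound from above on the earlier values; it exists because
      surplus plus claims never decreases.\<close>
    have "0 \<le> c * (t - s)" using c_pos s by simp
    then have "?X s + S s w \<le> ?X t + S t w" using free_surplus_increment(1,2)[OF w s] by linarith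
    then show "?X s + g 0 / L \<le> ?X t + S t w + g 0 / L" using S0[OF s(1)] by simp
    have "(LBINT q:{0..s}. G (?X q) - rate u q w) \<le> (LBINT q:{0..s}. G (?X q))"
      by (rule set_integral_mono[OF drift_integrable[OF u w s(1)] free_surplus_integrable[OF u w s(1)]])
        (use rate_bounds(1)[OF u w] in simp)
    then show "?X s + g 0 / L \<le> x + g 0 / L + (LBINT q:{0..s}. G (?X q))"
      using free_surplus_eq[OF u w s(1), where x = x] S0[OF s(1)] by linarith
  next
    show "set_integrable lborel {0..t} (\<lambda>s. G (?X s))" by (rule free_surplus_integrable[OF u w t(1)])
  next
    fix s assume s: "0 \<le> s" "s < t"
    then have "0 \<le> ?X s" using al alive_iff[OF w t(1)] by simp
    then show "G (?X s) \<le> L * (?X s + g 0 / L)" using G_le L_pos by (simp add: distrib_left add.commute)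
  qed (use t in auto)
  also have "\<dots> \<le> cap T" unfolding cap_def using a t L_pos by (intro mult_left_mono) auto
  finally show ?thesis using g0 L_pos by (smt (verit) divide_pos_pos)
qed

lemma drift_le_slope:
  assumes w: "w \<in> space M" and mono: "\<forall>s t. 0 \<le> s \<longrightarrow> s \<le> t \<longrightarrow> S s w \<le> S t w"
    and al: "alive r w" and t: "0 \<le> t" "t \<le> r" "r \<le> T"
  shows "(LBINT q:{t..r}. G (free_surplus u x q w) - rate u q w) \<le> slope T * (r - t)"
proof (rule set_integral_Icc_bounds(2)[OF free_surplus_increment(3)[OF w t(1,2)] t(2)])
  fix q assume q: "t \<le> q" "q \<le> r"
  have a: "alive q w" using alive_earlier[OF al q(2)] .
  have X: "0 \<le> free_surplus u x q w" "free_surplus u x q w \<le> cap T"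
    using a alive_iff[OF w, of q] free_surplus_le_cap[OF w mono a, of T] q t by auto
  have "L * free_surplus u x q w \<le> L * cap T" using X L_pos by (intro mult_left_mono) auto
  then show "G (free_surplus u x q w) - rate u q w \<le> slope T"
    using G_le[OF X(1)] rate_bounds(1)[OF u w, of q] unfolding slope_def by linarith
qed

text \<open>Switching the rate off at ruin replaces the random horizon of the payments by a fixed
  one.\<close>

definition live_rate :: "real \<Rightarrow> 'a \<Rightarrow> real" where
  "live_rate t w = (if alive t w then rate u t w else 0)"

text \<open>The value \<open>- 1\<close> is a mark for ruin; one real variable known at time
  \<open>t\<close> thus carries both the surplus and whether ruin has occurred.\<close>

definition state :: "real \<Rightarrow> 'a \<Rightarrow> real" where
  "state t w = (if alive t w then free_surplus u x t w else - 1)"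

lemma state_adapted: "0 \<le> t \<Longrightarrow> state t \<in> borel_measurable (F t)"
proof -
  assume t: "0 \<le> t"
  have [measurable]: "free_surplus u x t \<in> borel_measurable (F t)" by (rule free_surplus_adapted[OF u t])
  have "{w\<in>space (F t). alive t w} \<in> sets (F t)"
    unfolding alive_def using free_ruin_measurable(1)[OF u t] space_F[OF t] by simp
  then have [measurable]: "Measurable.pred (F t) (alive t)" by (simp add: pred_def)
  show ?thesis unfolding state_def[abs_def] by measurable
qed

lemma live_rate_bounds: "w \<in> space M \<Longrightarrow> 0 \<le> live_rate t w" "w \<in> space M \<Longrightarrow> live_rate t w \<le> u0"
  using rate_bounds[OF u] u0_pos by (auto simp: live_rate_def)

lemma live_rate_joint: "(\<lambda>(s, w). live_rate s w) \<in> borel_measurable (borel \<Otimes>\<^sub>M M)"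
proof -
  have [measurable]: "(\<lambda>p. ruin_time (\<lambda>t. free_surplus u x t (snd p))) \<in> borel_measurable ((borel :: real measure) \<Otimes>\<^sub>M M)"
    by (rule measurable_compose[OF measurable_snd free_ruin_measurable(2)[OF u]])
  have [measurable]: "(\<lambda>p. rate u (fst p) (snd p)) \<in> borel_measurable (borel \<Otimes>\<^sub>M M)"
    using rate_joint[OF u] by (simp add: split_def)
  have "(\<lambda>p. if ereal (fst p) < ruin_time (\<lambda>t. free_surplus u x t (snd p)) then rate u (fst p) (snd p) else 0)
      \<in> borel_measurable (borel \<Otimes>\<^sub>M M)" by measurable
  then show ?thesis by (simp add: live_rate_def alive_def split_def)
qed

lemma discounted_integrable:
  assumes w: "w \<in> space M"
  shows "set_integrable lborel {a..b} (\<lambda>s. exp (- \<delta> * (s - p)) * live_rate s w)"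
proof (rule set_integrable_bounded[where B = "exp (- \<delta> * (a - p)) * u0"])
  have [measurable]: "(\<lambda>s. live_rate s w) \<in> borel_measurable borel" by (rule measurable_joint_section[OF live_rate_joint w])
  show "set_borel_measurable borel {a..b} (\<lambda>s. exp (- \<delta> * (s - p)) * live_rate s w)"
    unfolding set_borel_measurable_def by measurable
  fix s assume "a \<le> s" "s \<le> b"
  then show "norm (exp (- \<delta> * (s - p)) * live_rate s w) \<le> exp (- \<delta> * (a - p)) * u0"
    using live_rate_bounds[OF w, of s] delta_pos by (auto simp: abs_mult intro!: mult_mono)
qed

lemma discounted_bounds:
  assumes w: "w \<in> space M" and h: "0 \<le> h"
  shows "0 \<le> (LBINT s:{t..t + h}. exp (- \<delta> * (s - t)) * live_rate s w)"
    and "(LBINT s:{t..t + h}. exp (- \<delta> * (s - t)) * live_rate s w) \<le> u0 * h"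
proof -
  have th: "t \<le> t + h" using h by simp
  have "0 * (t + h - t) \<le> (LBINT s:{t..t + h}. exp (- \<delta> * (s - t)) * live_rate s w)"
    by (rule set_integral_Icc_bounds(1)[OF discounted_integrable[OF w] th]) (use live_rate_bounds[OF w] in simp)
  then show "0 \<le> (LBINT s:{t..t + h}. exp (- \<delta> * (s - t)) * live_rate s w)" by simp
  have "(LBINT s:{t..t + h}. exp (- \<delta> * (s - t)) * live_rate s w) \<le> u0 * (t + h - t)"
  proof (rule set_integral_Icc_bounds(2)[OF discounted_integrable[OF w] th])
    fix s assume "t \<le> s"
    then have "exp (- \<delta> * (s - t)) * live_rate s w \<le> 1 * live_rate s w"
      using live_rate_bounds[OF w] delta_pos by (intro mult_right_mono) auto
    then show "exp (- \<delta> * (s - t)) * live_rate s w \<le> u0" using live_rate_bounds(2)[OF w, of s] by simp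
  qed
  then show "(LBINT s:{t..t + h}. exp (- \<delta> * (s - t)) * live_rate s w) \<le> u0 * h" by simp
qed

definition payout :: "real \<Rightarrow> 'a \<Rightarrow> real" where
  "payout t w = (LBINT s:{0..t}. exp (- \<delta> * s) * live_rate s w)"

lemma payout_measurable: "payout t \<in> borel_measurable M"
proof -
  have "(\<lambda>(s, w). exp (- \<delta> * s) * live_rate s w) \<in> borel_measurable (borel \<Otimes>\<^sub>M M)"
    using live_rate_joint by (simp add: split_def)
  from measurable_compose[OF measurable_Pair1' measurable_joint_set_integral[OF this], of t]
  show ?thesis by (simp add: payout_def[abs_def])
qed

lemma payout_add:
  assumes w: "w \<in> space M" and t: "0 \<le> t" "0 \<le> h"
  shows "payout (t + h) w = payout t w + exp (- \<delta> * t) * (LBINT s:{t..t + h}. exp (- \<delta> * (s - t)) * live_rate s w)"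
proof -
  have e: "exp (- \<delta> * s) * live_rate s w = exp (- \<delta> * t) * (exp (- \<delta> * (s - t)) * live_rate s w)" for s
    by (simp add: mult.assoc[symmetric] exp_add[symmetric] algebra_simps)
  have i: "set_integrable lborel {0..t + h} (\<lambda>s. exp (- \<delta> * s) * live_rate s w)"
    using discounted_integrable[OF w, of 0 "t + h" 0] by simp
  have "(LBINT s:{t..t + h}. exp (- \<delta> * s) * live_rate s w) = exp (- \<delta> * t) * (LBINT s:{t..t + h}. exp (- \<delta> * (s - t)) * live_rate s w)"
    unfolding e by simp
  then show ?thesis using set_integral_Icc_split(1)[OF i t(1), of] t by (simp add: payout_def)
qed

lemma payout_limit:
  assumes w: "w \<in> space M"
  shows "(\<lambda>n. payout (real n) w) \<longlonglongrightarrow> (LBINT t:{t. 0 \<le> t \<and> ereal t \<le> ruin g N Y x u w}. exp (- \<delta> * t) * u t w)"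
    and "0 \<le> payout t w" "payout t w \<le> u0 / \<delta>"
proof -
  define f where "f = (\<lambda>s. exp (- \<delta> * s) * live_rate s w)"
  have [measurable]: "f \<in> borel_measurable borel"
    unfolding f_def using measurable_joint_section[OF live_rate_joint w] by measurable
  have fb: "0 \<le> f s" "f s \<le> exp (- \<delta> * s) * u0" for s
    using live_rate_bounds[OF w, of s] by (auto simp: f_def intro: mult_left_mono)
  \<comment> \<open>The majorant \<open>u0 * exp (- \<delta> * s)\<close> is written as a multiple
    of the exponential density with parameter \<open>\<delta>\<close>, whose integrability is
    known.\<close>
  have ei: "integrable lborel (\<lambda>s. exponential_density \<delta> s * (u0 / \<delta>))"
  proof -
    interpret E: prob_space "density lborel (exponential_density \<delta>)" by (rule prob_space_exponential_density[OF delta_pos])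
    have "integrable (density lborel (exponential_density \<delta>)) (\<lambda>_. 1::real)" by simp
    then show ?thesis using delta_pos by (subst (asm) integrable_density) (auto simp: exponential_density_nonneg)
  qed
  have fi: "set_integrable lborel {0..} f"
    unfolding set_integrable_def
  proof (rule Bochner_Integration.integrable_bound[OF ei])
    show "AE s in lborel. norm (indicat_real {0..} s *\<^sub>R f s) \<le> norm (exponential_density \<delta> s * (u0 / \<delta>))"
      using fb delta_pos u0_pos by (intro AE_I2) (auto simp: exponential_density_def indicator_def abs_mult mult.commute)
  qed measurable
  have "((\<lambda>b. LBINT s:{0..b}. f s) \<longlongrightarrow> (LBINT s:{0..}. f s)) at_top"
    by (rule tendsto_set_lebesgue_integral_at_top[OF _ fi]) simp
  from filterlim_compose[OF this filterlim_real_sequentially]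
  have l: "(\<lambda>n. payout (real n) w) \<longlonglongrightarrow> (LBINT s:{0..}. f s)" by (simp add: payout_def f_def)
  define \<rho> where "\<rho> = ruin_time (\<lambda>t. free_surplus u x t w)"
  have "(LBINT s:{0..}. f s) = (LBINT t:{t. 0 \<le> t \<and> ereal t \<le> ruin g N Y x u w}. exp (- \<delta> * t) * u t w)"
    unfolding set_lebesgue_integral_def ruin_eq[OF u w] \<rho>_def[symmetric]
  proof (rule integral_cong_AE)
    have [measurable]: "(\<lambda>s. rate u s w) \<in> borel_measurable borel" by (rule measurable_joint_section[OF rate_joint[OF u] w])
    have "(\<lambda>s. if 0 \<le> s \<and> ereal s \<le> \<rho> then exp (- \<delta> * s) * rate u s w else 0) \<in> borel_measurable borel" by measurable
    moreover have "(\<lambda>s. if 0 \<le> s \<and> ereal s \<le> \<rho> then exp (- \<delta> * s) * rate u s w else 0)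
        = (\<lambda>s. indicat_real {t. 0 \<le> t \<and> ereal t \<le> \<rho>} s *\<^sub>R (exp (- \<delta> * s) * u s w))"
      by (auto simp: fun_eq_iff indicator_def rate_def[OF u])
    ultimately show "(\<lambda>s. indicat_real {t. 0 \<le> t \<and> ereal t \<le> \<rho>} s *\<^sub>R (exp (- \<delta> * s) * u s w)) \<in> borel_measurable lborel" by simp
    \<comment> \<open>The objective includes the ruin time itself, \<open>live_rate\<close> excludes
      it; this is a single point.\<close>
    show "AE s in lborel. indicat_real {0..} s *\<^sub>R f s = indicat_real {t. 0 \<le> t \<and> ereal t \<le> \<rho>} s *\<^sub>R (exp (- \<delta> * s) * u s w)"
      using AE_lborel_singleton[of "real_of_ereal \<rho>"]
    proof eventually_elim
      case (elim s)
      then have "ereal s < \<rho> \<longleftrightarrow> ereal s \<le> \<rho>" by (cases \<rho>) auto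
      then show ?case by (auto simp: f_def live_rate_def alive_def \<rho>_def[symmetric] rate_def[OF u] indicator_def)
    qed
  qed measurable
  with l show "(\<lambda>n. payout (real n) w) \<longlonglongrightarrow> (LBINT t:{t. 0 \<le> t \<and> ereal t \<le> ruin g N Y x u w}. exp (- \<delta> * t) * u t w)" by simp
  show "0 \<le> payout t w" unfolding payout_def f_def[symmetric, THEN fun_cong] set_lebesgue_integral_def using fb
    by (intro integral_nonneg_AE AE_I2) (auto simp: indicator_def f_def)
  show "payout t w \<le> u0 / \<delta>"
  proof (cases "0 \<le> t")
    case True
    have "payout t w \<le> (LBINT s:{0..t}. exp (- \<delta> * s) * u0)" unfolding payout_def
    proof (rule set_integral_mono)
      show "set_integrable lborel {0..t} (\<lambda>s. exp (- \<delta> * s) * live_rate s w)" using discounted_integrable[OF w, of 0 t 0] by simp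
      show "set_integrable lborel {0..t} (\<lambda>s. exp (- \<delta> * s) * u0)" using set_integral_exp(2)[OF True, of "- \<delta>"] delta_pos by simp
    qed (use fb in \<open>simp add: f_def\<close>)
    also have "\<dots> = (exp (- \<delta> * t) - 1) / (- \<delta>) * u0" using set_integral_exp(1)[OF True, of "- \<delta>"] delta_pos by simp
    also have "\<dots> \<le> u0 / \<delta>" using delta_pos u0_pos by (simp add: field_simps)
    finally show ?thesis .
  next
    case False
    then have "payout t w = 0" by (simp add: payout_def set_lebesgue_integral_def)
    then show ?thesis using delta_pos u0_pos by simp
  qed
qed

end

end

section \<open>Comparison of the expected dividends with the candidate\<close>

context dividend_model begin

context
  fixes u :: "real \<Rightarrow> 'a \<Rightarrow> real" and x :: real
    and v v' :: "real \<Rightarrow> real" and Bv d :: real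
  assumes u: "u \<in> rates M F u0" and x: "0 \<le> x"
    and hv: "has_hderiv v v'" and cv': "continuous_on {0..} v'" and vB: "\<And>y. 0 \<le> y \<Longrightarrow> \<bar>v y\<bar> \<le> Bv"
    and hjb_eq: "\<And>y. 0 \<le> y \<Longrightarrow> g y * v' y - (lam + \<delta>) * v y + lam * exp_conv \<alpha> v y + u0 * max 0 (1 - v' y) = 0"
    and d: "0 \<le> d" and v'_ge: "\<And>y. 0 \<le> y \<Longrightarrow> y < d \<Longrightarrow> 1 \<le> v' y" and v'_le: "\<And>y. d \<le> y \<Longrightarrow> v' y \<le> 1"
begin

lemmas alive_ux = alive_iff[OF u x] and alive_early = alive_earlier[OF u x]
lemmas vbdef = vb_def[OF hv cv' vB hjb_eq] and vbb = vb_bound[OF hv cv' vB hjb_eq]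

definition step :: "real \<Rightarrow> real \<Rightarrow> 'a \<Rightarrow> real" where
  "step t h w = exp (- \<delta> * h) * vb v (state u x (t + h) w) - vb v (state u x t w)
     + (LBINT s:{t..t + h}. exp (- \<delta> * (s - t)) * live_rate u x s w)"

lemma v_lipschitz_Icc:
  obtains V1 where "0 \<le> V1" "\<And>a b. 0 \<le> a \<Longrightarrow> a \<le> b \<Longrightarrow> b \<le> K \<Longrightarrow> \<bar>v b - v a\<bar> \<le> V1 * (b - a)"
proof -
  have "continuous_on {0..K} v'" using cv' by (rule continuous_on_subset) auto
  then have "compact (v' ` {0..K})" by (intro compact_continuous_image) auto
  then obtain V0 where V0: "\<forall>y\<in>v' ` {0..K}. norm y \<le> V0" using compact_imp_bounded bounded_iff by metis
  have "\<bar>v b - v a\<bar> \<le> max V0 0 * (b - a)" if ab: "0 \<le> a" "a \<le> b" "b \<le> K" for a b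
  proof (cases "a = b")
    case False
    then have "a < b" using ab by simp
    then obtain z where z: "a < z" "z < b" "v b - v a = (b - a) * v' z" using has_hderiv_mvt[OF hv ab(1)] by blast
    have "norm (v' z) \<le> V0" using V0 z ab by auto
    then have "\<bar>v' z\<bar> \<le> max V0 0" by simp
    then have "(b - a) * \<bar>v' z\<bar> \<le> (b - a) * max V0 0" using ab by (intro mult_left_mono) auto
    then show ?thesis using z(3) ab by (simp add: abs_mult mult.commute)
  qed simp
  then show ?thesis using that[of "max V0 0"] by simp
qed

text \<open>For \<open>\<sigma> = 1\<close> any scheme is allowed; for \<open>\<sigma> = - 1\<close>
  the threshold feedback is imposed, since a lower bound is possible only if the maximising rate is
  attained up to a small error. \<open>h0\<close> is uniform in time and scenario, because up to
  time \<open>T\<close> the surplus before ruin stays below \<open>cap x T\<close>.\<close>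

lemma step_le_step_bound:
  assumes \<sigma>: "\<sigma> = 1 \<or> \<sigma> = - 1 \<and> (\<forall>t w. 0 \<le> t \<longrightarrow> w \<in> space M \<longrightarrow> alive u x t w \<longrightarrow>
      u t w = u0 * indicator {d..} (free_surplus u x t w))" and \<epsilon>: "0 < \<epsilon>"
  obtains h0 where "0 < h0" "\<And>h t w. 0 < h \<Longrightarrow> h \<le> h0 \<Longrightarrow> 0 \<le> t \<Longrightarrow> t + h \<le> T \<Longrightarrow> w \<in> space M \<Longrightarrow>
      \<forall>s t. 0 \<le> s \<longrightarrow> s \<le> t \<longrightarrow> S s w \<le> S t w \<Longrightarrow>
      \<sigma> * step t h w \<le> step_bound v Bv \<sigma> \<epsilon> (slope x T) h (state u x t w) (S (t + h) w - S t w)"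
proof -
  define K where "K = cap x T"
  define Gm where "Gm = slope x T"
  have K: "0 \<le> K" and Gm: "0 < Gm" using cap_nonneg[OF u x] slope_pos[OF u x] by (auto simp: K_def Gm_def)
  have Bv: "0 \<le> Bv" using vB[of 0] by linarith
  obtain V1 where V1: "0 \<le> V1" "\<And>a b. 0 \<le> a \<Longrightarrow> a \<le> b \<Longrightarrow> b \<le> K \<Longrightarrow> \<bar>v b - v a\<bar> \<le> V1 * (b - a)"
  proof (rule v_lipschitz_Icc[of K], goal_cases)
    case (1 V1)
    show ?case by (rule 1(1)[OF 1(2-)])
  qed
  have "uniformly_continuous_on {0..K} v'"
    by (rule compact_uniformly_continuous[OF continuous_on_subset[OF cv']]) auto
  moreover have "0 < \<epsilon> / (2 * u0)" using \<epsilon> u0_pos by simp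
  ultimately obtain \<eta> where \<eta>: "0 < \<eta>" "\<And>y z. y \<in> {0..K} \<Longrightarrow> z \<in> {0..K} \<Longrightarrow> dist z y < \<eta> \<Longrightarrow> dist (v' z) (v' y) < \<epsilon> / (2 * u0)"
    unfolding uniformly_continuous_on_def by metis
  have e2: "0 < \<epsilon> / 2" using \<epsilon> by simp
  obtain h1 where h1: "0 < h1"
    "\<And>h t X r. 0 < h \<Longrightarrow> h \<le> h1 \<Longrightarrow> set_integrable lborel {t..t + h} (\<lambda>s. G (X s)) \<Longrightarrow> set_integrable lborel {t..t + h} r \<Longrightarrow>
      (\<And>s. t \<le> s \<Longrightarrow> s \<le> t + h \<Longrightarrow> 0 \<le> X t \<and> X t \<le> X s \<and> X s \<le> K \<and> X s = X t + (LBINT q:{t..s}. G (X q) - r q)) \<Longrightarrow>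
      (\<And>s. 0 \<le> r s \<and> r s \<le> u0) \<Longrightarrow>
      \<bar>exp (- \<delta> * h) * v (X (t + h)) - v (X t) + (LBINT s:{t..t + h}. exp (- \<delta> * (s - t)) * r s)
        - (h * (g (X t) * v' (X t) - \<delta> * v (X t)) + (LBINT s:{t..t + h}. r s) * (1 - v' (X t)))\<bar> \<le> \<epsilon> / 2 * h"
    by (rule no_jump_step[OF hv cv' vB hjb_eq K e2]) blast+
  \<comment> \<open>For steps with a claim: movement of the surplus, discounting and dividends.
    There an error of size \<open>\<epsilon>\<close> instead of \<open>\<epsilon> * h\<close> is
    affordable, because a claim has probability of order \<open>h\<close>.\<close>
  define C where "C = V1 * Gm + \<delta> * Bv + u0"
  have C: "0 < C" unfolding C_def using V1(1) Gm delta_pos Bv u0_pos by (intro add_nonneg_pos add_nonneg_nonneg mult_nonneg_nonneg) auto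
  define h0 where "h0 = min h1 (min (\<eta> / (2 * Gm)) (\<epsilon> / C))"
  have h0: "0 < h0" using h1(1) \<eta>(1) Gm \<epsilon> C by (simp add: h0_def)
  show ?thesis
  proof (rule that[OF h0])
    fix h t w assume h: "0 < h" "h \<le> h0" and t: "0 \<le> t" "t + h \<le> T" and w: "w \<in> space M"
      and mono: "\<forall>s t. 0 \<le> s \<longrightarrow> s \<le> t \<longrightarrow> S s w \<le> S t w"
    let ?X = "\<lambda>s. free_surplus u x s w"
    define E where "E = (LBINT s:{t..t + h}. exp (- \<delta> * (s - t)) * live_rate u x s w)"
    define y where "y = S (t + h) w - S t w"
    have y: "0 \<le> y" using mono h t by (simp add: y_def)
    have E: "0 \<le> E" "E \<le> u0 * h" using discounted_bounds[OF u x w, of h t] h by (simp_all add: E_def)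
    have Ch: "C * h \<le> \<epsilon>" using h C by (simp add: h0_def field_simps)
    have Gh: "Gm * h < \<eta>"
    proof -
      have "2 * (Gm * h) \<le> \<eta>" using h Gm by (simp add: h0_def field_simps)
      moreover have "0 < Gm * h" using h Gm by simp
      ultimately show ?thesis by linarith
    qed
    have \<sigma>1: "\<bar>\<sigma>\<bar> = 1" using \<sigma> by auto
    have st: "step t h w = exp (- \<delta> * h) * vb v (state u x (t + h) w) - vb v (state u x t w) + E"
      by (simp add: step_def E_def)
    note state = state_def[OF u x] and lr = live_rate_def[OF u x] and sb = step_bound_def[OF hv cv' vB hjb_eq]
    have "\<sigma> * step t h w \<le> step_bound v Bv \<sigma> \<epsilon> Gm h (state u x t w) y"
    proof (cases "alive u x t w")
      case False
      have dead: "\<not> alive u x s w" if "t \<le> s" for s using False alive_early[of s w t] that by blast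
      have "E = (LBINT s:{t..t + h}. 0)" unfolding E_def
        by (rule set_lebesgue_integral_cong) (use dead in \<open>auto simp: lr\<close>)
      then have "E = 0" by simp
      moreover have "state u x t w = - 1" "state u x (t + h) w = - 1" using dead[of t] dead[of "t + h"] h by (auto simp: state)
      ultimately show ?thesis unfolding st by (simp add: vbdef sb)
    next
      case True
      define a where "a = ?X t"
      have nn: "0 \<le> ?X s" if "0 \<le> s" "s \<le> t" for s using True alive_ux[OF w t(1)] that by blast
      have a: "0 \<le> a" using nn[of t] t by (simp add: a_def)
      have sa: "state u x t w = a" using True by (simp add: state a_def)
      have va: "vb v a = v a" using a by (simp add: vbdef)
      have up: "a - (S s w - S t w) \<le> ?X s" if "t \<le> s" for s
        using free_surplus_increment(1,2)[OF u x w t(1) that] c_pos that unfolding a_def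
        by (smt (verit) mult_nonneg_nonneg)
      \<comment> \<open>Only claims lower the surplus, so if their total in the step is at most
        \<open>a\<close>, ruin is impossible no matter when they occur within the step.\<close>
      have ali: "alive u x (t + h) w" if le: "y \<le> a"
      proof (subst alive_ux[OF w], use t h in simp, intro allI impI)
        fix s assume s: "0 \<le> s" "s \<le> t + h"
        show "0 \<le> ?X s"
        proof (cases "s \<le> t")
          case False
          have "S s w \<le> S (t + h) w" using mono s by blast
          then show ?thesis using up[of s] False le by (simp add: y_def)
        qed (use nn s in blast)
      qed
      have low: "?X (t + h) \<le> a - y + Gm * h" "?X (t + h) \<le> K" if al: "alive u x (t + h) w"
        using free_surplus_increment(1)[OF u x w t(1), of "t + h"] drift_le_slope[OF u x w mono al t(1) _ t(2)]
          free_surplus_le_cap[OF u x w mono al _ t(2)] h t by (auto simp: a_def y_def K_def Gm_def)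
      show ?thesis
      proof (cases "y = 0")
        case True
        have Sc: "S s w = S t w" if "t \<le> s" "s \<le> t + h" for s
          using mono[rule_format, of t s] mono[rule_format, of s "t + h"] True that t by (simp add: y_def)
        have al: "alive u x (t + h) w" using ali a True by simp
        have win: "0 \<le> ?X t \<and> ?X t \<le> ?X s \<and> ?X s \<le> K \<and> ?X s = ?X t + (LBINT q:{t..s}. G (?X q) - rate u q w)"
          if s: "t \<le> s" "s \<le> t + h" for s
          using a up[OF s(1)] Sc[OF s] free_surplus_increment(1)[OF u x w t(1) s(1)]
            free_surplus_le_cap[OF u x w mono alive_early[OF al s(2)], of T] s t by (simp add: a_def K_def)
        define U where "U = (LBINT s:{t..t + h}. rate u s w)"
        have th: "0 \<le> t + h" "t \<le> t + h" using t h by auto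
        have iG: "set_integrable lborel {t..t + h} (\<lambda>s. G (?X s))"
          by (rule set_integral_Icc_split(3)[OF free_surplus_integrable[OF u w th(1)] t(1) th(2)])
        have rb: "0 \<le> rate u s w \<and> rate u s w \<le> u0" for s using rate_bounds[OF u w] by blast
        have EE: "E = (LBINT s:{t..t + h}. exp (- \<delta> * (s - t)) * rate u s w)" unfolding E_def
          by (rule set_lebesgue_integral_cong) (use alive_early[OF al] in \<open>auto simp: lr\<close>)
        have hh: "h \<le> h1" using h by (simp add: h0_def)
        have nj: "\<bar>exp (- \<delta> * h) * v (?X (t + h)) - v a + E - (h * (g a * v' a - \<delta> * v a) + U * (1 - v' a))\<bar> \<le> \<epsilon> / 2 * h"
          using h1(2)[OF h(1) hh iG rate_integrable[OF u w] win rb] unfolding EE U_def a_def .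
        have "0 * (t + h - t) \<le> U" unfolding U_def by (rule set_integral_Icc_bounds(1)[OF rate_integrable[OF u w] th(2)]) (use rb in auto)
        moreover have "U \<le> u0 * (t + h - t)" unfolding U_def by (rule set_integral_Icc_bounds(2)[OF rate_integrable[OF u w] th(2)]) (use rb in auto)
        ultimately have U: "0 \<le> U" "U \<le> u0 * h" by simp_all
        \<comment> \<open>The shortfall of the dividends paid against the maximising rate over the
          step; it is never positive.\<close>
        define Q where "Q = U * (1 - v' a) - h * u0 * max 0 (1 - v' a)"
        have Q0: "Q \<le> 0"
        proof (cases "v' a \<le> 1")
          case True
          then show ?thesis using mult_right_mono[OF U(2), of "1 - v' a"] by (simp add: Q_def algebra_simps)
        next
          case False
          then have "U * (1 - v' a) \<le> 0" using U(1) by (intro mult_nonneg_nonpos) auto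
          then show ?thesis using False by (simp add: Q_def)
        qed
        \<comment> \<open>Without claims the path rises through the step. If it starts at or above
          \<open>d\<close>, then \<open>U = u0 * h\<close>; if it ends below \<open>d\<close>, then
          \<open>U = 0\<close>. If it reaches \<open>d\<close> in between, \<open>d - a\<close> is
          at most \<open>Gm * h\<close>, so \<open>v' a\<close> exceeds \<open>v' d\<close>, which
          is at most \<open>1\<close>, only by little.\<close>
        have Q1: "- Q \<le> \<epsilon> / 2 * h" if "\<sigma> \<noteq> 1"
        proof -
          have feedback: "rate u s w = u0 * indicator {d..} (?X s)" if s: "t \<le> s" "s \<le> t + h" for s
          proof -
            have "0 \<le> s" using s t by simp
            then show ?thesis using \<sigma> \<open>\<sigma> \<noteq> 1\<close> alive_early[OF al s(2)] w by (simp add: rate_def[OF u])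
          qed
          show ?thesis
          proof (cases "d \<le> a")
            case True
            have "U = (LBINT s:{t..t + h}. u0)" unfolding U_def
            proof (rule set_lebesgue_integral_cong)
              show "\<forall>s. s \<in> {t..t + h} \<longrightarrow> rate u s w = u0"
              proof (intro allI impI)
                fix s assume "s \<in> {t..t + h}"
                then show "rate u s w = u0" using feedback[of s] win[of s] True by (simp add: a_def)
              qed
            qed simp
            then have "U = u0 * h" using h by (simp add: set_integral_const)
            moreover have "max 0 (1 - v' a) = 1 - v' a" using v'_le[OF True] by simp
            ultimately have "Q = 0" by (simp add: Q_def)
            then show ?thesis using \<epsilon> h by simp
          next
            case False
            then have ad: "a < d" by simp
            have g1: "1 \<le> v' a" by (rule v'_ge[OF a ad])
            then have Qe: "- Q = U * (v' a - 1)" by (simp add: Q_def algebra_simps)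
            show ?thesis
            proof (cases "?X (t + h) < d")
              case True
              have "U = (LBINT s:{t..t + h}. 0)" unfolding U_def
              proof (rule set_lebesgue_integral_cong)
                show "\<forall>s. s \<in> {t..t + h} \<longrightarrow> rate u s w = 0"
                proof (intro allI impI)
                  fix s assume s: "s \<in> {t..t + h}"
                  then have s': "0 \<le> s" "s \<le> t + h" using t by auto
                  have "0 \<le> c * (t + h - s)" using c_pos s' by simp
                  then have "?X s \<le> ?X (t + h)"
                    using free_surplus_increment(1,2)[OF u x w s'] Sc[of s] Sc[of "t + h"] s h by simp
                  then show "rate u s w = 0" using feedback[of s] s True by simp
                qed
              qed simp
              then have "U = 0" by simp
              then show ?thesis using Qe \<epsilon> h by simp
            next
              case False
              have "d \<le> K" "d - a \<le> Gm * h" using False low[OF al] \<open>y = 0\<close> by auto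
              then have "dist (v' a) (v' d) < \<epsilon> / (2 * u0)"
                using \<eta>(2)[of d a] a ad d Gh by (simp add: dist_real_def)
              then have "v' a - 1 \<le> \<epsilon> / (2 * u0)" using v'_le[of d] by (simp add: dist_real_def)
              then have "U * (v' a - 1) \<le> (u0 * h) * (\<epsilon> / (2 * u0))" using U g1 h u0_pos by (intro mult_mono) auto
              then show ?thesis unfolding Qe using u0_pos by (simp add: mult.commute)
            qed
          qed
        qed
        \<comment> \<open>The equation for \<open>v\<close> trades the drift term for the claim
          term, the form that cancels in mean against the steps with a claim.\<close>
        have hj: "h * (g a * v' a - \<delta> * v a) + U * (1 - v' a) = h * (lam * (v a - exp_conv \<alpha> v a)) + Q"
        proof -
          have e: "g a * v' a - \<delta> * v a = lam * (v a - exp_conv \<alpha> v a) - u0 * max 0 (1 - v' a)"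
            using hjb_eq[OF a] by (simp add: algebra_simps)
          show ?thesis unfolding e Q_def by (simp add: algebra_simps)
        qed
        have sX: "state u x (t + h) w = ?X (t + h)" using al by (simp add: state)
        have vX: "vb v (?X (t + h)) = v (?X (t + h))" using win[of "t + h"] h by (simp add: vbdef)
        have b: "\<bar>step t h w - (h * (lam * (v a - exp_conv \<alpha> v a)) + Q)\<bar> \<le> \<epsilon> / 2 * h"
          using nj unfolding st sa sX va vX hj .
        have nn2: "0 \<le> \<epsilon> / 2 * h" using \<epsilon> h by simp
        have "\<sigma> * step t h w \<le> \<sigma> * (h * (lam * (v a - exp_conv \<alpha> v a))) + (\<epsilon> / 2 * h + \<epsilon> / 2 * h)"
        proof (cases "\<sigma> = 1")
          case True
          show ?thesis unfolding True mult_1 using b nn2 Q0 by linarith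
        next
          case False
          then have m: "\<sigma> = - 1" using \<sigma> by auto
          show ?thesis unfolding m mult_minus1 using b Q1[OF False] by linarith
        qed
        also have "\<epsilon> / 2 * h + \<epsilon> / 2 * h = \<epsilon> * h" by simp
        finally show ?thesis using a True by (simp add: sa sb va claim_mean_vb[OF hv cv' vB hjb_eq a])
      next
        case False
        then have yp: "0 < y" using y by simp
        define ind where "ind = (if a < y \<and> y \<le> a + Gm * h then 1 else 0 :: real)"
        define R where "R = exp (- \<delta> * h) * vb v (state u x (t + h) w)"
        have eh: "0 \<le> exp (- \<delta> * h)" "exp (- \<delta> * h) \<le> 1" "1 - exp (- \<delta> * h) \<le> \<delta> * h"
          using h delta_pos exp_ge_add_one_self[of "- \<delta> * h"] by auto
        have Rb: "\<bar>R - vb v (a - y)\<bar> \<le> (V1 * Gm + \<delta> * Bv) * h + Bv * ind"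
        proof -
          have nn': "0 \<le> (V1 * Gm + \<delta> * Bv) * h" using V1(1) Gm delta_pos Bv h by simp
          \<comment> \<open>The timing of the claims within the step is unknown. A total claim up to
            \<open>a\<close> cannot cause ruin, one beyond \<open>a + Gm * h\<close> must cause it,
            and in between only boundedness of \<open>v\<close> is used; this is the indicator in
            \<open>step_bound\<close>.\<close>
          consider "y \<le> a" | "a < y" "y \<le> a + Gm * h" | "a + Gm * h < y" by linarith
          then show ?thesis
          proof cases
            case 1
            note al = ali[OF 1]
            have "?X (t + h) \<le> K" "?X (t + h) - (a - y) \<le> Gm * h" "a - y \<le> ?X (t + h)"
              using low[OF al] up[of "t + h"] h by (auto simp: y_def)
            then have X: "\<bar>v (?X (t + h)) - v (a - y)\<bar> \<le> V1 * (Gm * h)" "0 \<le> ?X (t + h)"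
              using V1(2)[of "a - y" "?X (t + h)"] 1 mult_left_mono[OF _ V1(1), of "?X (t + h) - (a - y)" "Gm * h"] by auto
            have "\<bar>(exp (- \<delta> * h) - 1) * v (?X (t + h))\<bar> \<le> \<delta> * h * Bv"
              unfolding abs_mult using eh vB[OF X(2)] delta_pos h by (intro mult_mono) auto
            moreover have "R - vb v (a - y) = (exp (- \<delta> * h) - 1) * v (?X (t + h)) + (v (?X (t + h)) - v (a - y))"
              using al 1 X(2) by (simp add: R_def state vbdef algebra_simps)
            ultimately have "\<bar>R - vb v (a - y)\<bar> \<le> \<delta> * h * Bv + V1 * (Gm * h)" using X(1) by linarith
            then show ?thesis using 1 by (simp add: ind_def algebra_simps)
          next
            case 2
            have "\<bar>R\<bar> \<le> 1 * Bv" unfolding R_def abs_mult using eh vbb by (intro mult_mono) auto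
            then show ?thesis using 2 nn' by (simp add: ind_def vbdef)
          next
            case 3
            have "\<not> alive u x (t + h) w"
            proof
              assume al: "alive u x (t + h) w"
              then have "0 \<le> ?X (t + h)" using alive_ux[OF w, of "t + h"] t h by auto
              then show False using low(1)[OF al] 3 by simp
            qed
            moreover have "0 < Gm * h" using Gm h by simp
            ultimately show ?thesis using 3 nn' by (simp add: R_def state vbdef ind_def)
          qed
        qed
        have "\<bar>step t h w - (vb v (a - y) - vb v a)\<bar> \<le> \<epsilon> + Bv * ind"
        proof -
          have "\<bar>step t h w - (vb v (a - y) - vb v a)\<bar> \<le> (V1 * Gm + \<delta> * Bv) * h + Bv * ind + u0 * h"
            using Rb E unfolding st sa R_def by linarith
          also have "\<dots> = C * h + Bv * ind" by (simp add: C_def algebra_simps)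
          finally show ?thesis using Ch by linarith
        qed
        then have "\<sigma> * step t h w \<le> \<sigma> * (vb v (a - y) - vb v a) + \<epsilon> + Bv * ind"
          using \<sigma> by (cases "\<sigma> = 1") auto
        then show ?thesis using a False by (simp add: sa sb ind_def)
      qed
    qed
    then show "\<sigma> * step t h w \<le> step_bound v Bv \<sigma> \<epsilon> (slope x T) h (state u x t w) (S (t + h) w - S t w)"
      by (simp add: y_def Gm_def)
  qed
qed

text \<open>The process whose mean should not increase under any scheme and stay constant under the
  optimal one. It starts at \<open>v x\<close>, and its limit is the total of the discounted
  dividends.\<close>

definition total_value :: "real \<Rightarrow> 'a \<Rightarrow> real" where
  "total_value t w = exp (- \<delta> * t) * vb v (state u x t w) + payout u x t w"


lemma value_bounded: "w \<in> space M \<Longrightarrow> 0 \<le> t \<Longrightarrow> \<bar>total_value t w\<bar> \<le> Bv + u0 / \<delta>"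
proof -
  assume w: "w \<in> space M" and t: "0 \<le> t"
  have "\<bar>exp (- \<delta> * t) * vb v (state u x t w)\<bar> \<le> 1 * Bv"
    unfolding abs_mult using vbb t delta_pos by (intro mult_mono) auto
  then show ?thesis using payout_limit(2,3)[OF u x w, of t] unfolding total_value_def by linarith
qed

lemma value_measurable: "0 \<le> t \<Longrightarrow> total_value t \<in> borel_measurable M"
proof -
  assume t: "0 \<le> t"
  have [measurable]: "state u x t \<in> borel_measurable M" "payout u x t \<in> borel_measurable M" "vb v \<in> borel_measurable borel"
    using state_adapted[OF u x t] measurable_F_M t payout_measurable[OF u x] vb_measurable[OF hv cv' vB hjb_eq] by auto
  show ?thesis unfolding total_value_def[abs_def] by measurable
qed

lemma value_integrable: "0 \<le> t \<Longrightarrow> integrable M (total_value t)"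
  using value_measurable value_bounded by (intro integrable_const_bound[of _ "Bv + u0 / \<delta>"]) auto

lemma value_step: "w \<in> space M \<Longrightarrow> 0 \<le> t \<Longrightarrow> 0 \<le> h \<Longrightarrow> total_value (t + h) w - total_value t w = exp (- \<delta> * t) * step t h w"
  using payout_add[OF u x, of w t h]
  by (simp add: total_value_def step_def algebra_simps exp_add[symmetric] mult.assoc[symmetric])

text \<open>With \<open>\<sigma> = 1\<close> this bounds every scheme by the candidate, with
  \<open>\<sigma> = - 1\<close> it shows that the feedback scheme attains it. Each step errs by at
  most \<open>(2 + lam) * \<epsilon> * h\<close>, hence by \<open>(2 + lam) * \<epsilon> * T\<close>
  in total, and \<open>\<epsilon>\<close> is arbitrary for fixed \<open>T\<close>.\<close>

lemma verification:
  assumes \<sigma>: "\<sigma> = 1 \<or> \<sigma> = - 1 \<and> (\<forall>t w. 0 \<le> t \<longrightarrow> w \<in> space M \<longrightarrow> alive u x t w \<longrightarrow>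
      u t w = u0 * indicator {d..} (free_surplus u x t w))"
  shows "\<sigma> * (J M g N Y \<delta> x u - v x) \<le> 0"
proof -
  have \<sigma>1: "\<bar>\<sigma>\<bar> = 1" using \<sigma> by auto
  define Z where "Z = (\<lambda>t. \<integral>w. total_value t w \<partial>M)"
  have fin: "\<sigma> * (Z T - Z 0) \<le> (2 + lam) * \<epsilon> * T" if T: "0 < T" and \<epsilon>: "0 < \<epsilon>" "\<epsilon> \<le> 1" for T \<epsilon>
  proof -
    obtain h0 where h0: "0 < h0" "\<And>h t w. 0 < h \<Longrightarrow> h \<le> h0 \<Longrightarrow> 0 \<le> t \<Longrightarrow> t + h \<le> T \<Longrightarrow> w \<in> space M \<Longrightarrow>
      \<forall>s t. 0 \<le> s \<longrightarrow> s \<le> t \<longrightarrow> S s w \<le> S t w \<Longrightarrow>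
      \<sigma> * step t h w \<le> step_bound v Bv \<sigma> \<epsilon> (slope x T) h (state u x t w) (S (t + h) w - S t w)"
      by (rule step_le_step_bound[OF \<sigma> \<epsilon>(1), of T]) blast
    have sl: "0 \<le> slope x T" using slope_pos[OF u x, of T] by simp
    obtain h1 where h1: "0 < h1" "\<And>h s w. 0 < h \<Longrightarrow> h \<le> h1 \<Longrightarrow> 0 \<le> s \<Longrightarrow>
      (\<integral>z. step_bound v Bv \<sigma> \<epsilon> (slope x T) h w (S (s + h) z - S s z) \<partial>M) \<le> (2 + lam) * \<epsilon> * h"
      by (rule step_bound_mean[OF hv cv' vB hjb_eq \<sigma>1 \<epsilon> sl]) blast+
    define m where "m = min (min h0 h1) 1"
    have m: "0 < m" using h0 h1 by (simp add: m_def)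
    \<comment> \<open>The step length must divide \<open>T\<close> and respect the limits of both
      step estimates.\<close>
    obtain n :: nat where n: "T / m < real n" using reals_Archimedean2 by blast
    have n0: "0 < real n" using n T m by (smt (verit) divide_pos_pos)
    define h where "h = T / n"
    have h: "0 < h" "h \<le> m" "real n * h = T" using T n n0 m by (auto simp: h_def field_simps)
    have hb: "h \<le> h0" "h \<le> h1" "h \<le> 1" using h(2) by (auto simp: m_def)
    have one: "\<sigma> * (Z (t + h) - Z t) \<le> (2 + lam) * \<epsilon> * h" if t: "0 \<le> t" "t + h \<le> T" for t
    proof -
      define \<Phi> where "\<Phi> = step_bound v Bv \<sigma> \<epsilon> (slope x T) h"
      have th: "t \<le> t + h" using h by simp
      have e: "(\<integral>w. \<Phi> (state u x t w) (S (t + h) w - S t w) \<partial>M) \<le> (2 + lam) * \<epsilon> * h"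
        "integrable M (\<lambda>w. \<Phi> (state u x t w) (S (t + h) w - S t w))"
      proof -
        have b: "\<bar>\<Phi> y z\<bar> \<le> 2 * lam * Bv + 3 * Bv + 1" for y z unfolding \<Phi>_def
          by (rule step_bound_bounded[OF hv cv' vB hjb_eq \<sigma>1]) (use \<epsilon> h hb in auto)
        have me: "case_prod \<Phi> \<in> borel_measurable (borel \<Otimes>\<^sub>M borel)"
          unfolding \<Phi>_def by (rule step_bound_measurable[OF hv cv' vB hjb_eq])
        have le: "(\<integral>z. \<Phi> y (S (t + h) z - S t z) \<partial>M) \<le> (2 + lam) * \<epsilon> * h" for y
          unfolding \<Phi>_def by (rule h1(2)[OF h(1) hb(2) t(1)])
        show "(\<integral>w. \<Phi> (state u x t w) (S (t + h) w - S t w) \<partial>M) \<le> (2 + lam) * \<epsilon> * h"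
          "integrable M (\<lambda>w. \<Phi> (state u x t w) (S (t + h) w - S t w))"
          by (rule expectation_independent_le[OF t(1) th state_adapted[OF u x t(1)] me b le])+
      qed
      have "\<sigma> * (Z (t + h) - Z t) = (\<integral>w. \<sigma> * (total_value (t + h) w - total_value t w) \<partial>M)"
        unfolding Z_def using value_integrable[of t] value_integrable[of "t + h"] t h by simp
      also have "\<dots> \<le> (\<integral>w. exp (- \<delta> * t) * \<Phi> (state u x t w) (S (t + h) w - S t w) \<partial>M)"
      proof (rule integral_mono_AE)
        show "integrable M (\<lambda>w. \<sigma> * (total_value (t + h) w - total_value t w))"
          using value_integrable[of t] value_integrable[of "t + h"] t h by simp
        show "integrable M (\<lambda>w. exp (- \<delta> * t) * \<Phi> (state u x t w) (S (t + h) w - S t w))" using e(2) by simp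
        show "AE w in M. \<sigma> * (total_value (t + h) w - total_value t w) \<le> exp (- \<delta> * t) * \<Phi> (state u x t w) (S (t + h) w - S t w)"
          using S_mono_AE AE_space
        proof eventually_elim
          case (elim w)
          have "\<sigma> * (total_value (t + h) w - total_value t w) = exp (- \<delta> * t) * (\<sigma> * step t h w)"
            using value_step[OF elim(2) t(1), of h] h by simp
          also have "\<dots> \<le> exp (- \<delta> * t) * \<Phi> (state u x t w) (S (t + h) w - S t w)"
            unfolding \<Phi>_def by (intro mult_left_mono h0(2)[OF h(1) hb(1) t elim(2,1)]) simp
          finally show ?case .
        qed
      qed
      also have "\<dots> = exp (- \<delta> * t) * (\<integral>w. \<Phi> (state u x t w) (S (t + h) w - S t w) \<partial>M)" by simp
      also have "\<dots> \<le> exp (- \<delta> * t) * ((2 + lam) * \<epsilon> * h)" using e(1) by (intro mult_left_mono) auto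
      also have "\<dots> \<le> 1 * ((2 + lam) * \<epsilon> * h)"
        using t delta_pos lam_pos \<epsilon> h by (intro mult_right_mono) auto
      finally show ?thesis by simp
    qed
    have "\<sigma> * (Z (real i * h) - Z 0) \<le> real i * ((2 + lam) * \<epsilon> * h)" if "i \<le> n" for i
      using that
    proof (induction i)
      case (Suc i)
      have "real (Suc i) * h \<le> real n * h" using Suc.prems h(1) by (intro mult_right_mono) auto
      then have "real i * h + h \<le> T" unfolding h(3) by (simp add: algebra_simps)
      from one[OF _ this] have "\<sigma> * (Z (real i * h + h) - Z (real i * h)) \<le> (2 + lam) * \<epsilon> * h" using h(1) by simp
      moreover have "real (Suc i) * h = real i * h + h" by (simp add: algebra_simps)
      ultimately show ?case using Suc by (simp add: algebra_simps)
    qed simp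
    from this[of n] have "\<sigma> * (Z (real n * h) - Z 0) \<le> (2 + lam) * \<epsilon> * (real n * h)" by (simp add: algebra_simps)
    then show ?thesis unfolding h(3) .
  qed
  have mono: "\<sigma> * (Z T - Z 0) \<le> 0" if T: "0 < T" for T
  proof (rule field_le_epsilon)
    fix e :: real assume e: "0 < e"
    define k where "k = (2 + lam) * T"
    have k: "0 < k" using lam_pos T by (simp add: k_def)
    define \<epsilon> where "\<epsilon> = min 1 (e / k)"
    have "0 < \<epsilon>" "\<epsilon> \<le> 1" "\<epsilon> * k \<le> e"
    proof -
      show "0 < \<epsilon>" "\<epsilon> \<le> 1" using e k by (simp_all add: \<epsilon>_def)
      have "\<epsilon> \<le> e / k" by (simp add: \<epsilon>_def)
      then show "\<epsilon> * k \<le> e" using k by (simp add: field_simps)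
    qed
    then show "\<sigma> * (Z T - Z 0) \<le> 0 + e" using fin[OF T, of \<epsilon>] by (simp add: k_def algebra_simps)
  qed
  have Z0: "Z 0 = v x"
  proof -
    have "total_value 0 w = v x" if w: "w \<in> space M" for w
    proof -
      have X0: "free_surplus u x 0 w = x"
      proof -
        have "(LBINT s:{0..0}. G (free_surplus u x s w) - rate u s w) = 0"
          using set_integral_discrete_difference[of "{0::real}" "{0..0}" "{}" lborel "\<lambda>s. G (free_surplus u x s w) - rate u s w"]
          by (simp add: set_lebesgue_integral_def)
        then show ?thesis using free_surplus_eq[OF u w, of 0 x] w by simp
      qed
      have "alive u x 0 w" using alive_ux[OF w, of 0] X0 x by simp
      moreover have "payout u x 0 w = 0"
      proof -
        have "(LBINT s:{0..0}. exp (- \<delta> * s) * live_rate u x s w) = 0"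
          using set_integral_discrete_difference[of "{0::real}" "{0..0}" "{}" lborel "\<lambda>s. exp (- \<delta> * s) * live_rate u x s w"]
          by (simp add: set_lebesgue_integral_def)
        then show ?thesis by (simp add: payout_def[OF u x])
      qed
      ultimately show ?thesis using x by (simp add: total_value_def state_def[OF u x] X0 vbdef)
    qed
    then have "Z 0 = (\<integral>w. v x \<partial>M)" unfolding Z_def by (intro Bochner_Integration.integral_cong) auto
    then show ?thesis by (simp add: prob_space)
  qed
  have lim: "(\<lambda>n. Z (real n)) \<longlonglongrightarrow> J M g N Y \<delta> x u"
    unfolding Z_def J_def
  proof (rule integral_dominated_convergence[where w = "\<lambda>_. Bv + u0 / \<delta>"])
    have l: "(\<lambda>n. total_value (real n) w) \<longlonglongrightarrow> (LBINT t:{t. 0 \<le> t \<and> ereal t \<le> ruin g N Y x u w}. exp (- \<delta> * t) * u t w)"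
      if w: "w \<in> space M" for w
    proof -
      have e0: "(\<lambda>n. exp (- \<delta> * real n) * Bv) \<longlonglongrightarrow> 0"
      proof -
        have "((\<lambda>t. exp (- (\<delta> * t))) \<longlongrightarrow> 0) at_top"
          using delta_pos by (intro filterlim_compose[OF exp_at_bot] filterlim_compose[OF filterlim_uminus_at_bot_at_top] filterlim_tendsto_pos_mult_at_top[OF tendsto_const] filterlim_ident)
        from filterlim_compose[OF this filterlim_real_sequentially]
        show ?thesis using tendsto_mult_left_zero by (auto simp: tendsto_mult_left_zero)
      qed
      have "(\<lambda>n. exp (- \<delta> * real n) * vb v (state u x (real n) w)) \<longlonglongrightarrow> 0"
        by (rule Lim_null_comparison[OF _ e0]) (auto simp: abs_mult vbb)
      from tendsto_add[OF this payout_limit(1)[OF u x w]] show ?thesis unfolding total_value_def by simp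
    qed
    then show "AE w in M. (\<lambda>n. total_value (real n) w) \<longlonglongrightarrow> (LBINT t:{t. 0 \<le> t \<and> ereal t \<le> ruin g N Y x u w}. exp (- \<delta> * t) * u t w)"
      by (intro AE_I2)
    show "total_value (real n) \<in> borel_measurable M" for n by (rule value_measurable) simp
    then show "(\<lambda>w. LBINT t:{t. 0 \<le> t \<and> ereal t \<le> ruin g N Y x u w}. exp (- \<delta> * t) * u t w) \<in> borel_measurable M"
      using l by (rule borel_measurable_LIMSEQ_real[rotated])
    show "AE w in M. norm (total_value (real n) w) \<le> Bv + u0 / \<delta>" for n using value_bounded by (intro AE_I2) simp
  qed simp
  have "(\<lambda>n. \<sigma> * (Z (real n) - v x)) \<longlonglongrightarrow> \<sigma> * (J M g N Y \<delta> x u - v x)"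
    by (intro tendsto_mult tendsto_diff lim tendsto_const)
  then show ?thesis
  proof (rule LIMSEQ_le_const2)
    show "\<exists>N. \<forall>n\<ge>N. \<sigma> * (Z (real n) - v x) \<le> 0" using mono[unfolded Z0] by (intro exI[of _ 1]) auto
  qed
qed

end

end

section \<open>Value function and optimal schemes from the candidates\<close>

theorem theorem2p5:
  fixes M :: "'a measure" and F :: "real \<Rightarrow> 'a measure"
    and N :: "real \<Rightarrow> 'a \<Rightarrow> nat" and Y :: "nat \<Rightarrow> 'a \<Rightarrow> real"
    and g :: "real \<Rightarrow> real" and lam \<alpha> \<delta> u0 :: real
  assumes model: "risk_model M F N Y lam \<alpha>"
    and delta_pos: "0 < \<delta>"
    and g_pos: "\<And>x. 0 \<le> x \<Longrightarrow> 0 < g x"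
    and g_lipschitz: "\<exists>L. L-lipschitz_on {0..} g"
    and g_growth: "\<exists>C. \<forall>x\<ge>0. \<bar>g x\<bar> \<le> C * (1 + x)"
    and u0: "0 < u0" "u0 < (INF x\<in>{0..}. g x)"
    and g_C2: "C2_halfline g"
    and cond_0: "\<alpha> * lam * g 0 + (hderiv g 0 - lam - \<delta>) * (lam + \<delta>) > 0"
    and cond_sup: "(SUP x\<in>{0..}. ereal (hderiv (hderiv g) x + \<alpha> * hderiv g x - \<alpha> * \<delta>)) < 0"
  shows "(\<exists>\<psi>2. ode_solution g lam \<alpha> \<delta> u0 \<psi>2 \<and> (\<forall>x\<ge>0. \<psi>2 x < 0) \<and>
            strict_mono_on {0..} \<psi>2 \<and> concave_on {0..} \<psi>2) \<and>
    (\<forall>\<psi>2. ode_solution g lam \<alpha> \<delta> u0 \<psi>2 \<and> (\<forall>x\<ge>0. \<psi>2 x < 0) \<and>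
            strict_mono_on {0..} \<psi>2 \<and> concave_on {0..} \<psi>2 \<longrightarrow>
      (\<psi>2 0 / hderiv \<psi>2 0 > g 0 / (lam + \<delta>) - u0 / \<delta> \<longrightarrow>
        (\<forall>\<psi>1. ide_solution g lam \<alpha> \<delta> \<psi>1 \<and> (\<forall>x\<ge>0. \<psi>1 x > 0) \<and> strict_mono_on {0..} \<psi>1 \<longrightarrow>
          (\<exists>!d. d > 0 \<and> \<psi>1 d / hderiv \<psi>1 d - \<psi>2 d / hderiv \<psi>2 d = u0 / \<delta>) \<and>
          (\<forall>d. d > 0 \<and> \<psi>1 d / hderiv \<psi>1 d - \<psi>2 d / hderiv \<psi>2 d = u0 / \<delta> \<longrightarrow>
            (\<forall>x\<ge>0.
              (\<exists>u\<in>rates M F u0. threshold_rate M g N Y u0 d x u) \<and>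
              (\<forall>u\<in>rates M F u0. threshold_rate M g N Y u0 d x u \<longrightarrow>
                 optimal M F g N Y \<delta> u0 x u) \<and>
              V_R M F g N Y \<delta> u0 x =
                (if x < d then \<psi>1 x / hderiv \<psi>1 d else u0 / \<delta> + \<psi>2 x / hderiv \<psi>2 d))))) \<and>
      (\<psi>2 0 / hderiv \<psi>2 0 \<le> g 0 / (lam + \<delta>) - u0 / \<delta> \<longrightarrow>
        (\<forall>x\<ge>0.
          optimal M F g N Y \<delta> u0 x (\<lambda>t \<omega>. u0) \<and>
          V_R M F g N Y \<delta> u0 x =
            \<psi>2 x / (((g 0 - u0) * hderiv \<psi>2 0 - (lam + \<delta>) * \<psi>2 0) / ((lam / \<delta>) * u0)) + u0 / \<delta>)))"
proof -
  obtain L0 where L0: "L0-lipschitz_on {0..} g" using g_lipschitz by blast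
  define L where "L = max L0 1"
  \<comment> \<open>The strict bound on \<open>u0\<close> becomes a uniform positive margin, the
    lower bound of all drifts.\<close>
  define c where "c = (INF x\<in>{0..}. g x) - u0"
  have g_inf: "u0 + c \<le> g x" if "0 \<le> x" for x
  proof -
    have "bdd_below (g ` {0..})" using less_imp_le[OF g_pos] by (intro bdd_belowI2[of _ 0]) auto
    then show ?thesis using cINF_lower[of g "{0..}" x] that by (simp add: c_def)
  qed
  have cpos: "0 < c" using u0(2) by (simp add: c_def)
  have lip: "\<bar>g x - g y\<bar> \<le> L * \<bar>x - y\<bar>" if "0 \<le> x" "0 \<le> y" for x y
  proof -
    have "\<bar>g x - g y\<bar> \<le> L0 * \<bar>x - y\<bar>" using lipschitz_onD[OF L0, of x y] that by (simp add: dist_real_def)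
    also have "\<dots> \<le> L * \<bar>x - y\<bar>" unfolding L_def by (intro mult_right_mono) auto
    finally show ?thesis .
  qed
  have Lpos: "0 < L" by (simp add: L_def)
  have "dividend_model M F N Y lam \<alpha> g \<delta> u0 c L"
    by (rule dividend_model.intro[OF model], rule dividend_model_axioms.intro[OF delta_pos u0(1) cpos g_inf Lpos lip])
  then interpret D: dividend_model M F N Y lam \<alpha> g \<delta> u0 c L .
  have c1: "C1_halfline g" "C1_halfline (hderiv g)" using g_C2 by (auto simp: C2_halfline_def)
  have sup: "hderiv (hderiv g) x + \<alpha> * hderiv g x - \<alpha> * \<delta> < 0" if "0 \<le> x" for x
  proof -
    have "ereal (hderiv (hderiv g) x + \<alpha> * hderiv g x - \<alpha> * \<delta>)
        \<le> (SUP x\<in>{0..}. ereal (hderiv (hderiv g) x + \<alpha> * hderiv g x - \<alpha> * \<delta>))"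
      by (rule SUP_upper) (use that in simp)
    from le_less_trans[OF this cond_sup] show ?thesis by simp
  qed
  have g_gt: "u0 < g x" if "0 \<le> x" for x using g_inf[OF that] cpos by simp
  interpret E: dividend_equations g "hderiv g" "hderiv (hderiv g)" lam \<alpha> \<delta> u0
    by (rule dividend_equations.intro[OF D.lam_pos D.alpha_pos delta_pos u0(1)
        C1_halfline_hderiv[OF c1(1)] C1_halfline_hderiv[OF c1(2)] g_gt cond_0 sup])
  have exists: "\<exists>\<psi>2. ode_solution g lam \<alpha> \<delta> u0 \<psi>2 \<and> (\<forall>x\<ge>0. \<psi>2 x < 0) \<and>
      strict_mono_on {0..} \<psi>2 \<and> concave_on {0..} \<psi>2"
  proof -
    obtain \<phi> \<phi>1 \<phi>2 where \<phi>: "E.ode u0 \<phi> \<phi>1 \<phi>2" "\<And>x. 0 \<le> x \<Longrightarrow> \<phi> x < 0" "\<And>x. 0 \<le> x \<Longrightarrow> 0 < \<phi>1 x"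
      using E.negative_increasing_solution_exists by metis
    have d: "has_hderiv \<phi> \<phi>1" "has_hderiv \<phi>1 \<phi>2" using \<phi>(1) by (auto simp: E.ode_def)
    have "ode_solution g lam \<alpha> \<delta> u0 \<phi>" by (rule E.ode_imp_ode_solution[OF \<phi>(1)]) simp
    moreover have "strict_mono_on {0..} \<phi>" by (rule hderiv_pos_strict_mono[OF d(1) \<phi>(3)])
    moreover have "concave_on {0..} \<phi>"
      by (rule concave_on_halfline[OF d]) (rule less_imp_le[OF E.negative_ode_concave[OF \<phi>]])
    ultimately show ?thesis using \<phi>(2) by blast
  qed
  have ver: "\<sigma> * (J M g N Y \<delta> x u - v x) \<le> 0"
    if H: "E.hjb d v v'" and u: "u \<in> rates M F u0" and x: "0 \<le> x"
      and \<sigma>: "\<sigma> = 1 \<or> \<sigma> = - 1 \<and> (\<forall>t w. 0 \<le> t \<longrightarrow> w \<in> space M \<longrightarrow> D.alive u x t w \<longrightarrow>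
        u t w = u0 * indicator {d..} (D.free_surplus u x t w))"
    for d v v' u x \<sigma>
  proof -
    have h: "0 \<le> d" "has_hderiv v v'" "continuous_on {0..} v'" "\<exists>B. \<forall>x\<ge>0. \<bar>v x\<bar> \<le> B"
      "\<forall>x. 0 \<le> x \<longrightarrow> x < d \<longrightarrow> 1 \<le> v' x" "\<forall>x\<ge>d. v' x \<le> 1"
      "\<forall>x\<ge>0. g x * v' x - (lam + \<delta>) * v x + lam * exp_conv \<alpha> v x + u0 * max 0 (1 - v' x) = 0"
      using H unfolding E.hjb_def by blast+
    from h(4) obtain B where B: "\<forall>x\<ge>0. \<bar>v x\<bar> \<le> B" by blast
    show ?thesis
      by (rule D.verification[OF u x h(2,3) B[rule_format] h(7)[rule_format] h(1) h(5)[rule_format] h(6)[rule_format] \<sigma>])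
  qed
  have opt: "optimal M F g N Y \<delta> u0 x u \<and> V_R M F g N Y \<delta> u0 x = v x"
    if H: "E.hjb d v v'" and u: "u \<in> rates M F u0" and x: "0 \<le> x"
      and fb: "\<forall>t w. 0 \<le> t \<longrightarrow> w \<in> space M \<longrightarrow> D.alive u x t w \<longrightarrow> u t w = u0 * indicator {d..} (D.free_surplus u x t w)"
    for d v v' u x
  proof -
    have le: "J M g N Y \<delta> x w \<le> v x" if "w \<in> rates M F u0" for w
      using ver[OF H that x, of 1] by simp
    have eq: "J M g N Y \<delta> x u = v x" using le[OF u] ver[OF H u x, of "- 1"] fb by simp
    have "V_R M F g N Y \<delta> u0 x = v x" unfolding V_R_def
    proof (rule cSup_eq_maximum)
      show "v x \<in> J M g N Y \<delta> x ` rates M F u0" using eq[symmetric] u by (rule image_eqI)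
    qed (use le in auto)
    then show ?thesis using eq u by (simp add: optimal_def)
  qed
  have main: "(\<psi>2 0 / hderiv \<psi>2 0 > g 0 / (lam + \<delta>) - u0 / \<delta> \<longrightarrow>
        (\<forall>\<psi>1. ide_solution g lam \<alpha> \<delta> \<psi>1 \<and> (\<forall>x\<ge>0. \<psi>1 x > 0) \<and> strict_mono_on {0..} \<psi>1 \<longrightarrow>
          (\<exists>!d. d > 0 \<and> \<psi>1 d / hderiv \<psi>1 d - \<psi>2 d / hderiv \<psi>2 d = u0 / \<delta>) \<and>
          (\<forall>d. d > 0 \<and> \<psi>1 d / hderiv \<psi>1 d - \<psi>2 d / hderiv \<psi>2 d = u0 / \<delta> \<longrightarrow>
            (\<forall>x\<ge>0.
              (\<exists>u\<in>rates M F u0. threshold_rate M g N Y u0 d x u) \<and>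
              (\<forall>u\<in>rates M F u0. threshold_rate M g N Y u0 d x u \<longrightarrow>
                 optimal M F g N Y \<delta> u0 x u) \<and>
              V_R M F g N Y \<delta> u0 x =
                (if x < d then \<psi>1 x / hderiv \<psi>1 d else u0 / \<delta> + \<psi>2 x / hderiv \<psi>2 d))))) \<and>
      (\<psi>2 0 / hderiv \<psi>2 0 \<le> g 0 / (lam + \<delta>) - u0 / \<delta> \<longrightarrow>
        (\<forall>x\<ge>0.
          optimal M F g N Y \<delta> u0 x (\<lambda>t \<omega>. u0) \<and>
          V_R M F g N Y \<delta> u0 x =
            \<psi>2 x / (((g 0 - u0) * hderiv \<psi>2 0 - (lam + \<delta>) * \<psi>2 0) / ((lam / \<delta>) * u0)) + u0 / \<delta>))"
    if sol: "ode_solution g lam \<alpha> \<delta> u0 \<psi>2" and neg: "\<forall>x\<ge>0. \<psi>2 x < 0" and mono: "strict_mono_on {0..} \<psi>2" for \<psi>2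
  proof -
    have s1: "E.ode u0 \<psi>2 (hderiv \<psi>2) (hderiv (hderiv \<psi>2))" by (rule E.ode_solution_imp_ode[OF sol]) simp
    have s2: "\<psi>2 x < 0" if "0 \<le> x" for x using neg that by blast
    have s3: "0 < hderiv \<psi>2 x" if "0 \<le> x" for x
      by (rule E.ode_mono_imp_deriv_pos[OF s1 g_gt mono that disjI1[OF s2[OF that]]])
    have s4: "hderiv (hderiv \<psi>2) x < 0" if "0 \<le> x" for x by (rule E.negative_ode_concave[OF s1 s2 s3 that])
    note s = s1 s2 s3 s4
    show ?thesis
    proof (intro conjI impI allI)
      fix \<psi>1 assume gt: "\<psi>2 0 / hderiv \<psi>2 0 > g 0 / (lam + \<delta>) - u0 / \<delta>"
        and "ide_solution g lam \<alpha> \<delta> \<psi>1 \<and> (\<forall>x\<ge>0. \<psi>1 x > 0) \<and> strict_mono_on {0..} \<psi>1"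
      then have 1: "ide_solution g lam \<alpha> \<delta> \<psi>1" "\<And>x. 0 \<le> x \<Longrightarrow> 0 < \<psi>1 x" "strict_mono_on {0..} \<psi>1" by auto
      obtain \<psi>1'' where p: "E.ode 0 \<psi>1 (hderiv \<psi>1) \<psi>1''" "\<And>x. 0 \<le> x \<Longrightarrow> 0 < hderiv \<psi>1 x"
        "\<And>x. 0 \<le> x \<Longrightarrow> g x * hderiv \<psi>1 x - (lam + \<delta>) * \<psi>1 x + lam * exp_conv \<alpha> \<psi>1 x = 0" "\<psi>1'' 0 < 0"
        using E.ide_solution_props[OF 1] by metis
      note ps = p(1) 1(2) p(2) p(4) s
      \<comment> \<open>At \<open>0\<close> the convolution vanishes, so the ratio for
        \<open>\<psi>1\<close> is explicit, and the hypothesis of case (i) says that the fit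
        difference starts below its target.\<close>
      have "\<psi>1 0 / hderiv \<psi>1 0 = g 0 / (lam + \<delta>)"
        using p(3)[of 0] p(2)[of 0] D.lam_pos delta_pos by (simp add: exp_conv_0 field_simps)
      then have "\<psi>1 0 / hderiv \<psi>1 0 - \<psi>2 0 / hderiv \<psi>2 0 < u0 / \<delta>" using gt by simp
      from E.fit_root_exists[OF ps this] E.fit_root_unique[OF ps]
      show "\<exists>!d. d > 0 \<and> \<psi>1 d / hderiv \<psi>1 d - \<psi>2 d / hderiv \<psi>2 d = u0 / \<delta>"
        by (metis less_imp_le)
      fix d assume d: "d > 0 \<and> \<psi>1 d / hderiv \<psi>1 d - \<psi>2 d / hderiv \<psi>2 d = u0 / \<delta>"
      fix x :: real assume x: "0 \<le> x"
      note H = E.hjb_barrier[OF p(1) 1(2) p(2) p(4) p(3) s conjunct1[OF d] conjunct2[OF d]]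
      have fb: "\<forall>t w. 0 \<le> t \<longrightarrow> w \<in> space M \<longrightarrow> D.alive u x t w \<longrightarrow> u t w = u0 * indicator {d..} (D.free_surplus u x t w)"
        if u: "u \<in> rates M F u0" and th: "threshold_rate M g N Y u0 d x u" for u
      proof (intro allI impI)
        fix t w assume t: "0 \<le> t" and w: "w \<in> space M" and al: "D.alive u x t w"
        have "surplus g N Y x u t w = D.free_surplus u x t w"
          using D.surplus_eq[OF u w t, of x] al D.alive_def[OF u x, of t w] by (simp add: killed_def less_imp_le)
        then show "u t w = u0 * indicator {d..} (D.free_surplus u x t w)"
          using th t w unfolding threshold_rate_def by simp
      qed
      show ex: "\<exists>u\<in>rates M F u0. threshold_rate M g N Y u0 d x u" by (rule D.threshold_rate_exists[OF conjunct1[OF d]])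
      show "\<forall>u\<in>rates M F u0. threshold_rate M g N Y u0 d x u \<longrightarrow> optimal M F g N Y \<delta> u0 x u"
        using opt[OF H _ x fb] by blast
      show "V_R M F g N Y \<delta> u0 x = (if x < d then \<psi>1 x / hderiv \<psi>1 d else u0 / \<delta> + \<psi>2 x / hderiv \<psi>2 d)"
        using ex opt[OF H _ x fb] by blast
    next
      assume le: "\<psi>2 0 / hderiv \<psi>2 0 \<le> g 0 / (lam + \<delta>) - u0 / \<delta>"
      fix x :: real assume x: "0 \<le> x"
      note H = E.hjb_no_barrier[OF s le refl]
      have u: "(\<lambda>t \<omega>. u0) \<in> rates M F u0" using u0(1) by (simp add: rates_def split_def)
      \<comment> \<open>Paying at the maximal rate is, before ruin, the threshold rule with barrier
        \<open>0\<close>, as the surplus is then nonnegative.\<close>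
      have "\<forall>t w. 0 \<le> t \<longrightarrow> w \<in> space M \<longrightarrow> D.alive (\<lambda>t \<omega>. u0) x t w \<longrightarrow> u0 = u0 * indicator {0..} (D.free_surplus (\<lambda>t \<omega>. u0) x t w)"
        using before_ruin D.alive_def[OF u x] by (auto simp: indicator_def)
      from opt[OF H u x this]
      show "optimal M F g N Y \<delta> u0 x (\<lambda>t \<omega>. u0)"
        "V_R M F g N Y \<delta> u0 x = \<psi>2 x / (((g 0 - u0) * hderiv \<psi>2 0 - (lam + \<delta>) * \<psi>2 0) / ((lam / \<delta>) * u0)) + u0 / \<delta>"
        by blast+
    qed
  qed
  show ?thesis by (rule conjI[OF exists], rule allI, rule impI, elim conjE, rule main)
qed

end
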